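(* Let $F\in\mathbb{K}[x_0,\ldots,x_n]$ be a concise homogeneous polynomial such that its dehomogenization $f=F|_{x_0=1}\in\mathbb{K}[x_1,\ldots,x_n]$ is encompassing and the apolar algebra $\operatorname{Ap}(f)$ is smoothable. Then for every $d\geq 1$: (1) the form $\mathrm{tw}(F^d)$ has smoothable rank, border rank, cactus rank, border cactus rank and middle catalecticant rank all equal to $\binom{n+d}{d}$; (2) the scheme $\operatorname{Spec}(\operatorname{Ap}(f^d))$ is smoothable and, under the embedding $\operatorname{Spec}(\operatorname{Ap}(f^d))\subseteq\{\alpha_0\neq0\}\subseteq\mathbb{P}^n$ described in the context, it is apolar to $\mathrm{tw}(F^d)$.
   Context: $\mathbb{K}$ is an algebraically closed field of characteristic zero. Apolarity. $\mathbb{K}[\alpha_0,\ldots,\alpha_n]$ acts on $\mathbb{K}[x_0,\ldots,x_n]$ by letting $\alpha_i$ act as $\partial/\partial x_i$ (written $\sigma\circ F$); $\operatorname{Ann}(F)=\{\sigma:\sigma\circ F=0\}$. Likewise $\mathcal{D}=\mathbb{K}[\alpha_1,\ldots,\alpha_n]$ acts on $\mathbb{K}[x_1,\ldots,x_n]$, and for $f\in\mathbb{K}[x_1,\ldots,x_n]$ we put $\operatorname{Ann}(f)=\{\sigma\in\mathcal{D}:\sigma\circ f=0\}$, $\operatorname{Ap}(f)=\mathcal{D}/\operatorname{Ann}(f)$. A polynomial is concise if its annihilator contains no nonzero element of degree $\le 1$. Encompassing. $f\in\mathbb{K}[x_1,\ldots,x_n]$ is encompassing if no nonzero $g\in\mathcal{D}\circ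 f$ satisfies $g_{\leq1}=0$, where $g_{\le 1}$ is the sum of the homogeneous parts of $g$ of degree $0$ and $1$. Twist. For $F=\sum_i\lambda_i\mathbf{x}^i$, $i=(i_0,\ldots,i_n)$, put $\mathrm{tw}(F)=\sum_i\lambda_i\frac{1}{i_0!}\mathbf{x}^i$. Embedding. $\mathbb{P}^n=\operatorname{Proj}\mathbb{K}[\alpha_0,\ldots,\alpha_n]$ and the chart $\{\alpha_0\neq0\}$ is identified with $\operatorname{Spec}\mathcal{D}$ by setting $\alpha_0=1$; $\operatorname{Spec}(\operatorname{Ap}(f^d))=V(\operatorname{Ann}(f^d))\subseteq\operatorname{Spec}\mathcal{D}$. A finite scheme $Z\subseteq\mathbb{P}^n$ with saturated homogeneous ideal $I(Z)$ is apolar to a form $H$ if $I(Z)\subseteq\operatorname{Ann}(H)$. Smoothability. A finite $\mathbb{K}$-algebra $A$ (or $\operatorname{Spec} A$) is smoothable if there is a $\mathbb{K}[[t]]$-algebra $\mathcal{A}$, free of finite rank as a module, with $\mathcal{A}/t\mathcal{A}\simeq A$ and $\mathcal{A}[t^{-1}]$ smooth over $\mathbb{K}[[t]][t^{-1}]$. Ranks of a form $H$ of degree $e$. The Waring rank is the least number of $e$-th powers of linear forms whose linear combination is $H$; the border rank is the least $r$ such that $H$ lies in the Zariski closure of the forms of degree $e$ of Waring rank $\le r$; the cactus rank (resp. smoothable rank) is the least degree of a finite (resp. finite smoothable) scheme apolar to $H$; the border cactus rank is the least $r$ such that $H$ lies in the Zariski closure of the forms of degree $e$ of cactus rank $\leq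 r$; the middle catalecticant rank is the rank of the linear map $\mathbb{K}[\alpha_0,\ldots,\alpha_n]_k\to\mathbb{K}[x_0,\ldots,x_n]_{e-k}$, $\sigma\mapsto\sigma\circ H$, with $k=\lfloor e/2\rfloor$. *)

theory Defs
  imports
    "HOL-Library.Poly_Mapping"
    "HOL-Library.Extended_Nat"
    "HOL-Computational_Algebra.Formal_Laurent_Series"
    "HOL-Algebra.Generated_Rings"
    "HOL-Algebra.Algebraic_Closure_Type"
begin

section \<open>Polynomials in the variables indexed by a set of natural numbers\<close>

text \<open>The polynomial rings in $x_0,\dots,x_n$ and in $x_1,\dots,x_n$ are the subrings
  \<open>polys {0..n}\<close> and \<open>polys {1..n}\<close> of one polynomial ring in countably many variables;
  the dual rings in the $\alpha_i$ are represented by the same subrings.\<close>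

type_synonym 'a mpoly = "(nat \<Rightarrow>\<^sub>0 nat) \<Rightarrow>\<^sub>0 'a"

definition polys :: "nat set \<Rightarrow> 'a::zero mpoly set" where
  "polys V = {p. \<forall>m \<in> Poly_Mapping.keys p. Poly_Mapping.keys m \<subseteq> V}"

definition Const :: "'a::zero \<Rightarrow> 'a mpoly" where
  "Const c = Poly_Mapping.single 0 c"

definition Var :: "nat \<Rightarrow> 'a::zero_neq_one mpoly" where
  "Var i = Poly_Mapping.single (Poly_Mapping.single i 1) 1"

definition mdeg :: "('v \<Rightarrow>\<^sub>0 nat) \<Rightarrow> nat" where
  "mdeg m = (\<Sum>i \<in> Poly_Mapping.keys m. Poly_Mapping.lookup m i)"

definition total_degree :: "'a::zero mpoly \<Rightarrow> nat" where
  "total_degree p = Max (insert 0 (mdeg ` Poly_Mapping.keys p))"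

definition hom_part :: "nat \<Rightarrow> 'a::comm_monoid_add mpoly \<Rightarrow> 'a mpoly" where
  "hom_part e p = (\<Sum>m \<in> {m \<in> Poly_Mapping.keys p. mdeg m = e}.
      Poly_Mapping.single m (Poly_Mapping.lookup p m))"

definition forms :: "nat \<Rightarrow> nat \<Rightarrow> 'a::zero mpoly set" where
  "forms n e = {p \<in> polys {0..n}. \<forall>m \<in> Poly_Mapping.keys p. mdeg m = e}"

text \<open>Evaluation at \<open>s\<close>, the coefficients being mapped along \<open>h\<close>.\<close>

definition peval ::
  "('a::zero \<Rightarrow> 'b::comm_semiring_1) \<Rightarrow> ('v \<Rightarrow> 'b) \<Rightarrow> (('v \<Rightarrow>\<^sub>0 nat) \<Rightarrow>\<^sub>0 'a) \<Rightarrow> 'b" where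
  "peval h s p = (\<Sum>m \<in> Poly_Mapping.keys p. h (Poly_Mapping.lookup p m) *
      (\<Prod>i \<in> Poly_Mapping.keys m. s i ^ Poly_Mapping.lookup m i))"

definition dehomogenize :: "'a::comm_semiring_1 mpoly \<Rightarrow> 'a mpoly" where
  "dehomogenize = peval Const (\<lambda>i. if i = 0 then 1 else Var i)"

definition twist :: "'a::field_char_0 mpoly \<Rightarrow> 'a mpoly" where
  "twist F = (\<Sum>m \<in> Poly_Mapping.keys F.
      Poly_Mapping.single m (Poly_Mapping.lookup F m / fact (Poly_Mapping.lookup m 0)))"

definition mpoly_ring :: "nat set \<Rightarrow> 'a::comm_ring_1 mpoly ring" where
  "mpoly_ring V = ring_of_type_algebra \<lparr>carrier := polys V\<rparr>"


section \<open>Apolarity\<close>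

definition partial :: "nat \<Rightarrow> 'a::comm_semiring_1 mpoly \<Rightarrow> 'a mpoly" where
  "partial i p = (\<Sum>m \<in> Poly_Mapping.keys p. Poly_Mapping.single (m - Poly_Mapping.single i 1)
      (of_nat (Poly_Mapping.lookup m i) * Poly_Mapping.lookup p m))"

text \<open>The operator $\partial^m = \prod_i (\partial/\partial x_i)^{m_i}$.\<close>

definition partials :: "(nat \<Rightarrow>\<^sub>0 nat) \<Rightarrow> 'a::comm_semiring_1 mpoly \<Rightarrow> 'a mpoly" where
  "partials m = fold (\<lambda>i. partial i ^^ Poly_Mapping.lookup m i)
      (sorted_list_of_set (Poly_Mapping.keys m))"

definition act :: "'a::comm_semiring_1 mpoly \<Rightarrow> 'a mpoly \<Rightarrow> 'a mpoly" where
  "act \<sigma> F = (\<Sum>m \<in> Poly_Mapping.keys \<sigma>. Const (Poly_Mapping.lookup \<sigma> m) * partials m F)"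

definition Ann :: "nat set \<Rightarrow> 'a::comm_semiring_1 mpoly \<Rightarrow> 'a mpoly set" where
  "Ann V F = {\<sigma> \<in> polys V. act \<sigma> F = 0}"

definition concise :: "nat set \<Rightarrow> 'a::comm_semiring_1 mpoly \<Rightarrow> bool" where
  "concise V F \<longleftrightarrow> \<not> (\<exists>\<sigma> \<in> Ann V F. \<sigma> \<noteq> 0 \<and> total_degree \<sigma> \<le> 1)"

definition encompassing :: "nat set \<Rightarrow> 'a::comm_semiring_1 mpoly \<Rightarrow> bool" where
  "encompassing V f \<longleftrightarrow>
     \<not> (\<exists>g \<in> (\<lambda>\<sigma>. act \<sigma> f) ` polys V. g \<noteq> 0 \<and> hom_part 0 g + hom_part 1 g = 0)"


section \<open>Commutative algebras\<close>

text \<open>An algebra over the ring \<open>'r\<close> is a commutative ring together with its structure map.\<close>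

definition is_algebra :: "('r::comm_ring_1 \<Rightarrow> 'a) \<Rightarrow> 'a ring \<Rightarrow> bool" where
  "is_algebra \<phi> A \<longleftrightarrow> cring A \<and> \<phi> \<in> ring_hom ring_of_type_algebra A"

definition alg_hom :: "('r \<Rightarrow> 'a) \<Rightarrow> 'a ring \<Rightarrow> ('r \<Rightarrow> 'b) \<Rightarrow> 'b ring \<Rightarrow> ('a \<Rightarrow> 'b) set" where
  "alg_hom \<phi> A \<psi> B = {h \<in> ring_hom A B. \<forall>c. h (\<phi> c) = \<psi> c}"

definition alg_isomorphic :: "('r \<Rightarrow> 'a) \<Rightarrow> 'a ring \<Rightarrow> ('r \<Rightarrow> 'b) \<Rightarrow> 'b ring \<Rightarrow> bool" where
  "alg_isomorphic \<phi> A \<psi> B \<longleftrightarrow> (\<exists>h \<in> alg_hom \<phi> A \<psi> B. bij_betw h (carrier A) (carrier B))"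

definition quot_map :: "('r \<Rightarrow> 'a) \<Rightarrow> 'a ring \<Rightarrow> 'a set \<Rightarrow> 'r \<Rightarrow> 'a set" where
  "quot_map \<phi> A I c = I +>\<^bsub>A\<^esub> \<phi> c"

definition free_of_rank :: "('r::comm_ring_1 \<Rightarrow> 'a) \<Rightarrow> 'a ring \<Rightarrow> nat \<Rightarrow> bool" where
  "free_of_rank \<phi> A r \<longleftrightarrow> (\<exists>b. (\<forall>i<r. b i \<in> carrier A) \<and>
     (\<forall>x \<in> carrier A. \<exists>!c. (\<forall>i\<ge>r. c i = 0) \<and> x = (\<Oplus>\<^bsub>A\<^esub>i\<in>{..<r}. \<phi> (c i) \<otimes>\<^bsub>A\<^esub> b i)))"

text \<open>\<open>\<iota>\<close> exhibits \<open>B\<close> as the localization $A[s^{-1}]$.\<close>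

definition is_localization :: "'a ring \<Rightarrow> 'a \<Rightarrow> 'b ring \<Rightarrow> ('a \<Rightarrow> 'b) \<Rightarrow> bool" where
  "is_localization A s B \<iota> \<longleftrightarrow> cring B \<and> \<iota> \<in> ring_hom A B \<and> \<iota> s \<in> Units B \<and>
     (\<forall>b \<in> carrier B. \<exists>a \<in> carrier A. \<exists>k::nat. b \<otimes>\<^bsub>B\<^esub> \<iota> s [^]\<^bsub>B\<^esub> k = \<iota> a) \<and>
     (\<forall>a \<in> carrier A. \<iota> a = \<zero>\<^bsub>B\<^esub> \<longrightarrow> (\<exists>k::nat. s [^]\<^bsub>A\<^esub> k \<otimes>\<^bsub>A\<^esub> a = \<zero>\<^bsub>A\<^esub>))"

text \<open>Formal smoothness is the infinitesimal lifting property along square-zero ideals. For an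
  algebra of finite type it suffices to test on algebras \<open>C\<close> of finite type (replace \<open>C\<close> by the
  subalgebra generated by lifts of the images of the generators), and each of these has an
  isomorphic copy on the type \<open>'r mpoly\<close>.\<close>

definition formally_smooth :: "('r::comm_ring_1 \<Rightarrow> 'a) \<Rightarrow> 'a ring \<Rightarrow> bool" where
  "formally_smooth \<psi> B \<longleftrightarrow>
     (\<forall>(C :: 'r mpoly ring) \<chi> N. \<forall>u \<in> alg_hom \<psi> B (quot_map \<chi> C N) (C Quot N).
        is_algebra \<chi> C \<and> ideal N C \<and> (\<forall>x\<in>N. \<forall>y\<in>N. x \<otimes>\<^bsub>C\<^esub> y = \<zero>\<^bsub>C\<^esub>) \<longrightarrow>
        (\<exists>v \<in> alg_hom \<psi> B \<chi> C. \<forall>b \<in> carrier B. N +>\<^bsub>C\<^esub> v b = u b))"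

text \<open>Over a field, finite type and finite presentation coincide.\<close>

definition smooth_algebra :: "('r::field \<Rightarrow> 'a) \<Rightarrow> 'a ring \<Rightarrow> bool" where
  "smooth_algebra \<psi> B \<longleftrightarrow> is_algebra \<psi> B \<and>
     (\<exists>G. finite G \<and> G \<subseteq> carrier B \<and> carrier B = generate_ring B (range \<psi> \<union> G)) \<and>
     formally_smooth \<psi> B"

text \<open>The ring $\mathbb{K}[[t]]$ is \<open>'k fps\<close>, and $\mathbb{K}[[t]][t^{-1}] = \mathbb{K}((t))$ is
  \<open>'k fls\<close>. Free modules of finite rank over these rings have isomorphic copies on the types
  \<open>nat \<Rightarrow> 'k fps\<close> and \<open>nat \<Rightarrow> 'k fls\<close>, so fixing the carrier types below loses no generality.\<close>

definition smoothable :: "('k::field \<Rightarrow> 'a) \<Rightarrow> 'a ring \<Rightarrow> bool" where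
  "smoothable \<theta> A \<longleftrightarrow>
     (\<exists>(\<phi> :: 'k fps \<Rightarrow> nat \<Rightarrow> 'k fps) \<A> (\<psi> :: 'k fls \<Rightarrow> nat \<Rightarrow> 'k fls) \<B> \<iota> r.
        is_algebra \<phi> \<A> \<and> free_of_rank \<phi> \<A> r \<and>
        (let t\<A> = PIdl\<^bsub>\<A>\<^esub> (\<phi> fps_X)
         in alg_isomorphic (\<lambda>c. quot_map \<phi> \<A> t\<A> (fps_const c)) (\<A> Quot t\<A>) \<theta> A) \<and>
        is_localization \<A> (\<phi> fps_X) \<B> \<iota> \<and>
        is_algebra \<psi> \<B> \<and> (\<forall>c. \<psi> (fps_to_fls c) = \<iota> (\<phi> c)) \<and>
        smooth_algebra \<psi> \<B>)"

definition Ap :: "nat set \<Rightarrow> 'k::comm_ring_1 mpoly \<Rightarrow> 'k mpoly set ring" where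
  "Ap V f = mpoly_ring V Quot Ann V f"

definition Ap_map :: "nat set \<Rightarrow> 'k::comm_ring_1 mpoly \<Rightarrow> 'k \<Rightarrow> 'k mpoly set" where
  "Ap_map V f = quot_map Const (mpoly_ring V) (Ann V f)"


section \<open>Closed subschemes of projective space\<close>

text \<open>A closed subscheme of $\mathbb{P}^n$ is represented by its saturated homogeneous ideal.\<close>

definition closed_subscheme :: "nat \<Rightarrow> 'k::field mpoly set \<Rightarrow> bool" where
  "closed_subscheme n I \<longleftrightarrow> ideal I (mpoly_ring {0..n}) \<and>
     (\<forall>p \<in> I. \<forall>e. hom_part e p \<in> I) \<and>
     (\<forall>p \<in> polys {0..n}. (\<exists>k. \<forall>q \<in> forms n k. q * p \<in> I) \<longrightarrow> p \<in> I)"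

text \<open>The subscheme is contained in the affine chart $\{l \neq 0\}$ of a linear form \<open>l\<close>. As the base
  field is algebraically closed, this can be checked on its rational points.\<close>

definition in_chart :: "nat \<Rightarrow> 'k::field mpoly set \<Rightarrow> 'k mpoly \<Rightarrow> bool" where
  "in_chart n I l \<longleftrightarrow> l \<in> forms n 1 \<and>
     (\<forall>a. (\<exists>i\<le>n. a i \<noteq> 0) \<and> (\<forall>\<sigma> \<in> I. peval (\<lambda>c. c) a \<sigma> = 0) \<longrightarrow> peval (\<lambda>c. c) a l \<noteq> 0)"

text \<open>The coordinate ring of the part of the subscheme in the chart $\{l \neq 0\}$, obtained by setting
  $l = 1$. It is the algebra of global functions of the subscheme whenever \<open>in_chart n I l\<close>.
  Every finite subscheme lies in such a chart, since the base field is infinite.\<close>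

definition chart_ideal :: "nat \<Rightarrow> 'k::field mpoly set \<Rightarrow> 'k mpoly \<Rightarrow> 'k mpoly set" where
  "chart_ideal n I l = Idl\<^bsub>mpoly_ring {0..n}\<^esub> (I \<union> {l - 1})"

definition chart_ring :: "nat \<Rightarrow> 'k::field mpoly set \<Rightarrow> 'k mpoly \<Rightarrow> 'k mpoly set ring" where
  "chart_ring n I l = mpoly_ring {0..n} Quot chart_ideal n I l"

definition chart_map :: "nat \<Rightarrow> 'k::field mpoly set \<Rightarrow> 'k mpoly \<Rightarrow> 'k \<Rightarrow> 'k mpoly set" where
  "chart_map n I l = quot_map Const (mpoly_ring {0..n}) (chart_ideal n I l)"

definition finite_subscheme :: "nat \<Rightarrow> 'k::field mpoly set \<Rightarrow> nat \<Rightarrow> bool" where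
  "finite_subscheme n I r \<longleftrightarrow> closed_subscheme n I \<and>
     (\<exists>l. in_chart n I l \<and> free_of_rank (chart_map n I l) (chart_ring n I l) r)"

definition smoothable_subscheme :: "nat \<Rightarrow> 'k::field mpoly set \<Rightarrow> bool" where
  "smoothable_subscheme n I \<longleftrightarrow>
     (\<exists>l. in_chart n I l \<and> smoothable (chart_map n I l) (chart_ring n I l))"

definition apolar :: "nat \<Rightarrow> 'k::field mpoly set \<Rightarrow> 'k mpoly \<Rightarrow> bool" where
  "apolar n I H \<longleftrightarrow> I \<subseteq> Ann {0..n} H"

text \<open>For a finite subscheme \<open>V(J)\<close> of $\operatorname{Spec} \mathbb{K}[\alpha_1,\dots,\alpha_n]$, viewed in
  $\mathbb{P}^n$ through the chart $\{\alpha_0 \neq 0\}$, the saturated homogeneous ideal: it is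
  spanned by the forms whose dehomogenization lies in \<open>J\<close>.\<close>

definition embedded_ideal :: "nat \<Rightarrow> 'k::field mpoly set \<Rightarrow> 'k mpoly set" where
  "embedded_ideal n J = {\<sigma> \<in> polys {0..n}. \<forall>e. dehomogenize (hom_part e \<sigma>) \<in> J}"


section \<open>Ranks of forms\<close>

text \<open>Zariski topology on a set \<open>V\<close> of polynomials, with the coefficients as coordinates. For
  \<open>V = forms n e\<close> all coordinates of monomials not occurring in forms of degree \<open>e\<close> vanish.\<close>

definition zero_locus ::
  "'k::field mpoly set \<Rightarrow> (((nat \<Rightarrow>\<^sub>0 nat) \<Rightarrow>\<^sub>0 nat) \<Rightarrow>\<^sub>0 'k) set \<Rightarrow> 'k mpoly set" where
  "zero_locus V \<Phi> = {H \<in> V. \<forall>\<phi> \<in> \<Phi>. peval (\<lambda>c. c) (Poly_Mapping.lookup H) \<phi> = 0}"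

definition zariski_closure :: "'k::field mpoly set \<Rightarrow> 'k mpoly set \<Rightarrow> 'k mpoly set" where
  "zariski_closure V S = \<Inter>{Z. S \<subseteq> Z \<and> (\<exists>\<Phi>. Z = zero_locus V \<Phi>)}"

definition waring_rank :: "nat \<Rightarrow> nat \<Rightarrow> 'k::field mpoly \<Rightarrow> enat" where
  "waring_rank n e H = Inf {enat r | r. \<exists>c L. (\<forall>i<r. L i \<in> forms n 1) \<and>
      H = (\<Sum>i<r. Const (c i) * L i ^ e)}"

definition border_rank :: "nat \<Rightarrow> nat \<Rightarrow> 'k::field mpoly \<Rightarrow> enat" where
  "border_rank n e H = Inf {enat r | r.
      H \<in> zariski_closure (forms n e) {G \<in> forms n e. waring_rank n e G \<le> enat r}}"

definition cactus_rank :: "nat \<Rightarrow> 'k::field mpoly \<Rightarrow> enat" where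
  "cactus_rank n H = Inf {enat r | r. \<exists>I. finite_subscheme n I r \<and> apolar n I H}"

definition smoothable_rank :: "nat \<Rightarrow> 'k::field mpoly \<Rightarrow> enat" where
  "smoothable_rank n H = Inf {enat r | r.
      \<exists>I. finite_subscheme n I r \<and> smoothable_subscheme n I \<and> apolar n I H}"

definition border_cactus_rank :: "nat \<Rightarrow> nat \<Rightarrow> 'k::field mpoly \<Rightarrow> enat" where
  "border_cactus_rank n e H = Inf {enat r | r.
      H \<in> zariski_closure (forms n e) {G \<in> forms n e. cactus_rank n G \<le> enat r}}"

definition middle_catalecticant_rank :: "nat \<Rightarrow> nat \<Rightarrow> 'k::field mpoly \<Rightarrow> nat" where
  "middle_catalecticant_rank n e H =
     vector_space.dim (\<lambda>c p. Const c * p) ((\<lambda>\<sigma>. act \<sigma> H) ` forms n (e div 2))"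

end

theory Submission
 imports
  Defs
  "Jordan_Normal_Form.Determinant"
begin

text \<open>
Put $a_0 = 1$ and let $a_i$ be the class of $\alpha_i$ in $\mathrm{Ap}(f)$. Because $f$ is encompassing,
$a_0, \dots, a_n$ is a basis of $\mathrm{Ap}(f)$. Multiplication by $a_i$ extends to a derivation
\<open>\<Delta>\<^sub>i\<close> of the symmetric algebra, and \<open>Ann (f ^ d)\<close> is the kernel of
\<open>p \<mapsto> p(\<Delta>\<^sub>1, \<dots>, \<Delta>\<^sub>n) (y\<^sub>0 ^ d)\<close>, a surjection onto the forms of degree \<open>d\<close> in $y_0, \dots, y_n$;
so \<open>Ap (f ^ d)\<close> has dimension \<open>N = (n + d) choose d\<close> and depends only on the structure constants.
These deform along a smoothing of $\mathrm{Ap}(f)$. The geometric generic fibre is smooth, hence split; its \<open>n + 1\<close>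
characters yield \<open>N\<close> points whose ideal is the deformed kernel. This smooths \<open>Ap (f ^ d)\<close> and exhibits
\<open>tw (F ^ d)\<close> as a limit of sums of \<open>N\<close> powers of linear forms. The lower bounds come from
the middle catalecticant, whose rank is at most the degree of any apolar scheme and is lower semicontinuous.
\<close>

text \<open>The generic fibre splits only over an algebraic closure of K((t)), where the N points
  cannot be specialised at t = 0 one by one. The border rank bound therefore works with equations
  instead of limits. An equation that holds for all sums of N powers over K becomes, after
  substitution of a general such sum, the zero polynomial in the parameters; so it also holds for
  the parameters given by the points over the closure. The coefficients of that sum lie in K[[t]],
  being expressed through structure constants and elements of K, and t = 0 yields the form itself.
  Smoothness is used through tangent vectors: one at a character would extend to formal curves of
  every order, while each coordinate satisfies a polynomial of degree at most n + 1. The dimension N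
  comes from triangularity: among the terms of \<Delta>_i only y_i d/dy_0 lowers the exponent of
  y_0. This holds over every base ring in which positive integers are invertible, so the family is
  free by construction. In the lower bound, conciseness gives e \<ge> 2 for n \<ge> 1, so degree d
  fits on both sides of the middle of d * e.\<close>

abbreviation lookup :: "('a \<Rightarrow>\<^sub>0 'b::zero) => 'a => 'b" where "lookup \<equiv> Poly_Mapping.lookup"
abbreviation keys :: "('a \<Rightarrow>\<^sub>0 'b::zero) => 'a set" where "keys \<equiv> Poly_Mapping.keys"
abbreviation single :: "'a => 'b => ('a \<Rightarrow>\<^sub>0 'b::zero)" where "single \<equiv> Poly_Mapping.single"

section \<open>Monomial expansions of polynomials\<close>

lemma sum_singles: "(\<Sum>m\<in>keys p. single m (lookup p m)) = p" for p :: "'a \<Rightarrow>\<^sub>0 'b::comm_monoid_add"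
proof (rule poly_mapping_eqI)
 fix k
 have "lookup (\<Sum>m\<in>keys p. single m (lookup p m)) k = (\<Sum>m\<in>keys p. (lookup p m when m = k))"
  by (simp add: lookup_sum lookup_single)
 also have "\<dots> = (\<Sum>m\<in>keys p. if m = k then lookup p m else 0)"
  by (rule sum.cong) (auto simp: when_def)
 also have "\<dots> = lookup p k"
  by (simp add: not_in_keys_iff_lookup_eq_zero)
 finally show "lookup (\<Sum>m\<in>keys p. single m (lookup p m)) k = lookup p k" .
qed

text \<open>The zero polynomial is a monomial with coefficient 0, so monomials and sums are the only
  cases. The rule settles statements that are additive in \<open>p\<close>.\<close>

lemma mpoly_induct [case_names single add]:
 assumes "\<And>m c. P (single m c)" and "\<And>p q. P p ==> P q ==> P (p + q)"
 shows "P (p :: 'a \<Rightarrow>\<^sub>0 'b::comm_monoid_add)"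
proof -
 have "P (\<Sum>m\<in>A. single m (lookup p m))" if "finite A" for A
  using that
 proof induct
  case empty
  have "P (single undefined 0)" using assms(1) by blast
  then show ?case by simp
 qed (auto intro: assms)
 from this[of "keys p"] show ?thesis by (simp add: sum_singles)
qed

lemma lookup_Const_mult: "lookup (Const c * p) m = c * lookup p m" for p :: "'a::comm_semiring_1 mpoly"
proof (induction p rule: mpoly_induct)
 case (single k d)
 then show ?case by (auto simp: Const_def mult_single lookup_single when_def)
qed (simp add: algebra_simps lookup_add)

lemma lookup_single_mult_plus:
 "lookup (single a c * p) (a + m) = c * lookup p m" for p :: "('b::cancel_comm_monoid_add) \<Rightarrow>\<^sub>0 'a::comm_semiring_1"
proof (induction p rule: mpoly_induct)
 case (single k d)
 then show ?case by (auto simp: mult_single lookup_single when_def)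
qed (simp add: algebra_simps lookup_add)

lemma Const_0 [simp]: "Const 0 = 0" and Const_1 [simp]: "Const 1 = 1"
 and Const_add: "Const (a + b) = Const a + Const b"
 and Const_mult: "Const (a * b) = Const a * Const b" for a b :: "'a::comm_semiring_1"
 by (auto simp: Const_def single_add mult_single)

lemma Const_uminus: "Const (- a) = - Const a" and Const_diff: "Const (a - b) = Const a - Const b"
 for a b :: "'a::comm_ring_1"
 by (auto simp: Const_def single_uminus single_diff)

lemma comm_ring_hom_Const: "comm_ring_hom (Const :: 'a::comm_ring_1 => 'a mpoly)"
 by standard (auto simp: Const_add Const_mult)

lemma Const_eq_0_iff [simp]: "Const a = 0 \<longleftrightarrow> a = 0"
 by (metis Const_def lookup_single_eq lookup_zero single_zero)

lemma Const_sum: "Const (sum f A) = (\<Sum>x\<in>A. Const (f x))" for f :: "_ => 'a::comm_semiring_1"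
 by (induction A rule: infinite_finite_induct) (auto simp: Const_add)

lemma single_eq_Const_mult: "single m c = Const c * single m 1" for c :: "'a::comm_semiring_1"
 by (simp add: Const_def mult_single)

lemma mpoly_eq_sum: "p = (\<Sum>m\<in>keys p. Const (lookup p m) * single m 1)" for p :: "'a::comm_semiring_1 mpoly"
 by (subst sum_singles[symmetric]) (simp add: single_eq_Const_mult[symmetric])

lemma Var_mult_single: "Var i * single m c = single (single i 1 + m) c" for c :: "'a::comm_semiring_1"
 by (simp add: Var_def mult_single)

section \<open>Evaluation\<close>

text \<open>Sums over \<open>keys\<close> of different polynomials have different index sets;
  passing to a common finite superset makes additivity termwise. The other \<open>_superset\<close>
  lemmas serve the same purpose.\<close>

lemma peval_superset:
 assumes "h 0 = 0" "finite A" "keys p \<subseteq> A"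
 shows "peval h s p = (\<Sum>m\<in>A. h (lookup p m) * (\<Prod>i\<in>keys m. s i ^ lookup m i))"
 unfolding peval_def using assms
 by (intro sum.mono_neutral_left) (auto simp: in_keys_iff)

lemma prod_keys_superset:
 fixes s :: "_ => 'a::comm_monoid_mult"
 assumes "finite A" "keys m \<subseteq> A"
 shows "(\<Prod>i\<in>keys m. s i ^ lookup m i) = (\<Prod>i\<in>A. s i ^ lookup m i)"
 using assms by (intro prod.mono_neutral_left) (auto simp: in_keys_iff)

definition mval :: "('v => 'b) => ('v \<Rightarrow>\<^sub>0 nat) => 'b::comm_monoid_mult" where
 "mval s m = (\<Prod>i\<in>keys m. s i ^ lookup m i)"

lemma mval_add: "mval s (a + b) = mval s a * mval s b"
proof -
 have "keys (a + b) \<subseteq> keys a \<union> keys b" by (rule keys_add)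
 then show ?thesis unfolding mval_def
  by (subst (1 2 3) prod_keys_superset[of "keys a \<union> keys b"])
    (auto simp: lookup_add power_add prod.distrib)
qed

lemma mval_0 [simp]: "mval s 0 = 1" by (simp add: mval_def)

lemma mval_single [simp]: "mval s (single i k) = s i ^ k"
 by (cases "k = 0") (auto simp: mval_def)

lemma mval_superset:
 "finite A ==> keys m \<subseteq> A ==> mval s m = (\<Prod>i\<in>A. s i ^ lookup m i)"
 unfolding mval_def by (rule prod_keys_superset)

lemma mval_cong: "(\<And>i. i \<in> keys m ==> s i = t i) ==> mval s m = mval t m"
 by (simp add: mval_def)

lemma peval_alt: "peval h s p = (\<Sum>m\<in>keys p. h (lookup p m) * mval s m)"
 by (simp add: peval_def mval_def)

lemma peval_single: "h 0 = 0 ==> peval h s (single m c) = h c * mval s m"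
 by (cases "c = 0") (auto simp: peval_alt)

lemma peval_add:
 assumes "h 0 = 0" "\<And>a b. h (a + b) = h a + h b"
 shows "peval h s (p + q) = peval h s p + peval h s q"
proof -
 let ?A = "keys p \<union> keys q"
 have "keys (p + q) \<subseteq> ?A" by (rule keys_add)
 then show ?thesis
  using assms by (simp add: peval_superset[of h ?A] lookup_add algebra_simps sum.distrib)
qed

lemma comm_ring_hom_peval:
 fixes h :: "'a::comm_ring_1 => 'b::comm_ring_1"
 assumes "comm_ring_hom h"
 shows "comm_ring_hom (peval h s)"
proof -
 interpret h: comm_ring_hom h by fact
 have m: "peval h s (p * q) = peval h s p * peval h s q" for p q
 proof (induction p rule: mpoly_induct)
  case (single m c)
  show ?case
  proof (induction q rule: mpoly_induct)
   case (single k d)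
   show ?case by (simp add: mult_single peval_single h.hom_mult mval_add)
  qed (simp add: peval_add h.hom_add algebra_simps)
 qed (simp add: peval_add h.hom_add algebra_simps)
 show ?thesis
  by standard (auto simp: peval_add h.hom_add m peval_single peval_alt[of h s 0] simp flip: single_one)
qed

lemma peval_Const [simp]: "h 0 = 0 ==> peval h s (Const c) = h c"
 by (simp add: Const_def peval_single)

lemma peval_Var:
 fixes h :: "'a::comm_semiring_1 => 'b::comm_semiring_1"
 shows "h 0 = 0 ==> h 1 = 1 ==> peval h s (Var i) = s i"
 by (simp add: Var_def peval_single)

lemma hom_peval:
 assumes "comm_ring_hom g" "h 0 = 0"
 shows "g (peval h s p) = peval (\<lambda>c. g (h c)) (\<lambda>i. g (s i)) p"
proof -
 interpret g: comm_ring_hom g by fact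
 show ?thesis by (simp add: peval_alt mval_def g.hom_sum g.hom_mult g.hom_prod g.hom_power)
qed

lemma peval_cong:
 assumes "\<And>c. h c = h' c" "\<And>m i. m \<in> keys p ==> i \<in> keys m ==> s i = t i"
 shows "peval h s p = peval h' t p"
 unfolding peval_alt by (intro sum.cong refl) (metis assms mval_cong)

lemma comm_ring_hom_id: "comm_ring_hom (\<lambda>x::'a::comm_ring_1. x)"
 by standard auto

lemma comm_ring_hom_comp:
 "comm_ring_hom g ==> comm_ring_hom h ==> comm_ring_hom (\<lambda>x. g (h x))"
proof -
 assume "comm_ring_hom g" "comm_ring_hom h"
 then interpret g: comm_ring_hom g + h: comm_ring_hom h .
 show ?thesis by standard (auto simp: g.hom_add g.hom_mult h.hom_add h.hom_mult)
qed

text \<open>Base change of coefficients, written as evaluation at the variables so that the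
  homomorphism laws come from \<open>comm_ring_hom_peval\<close>.\<close>

definition mapc :: "('a::comm_ring_1 => 'b::comm_ring_1) => 'a mpoly => 'b mpoly" where
 "mapc h = peval (\<lambda>c. Const (h c)) Var"

lemma mval_Var: "mval Var m = (single m 1 :: 'a::comm_semiring_1 mpoly)"
proof (induction m rule: mpoly_induct)
 case (single i k)
 show ?case
 proof (induction k)
  case (Suc k)
  have "Var i * single (single i k) 1 = (single (single i (Suc k)) 1 :: 'a mpoly)"
   by (simp add: Var_mult_single flip: single_add)
  with Suc show ?case by simp
 qed simp
qed (simp add: mval_add mult_single)

lemma comm_ring_hom_mapc:
 "comm_ring_hom h ==> comm_ring_hom (mapc h)"
 unfolding mapc_def by (intro comm_ring_hom_peval comm_ring_hom_comp[OF comm_ring_hom_Const])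

lemma mapc_single: "h 0 = 0 ==> mapc h (single m c) = single m (h c)"
 by (simp add: mapc_def peval_single mval_Var flip: single_eq_Const_mult)

lemma lookup_mapc:
 assumes "comm_ring_hom h" shows "lookup (mapc h p) m = h (lookup p m)"
proof -
 interpret h: comm_ring_hom h by fact
 interpret p: comm_ring_hom "mapc h" by (rule comm_ring_hom_mapc) fact
 show ?thesis
 proof (induction p rule: mpoly_induct)
  case (single k c)
  then show ?case by (simp add: mapc_single lookup_single when_def)
 qed (simp add: p.hom_add lookup_add h.hom_add)
qed

lemma mapc_Var [simp]: "comm_ring_hom h ==> mapc h (Var i) = Var i"
proof -
 assume "comm_ring_hom h" then interpret h: comm_ring_hom h .
 show ?thesis by (simp add: Var_def mapc_single)
qed

lemma mapc_Const [simp]: "comm_ring_hom h ==> mapc h (Const c) = Const (h c)"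
proof -
 assume "comm_ring_hom h" then interpret h: comm_ring_hom h .
 show ?thesis by (simp add: Const_def mapc_single)
qed

lemma peval_mapc:
 assumes "comm_ring_hom g" "comm_ring_hom h"
 shows "peval g s (mapc h p) = peval (\<lambda>c. g (h c)) s p"
proof -
 interpret h: comm_ring_hom h by fact
 interpret g: comm_ring_hom g by fact
 interpret m: comm_ring_hom "mapc h" by (rule comm_ring_hom_mapc) fact
 interpret p: comm_ring_hom "peval g s" by (rule comm_ring_hom_peval) fact
 interpret q: comm_ring_hom "peval (\<lambda>c. g (h c)) s"
  by (rule comm_ring_hom_peval[OF comm_ring_hom_comp[OF assms]])
 show ?thesis
  by (induction p rule: mpoly_induct) (auto simp: mapc_single peval_single m.hom_add p.hom_add q.hom_add)
qed

section \<open>Polynomial subrings\<close>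

lemma polysI: "(\<And>m. m \<in> keys p ==> keys m \<subseteq> V) ==> p \<in> polys V"
 by (simp add: polys_def)

lemma single_polys: "keys m \<subseteq> V ==> single m c \<in> polys V"
 by (auto simp: polys_def)

lemma Const_polys [simp]: "Const c \<in> polys V" by (auto simp: Const_def polys_def)
lemma zero_polys [simp]: "0 \<in> polys V" by (auto simp: polys_def)
lemma one_polys [simp]: "(1::'a::comm_semiring_1 mpoly) \<in> polys V" by (auto simp: polys_def)
lemma Var_polys: "i \<in> V ==> Var i \<in> polys V" by (auto simp: polys_def Var_def)

lemma add_polys: "p \<in> polys V ==> q \<in> polys V ==> p + q \<in> polys V"
 using keys_add[of p q] by (auto simp: polys_def)

lemma uminus_polys: "p \<in> polys V ==> - p \<in> polys V" for p :: "'a::ab_group_add mpoly"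
 by (auto simp: polys_def in_keys_iff)

lemma diff_polys: "p \<in> polys V ==> q \<in> polys V ==> p - q \<in> polys V" for p :: "'a::ab_group_add mpoly"
 using add_polys[of p V "- q"] uminus_polys[of q V] by simp

lemma mult_polys: "p \<in> polys V ==> q \<in> polys V ==> p * q \<in> polys V" for p :: "'a::comm_semiring_1 mpoly"
proof (rule polysI)
 fix m assume "p \<in> polys V" "q \<in> polys V" "m \<in> keys (p * q)"
 then obtain a b where "a \<in> keys p" "b \<in> keys q" "m = a + b" using keys_mult[of p q] by blast
 moreover from this have "keys m \<subseteq> keys a \<union> keys b" by (simp add: keys_add)
 ultimately show "keys m \<subseteq> V" using \<open>p \<in> polys V\<close> \<open>q \<in> polys V\<close> by (fastforce simp: polys_def)
qed

lemma sum_polys: "(\<And>x. x \<in> A ==> f x \<in> polys V) ==> sum f A \<in> polys V"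
 by (induction A rule: infinite_finite_induct) (auto intro: add_polys)

lemma power_polys: "p \<in> polys V ==> p ^ k \<in> polys V" for p :: "'a::comm_semiring_1 mpoly"
 by (induction k) (auto intro: mult_polys)

lemma polys_mono: "V \<subseteq> W ==> p \<in> polys V ==> p \<in> polys W"
 by (auto simp: polys_def)

text \<open>Peeling one variable off a monomial lowers the sum of its exponents, which is the
  measure of the induction.\<close>

lemma single_induct [consumes 1, case_names zero add]:
 fixes m :: "'v \<Rightarrow>\<^sub>0 nat"
 assumes "keys m \<subseteq> V" "P 0"
  and "\<And>i m. i \<in> V ==> keys m \<subseteq> V ==> P m ==> P (single i 1 + m)"
 shows "P m"
 using assms(1)
proof (induction "sum (lookup m) (keys m)" arbitrary: m)
 case 0
 then have "keys m = {}" by (metis finite_keys in_keys_iff sum_eq_0_iff equals0I)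
 then have "m = 0" by (intro poly_mapping_eqI) (auto simp: in_keys_iff)
 with assms(2) show ?case by simp
next
 case (Suc k)
 then have "keys m \<noteq> {}" by auto
 then obtain i where i: "i \<in> keys m" by blast
 define m' where "m' = m - single i 1"
 have m: "m = single i 1 + m'" using i
  by (intro poly_mapping_eqI) (auto simp: m'_def lookup_add lookup_minus lookup_single when_def in_keys_iff)
 have km: "keys m = insert i (keys m')" 
  by (subst m) (auto simp: in_keys_iff lookup_add lookup_single when_def split: if_splits)
 have "sum (lookup m) (keys m) = (\<Sum>j\<in>keys m. lookup m' j) + (\<Sum>j\<in>keys m. (if j = i then 1 else 0))"
  unfolding sum.distrib[symmetric] by (rule sum.cong) (auto simp: m lookup_add lookup_single when_def)
 also have "(\<Sum>j\<in>keys m. lookup m' j) = sum (lookup m') (keys m')"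
  by (rule sum.mono_neutral_right) (auto simp: km in_keys_iff)
 finally have "sum (lookup m') (keys m') = k" using Suc(2) i by simp
 then have "P m'" using Suc(1)[of m'] Suc(3) km by auto
 then show ?case unfolding m using Suc(3) km i by (intro assms(3)) auto
qed

text \<open>Multiplication by one variable at a time is the right step for maps that turn it into an
  operator, such as \<open>Theta\<close> and \<open>act\<close>.\<close>

lemma polys_induct [consumes 1, case_names Const add Var]:
 fixes p :: "'a::comm_semiring_1 mpoly"
 assumes "p \<in> polys V" and C: "\<And>c. P (Const c)"
  and A: "\<And>p q. p \<in> polys V ==> q \<in> polys V ==> P p ==> P q ==> P (p + q)"
  and M: "\<And>i p. i \<in> V ==> p \<in> polys V ==> P p ==> P (Var i * p)"
 shows "P p"
proof -
 have S: "P (single m c)" if "keys m \<subseteq> V" for m c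
  using that
 proof (induction m rule: single_induct)
  case zero
  then show ?case using C[of c] by (simp add: Const_def)
 next
  case (add i m)
  have "single (single i 1 + m) c = Var i * single m c" by (simp add: Var_mult_single)
  then show ?case using M[OF add(1) single_polys[OF add(2)] add(3)] by metis
 qed
 have "P (\<Sum>m\<in>A. single m (lookup p m))" if "finite A" "\<forall>m\<in>A. keys m \<subseteq> V" for A
  using that
 proof (induct A rule: finite_induct)
  case empty
  show "P (\<Sum>m\<in>{}. single m (lookup p m))" using C[of 0] by simp
 next
  case (insert x F)
  then show "P (\<Sum>m\<in>insert x F. single m (lookup p m))" by (auto intro!: A S single_polys sum_polys)
 qed
 from this[of "keys p"] assms(1) show ?thesis by (simp add: sum_singles polys_def)
qed

section \<open>Differentiation\<close>

lemma partial_superset: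
 assumes "finite A" "keys p \<subseteq> A"
 shows "partial i p = (\<Sum>m\<in>A. single (m - single i 1) (of_nat (lookup m i) * lookup p m))"
 unfolding partial_def using assms
 by (intro sum.mono_neutral_left) (auto simp: in_keys_iff)

lemma partial_add: "partial i (p + q) = partial i p + partial i q"
proof -
 have "keys (p + q) \<subseteq> keys p \<union> keys q" by (rule keys_add)
 then show ?thesis
  by (simp add: partial_superset[of "keys p \<union> keys q"] lookup_add algebra_simps sum.distrib single_add)
qed

lemma partial_single: "partial i (single m c) = single (m - single i 1) (of_nat (lookup m i) * c)"
 by (cases "c = 0") (auto simp: partial_def)

lemma minus_single_eq_iff:
 "lookup m i > 0 ==> m - single i 1 = c \<longleftrightarrow> m = c + single i (1::nat)"
 by (auto simp: poly_mapping_eq_iff fun_eq_iff lookup_add lookup_minus lookup_single when_def split: if_splits)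

lemma lookup_partial: "lookup (partial i p) c = of_nat (Suc (lookup c i)) * lookup p (c + single i 1)"
proof (induction p rule: mpoly_induct)
 case (single m d)
 show ?case
 proof (cases "lookup m i = 0")
  case True
  then have "m \<noteq> c + single i 1" by (auto simp: lookup_add)
  with True show ?thesis by (auto simp: partial_single lookup_single when_def)
 next
  case False
  then show ?thesis using minus_single_eq_iff[of m i c]
   by (auto simp: partial_single lookup_single when_def lookup_add)
 qed
qed (simp add: partial_add lookup_add algebra_simps)

lemma partial_0 [simp]: "partial i 0 = 0"
 by (simp add: partial_def)

lemma partial_Const [simp]: "partial i (Const c) = 0"
 by (simp add: Const_def partial_single)

lemma partial_Var: "partial i (Var j :: 'a::comm_semiring_1 mpoly) = (if i = j then 1 else 0)"
 by (simp add: Var_def partial_single lookup_single when_def)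

lemma partial_mult: "partial i (p * q) = partial i p * q + p * partial i q" for p :: "'a::comm_semiring_1 mpoly"
proof (induction p rule: mpoly_induct)
 case (single a c)
 show ?case
 proof (induction q rule: mpoly_induct)
  case (single b d)
  have 1: "lookup a i > 0 ==> a + b - single i 1 = (a - single i 1) + b"
   by (auto simp: poly_mapping_eq_iff fun_eq_iff lookup_add lookup_minus lookup_single when_def)
  have 2: "lookup b i > 0 ==> a + b - single i 1 = a + (b - single i 1)"
   by (auto simp: poly_mapping_eq_iff fun_eq_iff lookup_add lookup_minus lookup_single when_def)
  have "partial i (single a c * single b d) =
    single (a + b - single i 1) (of_nat (lookup a i) * (c * d)) +
    single (a + b - single i 1) (of_nat (lookup b i) * (c * d))"
   by (simp add: mult_single partial_single lookup_add algebra_simps single_add)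
  also have "single (a + b - single i 1) (of_nat (lookup a i) * (c * d)) =
    partial i (single a c) * single b d"
   using 1 by (cases "lookup a i = 0") (auto simp: partial_single mult_single algebra_simps)
  also have "single (a + b - single i 1) (of_nat (lookup b i) * (c * d)) =
    single a c * partial i (single b d)"
   using 2 by (cases "lookup b i = 0") (auto simp: partial_single mult_single algebra_simps)
  finally show ?case .
 qed (simp add: partial_add algebra_simps)
qed (simp add: partial_add algebra_simps)

lemma partial_sum: "partial i (sum f A) = (\<Sum>x\<in>A. partial i (f x))"
 by (induction A rule: infinite_finite_induct) (auto simp: partial_add)

lemma partial_power:
 "partial i (p ^ Suc k) = of_nat (Suc k) * p ^ k * partial i p" for p :: "'a::comm_semiring_1 mpoly"
 by (induction k) (auto simp: partial_mult algebra_simps)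

lemma partial_polys: "p \<in> polys V ==> partial i p \<in> polys V" for p :: "'a::comm_semiring_1 mpoly"
proof (rule polysI)
 fix m assume p: "p \<in> polys V" "m \<in> keys (partial i p)"
 then have "m + single i 1 \<in> keys p" by (auto simp: in_keys_iff lookup_partial)
 then have "keys (m + single i 1) \<subseteq> V" using p by (auto simp: polys_def)
 then show "keys m \<subseteq> V" by (auto simp: in_keys_iff lookup_add subset_iff)
qed

text \<open>A derivation along \<open>h\<close> is determined by its values on the variables. It is
  applied to a commutator and to differences of two derivations along the same map.\<close>

lemma derivation_eq_0:
 fixes p :: "'a::comm_semiring_1 mpoly" and h E :: "'a mpoly => 'b::comm_ring_1"
 assumes "p \<in> polys V" "\<And>p q. E (p + q) = E p + E q" "\<And>p q. E (p * q) = h p * E q + E p * h q"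
  and "\<And>c. E (Const c) = 0" "\<And>i. i \<in> V ==> E (Var i) = 0"
 shows "E p = 0"
 using assms(1) by (induction rule: polys_induct) (auto simp: assms(2-))

section \<open>Contraction\<close>

definition mfact :: "('v \<Rightarrow>\<^sub>0 nat) => nat" where
 "mfact m = (\<Prod>i\<in>keys m. fact (lookup m i))"

lemma mfact_superset: "finite A ==> keys m \<subseteq> A ==> mfact m = (\<Prod>i\<in>A. fact (lookup m i))"
 unfolding mfact_def by (intro prod.mono_neutral_left) (auto simp: in_keys_iff)

lemma mfact_0 [simp]: "mfact 0 = 1" by (simp add: mfact_def)

lemma mfact_pos [simp]: "mfact m > 0" by (auto simp: mfact_def intro!: prod_pos)

lemma mfact_neq_0 [simp]: "mfact m \<noteq> 0" using mfact_pos[of m] by simp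

lemma mfact_add_single: "mfact (c + single i 1) = Suc (lookup c i) * mfact c"
proof -
 let ?A = "insert i (keys c)"
 have "keys (c + single i 1) \<subseteq> ?A" using keys_add[of c "single i 1"] by auto
 then have "mfact (c + single i 1) = (\<Prod>j\<in>?A. fact (lookup (c + single i 1) j))"
  by (intro mfact_superset) auto
 also have "\<dots> = fact (Suc (lookup c i)) * (\<Prod>j\<in>?A - {i}. fact (lookup (c + single i 1) j))"
  by (subst prod.remove[of _ i]) (auto simp: lookup_add)
 also have "(\<Prod>j\<in>?A - {i}. fact (lookup (c + single i 1) j)) = (\<Prod>j\<in>?A - {i}. fact (lookup c j) :: nat)"
  by (intro prod.cong) (auto simp: lookup_add lookup_single when_def)
 also have "fact (Suc (lookup c i)) * \<dots> = Suc (lookup c i) * (\<Prod>j\<in>?A. fact (lookup c j))"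
  by (subst (2) prod.remove[of _ i]) (auto simp: algebra_simps)
 also have "(\<Prod>j\<in>?A. fact (lookup c j)) = mfact c" by (rule mfact_superset[symmetric]) auto
 finally show ?thesis .
qed

text \<open>The value at the origin of the derivative $\partial^c p$.\<close>

definition dcoeff :: "'a::comm_semiring_1 mpoly => (nat \<Rightarrow>\<^sub>0 nat) => 'a" where
 "dcoeff p c = of_nat (mfact c) * lookup p c"

text \<open>The factorials in \<open>dcoeff\<close> absorb the exponents produced by
  differentiation, which becomes a shift of the index.\<close>

lemma dcoeff_partial: "dcoeff (partial i p) c = dcoeff p (c + single i 1)"
 by (simp add: dcoeff_def lookup_partial mfact_add_single[unfolded One_nat_def] algebra_simps)

lemma dcoeff_partial_pow: "dcoeff ((partial i ^^ k) p) c = dcoeff p (c + single i k)"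
proof (induction k arbitrary: c)
 case (Suc k)
 have "dcoeff ((partial i ^^ Suc k) p) c = dcoeff p (c + single i 1 + single i k)"
  by (simp add: dcoeff_partial Suc)
 then show ?case by (simp add: add.assoc flip: single_add)
qed simp

lemma dcoeff_partials: "dcoeff (partials m p) c = dcoeff p (c + m)"
proof -
 have "dcoeff (fold (\<lambda>i. partial i ^^ lookup m i) xs p) c = dcoeff p (c + (\<Sum>i\<leftarrow>xs. single i (lookup m i)))" for xs
  by (induction xs arbitrary: p) (auto simp: dcoeff_partial_pow algebra_simps)
 from this[of "sorted_list_of_set (keys m)"] show ?thesis
  by (simp add: partials_def sum_list_distinct_conv_sum_set sum_singles)
qed

lemma dcoeff_add: "dcoeff (p + q) c = dcoeff p c + dcoeff q c"
 by (simp add: dcoeff_def lookup_add algebra_simps)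

lemma dcoeff_Const_mult: "dcoeff (Const a * p) c = a * dcoeff p c"
 by (simp add: dcoeff_def lookup_Const_mult mult.left_commute)

lemma dcoeff_sum: "dcoeff (sum f A) c = (\<Sum>x\<in>A. dcoeff (f x) c)"
 by (induction A rule: infinite_finite_induct) (auto simp: dcoeff_add dcoeff_def[of 0])

text \<open>Characteristic zero enters here: the factor \<open>mfact c\<close> can be
  cancelled.\<close>

lemma mpoly_eqI_dcoeff:
 fixes p q :: "'a::field_char_0 mpoly"
 assumes "\<And>c. dcoeff p c = dcoeff q c" shows "p = q"
proof (rule poly_mapping_eqI)
 fix c :: "nat \<Rightarrow>\<^sub>0 nat"
 show "lookup p c = lookup q c" using assms[of c] by (simp add: dcoeff_def)
qed

text \<open>The apolarity pairing: the value of \<open>act \<sigma> F\<close> at the origin.\<close>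

definition pair :: "'a::comm_semiring_1 mpoly => 'a mpoly => 'a" where
 "pair F \<sigma> = (\<Sum>m\<in>keys \<sigma>. lookup \<sigma> m * dcoeff F m)"

lemma pair_superset:
 "finite A ==> keys \<sigma> \<subseteq> A ==> pair F \<sigma> = (\<Sum>m\<in>A. lookup \<sigma> m * dcoeff F m)"
 unfolding pair_def by (intro sum.mono_neutral_left) (auto simp: in_keys_iff)

lemma pair_add: "pair F (\<sigma> + \<tau>) = pair F \<sigma> + pair F \<tau>"
 using keys_add[of \<sigma> \<tau>]
 by (simp add: pair_superset[of "keys \<sigma> \<union> keys \<tau>"] lookup_add algebra_simps sum.distrib)

lemma pair_single: "pair F (single m c) = c * dcoeff F m"
 by (cases "c = 0") (auto simp: pair_def)

lemma pair_0 [simp]: "pair F 0 = 0" by (simp add: pair_def)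
lemma pair_0_left [simp]: "pair 0 \<sigma> = 0" by (simp add: pair_def dcoeff_def)

lemma pair_Const_mult: "pair F (Const c * \<sigma>) = c * pair F \<sigma>"
proof (induction \<sigma> rule: mpoly_induct)
 case (single m d)
 then show ?case by (simp add: Const_def mult_single pair_single algebra_simps)
qed (simp add: algebra_simps pair_add)

lemma pair_sum: "pair F (sum f A) = (\<Sum>x\<in>A. pair F (f x))"
 by (induction A rule: infinite_finite_induct) (auto simp: pair_add)

lemma pair_diff: "pair F (\<sigma> - \<tau>) = pair F \<sigma> - pair F \<tau>" for F :: "'a::comm_ring_1 mpoly"
 using pair_add[of F "\<sigma> - \<tau>" \<tau>] by (simp add: eq_diff_eq)

lemma pair_add_left: "pair (F + G) \<sigma> = pair F \<sigma> + pair G \<sigma>"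
 by (simp add: pair_def dcoeff_add algebra_simps sum.distrib)

lemma dcoeff_act: "dcoeff (act \<sigma> F) c = pair F (\<sigma> * single c 1)"
proof -
 have "pair F (\<sigma> * single c 1) = (\<Sum>m\<in>keys \<sigma>. lookup \<sigma> m * dcoeff F (c + m))"
  by (subst (1) sum_singles[of \<sigma>, symmetric])
    (simp add: sum_distrib_right pair_sum mult_single pair_single add.commute)
 then show ?thesis
  by (simp add: act_def dcoeff_sum dcoeff_Const_mult dcoeff_partials)
qed

text \<open>Acting by \<sigma> is the transpose of multiplying by \<sigma>. Since the pairings
  determine a polynomial, most rules for \<open>act\<close> below are read off from this adjunction
  instead of from iterated derivatives.\<close>

lemma pair_act: "pair (act \<sigma> F) \<tau> = pair F (\<sigma> * \<tau>)"
proof (induction \<tau> rule: mpoly_induct)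
 case (single m c)
 have "\<sigma> * single m c = Const c * (\<sigma> * single m 1)"
  by (subst single_eq_Const_mult) (simp add: algebra_simps)
 then show ?case by (simp add: pair_single dcoeff_act pair_Const_mult)
qed (simp add: pair_add algebra_simps)

lemma mpoly_eqI_pair:
 fixes p q :: "'a::field_char_0 mpoly"
 assumes "\<And>\<sigma>. pair p \<sigma> = pair q \<sigma>" shows "p = q"
 using assms[of "single _ 1"] by (intro mpoly_eqI_dcoeff) (simp add: pair_single)

lemma act_eq_0_iff: "act \<sigma> F = 0 \<longleftrightarrow> (\<forall>\<tau>. pair F (\<sigma> * \<tau>) = 0)" for F :: "'a::field_char_0 mpoly"
 by (metis mpoly_eqI_pair pair_0_left pair_act)

context
 fixes F G \<sigma> \<tau> :: "'a::field_char_0 mpoly"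
begin

lemma act_add: "act (\<sigma> + \<tau>) F = act \<sigma> F + act \<tau> F"
 by (rule mpoly_eqI_pair) (simp add: pair_act pair_add pair_add_left algebra_simps)
lemma act_add_right: "act \<sigma> (F + G) = act \<sigma> F + act \<sigma> G"
 by (rule mpoly_eqI_pair) (simp add: pair_act pair_add pair_add_left algebra_simps)
lemma act_mult: "act (\<sigma> * \<tau>) F = act \<sigma> (act \<tau> F)"
 by (rule mpoly_eqI_pair) (simp add: pair_act algebra_simps)
lemma act_1 [simp]: "act 1 F = F"
 by (rule mpoly_eqI_pair) (simp add: pair_act)
lemma act_0 [simp]: "act 0 F = 0"
 by (rule mpoly_eqI_pair) (simp add: pair_act)
lemma act_Var: "act (Var i) F = partial i F"
 by (rule mpoly_eqI_dcoeff) (simp add: dcoeff_act dcoeff_partial Var_mult_single pair_single add.commute)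
lemma act_Const: "act (Const c) F = Const c * F"
 by (rule mpoly_eqI_dcoeff) (simp add: dcoeff_act dcoeff_Const_mult pair_Const_mult pair_single)
lemma act_0_right [simp]: "act \<sigma> 0 = 0"
 by (simp add: act_eq_0_iff)

end

lemma act_Const_mult: "act (Const c * \<sigma>) F = Const c * act \<sigma> F" for F :: "'a::field_char_0 mpoly"
 by (simp add: act_mult act_Const)

lemma act_sum: "act (sum f A) F = (\<Sum>x\<in>A. act (f x) F)" for F :: "'a::field_char_0 mpoly"
 by (induction A rule: infinite_finite_induct) (auto simp: act_add)

lemma act_Const_mult_right: "act \<sigma> (Const c * F) = Const c * act \<sigma> F" for F :: "'a::field_char_0 mpoly"
 by (metis act_Const act_mult mult.commute)

lemma act_sum_right: "act \<sigma> (sum f A) = (\<Sum>x\<in>A. act \<sigma> (f x))" for \<sigma> :: "'a::field_char_0 mpoly"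
 by (induction A rule: infinite_finite_induct) (auto simp: act_add_right)

lemma Ann_iff: "\<sigma> \<in> Ann V F \<longleftrightarrow> \<sigma> \<in> polys V \<and> (\<forall>\<tau>. pair F (\<sigma> * \<tau>) = 0)" for F :: "'a::field_char_0 mpoly"
 by (auto simp: Ann_def act_eq_0_iff)

lemma act_polys: "F \<in> polys V ==> act \<sigma> F \<in> polys V" for F :: "'a::field_char_0 mpoly"
proof (induction \<sigma> rule: mpoly_induct)
 case (single m c)
 have "act (single m 1) F \<in> polys V"
 proof (induction m rule: single_induct[where V = UNIV, OF subset_UNIV, case_names zero add])
  case (add i m)
  have "single (single i 1 + m) (1::'a) = Var i * single m 1" by (simp add: Var_mult_single)
  with add show ?case by (simp add: act_mult act_Var partial_polys)
 qed (use single in auto)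
 then show ?case by (subst single_eq_Const_mult) (simp add: act_Const_mult mult_polys)
qed (simp add: act_add add_polys)

lemma pair_zero_outside:
 assumes "F \<in> polys V" "\<not> keys m \<subseteq> V" shows "pair F (single m c * \<tau>) = 0"
proof (induction \<tau> rule: mpoly_induct)
 case (single k d)
 have "m + k \<notin> keys F"
 proof
  assume "m + k \<in> keys F"
  then have "keys (m + k) \<subseteq> V" using assms by (auto simp: polys_def)
  with assms(2) show False by (auto simp: in_keys_iff lookup_add subset_iff)
 qed
 then show ?case by (simp add: mult_single pair_single dcoeff_def in_keys_iff)
qed (simp add: algebra_simps pair_add)

text \<open>A monomial with a variable outside \<open>V\<close> pairs to zero with \<open>F\<close>,
  and so do its multiples; this leaves the test elements in \<open>polys V\<close>.\<close>

lemma pair_polys_suffices: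
 assumes "F \<in> polys V" "\<And>\<tau>. \<tau> \<in> polys V ==> pair F (\<sigma> * \<tau>) = 0" shows "pair F (\<sigma> * \<tau>) = 0"
proof (induction \<tau> rule: mpoly_induct)
 case (single k d)
 show ?case
 proof (cases "keys k \<subseteq> V")
  case True then show ?thesis by (intro assms(2) single_polys)
 next
  case False then show ?thesis by (subst mult.commute) (rule pair_zero_outside[OF assms(1)])
 qed
qed (simp add: algebra_simps pair_add)

section \<open>Degrees\<close>

lemma mdeg_superset: "finite A ==> keys m \<subseteq> A ==> mdeg m = (\<Sum>i\<in>A. lookup m i)"
 unfolding mdeg_def by (intro sum.mono_neutral_left) (auto simp: in_keys_iff)

lemma mdeg_add: "mdeg (a + b) = mdeg a + mdeg b"
 using keys_add[of a b]
 by (simp add: mdeg_superset[of "keys a \<union> keys b"] lookup_add sum.distrib)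

lemma mdeg_0 [simp]: "mdeg 0 = 0" by (simp add: mdeg_def)
lemma mdeg_single [simp]: "mdeg (single i k) = k" by (cases "k = 0") (auto simp: mdeg_def)

lemma mdeg_eq_0_iff [simp]: "mdeg m = 0 \<longleftrightarrow> m = 0"
proof
 assume "mdeg m = 0"
 then show "m = 0" by (intro poly_mapping_eqI) (metis in_keys_iff finite_keys lookup_zero mdeg_def sum_eq_0_iff)
qed simp

lemma lookup_le_mdeg: "lookup m i \<le> mdeg m"
 using member_le_sum[of i "keys m" "lookup m"] by (cases "i \<in> keys m") (auto simp: mdeg_def in_keys_iff)

lemma lookup_hom_part: "lookup (hom_part e p) m = (if mdeg m = e then lookup p m else 0)"
proof -
 have "lookup (hom_part e p) m = (\<Sum>k\<in>{k \<in> keys p. mdeg k = e}. if k = m then lookup p k else 0)"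
  unfolding hom_part_def by (auto simp: lookup_sum lookup_single when_def intro!: sum.cong)
 also have "\<dots> = (if mdeg m = e then lookup p m else 0)"
  by (auto simp: in_keys_iff)
 finally show ?thesis .
qed

lemma hom_part_add: "hom_part e (p + q) = hom_part e p + hom_part e q"
 by (rule poly_mapping_eqI) (simp add: lookup_hom_part lookup_add)

lemma hom_part_0 [simp]: "hom_part e 0 = 0"
 by (rule poly_mapping_eqI) (simp add: lookup_hom_part)

lemma hom_part_sum: "hom_part e (sum f A) = (\<Sum>x\<in>A. hom_part e (f x))"
 by (induction A rule: infinite_finite_induct) (auto simp: hom_part_add)

lemma hom_part_forms: "p \<in> polys {0..n} ==> hom_part e p \<in> forms n e"
 by (auto simp: forms_def polys_def in_keys_iff lookup_hom_part split: if_splits)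

lemma hom_part_of_form: "p \<in> forms n k ==> hom_part e p = (if e = k then p else 0)"
 by (rule poly_mapping_eqI) (auto simp: lookup_hom_part forms_def in_keys_iff)

lemma sum_hom_part:
 assumes "\<And>m. m \<in> keys p ==> mdeg m \<le> N" shows "(\<Sum>e\<le>N. hom_part e p) = p"
proof (rule poly_mapping_eqI)
 fix k
 have "lookup p k = 0" if "N < mdeg k" using assms[of k] that by (auto simp: in_keys_iff)
 then show "lookup (\<Sum>e\<le>N. hom_part e p) k = lookup p k"
  by (auto simp: lookup_sum lookup_hom_part not_le)
qed

lemma degree_bound: obtains N where "\<And>m. m \<in> keys p ==> mdeg m \<le> N"
 by (metis finite_imageI finite_keys imageI Max_ge)

lemma hom_part_form_mult:
 fixes p q :: "'a::comm_semiring_1 mpoly"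
 assumes "q \<in> forms n k"
 shows "hom_part e (q * p) = (if k \<le> e then q * hom_part (e - k) p else 0)"
proof -
 have s: "hom_part e (single a c * single b d) = (if k \<le> e then single a c * hom_part (e - k) (single b d) else 0)"
  if "mdeg a = k" for a b and c d :: 'a
  using that by (intro poly_mapping_eqI)
   (auto simp: mult_single lookup_hom_part lookup_single when_def mdeg_add
    hom_part_def if_distrib[of "\<lambda>x. sum _ x"] Collect_conv_if split: if_splits)
 have t: "hom_part e (single a c * p) = (if k \<le> e then single a c * hom_part (e - k) p else 0)"
  if "mdeg a = k" for a c
  by (induction p rule: mpoly_induct) (simp_all add: s[OF that] hom_part_add distrib_left)
 have "hom_part e (\<Sum>m\<in>keys q. single m (lookup q m) * p) =
   (if k \<le> e then (\<Sum>m\<in>keys q. single m (lookup q m) * hom_part (e - k) p) else 0)"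
  using assms unfolding hom_part_sum by (auto simp: t forms_def)
 then show ?thesis by (simp add: sum_singles flip: sum_distrib_right)
qed

lemma forms_polys: "p \<in> forms n e ==> p \<in> polys {0..n}" by (simp add: forms_def)
lemma forms_mdeg: "p \<in> forms n e ==> m \<in> keys p ==> mdeg m = e" by (simp add: forms_def)

lemma zero_forms [simp]: "0 \<in> forms n e" by (simp add: forms_def)
lemma add_forms: "p \<in> forms n e ==> q \<in> forms n e ==> p + q \<in> forms n e"
 using keys_add[of p q] by (auto simp: forms_def add_polys)
lemma sum_forms: "(\<And>x. x \<in> A ==> f x \<in> forms n e) ==> sum f A \<in> forms n e"
 by (induction A rule: infinite_finite_induct) (auto intro: add_forms)
lemma uminus_forms: "p \<in> forms n e ==> - p \<in> forms n e" for p :: "'a::ab_group_add mpoly"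
 by (auto simp: forms_def uminus_polys)
lemma diff_forms: "p \<in> forms n e ==> q \<in> forms n e ==> p - q \<in> forms n e" for p :: "'a::ab_group_add mpoly"
 using add_forms[of p n e "- q"] uminus_forms[of q n e] by simp
lemma mult_forms: "p \<in> forms n e ==> q \<in> forms n k ==> p * q \<in> forms n (e + k)" for p :: "'a::comm_semiring_1 mpoly"
 using keys_mult[of p q] by (fastforce simp: forms_def mult_polys mdeg_add)
lemma single_forms: "keys m \<subseteq> {0..n} ==> mdeg m = e ==> single m c \<in> forms n e"
 by (auto simp: forms_def single_polys)
lemma Const_forms: "Const c \<in> forms n 0" by (auto simp: Const_def intro: single_forms)
lemma Const_mult_forms: "p \<in> forms n e ==> Const c * p \<in> forms n e" for p :: "'a::comm_semiring_1 mpoly"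
 using mult_forms[OF Const_forms, of p n e] by simp
lemma one_forms: "(1::'a::comm_semiring_1 mpoly) \<in> forms n 0" by (metis Const_1 Const_forms)
lemma Var_forms: "i \<le> n ==> Var i \<in> forms n 1" by (auto simp: Var_def intro!: single_forms)
lemma power_forms: "p \<in> forms n e ==> p ^ k \<in> forms n (k * e)" for p :: "'a::comm_semiring_1 mpoly"
 by (induction k) (auto intro: mult_forms one_forms)

section \<open>Linear algebra over a field\<close>

lemma linear_dependence:
 fixes v :: "nat => nat => 'a::field"
 obtains a where "\<exists>i\<le>N. a i \<noteq> 0" "\<And>j. j < N ==> (\<Sum>i\<le>N. a i * v i j) = 0"
proof -
 \<comment> \<open>A zero row makes the matrix square; the last unit vector is then killed by the
   transpose, so the determinant vanishes.\<close>
 define A where "A = mat (Suc N) (Suc N) (\<lambda>(j, i). if j < N then v i j else 0)"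
 have A: "A \<in> carrier_mat (Suc N) (Suc N)" by (simp add: A_def)
 have "A\<^sup>T *\<^sub>v unit_vec (Suc N) N = 0\<^sub>v (Suc N)"
  by (rule eq_vecI) (auto simp: A_def scalar_prod_def unit_vec_def intro!: sum.neutral)
 moreover have "unit_vec (Suc N) N \<noteq> (0\<^sub>v (Suc N) :: 'a vec)"
  by (metis index_unit_vec(2) index_zero_vec(1) lessI zero_neq_one)
 ultimately have "det A\<^sup>T = 0"
  using A by (subst det_0_iff_vec_prod_zero[of _ "Suc N"]) (auto intro!: exI[of _ "unit_vec (Suc N) N"])
 then have "det A = 0" using det_transpose[OF A] by simp
 then obtain w where w: "w \<in> carrier_vec (Suc N)" "w \<noteq> 0\<^sub>v (Suc N)" "A *\<^sub>v w = 0\<^sub>v (Suc N)"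
  using det_0_iff_vec_prod_zero[OF A] by auto
 show thesis
 proof (rule that[of "\<lambda>i. w $ i"])
  show "\<exists>i\<le>N. w $ i \<noteq> 0"
   using w(1,2) by (metis carrier_vecD eq_vecI index_zero_vec less_Suc_eq_le)
  fix j assume j: "j < N"
  have "(A *\<^sub>v w) $ j = (\<Sum>i\<le>N. v i j * w $ i)" using j w(1)
   by (simp add: A_def scalar_prod_def atLeast0LessThan lessThan_Suc_atMost)
  then show "(\<Sum>i\<le>N. w $ i * v i j) = 0" using w(3) j by (simp add: mult.commute)
 qed
qed

lemma matrix_inverse:
 fixes M :: "nat => nat => 'a::field"
 assumes "\<And>a. (\<And>j. j < N ==> (\<Sum>i<N. a i * M i j) = 0) ==> (\<And>i. i < N ==> a i = 0)"
 obtains W where "\<And>i k. i < N ==> k < N ==> (\<Sum>j<N. M i j * W j k) = (if i = k then 1 else 0)"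
  and "\<And>i k. i < N ==> k < N ==> (\<Sum>j<N. W i j * M j k) = (if i = k then 1 else 0)"
proof -
 define A where "A = mat N N (\<lambda>(j, i). M i j)"
 have A: "A \<in> carrier_mat N N" by (simp add: A_def)
 have "det A \<noteq> 0"
 proof
  assume "det A = 0"
  then obtain w where w: "w \<in> carrier_vec N" "w \<noteq> 0\<^sub>v N" "A *\<^sub>v w = 0\<^sub>v N"
   using det_0_iff_vec_prod_zero[OF A] by auto
  have "(\<Sum>i<N. w $ i * M i j) = 0" if j: "j < N" for j
  proof -
   have "(A *\<^sub>v w) $ j = (\<Sum>i<N. M i j * w $ i)" using j w(1)
    by (simp add: A_def scalar_prod_def atLeast0LessThan)
   then show ?thesis using w(3) j by (simp add: mult.commute)
  qed
  then have "w = 0\<^sub>v N" using assms[of "\<lambda>i. w $ i"] w(1) by (intro eq_vecI) auto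
  with w show False by simp
 qed
 from det_non_zero_imp_unit[OF A this, of "()"] obtain B where
  B: "B \<in> carrier_mat N N" "A * B = 1\<^sub>m N" "B * A = 1\<^sub>m N"
  by (auto simp: Units_def ring_mat_def)
 \<comment> \<open>\<open>A\<close> is the transpose of \<open>M\<close>, so its inverse has to be
   transposed back.\<close>
 show thesis
 proof (rule that[of "\<lambda>j k. B $$ (k, j)"])
  fix i k assume ik: "i < N" "k < N"
  have "(\<Sum>j<N. M i j * B $$ (k, j)) = (B * A) $$ (k, i)" using ik B(1)
   by (simp add: A_def scalar_prod_def atLeast0LessThan mult.commute)
  also have "\<dots> = (if i = k then 1 else 0)" using ik by (simp add: B(3))
  finally show "(\<Sum>j<N. M i j * B $$ (k, j)) = (if i = k then 1 else 0)" .
  have "(\<Sum>j<N. B $$ (j, i) * M j k) = (A * B) $$ (k, i)" using ik B(1)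
   by (simp add: A_def scalar_prod_def atLeast0LessThan mult.commute)
  also have "\<dots> = (if i = k then 1 else 0)" using ik by (simp add: B(2))
  finally show "(\<Sum>j<N. B $$ (j, i) * M j k) = (if i = k then 1 else 0)" .
 qed
qed

text \<open>From here on \<open>$\<close> denotes the coefficients of power series.\<close>

no_notation vec_index (infixl "$" 100)

section \<open>Counting monomials\<close>

definition monomials :: "nat => nat => (nat \<Rightarrow>\<^sub>0 nat) set" where
 "monomials n d = {m. keys m \<subseteq> {1..n} \<and> mdeg m \<le> d}"

definition form_monomials :: "nat => nat => (nat \<Rightarrow>\<^sub>0 nat) set" where
 "form_monomials n d = {m. keys m \<subseteq> {0..n} \<and> mdeg m = d}"

lemma bij_betw_form_monomials:
 "bij_betw (\<lambda>m. single 0 (d - mdeg m) + m) (monomials n d) (form_monomials n d)"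
proof (rule bij_betw_byWitness[where f' = "\<lambda>m. m - single 0 (lookup m 0)"])
 show "\<forall>m\<in>monomials n d. single 0 (d - mdeg m) + m - single 0 (lookup (single 0 (d - mdeg m) + m) 0) = m"
 proof
  fix m assume "m \<in> monomials n d"
  then have "lookup m 0 = 0" by (auto simp: monomials_def in_keys_iff)
  then show "single 0 (d - mdeg m) + m - single 0 (lookup (single 0 (d - mdeg m) + m) 0) = m"
   by (simp add: lookup_add)
 qed
 have s: "m = single 0 (lookup m 0) + (m - single 0 (lookup m 0))" for m :: "nat \<Rightarrow>\<^sub>0 nat"
  by (rule poly_mapping_eqI) (auto simp: lookup_add lookup_minus lookup_single when_def)
 have dg: "mdeg (m - single 0 (lookup m 0)) = mdeg m - lookup m 0" for m :: "nat \<Rightarrow>\<^sub>0 nat"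
  using arg_cong[OF s, of mdeg m] by (simp add: mdeg_add)
 show "\<forall>m\<in>form_monomials n d. single 0 (d - mdeg (m - single 0 (lookup m 0))) + (m - single 0 (lookup m 0)) = m"
 proof
  fix m assume "m \<in> form_monomials n d"
  then have "d - mdeg (m - single 0 (lookup m 0)) = lookup m 0"
   using lookup_le_mdeg[of m 0] by (simp add: form_monomials_def dg)
  then show "single 0 (d - mdeg (m - single 0 (lookup m 0))) + (m - single 0 (lookup m 0)) = m"
   using s[of m] by simp
 qed
 show "(\<lambda>m. single 0 (d - mdeg m) + m) ` monomials n d \<subseteq> form_monomials n d"
 proof safe
  fix m assume m: "m \<in> monomials n d"
  then have "keys (single 0 (d - mdeg m) + m) \<subseteq> {0..n}"
   using keys_add[of "single 0 (d - mdeg m)" m] by (fastforce simp: monomials_def split: if_splits)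
  with m show "single 0 (d - mdeg m) + m \<in> form_monomials n d"
   by (simp add: monomials_def form_monomials_def mdeg_add)
 qed
 show "(\<lambda>m. m - single 0 (lookup m 0)) ` form_monomials n d \<subseteq> monomials n d"
 proof safe
  fix m assume m: "m \<in> form_monomials n d"
  have "keys (m - single 0 (lookup m 0)) \<subseteq> keys m - {0}"
   by (auto simp: in_keys_iff lookup_minus lookup_single when_def)
  also have "keys m - {0} \<subseteq> {1..n}" using m by (auto simp: form_monomials_def Suc_le_eq)
  finally show "m - single 0 (lookup m 0) \<in> monomials n d" using m
   by (simp add: monomials_def form_monomials_def dg)
 qed
qed

text \<open>Exponent vectors correspond to lists of length n + 1 with sum d, which stars and bars
  counts.\<close>

lemma finite_card_form_monomials:
 "finite (form_monomials n d) \<and> card (form_monomials n d) = (n + d) choose d"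
proof -
 let ?L = "{l::nat list. length l = Suc n \<and> sum_list l = d}"
 have L: "card ?L = (n + d) choose d" using card_length_sum_list[of "Suc n" d] by (simp add: add.commute)
 have fL: "finite ?L"
  by (rule finite_subset[OF _ finite_lists_length_eq[of "{..d}" "Suc n"]]) (auto simp: member_le_sum_list)
 have "bij_betw (\<lambda>m. map (lookup m) [0..<Suc n]) (form_monomials n d) ?L"
 proof (rule bij_betw_byWitness[where f' = "\<lambda>l. \<Sum>i<Suc n. single i (l ! i)"])
  have key: "(\<Sum>i<Suc n. single i (f i)) = m" if "keys m \<subseteq> {0..n}" "\<And>i. i < Suc n ==> f i = lookup m i"
   for m :: "nat \<Rightarrow>\<^sub>0 nat" and f
   using that by (intro poly_mapping_eqI)
    (auto simp: lookup_sum lookup_single when_def in_keys_iff subset_iff less_Suc_eq_le simp del: sum.lessThan_Suc)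
  show "\<forall>m\<in>form_monomials n d. (\<Sum>i<Suc n. single i (map (lookup m) [0..<Suc n] ! i)) = m"
   by (intro ballI key) (auto simp: form_monomials_def simp del: upt_Suc)
  have lk: "lookup (\<Sum>i<Suc n. single i (l ! i)) j = l ! j" if "j < Suc n" for l :: "nat list" and j
   using that by (auto simp: lookup_sum lookup_single when_def simp del: sum.lessThan_Suc)
  show "\<forall>l\<in>?L. map (lookup (\<Sum>i<Suc n. single i (l ! i))) [0..<Suc n] = l"
  proof safe
   fix l :: "nat list" assume "length l = Suc n"
   then show "map (lookup (\<Sum>i<Suc n. single i (l ! i))) [0..<Suc n] = l"
    by (intro nth_equalityI) (auto simp: lk simp del: upt_Suc sum.lessThan_Suc)
  qed
  show "(\<lambda>m. map (lookup m) [0..<Suc n]) ` form_monomials n d \<subseteq> ?L"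
   by (auto simp: form_monomials_def mdeg_superset[of "{0..n}"] interv_sum_list_conv_sum_set_nat
     atLeastLessThanSuc_atLeastAtMost simp del: upt_Suc)
  show "(\<lambda>l. \<Sum>i<Suc n. single i (l ! i)) ` ?L \<subseteq> form_monomials n d"
  proof safe
   fix l :: "nat list" assume l: "length l = Suc n"
   let ?m = "\<Sum>i<Suc n. single i (l ! i)"
   have k: "keys ?m \<subseteq> {0..n}"
    by (auto simp: in_keys_iff lookup_sum lookup_single when_def simp del: sum.lessThan_Suc split: if_splits)
   have "mdeg ?m = (\<Sum>i\<in>{0..n}. lookup ?m i)" by (rule mdeg_superset) (use k in auto)
   also have "\<dots> = (\<Sum>i\<in>{0..<Suc n}. l ! i)" by (rule sum.cong) (auto simp: lk simp del: sum.lessThan_Suc)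
   also have "\<dots> = sum_list l" using l by (simp add: sum_list_sum_nth)
   finally show "?m \<in> form_monomials n (sum_list l)" using k by (simp add: form_monomials_def)
  qed
 qed
 from bij_betw_finite[OF this] bij_betw_same_card[OF this] show ?thesis using fL L by simp
qed

lemma finite_form_monomials [simp]: "finite (form_monomials n d)"
 and card_form_monomials: "card (form_monomials n d) = (n + d) choose d"
 using finite_card_form_monomials by blast+

lemma finite_monomials [simp]: "finite (monomials n d)"
 and card_monomials: "card (monomials n d) = (n + d) choose d"
 using bij_betw_finite[OF bij_betw_form_monomials[of d n]] bij_betw_same_card[OF bij_betw_form_monomials[of d n]]
 by (simp_all add: card_form_monomials)

section \<open>Symmetric powers of a commutative algebra\<close>

text \<open>A monomial in the operators \<open>D i\<close>, applied in the order of the indices. An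
  order has to be fixed because the operators commute only for indices in a given set;
  \<open>opw_step\<close> shows that it is then immaterial.\<close>

primrec opw :: "(nat => 'x => 'x) => (nat \<Rightarrow>\<^sub>0 nat) => nat => 'x => 'x" where
 "opw D m 0 x = x"
| "opw D m (Suc B) x = (D B ^^ lookup m B) (opw D m B x)"

lemma opw_cong: "(\<And>i. i < B ==> lookup m i = lookup m' i) ==> opw D m B x = opw D m' B x"
 by (induction B) auto

lemma opw_step:
 assumes "\<And>i j x. i \<in> V ==> j \<in> V ==> D i (D j x) = D j (D i x)" "keys m \<subseteq> V" "i \<in> V" "i < B"
 shows "opw D (single i 1 + m) B x = D i (opw D m B x)"
 using assms(4)
proof (induction B)
 case (Suc B)
 have comm: "(D B ^^ k) (D i y) = D i ((D B ^^ k) y)" if "k = 0 \<or> B \<in> V" for k y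
 proof (cases "k = 0")
  case False
  with that have "B \<in> V" by simp
  show ?thesis
  proof (induction k)
   case (Suc k)
   have "(D B ^^ Suc k) (D i y) = D B (D i ((D B ^^ k) y))" by (simp add: Suc)
   also have "\<dots> = D i (D B ((D B ^^ k) y))" by (rule assms(1)) fact+
   finally show ?case by simp
  qed simp
 qed simp
 show ?case
 proof (cases "i = B")
  case True
  have "lookup (single i 1 + m) j = lookup m j" if "j < B" for j
   using that True by (simp add: lookup_add lookup_single)
  then have "opw D (single i 1 + m) B x = opw D m B x" by (rule opw_cong)
  moreover have "lookup (single i 1 + m) B = Suc (lookup m B)" by (simp add: lookup_add True)
  ultimately have "opw D (single i 1 + m) (Suc B) x = (D B ^^ Suc (lookup m B)) (opw D m B x)"
   by (simp only: opw.simps)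
  then show ?thesis by (simp only: True opw.simps funpow.simps o_apply)
 next
  case False
  then have IH: "opw D (single i 1 + m) B x = D i (opw D m B x)" using Suc by simp
  have "lookup m B = 0 \<or> B \<in> V" using assms(2) by (auto simp: in_keys_iff)
  moreover have "lookup (single i 1 + m) B = lookup m B"
   using False by (simp add: lookup_add lookup_single)
  ultimately show ?thesis by (simp only: opw.simps IH comm)
 qed
qed simp

text \<open>Structure constants, with respect to a basis $a_0 = 1, a_1, \dots, a_n$, of a commutative algebra
 in which all positive integers are invertible.\<close>

locale struct_consts =
 fixes n :: nat and c :: "nat => nat => nat => 'r::comm_ring_1"
 assumes unit: "j \<le> n ==> k \<le> n ==> c 0 j k = (if j = k then 1 else 0)"
  and comm: "i \<le> n ==> j \<le> n ==> k \<le> n ==> c i j k = c j i k"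
  and assoc: "i \<le> n ==> j \<le> n ==> k \<le> n ==> m \<le> n ==>
   (\<Sum>l\<le>n. c i j l * c l k m) = (\<Sum>l\<le>n. c j k l * c i l m)"
  and nat_inverse: "k > 0 ==> \<exists>w. of_nat k * w = (1::'r)"
begin

definition mult_form :: "nat => nat => 'r mpoly" where
 "mult_form i j = (\<Sum>k\<le>n. Const (c i j k) * Var k)"

text \<open>The derivation of the symmetric algebra that extends multiplication by $a_i$.\<close>

definition Delta :: "nat => 'r mpoly => 'r mpoly" where
 "Delta i P = (\<Sum>j\<le>n. mult_form i j * partial j P)"

lemma Delta_add: "Delta i (P + Q) = Delta i P + Delta i Q"
 by (simp add: Delta_def partial_add distrib_left sum.distrib)

lemma Delta_0 [simp]: "Delta i 0 = 0" by (simp add: Delta_def)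

lemma Delta_mult: "Delta i (P * Q) = Delta i P * Q + P * Delta i Q"
 unfolding Delta_def partial_mult sum_distrib_left sum_distrib_right sum.distrib[symmetric]
 by (rule sum.cong) (simp_all add: algebra_simps)

lemma Delta_Const [simp]: "Delta i (Const a) = 0" by (simp add: Delta_def)

lemma Delta_Const_mult: "Delta i (Const a * P) = Const a * Delta i P"
 by (simp add: Delta_mult)

lemma Delta_sum: "Delta i (sum f A) = (\<Sum>x\<in>A. Delta i (f x))"
 by (induction A rule: infinite_finite_induct) (auto simp: Delta_add)

lemma Delta_Var: "Delta i (Var j) = (if j \<le> n then mult_form i j else 0)"
 by (simp add: Delta_def partial_Var if_distrib[of "(*) _"] cong: if_cong)

text \<open>This is a_i (a_j a_k) = (a_i a_j) a_k inside the degree one part of the symmetric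
  algebra.\<close>

lemma Delta_mult_form:
 assumes "i \<le> n" "j \<le> n" "k \<le> n"
 shows "Delta i (mult_form j k) = (\<Sum>l\<le>n. Const (c i j l) * mult_form l k)"
proof -
 have "Delta i (mult_form j k) = (\<Sum>l\<le>n. \<Sum>m\<le>n. Const (c j k l * c i l m) * Var m)"
  by (simp add: mult_form_def[of j k] Delta_sum Delta_Const_mult Delta_Var)
    (simp add: mult_form_def sum_distrib_left Const_mult mult.assoc)
 also have "\<dots> = (\<Sum>m\<le>n. Const (\<Sum>l\<le>n. c j k l * c i l m) * Var m)"
  by (subst sum.swap) (simp add: Const_sum sum_distrib_right)
 also have "\<dots> = (\<Sum>m\<le>n. Const (\<Sum>l\<le>n. c i j l * c l k m) * Var m)"
  by (intro sum.cong refl) (simp add: assoc[OF assms])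
 also have "\<dots> = (\<Sum>l\<le>n. \<Sum>m\<le>n. Const (c i j l * c l k m) * Var m)"
  by (subst sum.swap) (simp add: Const_sum sum_distrib_right)
 also have "\<dots> = (\<Sum>l\<le>n. Const (c i j l) * mult_form l k)"
  by (simp add: mult_form_def sum_distrib_left Const_mult mult.assoc)
 finally show ?thesis .
qed

text \<open>The commutator of two derivations is again a derivation, so it suffices to look at the
  variables; there \<open>Delta_mult_form\<close> reduces the claim to commutativity of the
  algebra.\<close>

lemma Delta_commute:
 assumes ij: "i \<le> n" "j \<le> n"
 shows "Delta i (Delta j P) = Delta j (Delta i P)"
proof -
 have V: "Delta i (Delta j (Var k)) = Delta j (Delta i (Var k))" for k
 proof (cases "k \<le> n")
  case True
  have "(\<Sum>l\<le>n. Const (c i j l) * mult_form l k) = (\<Sum>l\<le>n. Const (c j i l) * mult_form l k)"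
   using ij by (intro sum.cong) (auto simp: comm[of i j])
  with True show ?thesis using ij by (simp add: Delta_Var Delta_mult_form)
 qed (simp add: Delta_Var)
 have "Delta i (Delta j P) - Delta j (Delta i P) = 0"
 proof (rule derivation_eq_0[where V = UNIV and h = "\<lambda>x. x" and E = "\<lambda>P. Delta i (Delta j P) - Delta j (Delta i P)"])
  show "P \<in> polys UNIV" by (simp add: polys_def)
  show "Delta i (Delta j (p * q)) - Delta j (Delta i (p * q)) =
   p * (Delta i (Delta j q) - Delta j (Delta i q)) + (Delta i (Delta j p) - Delta j (Delta i p)) * q" for p q
   unfolding Delta_mult Delta_add right_diff_distrib left_diff_distrib by simp
 qed (simp_all add: Delta_add V)
 then show ?thesis by simp
qed

lemma mult_form_0: "i \<le> n ==> mult_form i 0 = Var i"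
proof -
 assume i: "i \<le> n"
 have "mult_form i 0 = (\<Sum>k\<le>n. if k = i then Var k else 0)"
  unfolding mult_form_def by (rule sum.cong) (use i in \<open>auto simp: comm[of i 0] unit\<close>)
 then show ?thesis using i by simp
qed

end

section \<open>The orbit of y_0^d under the operators\<close>

locale sym_power = struct_consts n c for n and c :: "nat => nat => nat => 'r::comm_ring_1" +
 fixes d :: nat
begin

text \<open>The symmetric algebra has the variables \<open>Var 0\<close>, ..., \<open>Var n\<close>,
  the acting ring has \<open>Var 1\<close>, ..., \<open>Var n\<close>. On
  \<open>polys {1..n}\<close> the exponent of \<open>Var 0\<close> is zero, so
  \<open>Delta 0\<close> is applied zero times.\<close>

definition Theta :: "'r mpoly => 'r mpoly" where
 "Theta p = (\<Sum>m\<in>keys p. Const (lookup p m) * opw Delta m (Suc n) (Var 0 ^ d))"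

lemma Theta_superset:
 "finite A ==> keys p \<subseteq> A ==> Theta p = (\<Sum>m\<in>A. Const (lookup p m) * opw Delta m (Suc n) (Var 0 ^ d))"
 unfolding Theta_def by (intro sum.mono_neutral_left) (auto simp: in_keys_iff)

lemma Theta_add: "Theta (p + q) = Theta p + Theta q"
 using keys_add[of p q]
 by (simp add: Theta_superset[of "keys p \<union> keys q"] lookup_add Const_add distrib_right sum.distrib)

lemma Theta_single: "Theta (single m a) = Const a * opw Delta m (Suc n) (Var 0 ^ d)"
 by (cases "a = 0") (auto simp: Theta_def)

lemma Theta_0 [simp]: "Theta 0 = 0" by (simp add: Theta_def)

lemma Theta_sum: "Theta (sum f A) = (\<Sum>x\<in>A. Theta (f x))"
 by (induction A rule: infinite_finite_induct) (auto simp: Theta_add)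

lemma opw_0: "opw D 0 B x = x" by (induction B) auto

lemma Theta_Const: "Theta (Const a) = Const a * Var 0 ^ d"
 unfolding Const_def[of a] Theta_single by (simp add: opw_0 Const_def del: opw.simps)

lemma Theta_Const_mult: "Theta (Const a * p) = Const a * Theta p"
proof (induction p rule: mpoly_induct)
 case (single m b)
 have "Const a * single m b = single m (a * b)" by (simp add: Const_def mult_single)
 then show ?case by (simp add: Theta_single Const_mult mult.assoc del: opw.simps)
qed (simp add: Theta_add distrib_left)

text \<open>This intertwining rests on the commutation of the operators and makes the kernel of
  \<open>Theta\<close> an ideal.\<close>

lemma Theta_Var_mult:
 assumes "i \<in> {1..n}" "p \<in> polys {1..n}"
 shows "Theta (Var i * p) = Delta i (Theta p)"
proof -
 have s: "Theta (Var i * single m a) = Delta i (Theta (single m a))" if "keys m \<subseteq> {1..n}" for m a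
  using opw_step[of "{1..n}" Delta m i "Suc n" "Var 0 ^ d"] that assms Delta_commute
  by (simp add: Var_mult_single Theta_single Delta_Const_mult del: opw.simps)
 have "Theta (Var i * (\<Sum>m\<in>keys p. single m (lookup p m))) = Delta i (Theta (\<Sum>m\<in>keys p. single m (lookup p m)))"
  unfolding sum_distrib_left Theta_sum Delta_sum using assms(2) by (intro sum.cong s) (auto simp: polys_def)
 then show ?thesis by (simp add: sum_singles)
qed

lemma Theta_uminus: "Theta (- p) = - Theta p"
 using Theta_add[of p "- p"] by (simp add: eq_neg_iff_add_eq_0 add.commute)

lemma Theta_diff: "Theta (p - q) = Theta p - Theta q"
 using Theta_add[of p "- q"] by (simp add: Theta_uminus)

lemma Theta_ideal:
 assumes "q \<in> polys {1..n}" "p \<in> polys {1..n}" "Theta p = 0"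
 shows "Theta (q * p) = 0"
 using assms(1)
proof (induction rule: polys_induct)
 case (Var i q)
 then have "Theta (Var i * (q * p)) = Delta i (Theta (q * p))"
  by (intro Theta_Var_mult mult_polys assms)
 with Var show ?case by (simp add: mult.assoc)
qed (auto simp: Theta_Const_mult Theta_add distrib_right assms)

text \<open>A filtration by the exponent of the variable that corresponds to $a_0 = 1$.\<close>

definition Fil :: "nat => 'r mpoly set" where
 "Fil s = {P \<in> forms n d. \<forall>m\<in>keys P. d < lookup m 0 + s}"

lemma Fil_0 [simp]: "0 \<in> Fil s" by (simp add: Fil_def)
lemma Fil_add: "P \<in> Fil s ==> Q \<in> Fil s ==> P + Q \<in> Fil s"
 using keys_add[of P Q] by (auto simp: Fil_def add_forms)
lemma Fil_uminus: "P \<in> Fil s ==> - P \<in> Fil s"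
 by (auto simp: Fil_def uminus_forms)
lemma Fil_diff: "P \<in> Fil s ==> Q \<in> Fil s ==> P - Q \<in> Fil s"
 using Fil_add[of P s "- Q"] Fil_uminus by simp
lemma Fil_sum: "(\<And>x. x \<in> A ==> f x \<in> Fil s) ==> sum f A \<in> Fil s"
 by (induction A rule: infinite_finite_induct) (auto intro: Fil_add)
lemma Fil_Const_mult: "P \<in> Fil s ==> Const a * P \<in> Fil s"
 by (auto simp: Fil_def Const_mult_forms in_keys_iff lookup_Const_mult)
lemma Fil_forms: "P \<in> Fil s ==> P \<in> forms n d" by (simp add: Fil_def)

lemma keys_Var_mult_partial:
 assumes "m \<in> keys (Var k * partial j P)"
 obtains m' where "m = single k 1 + m'" "m' + single j 1 \<in> keys P"
proof -
 from assms obtain m' where "m = single k 1 + m'" "m' \<in> keys (partial j P)"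
  using keys_mult[of "Var k" "partial j P"] by (auto simp: Var_def)
 moreover from this have "m' + single j 1 \<in> keys P" by (auto simp: in_keys_iff lookup_partial)
 ultimately show thesis using that by blast
qed

text \<open>The operator y_k d/dy_j lowers the exponent of y_0 by at most one, and only for j =
  0.\<close>

lemma Var_mult_partial_Fil:
 assumes "P \<in> Fil s" "k \<le> n"
 shows "Var k * partial j P \<in> Fil (Suc s)" "j > 0 ==> Var k * partial j P \<in> Fil s"
proof -
 have *: "keys m \<subseteq> {0..n} \<and> mdeg m = d \<and> d < lookup m 0 + Suc s \<and> (j > 0 \<longrightarrow> d < lookup m 0 + s)"
  if "m \<in> keys (Var k * partial j P)" for m
  using that
 proof (rule keys_Var_mult_partial)
  fix m' assume m: "m = single k 1 + m'" "m' + single j 1 \<in> keys P"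
  then have "keys (m' + single j 1) \<subseteq> {0..n}" "mdeg (m' + single j 1) = d" "d < lookup (m' + single j 1) 0 + s"
   using assms by (auto simp: Fil_def forms_def polys_def)
  then show ?thesis using assms(2)
   by (auto simp: m mdeg_add in_keys_iff lookup_add lookup_single when_def subset_iff split: if_splits)
 qed
 then show "Var k * partial j P \<in> Fil (Suc s)" "j > 0 ==> Var k * partial j P \<in> Fil s"
  by (auto simp: Fil_def forms_def polys_def)
qed

lemma mult_form_partial_Fil:
 assumes "P \<in> Fil s"
 shows "mult_form i j * partial j P \<in> Fil (Suc s)" "j > 0 ==> mult_form i j * partial j P \<in> Fil s"
 unfolding mult_form_def sum_distrib_right mult.assoc
 by (intro Fil_sum Fil_Const_mult Var_mult_partial_Fil; use assms in simp)+

lemma Delta_Fil: "P \<in> Fil s ==> Delta i P \<in> Fil (Suc s)"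
 unfolding Delta_def by (intro Fil_sum mult_form_partial_Fil)

text \<open>Because a_i a_0 = a_i, the summand of \<open>Delta i\<close> that can lower the exponent
  of y_0 is exactly y_i d/dy_0; all others stay in the filtration step.\<close>

lemma Delta_Fil_lead:
 assumes "i \<le> n" "P \<in> Fil s" shows "Delta i P - Var i * partial 0 P \<in> Fil s"
proof -
 have "Delta i P - Var i * partial 0 P = (\<Sum>j\<in>{..n} - {0}. mult_form i j * partial j P)"
  unfolding Delta_def by (subst sum.remove[of _ 0]) (auto simp: mult_form_0 assms)
 also have "\<dots> \<in> Fil s" using assms by (intro Fil_sum mult_form_partial_Fil) auto
 finally show ?thesis .
qed

text \<open>The falling factorial of d, the scalar left by s-fold differentiation of y_0^d. For s at
  most d it is a positive integer, hence invertible by \<open>nat_inverse\<close>.\<close>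

primrec ff :: "nat => nat" where "ff 0 = 1" | "ff (Suc s) = (d - s) * ff s"

lemma ff_pos: "s \<le> d ==> ff s > 0" by (induction s) auto

definition lead :: "(nat \<Rightarrow>\<^sub>0 nat) => nat \<Rightarrow>\<^sub>0 nat" where
 "lead m = single 0 (d - mdeg m) + m"

text \<open>Triangularity of \<open>Theta\<close>: each factor \<alpha>_i trades one y_0 for y_i and
  multiplies by the exponent that y_0 had, up to terms with more y_0.\<close>

lemma Theta_lead:
 assumes "keys m \<subseteq> {1..n}" "mdeg m \<le> d"
 shows "Theta (single m 1) - single (lead m) (of_nat (ff (mdeg m))) \<in> Fil (mdeg m)"
 using assms
proof (induction m rule: single_induct)
 case zero
 have "Var 0 ^ d = (single (single 0 d) 1 :: 'r mpoly)"
  using mval_Var[of "single 0 d"] by simp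
 moreover have "Theta 1 = Var 0 ^ d" using Theta_Const[of 1] by simp
 ultimately show ?case by (simp add: lead_def)
next
 case (add i m)
 let ?s = "mdeg m" and ?S = "single (lead m) (of_nat (ff (mdeg m))) :: 'r mpoly"
 have s: "?s < d" using add by (simp add: mdeg_add)
 have m0: "lookup m 0 = 0" using add by (auto simp: in_keys_iff)
 have "keys (lead m) \<subseteq> insert 0 (keys m)"
  using keys_add[of "single 0 (d - mdeg m)" m] by (auto simp: lead_def split: if_splits)
 also have "\<dots> \<subseteq> {0..n}" using add by auto
 finally have "?S \<in> forms n d" using s by (intro single_forms) (auto simp: lead_def mdeg_add)
 then have S: "?S \<in> Fil (Suc ?s)"
  using s m0 by (auto simp: Fil_def lead_def lookup_add)
 have "Theta (single (single i 1 + m) 1) = Delta i (Theta (single m 1))"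
  using Theta_Var_mult[of i "single m 1"] add by (simp add: Var_mult_single single_polys)
 also have eq: "\<dots> = Delta i (Theta (single m 1) - ?S) + (Delta i ?S - Var i * partial 0 ?S) + Var i * partial 0 ?S"
  using Delta_add[of i "Theta (single m 1) - ?S" ?S] by simp
 finally have eq: "Theta (single (single i 1 + m) 1) = Delta i (Theta (single m 1) - ?S)
  + (Delta i ?S - Var i * partial 0 ?S) + Var i * partial 0 ?S" .
 have eq': "Var i * partial 0 ?S = single (lead (single i 1 + m)) (of_nat (ff (mdeg (single i 1 + m))))"
 proof -
  have "single i 1 + (lead m - single 0 1) = lead (single i 1 + m)"
   using s m0 by (intro poly_mapping_eqI)
    (auto simp: lead_def lookup_add lookup_minus lookup_single when_def mdeg_add)
  moreover have "lookup (lead m) 0 = d - ?s" by (simp add: lead_def lookup_add m0)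
  ultimately show ?thesis by (simp add: partial_single Var_mult_single mdeg_add)
 qed
 have "Theta (single (single i 1 + m) 1) - single (lead (single i 1 + m)) (of_nat (ff (mdeg (single i 1 + m))))
   = Delta i (Theta (single m 1) - ?S) + (Delta i ?S - Var i * partial 0 ?S)"
  unfolding eq'[symmetric] eq by (rule add_diff_cancel_right')
 also have "\<dots> \<in> Fil (Suc ?s)"
  using add s by (intro Fil_add Delta_Fil Delta_Fil_lead S) (auto simp: mdeg_add)
 finally show ?case by (simp add: mdeg_add)
qed

lemma Theta_forms: "p \<in> polys {1..n} ==> Theta p \<in> forms n d"
proof (induction rule: polys_induct)
 case (Const a)
 have "(Var 0 :: 'r mpoly) ^ d \<in> forms n d" using power_forms[OF Var_forms[of 0 n], of d] by simp
 then show ?case unfolding Theta_Const by (rule Const_mult_forms)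
next
 case (Var i p)
 then have "Theta p \<in> Fil (Suc d)" by (auto simp: Fil_def)
 then show ?case using Var Delta_Fil Fil_forms by (metis Theta_Var_mult)
qed (auto simp: Theta_add add_forms)

text \<open>Descent along the filtration. The degree bound on q is what makes the monomials of
  degree at most d span the quotient by the kernel.\<close>

lemma Theta_surj:
 assumes "P \<in> Fil s" "s \<le> Suc d"
 shows "\<exists>q \<in> polys {1..n}. (\<forall>m\<in>keys q. mdeg m < s) \<and> Theta q = P"
 using assms
proof (induction s arbitrary: P)
 case 0
 have "d < lookup m 0 \<and> mdeg m = d" if "m \<in> keys P" for m
  using that 0 by (auto simp: Fil_def forms_def)
 then have "keys P = {}" using lookup_le_mdeg by (metis equals0I linorder_not_le)
 then show ?case by (intro bexI[of _ 0]) auto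
next
 case (Suc s)
 \<comment> \<open>\<open>T\<close> collects the monomials of \<open>P\<close> with the least
   exponent of y_0 that this filtration step allows; \<open>r\<close> strips y_0 from them.\<close>
 define T where "T = {m \<in> keys P. lookup m 0 = d - s}"
 define r where "r m = m - single 0 (lookup m 0)" for m :: "nat \<Rightarrow>\<^sub>0 nat"
 obtain w where w: "of_nat (ff s) * w = (1::'r)" using nat_inverse[OF ff_pos[of s]] Suc(3) by auto
 have rm: "m = single 0 (lookup m 0) + r m" for m
  by (rule poly_mapping_eqI) (auto simp: r_def lookup_add lookup_minus lookup_single when_def)
 have mT: "keys m \<subseteq> {0..n} \<and> mdeg m = d \<and> lookup m 0 = d - s" if "m \<in> T" for m
  using that Suc(2) by (auto simp: T_def Fil_def forms_def polys_def)
 have rT: "mdeg (r m) = s" "lead (r m) = m" "keys (r m) \<subseteq> {1..n}" if "m \<in> T" for m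
 proof -
  show s: "mdeg (r m) = s" using arg_cong[OF rm, of mdeg m] mT[OF that] Suc(3) by (simp add: mdeg_add)
  have e: "d - s = lookup m 0" using mT[OF that] by simp
  show "lead (r m) = m" unfolding lead_def s e by (rule rm[symmetric])
  have "keys (r m) \<subseteq> keys m - {0}" by (auto simp: r_def in_keys_iff lookup_minus lookup_single when_def)
  with mT[OF that] show "keys (r m) \<subseteq> {1..n}" by (auto simp: subset_iff Suc_le_eq)
 qed
 \<comment> \<open>By triangularity this \<open>q\<close> reproduces the part \<open>T\<close> of
   \<open>P\<close> up to an error in the previous filtration step, to which the induction
   hypothesis applies.\<close>
 define q where "q = (\<Sum>m\<in>T. Const (w * lookup P m) * single (r m) 1)"
 have fT: "finite T" by (simp add: T_def)
 have qp: "q \<in> polys {1..n}" unfolding q_def by (intro sum_polys mult_polys single_polys rT Const_polys)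
 have "Theta q - (\<Sum>m\<in>T. single m (lookup P m)) =
   (\<Sum>m\<in>T. Const (w * lookup P m) * (Theta (single (r m) 1) - single m (of_nat (ff s))))"
 proof -
  have "Const (w * lookup P m) * single m (of_nat (ff s)) = single m (lookup P m)" for m
  proof -
   have "w * lookup P m * of_nat (ff s) = (of_nat (ff s) * w) * lookup P m" by (simp only: mult_ac)
   then show ?thesis by (simp add: Const_def mult_single w)
  qed
  then show ?thesis
   by (simp add: q_def Theta_sum Theta_Const_mult right_diff_distrib sum_subtractf)
 qed
 also have "\<dots> \<in> Fil s"
 proof (intro Fil_sum Fil_Const_mult)
  fix m assume "m \<in> T"
  then show "Theta (single (r m) 1) - single m (of_nat (ff s)) \<in> Fil s"
   using Theta_lead[of "r m"] rT[of m] Suc(3) by simp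
 qed
 finally have 1: "Theta q - (\<Sum>m\<in>T. single m (lookup P m)) \<in> Fil s" .
 have "lookup (\<Sum>m\<in>T. single m (lookup P m)) k = (if k \<in> T then lookup P k else 0)" for k
  using fT by (auto simp: lookup_sum lookup_single when_def)
 then have 2: "P - (\<Sum>m\<in>T. single m (lookup P m)) \<in> Fil s"
 proof -
  assume lk: "\<And>k. lookup (\<Sum>m\<in>T. single m (lookup P m)) k = (if k \<in> T then lookup P k else 0)"
  have "k \<in> keys P \<and> k \<notin> T" if "k \<in> keys (P - (\<Sum>m\<in>T. single m (lookup P m)))" for k
   using that by (auto simp: in_keys_iff lookup_minus lk split: if_splits)
  moreover have "d < lookup k 0 + s" if "k \<in> keys P" "k \<notin> T" for k
  proof -
   have "d < lookup k 0 + Suc s" "lookup k 0 \<noteq> d - s" using that Suc(2) by (auto simp: Fil_def T_def)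
   then show ?thesis using Suc(3) by linarith
  qed
  ultimately show ?thesis using Suc(2) unfolding Fil_def forms_def polys_def by blast
 qed
 have "P - Theta q \<in> Fil s" using Fil_diff[OF 2 1] by simp
 then obtain q' where q': "q' \<in> polys {1..n}" "\<forall>m\<in>keys q'. mdeg m < s" "Theta q' = P - Theta q"
  using Suc(1)[of "P - Theta q"] Suc(3) by auto
 have kq: "mdeg m < Suc s" if "m \<in> keys q" for m
 proof -
  have "m \<in> r ` T"
  proof (rule ccontr)
   assume "m \<notin> r ` T"
   then have "lookup q m = 0"
    unfolding q_def lookup_sum lookup_Const_mult
    by (intro sum.neutral ballI) (auto simp: lookup_single when_def)
   with that show False by (simp add: in_keys_iff)
  qed
  then show ?thesis using rT by auto
 qed
 show ?case
  using q' kq keys_add[of q q'] qp by (intro bexI[of _ "q + q'"]) (auto simp: Theta_add add_polys less_Suc_eq)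
qed

lemma normal_form_ex:
 assumes "p \<in> polys {1..n}"
 obtains q where "q \<in> polys {1..n}" "\<And>m. m \<in> keys q ==> m \<in> monomials n d" "Theta q = Theta p"
proof -
 have "Theta p \<in> Fil (Suc d)" using Theta_forms[OF assms] by (auto simp: Fil_def)
 from Theta_surj[OF this] obtain q where
  q: "q \<in> polys {1..n}" "\<forall>m\<in>keys q. mdeg m < Suc d" "Theta q = Theta p" by auto
 show thesis by (rule that[OF q(1) _ q(3)]) (use q in \<open>auto simp: monomials_def polys_def less_Suc_eq_le\<close>)
qed

text \<open>For a monomial m of largest degree in q, no other monomial of q contributes to the
  coefficient of \<open>lead m\<close> in \<open>Theta q\<close>; that coefficient is the one of m
  in q times an invertible falling factorial.\<close>

lemma normal_form_unique:
 assumes "\<And>m. m \<in> keys q ==> m \<in> monomials n d" "Theta q = 0"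
 shows "q = 0"
proof (rule ccontr)
 assume "q \<noteq> 0"
 then have "keys q \<noteq> {}" by simp
 then have "Max (mdeg ` keys q) \<in> mdeg ` keys q" by (intro Max_in) auto
 then obtain m where m0: "m \<in> keys q" "mdeg m = Max (mdeg ` keys q)" by auto
 then have m: "m \<in> keys q" "\<And>k. k \<in> keys q ==> mdeg k \<le> mdeg m" by auto
 have md: "mdeg m \<le> d" using assms(1)[OF m(1)] by (simp add: monomials_def)
 have lk: "lookup (Theta (single k 1)) (lead m) = (if k = m then of_nat (ff (mdeg m)) else 0)" if k: "k \<in> keys q" for k
 proof -
  have k': "keys k \<subseteq> {1..n}" "mdeg k \<le> d" using assms(1)[OF k] by (auto simp: monomials_def)
  have z: "lookup k 0 = 0" "lookup m 0 = 0" using assms(1)[OF k] assms(1)[OF m(1)]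
   by (auto simp: monomials_def in_keys_iff)
  have "lookup (Theta (single k 1) - single (lead k) (of_nat (ff (mdeg k)))) (lead m) = 0"
  proof (rule ccontr)
   assume "\<not> ?thesis"
   then have "lead m \<in> keys (Theta (single k 1) - single (lead k) (of_nat (ff (mdeg k))))"
    by (simp add: in_keys_iff)
   then have "d < lookup (lead m) 0 + mdeg k" using Theta_lead[OF k'] by (auto simp: Fil_def)
   then show False using m(2)[OF k] md by (simp add: lead_def lookup_add z)
  qed
  moreover have "lead k = lead m \<longleftrightarrow> k = m"
  proof
   assume e: "lead k = lead m"
   show "k = m"
   proof (rule poly_mapping_eqI)
    fix i show "lookup k i = lookup m i"
     using arg_cong[OF e, of "\<lambda>x. lookup x i"] z
     by (cases "i = 0") (auto simp: lead_def lookup_add lookup_single when_def)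
   qed
  qed simp
  ultimately show ?thesis by (auto simp: lookup_minus lookup_single when_def split: if_splits)
 qed
 have "Theta q = Theta (\<Sum>k\<in>keys q. Const (lookup q k) * single k 1)" by (rule arg_cong[OF mpoly_eq_sum])
 then have "lookup (Theta q) (lead m) = (\<Sum>k\<in>keys q. lookup q k * lookup (Theta (single k 1)) (lead m))"
  by (simp add: Theta_sum Theta_Const_mult lookup_sum lookup_Const_mult)
 also have "\<dots> = lookup q m * of_nat (ff (mdeg m))"
  using m(1) by (simp add: lk if_distrib[of "(*) _"] cong: sum.cong if_cong)
 finally have "lookup q m * of_nat (ff (mdeg m)) = 0" using assms by simp
 moreover obtain w where "of_nat (ff (mdeg m)) * w = (1::'r)" using nat_inverse[OF ff_pos[OF md]] by blast
 ultimately have "lookup q m = 0" by (metis mult.assoc mult.right_neutral mult_zero_left)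
 then show False using m(1) by (simp add: in_keys_iff)
qed

end

lemma hom_of_nat: "comm_ring_hom h ==> h (of_nat k) = of_nat k"
proof -
 assume "comm_ring_hom h"
 then interpret comm_ring_hom h .
 show ?thesis by (induction k) (auto simp: hom_add)
qed

lemma struct_consts_hom:
 assumes "struct_consts n c" "comm_ring_hom h"
 shows "struct_consts n (\<lambda>i j k. h (c i j k))"
proof -
 interpret struct_consts n c by fact
 interpret h: comm_ring_hom h by fact
 show ?thesis
 proof (unfold_locales, goal_cases)
  case (3 i j k m)
  then show ?case using assoc[of i j k m] by (simp flip: h.hom_mult h.hom_sum)
 next
  case (4 k)
  then obtain w where "of_nat k * w = (1::'a)" using nat_inverse by blast
  then have "of_nat k * h w = 1" using hom_of_nat[OF assms(2), of k] by (metis h.hom_mult h.hom_one)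
  then show ?case by blast
 next
  case (2 i j k)
  then show ?case by (rule arg_cong[OF comm])
 qed (simp add: unit)
qed

lemma mapc_partial:
 assumes "comm_ring_hom h" shows "mapc h (partial i P) = partial i (mapc h P)"
proof -
 interpret h: comm_ring_hom h by fact
 have e: "h (1 + of_nat k) = 1 + of_nat k" for k by (simp add: h.hom_add hom_of_nat[OF assms])
 show ?thesis by (rule poly_mapping_eqI) (simp add: lookup_mapc[OF assms] lookup_partial h.hom_mult e)
qed

text \<open>\<open>Theta\<close> is built from the structure constants alone, so it commutes with
  base change. The maps used are t = 0, the inclusion into Laurent series, and the passage to an
  algebraic closure.\<close>

lemma Theta_mapc:
 assumes "struct_consts n c" "comm_ring_hom h" "p \<in> polys {1..n}"
 shows "mapc h (sym_power.Theta n c d p) = sym_power.Theta n (\<lambda>i j k. h (c i j k)) d (mapc h p)"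
proof -
 interpret A: sym_power n c d unfolding sym_power_def by fact
 interpret B: sym_power n "\<lambda>i j k. h (c i j k)" d
  unfolding sym_power_def by (rule struct_consts_hom) fact+
 interpret h: comm_ring_hom h by fact
 interpret m: comm_ring_hom "mapc h" by (rule comm_ring_hom_mapc) fact
 have D: "mapc h (A.Delta i P) = B.Delta i (mapc h P)" for i P
  by (simp add: A.Delta_def B.Delta_def A.mult_form_def B.mult_form_def m.hom_sum m.hom_mult assms(2) mapc_partial)
 show ?thesis using assms(3)
 proof (induction rule: polys_induct)
  case (Const a)
  then show ?case by (simp add: A.Theta_Const B.Theta_Const m.hom_mult m.hom_power assms(2))
 next
  case (add p q)
  then show ?case by (simp add: A.Theta_add B.Theta_add m.hom_add)
 next
  case (Var i p)
  have "mapc h p \<in> polys {1..n}"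
  proof (rule polysI)
   fix k assume "k \<in> keys (mapc h p)"
   then have "k \<in> keys p" using h.hom_zero by (auto simp: in_keys_iff lookup_mapc[OF assms(2)])
   with Var show "keys k \<subseteq> {1..n}" by (auto simp: polys_def)
  qed
  with Var show ?case by (simp add: A.Theta_Var_mult B.Theta_Var_mult m.hom_mult D assms(2))
 qed
qed

section \<open>Powers of linear forms\<close>

definition linform :: "nat => (nat => 'a) => 'a::comm_ring_1 mpoly" where
 "linform n a = (\<Sum>i\<le>n. Const (a i) * Var i)"

lemma linform_forms: "linform n a \<in> forms n 1"
 unfolding linform_def by (intro sum_forms Const_mult_forms Var_forms) auto

lemma partial_linform: "i \<le> n ==> partial i (linform n a) = Const (a i)"
 by (simp add: linform_def partial_sum partial_mult partial_Var if_distrib[of "(*) _"] cong: if_cong)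

lemma form_is_linform:
 assumes "L \<in> forms n 1" obtains a where "L = linform n a"
proof -
 have "L = linform n (\<lambda>i. lookup L (single i 1))"
 proof (rule poly_mapping_eqI)
  fix m
  have "lookup (linform n (\<lambda>i. lookup L (single i 1))) m = (\<Sum>i\<le>n. if single i 1 = m then lookup L (single i 1) else 0)"
   by (simp add: linform_def lookup_sum lookup_Const_mult Var_def lookup_single when_def if_distrib[of "(*) _"] cong: if_cong)
  also have "\<dots> = lookup L m"
  proof (cases "\<exists>i\<le>n. m = single i 1")
   case True
   then obtain i where i: "i \<le> n" "m = single i 1" by blast
   have "(single k 1 = (single i 1 :: nat \<Rightarrow>\<^sub>0 nat)) = (k = i)" for k
    by (metis lookup_single_eq lookup_single_not_eq zero_neq_one)
   with i show ?thesis by simp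
  next
   case False
   have "lookup L m = 0"
   proof (rule ccontr)
    assume "lookup L m \<noteq> 0"
    then have m: "keys m \<subseteq> {0..n}" "mdeg m = 1" using assms by (auto simp: forms_def polys_def in_keys_iff)
    then obtain i where i: "i \<in> keys m" by (metis ex_in_conv mdeg_def sum.empty zero_neq_one)
    then have "m = single i 1 + (m - single i 1)"
     by (intro poly_mapping_eqI) (auto simp: lookup_add lookup_minus lookup_single when_def in_keys_iff)
    then have "mdeg m = 1 + mdeg (m - single i 1)" by (metis mdeg_add mdeg_single)
    with m have "m - single i 1 = 0" by simp
    with \<open>m = _\<close> have "m = single i 1" by simp
    with False i m show False by auto
   qed
   with False show ?thesis by (auto intro!: sum.neutral)
  qed
  finally show "lookup L m = lookup (linform n (\<lambda>i. lookup L (single i 1))) m" by simp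
 qed
 then show thesis by (rule that)
qed

text \<open>Each differentiation of a power of a linear form brings down one coordinate; hence
  apolarity to such a power is evaluation at its coordinate vector.\<close>

lemma dcoeff_linform_power:
 assumes "keys m \<subseteq> {0..n}" "mdeg m = D"
 shows "dcoeff (linform n a ^ D) m = fact D * mval a m"
 using assms
proof (induction m arbitrary: D rule: single_induct)
 case zero
 then show ?case by (simp add: dcoeff_def lookup_one)
next
 case (add i m)
 then obtain D' where D: "D = Suc D'" "mdeg m = D'" by (auto simp: mdeg_add)
 have "dcoeff (linform n a ^ D) (single i 1 + m) = dcoeff (partial i (linform n a ^ D)) m"
  by (simp add: dcoeff_partial add.commute)
 also have "partial i (linform n a ^ D) = Const (of_nat D * a i) * linform n a ^ D'"
  unfolding D(1) partial_power
  using add(1) by (simp add: partial_linform Const_mult) (simp add: Const_def mult_ac single_add)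
 also have "dcoeff \<dots> m = of_nat D * a i * (fact D' * mval a m)"
  by (simp only: dcoeff_Const_mult add.IH[OF D(2)])
 also have "\<dots> = fact D * mval a (single i 1 + m)" by (simp add: D(1) mval_add mult_ac)
 finally show ?case .
qed

lemma lookup_linform_power:
 fixes a :: "nat => 'a::field_char_0"
 shows "lookup (linform n a ^ D) m =
  (if m \<in> form_monomials n D then fact D / of_nat (mfact m) * mval a m else 0)"
proof (cases "m \<in> form_monomials n D")
 case True
 then have "of_nat (mfact m) * lookup (linform n a ^ D) m = fact D * mval a m"
  using dcoeff_linform_power[of m n D a] by (simp add: dcoeff_def form_monomials_def)
 with True show ?thesis by (simp add: field_simps)
next
 case False
 have "linform n a ^ D \<in> forms n D" using power_forms[OF linform_forms, of n a D] by simp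
 with False show ?thesis by (auto simp: forms_def polys_def form_monomials_def in_keys_iff)
qed

section \<open>Linear substitutions\<close>

definition lsubst :: "nat => (nat => nat => 'a) => 'a::comm_ring_1 mpoly => 'a mpoly" where
 "lsubst n M = peval Const (\<lambda>i. linform n (M i))"

lemma comm_ring_hom_lsubst: "comm_ring_hom (lsubst n M)"
 unfolding lsubst_def by (rule comm_ring_hom_peval[OF comm_ring_hom_Const])

lemma lsubst_Const [simp]: "lsubst n M (Const a) = Const a" by (simp add: lsubst_def)
lemma lsubst_Var [simp]: "lsubst n M (Var i) = linform n (M i)" by (simp add: lsubst_def peval_Var)

lemma lsubst_linform: "lsubst n W (linform n a) = linform n (\<lambda>k. \<Sum>j\<le>n. a j * W j k)"
proof -
 interpret l: comm_ring_hom "lsubst n W" by (rule comm_ring_hom_lsubst)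
 have "lsubst n W (linform n a) = (\<Sum>j\<le>n. \<Sum>k\<le>n. Const (a j * W j k) * Var k)"
  by (simp add: linform_def[of n a] l.hom_sum l.hom_mult) (simp add: linform_def sum_distrib_left Const_mult mult.assoc)
 also have "\<dots> = linform n (\<lambda>k. \<Sum>j\<le>n. a j * W j k)"
  by (subst sum.swap) (simp add: linform_def Const_sum sum_distrib_right)
 finally show ?thesis .
qed

lemma linform_cong: "(\<And>i. i \<le> n ==> a i = b i) ==> linform n a = linform n b"
 by (simp add: linform_def)

lemma linform_delta: "i \<le> n ==> linform n (\<lambda>k. if i = k then 1 else 0) = Var i"
proof -
 assume "i \<le> n"
 have "linform n (\<lambda>k. if i = k then 1 else 0) = (\<Sum>k\<le>n. if k = i then Var k else (0::'a mpoly))"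
  unfolding linform_def by (intro sum.cong) auto
 with \<open>i \<le> n\<close> show ?thesis by simp
qed

lemma lsubst_inverse:
 assumes "\<And>i k. i \<le> n ==> k \<le> n ==> (\<Sum>j\<le>n. M i j * W j k) = (if i = k then 1 else 0)"
  and "p \<in> polys {0..n}"
 shows "lsubst n W (lsubst n M p) = p"
proof -
 interpret W: comm_ring_hom "lsubst n W" by (rule comm_ring_hom_lsubst)
 interpret M: comm_ring_hom "lsubst n M" by (rule comm_ring_hom_lsubst)
 show ?thesis using assms(2)
 proof (induction rule: polys_induct)
  case (Var i p)
  have "lsubst n W (linform n (M i)) = linform n (\<lambda>k. if i = k then 1 else 0)"
   unfolding lsubst_linform by (rule linform_cong) (use Var assms(1) in auto)
  then show ?case using Var by (simp add: M.hom_mult W.hom_mult linform_delta)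
 qed (auto simp: M.hom_add W.hom_add)
qed

lemma lsubst_form:
 assumes "P \<in> forms n d" shows "lsubst n M P \<in> forms n d"
proof -
 have "mval (\<lambda>i. linform n (M i)) m \<in> forms n (mdeg m)" for m
 proof (induction m rule: single_induct[where V = UNIV, OF subset_UNIV, case_names zero add])
  case (add i m)
  then show ?case using mult_forms[OF linform_forms add(3)] by (simp add: mval_add mdeg_add)
 qed (simp add: one_forms)
 then show ?thesis unfolding lsubst_def peval_alt
  by (intro sum_forms Const_mult_forms) (metis assms forms_mdeg)
qed

section \<open>Split algebras\<close>

text \<open>Monomials are eigenvectors of the Euler operator y_j d/dy_j.\<close>

lemma lookup_Var_mult_partial: "lookup (Var j * partial j Q) \<mu> = of_nat (lookup \<mu> j) * lookup Q \<mu>"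
proof (cases "lookup \<mu> j = 0")
 case True
 have "\<mu> \<notin> keys (Var j * partial j Q)"
 proof
  assume "\<mu> \<in> keys (Var j * partial j Q)"
  then obtain m where "\<mu> = single j 1 + m"
   using keys_mult[of "Var j" "partial j Q"] by (auto simp: Var_def split: if_splits)
  with True show False by (simp add: lookup_add)
 qed
 with True show ?thesis by (simp add: in_keys_iff)
next
 case False
 then have \<mu>: "\<mu> = single j 1 + (\<mu> - single j 1)"
  by (intro poly_mapping_eqI) (auto simp: lookup_add lookup_minus lookup_single when_def)
 define \<nu> where "\<nu> = \<mu> - single j 1"
 have \<mu>': "\<mu> = single j 1 + \<nu>" using \<mu> by (simp add: \<nu>_def)
 show ?thesis unfolding \<mu>' Var_def lookup_single_mult_plus
  by (simp add: lookup_partial lookup_add add.commute)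
qed

text \<open>\<open>ch j i\<close> is the value of the j-th character at a_i, and \<open>W\<close>
  inverts this matrix: the n + 1 characters form a basis of the dual space, that is, the algebra is
  a product of n + 1 copies of the field.\<close>

locale split_power = sym_power n c d for n d and c :: "nat => nat => nat => 'a::field_char_0" +
 fixes ch W :: "nat => nat => 'a"
 assumes X0: "j \<le> n ==> ch j 0 = 1"
  and X_mult: "j \<le> n ==> i \<le> n ==> k \<le> n ==> ch j i * ch j k = (\<Sum>l\<le>n. c i k l * ch j l)"
  and XW: "i \<le> n ==> k \<le> n ==> (\<Sum>j\<le>n. ch j i * W j k) = (if i = k then 1 else 0)"
  and WX: "i \<le> n ==> k \<le> n ==> (\<Sum>j\<le>n. W i j * ch k j) = (if i = k then 1 else 0)"
begin

text \<open>The sum of the characters with multiplicities \<mu>. For \<mu> of degree d these are the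
  N points whose ideal is the kernel of \<open>Theta\<close>; \<open>rho \<mu> i\<close> is the
  eigenvalue of \<open>Delta i\<close> at the monomial \<mu> in the idempotents of the
  algebra.\<close>

definition rho :: "(nat \<Rightarrow>\<^sub>0 nat) => nat => 'a" where
 "rho \<mu> i = (\<Sum>j\<le>n. of_nat (lookup \<mu> j) * ch j i)"

abbreviation "eta \<equiv> lsubst n (\<lambda>i j. ch j i)"

text \<open>The substitution \<open>eta\<close> writes a_i in the idempotents of the split algebra,
  on which multiplication is diagonal; so \<open>Delta i\<close> becomes a combination of Euler
  operators.\<close>

lemma eta_Delta:
 assumes "i \<le> n" "P \<in> polys {0..n}"
 shows "eta (Delta i P) = (\<Sum>j\<le>n. Const (ch j i) * (Var j * partial j (eta P)))"
proof -
 interpret h: comm_ring_hom eta by (rule comm_ring_hom_lsubst)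
 define E where "E P = (\<Sum>j\<le>n. Const (ch j i) * (Var j * partial j P))" for P :: "'a mpoly"
 have Ea: "E (P + Q) = E P + E Q" for P Q
  by (simp add: E_def partial_add distrib_left sum.distrib)
 have Em: "E (P * Q) = P * E Q + E P * Q" for P Q
  unfolding E_def partial_mult sum_distrib_left sum_distrib_right sum.distrib[symmetric]
  by (rule sum.cong) (simp_all add: algebra_simps)
 have El: "E (linform n (\<lambda>j. ch j k)) = linform n (\<lambda>j. ch j i * ch j k)" for k
  unfolding E_def linform_def[of n "\<lambda>j. ch j i * ch j k"]
  by (intro sum.cong) (simp_all add: partial_linform Const_mult mult_ac)
 have Dl: "eta (mult_form i k) = linform n (\<lambda>j. ch j i * ch j k)" if k: "k \<le> n" for k
 proof -
  have "mult_form i k = linform n (c i k)" by (simp add: mult_form_def linform_def)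
  then have "eta (mult_form i k) = linform n (\<lambda>j. \<Sum>l\<le>n. c i k l * ch j l)" by (simp add: lsubst_linform)
  then show ?thesis using k assms by (simp add: X_mult linform_def)
 qed
 have "eta (Delta i P) - E (eta P) = 0" using assms(2)
 proof (rule derivation_eq_0[where h = eta and E = "\<lambda>P. eta (Delta i P) - E (eta P)"])
  show "eta (Delta i (p * q)) - E (eta (p * q)) =
   eta p * (eta (Delta i q) - E (eta q)) + (eta (Delta i p) - E (eta p)) * eta q" for p q
   by (simp add: Delta_mult h.hom_add h.hom_mult Em right_diff_distrib left_diff_distrib)
  show "eta (Delta i (p + q)) - E (eta (p + q)) = eta (Delta i p) - E (eta p) + (eta (Delta i q) - E (eta q))" for p q
   by (simp add: Delta_add h.hom_add Ea)
  show "eta (Delta i (Const a)) - E (eta (Const a)) = 0" for a by (simp add: E_def)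
  show "eta (Delta i (Var k)) - E (eta (Var k)) = 0" if "k \<in> {0..n}" for k
   using that by (simp add: Delta_Var Dl El)
 qed
 then show ?thesis by (simp add: E_def)
qed

text \<open>The operators act on each monomial in the idempotents by scalars, so p acts by its value
  at \<open>rho \<mu>\<close>. By \<open>X0\<close> the starting point y_0^d becomes the d-th power
  of the sum of all idempotents.\<close>

lemma lookup_eta_Theta:
 assumes "p \<in> polys {1..n}"
 shows "lookup (eta (Theta p)) \<mu> = peval (\<lambda>c. c) (rho \<mu>) p * lookup (linform n (\<lambda>_. 1) ^ d) \<mu>"
proof -
 interpret h: comm_ring_hom eta by (rule comm_ring_hom_lsubst)
 interpret r: comm_ring_hom "peval (\<lambda>c. c) (rho \<mu>)" by (rule comm_ring_hom_peval[OF comm_ring_hom_id])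
 show ?thesis using assms
 proof (induction rule: polys_induct)
  case (Const a)
  have "linform n (\<lambda>j. ch j 0) = linform n (\<lambda>_. 1)" by (rule linform_cong) (simp add: X0)
  then show ?case by (simp add: Theta_Const h.hom_mult h.hom_power lookup_Const_mult)
 next
  case (add p q)
  then show ?case by (simp add: Theta_add h.hom_add r.hom_add lookup_add distrib_right)
 next
  case (Var i p)
  have "lookup (eta (Theta (Var i * p))) \<mu> =
    (\<Sum>j\<le>n. ch j i * (of_nat (lookup \<mu> j) * lookup (eta (Theta p)) \<mu>))"
   using Var forms_polys[OF Theta_forms[OF Var(2)]]
   by (simp add: Theta_Var_mult eta_Delta lookup_sum lookup_Const_mult lookup_Var_mult_partial)
  also have "\<dots> = rho \<mu> i * lookup (eta (Theta p)) \<mu>"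
   by (simp add: rho_def sum_distrib_right mult_ac)
  finally show ?case using Var by (simp add: r.hom_mult peval_Var mult_ac)
 qed
qed

lemma multinomial_neq_0: "\<mu> \<in> form_monomials n d ==> lookup (linform n (\<lambda>_. 1::'a) ^ d) \<mu> \<noteq> 0"
 by (simp add: lookup_linform_power mval_def)

text \<open>All multinomial coefficients are nonzero in characteristic zero, and \<open>W\<close>
  undoes the substitution \<open>eta\<close>.\<close>

lemma Theta_eq_0_iff:
 assumes "p \<in> polys {1..n}"
 shows "Theta p = 0 \<longleftrightarrow> (\<forall>\<mu>\<in>form_monomials n d. peval (\<lambda>c. c) (rho \<mu>) p = 0)"
proof
 assume "Theta p = 0"
 then have "eta (Theta p) = 0" by (simp add: lsubst_def peval_def)
 then show "\<forall>\<mu>\<in>form_monomials n d. peval (\<lambda>c. c) (rho \<mu>) p = 0"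
  using lookup_eta_Theta[OF assms] multinomial_neq_0 by (metis lookup_zero mult_eq_0_iff)
next
 assume 0: "\<forall>\<mu>\<in>form_monomials n d. peval (\<lambda>c. c) (rho \<mu>) p = 0"
 have "eta (Theta p) = 0"
 proof (rule poly_mapping_eqI)
  fix \<mu> show "lookup (eta (Theta p)) \<mu> = lookup 0 \<mu>"
   using 0 by (cases "\<mu> \<in> form_monomials n d") (auto simp: lookup_eta_Theta[OF assms] lookup_linform_power)
 qed
 then have "lsubst n W (eta (Theta p)) = 0" by (simp add: lsubst_def peval_def)
 moreover have "lsubst n W (eta (Theta p)) = Theta p"
  by (rule lsubst_inverse[OF _ forms_polys[OF Theta_forms[OF assms]]]) (rule XW)
 ultimately show "Theta p = 0" by simp
qed

lemma rho_0: "\<mu> \<in> form_monomials n d ==> rho \<mu> 0 = of_nat d"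
proof -
 assume "\<mu> \<in> form_monomials n d"
 then have "(\<Sum>j\<le>n. lookup \<mu> j) = d"
  using mdeg_superset[of "{..n}" \<mu>] by (simp add: form_monomials_def atMost_atLeast0)
 then show ?thesis by (simp add: rho_def X0 flip: of_nat_sum)
qed

text \<open>\<open>W\<close> recovers the exponents from the coordinates 0, ..., n; coordinate 0
  equals d for every \<mu>, so the affine coordinates already separate the points.\<close>

lemma rho_inj:
 assumes "\<mu> \<in> form_monomials n d" "\<nu> \<in> form_monomials n d" "\<And>i. i \<in> {1..n} ==> rho \<mu> i = rho \<nu> i"
 shows "\<mu> = \<nu>"
proof (rule poly_mapping_eqI)
 fix k
 have e: "rho \<mu> i = rho \<nu> i" if "i \<le> n" for i
  using assms that rho_0 by (cases "i = 0") auto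
 have s: "(\<Sum>i\<le>n. W k i * rho \<mu> i) = of_nat (lookup \<mu> k)" if "k \<le> n" for \<mu>
 proof -
  have "(\<Sum>i\<le>n. W k i * rho \<mu> i) = (\<Sum>j\<le>n. of_nat (lookup \<mu> j) * (\<Sum>i\<le>n. W k i * ch j i))"
   by (simp add: rho_def sum_distrib_left) (subst sum.swap, simp add: mult_ac)
  also have "\<dots> = of_nat (lookup \<mu> k)"
   using that by (simp add: WX if_distrib[of "(*) _"] cong: if_cong)
  finally show ?thesis .
 qed
 show "lookup \<mu> k = lookup \<nu> k"
 proof (cases "k \<le> n")
  case True
  have "(of_nat (lookup \<mu> k) :: 'a) = of_nat (lookup \<nu> k)" using s[OF True] e by (metis (no_types, lifting) atMost_iff sum.cong)
  then show ?thesis by simp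
 next
  case False
  then have "k \<notin> keys \<mu>" "k \<notin> keys \<nu>" using assms(1,2) by (auto simp: form_monomials_def)
  then show ?thesis by (simp add: in_keys_iff)
 qed
qed

text \<open>If b is the combination of the characters with weights \<kappa>, expansion in the
  idempotents turns evaluation at b into a weighted sum over the N points. For monomials p this is
  the source of the N powers of linear forms in \<open>border_rank_upper\<close>.\<close>

lemma peval_Theta:
 assumes "p \<in> polys {1..n}" "\<And>i. i \<le> n ==> (\<Sum>j\<le>n. ch j i * \<kappa> j) = b i"
 shows "peval (\<lambda>c. c) b (Theta p) = (\<Sum>\<mu>\<in>form_monomials n d.
  (fact d / of_nat (mfact \<mu>) * mval \<kappa> \<mu>) * peval (\<lambda>c. c) (rho \<mu>) p)"
proof -
 interpret k: comm_ring_hom "peval (\<lambda>c. c) \<kappa> :: 'a mpoly => 'a" by (rule comm_ring_hom_peval[OF comm_ring_hom_id])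
 have "peval (\<lambda>c. c) \<kappa> (eta P) = peval (\<lambda>c. c) b P" if "P \<in> polys {0..n}" for P
 proof -
  have "peval (\<lambda>c. c) \<kappa> (eta P) = peval (\<lambda>c. c) (\<lambda>i. peval (\<lambda>c. c) \<kappa> (linform n (\<lambda>j. ch j i))) P"
   unfolding lsubst_def by (subst hom_peval[OF comm_ring_hom_peval[OF comm_ring_hom_id]]) auto
  also have "\<dots> = peval (\<lambda>c. c) b P"
  proof (rule peval_cong)
   fix m i assume "m \<in> keys P" "i \<in> keys m"
   then have "i \<in> {0..n}" using that unfolding polys_def by blast
   then have "i \<le> n" by simp
   then show "peval (\<lambda>c. c) \<kappa> (linform n (\<lambda>j. ch j i)) = b i"
    by (simp add: linform_def k.hom_sum k.hom_mult peval_Var assms(2))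
  qed simp
  finally show ?thesis .
 qed
 then have "peval (\<lambda>c. c) b (Theta p) = peval (\<lambda>c. c) \<kappa> (eta (Theta p))"
  using Theta_forms[OF assms(1)] by (simp add: forms_polys)
 also have "\<dots> = (\<Sum>\<mu>\<in>form_monomials n d. lookup (eta (Theta p)) \<mu> * mval \<kappa> \<mu>)"
  unfolding peval_alt
 proof (rule sum.mono_neutral_left)
  show "keys (eta (Theta p)) \<subseteq> form_monomials n d"
   using lsubst_form[OF Theta_forms[OF assms(1)]] by (auto simp: forms_def polys_def form_monomials_def)
 qed (auto simp: in_keys_iff)
 also have "\<dots> = (\<Sum>\<mu>\<in>form_monomials n d. (fact d / of_nat (mfact \<mu>) * mval \<kappa> \<mu>) * peval (\<lambda>c. c) (rho \<mu>) p)"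
  by (intro sum.cong) (simp_all add: lookup_eta_Theta[OF assms(1)] lookup_linform_power mval_def)
 finally show ?thesis .
qed

end

section \<open>Encompassing polynomials\<close>

definition alph :: "nat => 'a::comm_semiring_1 mpoly" where
 "alph i = (if i = 0 then 1 else Var i)"

lemma alph_0: "alph 0 = 1" by (simp add: alph_def)

lemma alph_polys: "i \<le> n ==> alph i \<in> polys {1..n}"
 by (auto simp: alph_def intro!: Var_polys)

definition afform :: "nat => (nat => 'a) => 'a::comm_ring_1 mpoly" where
 "afform n a = (\<Sum>i\<le>n. Const (a i) * alph i)"

lemma afform_polys: "afform n a \<in> polys {1..n}"
 unfolding afform_def by (intro sum_polys mult_polys Const_polys alph_polys) auto

lemma afform_diff: "afform n (\<lambda>i. a i - b i) = afform n a - afform n b"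
 by (simp add: afform_def Const_diff left_diff_distrib sum_subtractf)

lemma afform_sum: "(\<Sum>i\<in>I. Const (s i) * afform n (a i)) = afform n (\<lambda>k. \<Sum>i\<in>I. s i * a i k)"
 by (simp add: afform_def sum_distrib_left Const_sum sum_distrib_right Const_mult mult.assoc) (rule sum.swap)

lemma afform_delta: "j \<le> n ==> afform n (\<lambda>k. if j = k then 1 else 0) = alph j"
proof -
 assume "j \<le> n"
 have "afform n (\<lambda>k. if j = k then 1 else 0) = (\<Sum>k\<le>n. if k = j then alph k else (0::'a mpoly))"
  unfolding afform_def by (intro sum.cong) auto
 with \<open>j \<le> n\<close> show ?thesis by simp
qed

lemma low_degree_cases:
 assumes "mdeg m \<le> 1" obtains "m = 0" | i where "m = single i 1"
proof (cases "m = 0")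
 case False
 then obtain i where i: "i \<in> keys m" by (metis ex_in_conv keys_eq_empty)
 then have m: "m = single i 1 + (m - single i 1)"
  by (intro poly_mapping_eqI) (auto simp: lookup_add lookup_minus lookup_single when_def in_keys_iff)
 then have "mdeg m = 1 + mdeg (m - single i 1)" by (metis mdeg_add mdeg_single)
 with assms have "m - single i 1 = 0" by simp
 with m have "m = single i 1" by simp
 then show thesis by (rule that(2))
qed (rule that(1))

text \<open>\<open>indep\<close> is the linear independence of 1, \<alpha>_1, ..., \<alpha>_n in
  Ap(f); \<open>encompassing_polyI\<close> derives it from the conciseness of the form.\<close>

locale encompassing_poly =
 fixes n :: nat and f :: "'k::field_char_0 mpoly"
 assumes f_polys: "f \<in> polys {1..n}"
  and enc: "encompassing {1..n} f"
  and indep: "act (afform n a) f = 0 ==> i \<le> n ==> a i = 0"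
begin

text \<open>The pairings with 1, \<alpha>_1, ..., \<alpha>_n are the coefficients of degree at most
  1 of the derivative, and an encompassing polynomial has no nonzero derivative for which they all
  vanish.\<close>

lemma act_eq_0I:
 assumes "\<sigma> \<in> polys {1..n}" "\<And>j. j \<le> n ==> pair f (\<sigma> * alph j) = 0"
 shows "act \<sigma> f = 0"
proof -
 let ?g = "act \<sigma> f"
 have g: "?g \<in> polys {1..n}" by (rule act_polys[OF f_polys])
 have z: "lookup ?g m = 0" if "mdeg m \<le> 1" for m
  using that
 proof (cases m rule: low_degree_cases)
  case 1
  have "dcoeff ?g 0 = 0" using assms(2)[of 0] by (simp add: dcoeff_act alph_def)
  with 1 show ?thesis by (simp add: dcoeff_def)
 next
  case (2 i)
  show ?thesis
  proof (cases "i \<in> {1..n}")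
   case True
   then have "dcoeff ?g (single i 1) = 0" using assms(2)[of i] by (simp add: dcoeff_act alph_def Var_def)
   with 2 show ?thesis by (simp add: dcoeff_def)
  next
   case False
   then have "m \<notin> keys ?g" using g 2 by (auto simp: polys_def)
   then show ?thesis by (simp add: in_keys_iff)
  qed
 qed
 have "hom_part 0 ?g + hom_part 1 ?g = 0"
  by (rule poly_mapping_eqI) (auto simp: lookup_add lookup_hom_part z)
 with enc assms(1) show ?thesis unfolding encompassing_def by blast
qed

definition Mat :: "nat => nat => 'k" where "Mat i j = pair f (alph i * alph j)"

lemma pair_afform: "pair f (afform n a * alph j) = (\<Sum>i\<le>n. a i * Mat i j)"
 by (simp add: afform_def sum_distrib_right pair_sum mult.assoc pair_Const_mult Mat_def)

text \<open>A relation between the rows of the Gram matrix gives an affine form that annihilates f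
  by \<open>act_eq_0I\<close>, hence is trivial by \<open>indep\<close>.\<close>

lemma Mat_inverse:
 "\<exists>W. \<forall>i\<le>n. \<forall>k\<le>n. (\<Sum>j\<le>n. Mat i j * W j k) = (if i = k then 1 else 0)
  \<and> (\<Sum>j\<le>n. W i j * Mat j k) = (if i = k then 1 else 0)"
proof (rule matrix_inverse[of "Suc n" Mat])
 fix a i assume a: "\<And>j. j < Suc n ==> (\<Sum>i<Suc n. a i * Mat i j) = 0" and i: "i < Suc n"
 have "act (afform n a) f = 0"
  by (rule act_eq_0I[OF afform_polys]) (use a in \<open>simp add: pair_afform lessThan_Suc_atMost\<close>)
 then show "a i = 0" using indep i by simp
next
 fix W
 assume "\<And>i k. i < Suc n ==> k < Suc n ==> (\<Sum>j<Suc n. Mat i j * W j k) = (if i = k then 1 else 0)"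
  and "\<And>i k. i < Suc n ==> k < Suc n ==> (\<Sum>j<Suc n. W i j * Mat j k) = (if i = k then 1 else 0)"
 then show ?thesis unfolding lessThan_Suc_atMost less_Suc_eq_le by blast
qed

text \<open>Solving the Gram system gives an affine form with the same pairings as \<sigma>, so the
  difference annihilates f. Thus 1, \<alpha>_1, ..., \<alpha>_n span Ap(f).\<close>

lemma reduction:
 assumes "\<sigma> \<in> polys {1..n}"
 obtains a where "act (\<sigma> - afform n a) f = 0"
proof -
 obtain W where W0: "\<forall>i\<le>n. \<forall>k\<le>n. (\<Sum>j\<le>n. Mat i j * W j k) = (if i = k then 1 else 0)
  \<and> (\<Sum>j\<le>n. W i j * Mat j k) = (if i = k then 1 else 0)"
  using Mat_inverse by (elim exE)
 then have W: "\<And>i k. i \<le> n ==> k \<le> n ==> (\<Sum>j\<le>n. W i j * Mat j k) = (if i = k then 1 else 0)"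
  by blast
 define a where "a i = (\<Sum>j\<le>n. pair f (\<sigma> * alph j) * W j i)" for i
 have "(\<Sum>i\<le>n. a i * Mat i k) = pair f (\<sigma> * alph k)" if k: "k \<le> n" for k
 proof -
  have "(\<Sum>i\<le>n. a i * Mat i k) = (\<Sum>j\<le>n. pair f (\<sigma> * alph j) * (\<Sum>i\<le>n. W j i * Mat i k))"
   by (simp add: a_def sum_distrib_left sum_distrib_right mult.assoc) (rule sum.swap)
  also have "\<dots> = pair f (\<sigma> * alph k)"
   using k by (simp add: W if_distrib[of "(*) _"] cong: if_cong)
  finally show ?thesis .
 qed
 then have "act (\<sigma> - afform n a) f = 0"
  by (intro act_eq_0I diff_polys assms afform_polys) (simp add: left_diff_distrib pair_diff pair_afform)
 then show thesis by (rule that)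
qed

definition eqv :: "'k mpoly => 'k mpoly => bool" where "eqv \<sigma> \<tau> \<longleftrightarrow> act (\<sigma> - \<tau>) f = 0"

lemma eqv_iff: "eqv \<sigma> \<tau> \<longleftrightarrow> act \<sigma> f = act \<tau> f"
proof -
 have "act (\<sigma> - \<tau>) f = act \<sigma> f - act \<tau> f"
  using act_add[of "\<sigma> - \<tau>" \<tau> f] by (simp add: algebra_simps)
 then show ?thesis by (simp add: eqv_def)
qed

lemma eqv_mult: "eqv \<sigma> \<tau> ==> eqv (\<upsilon> * \<sigma>) (\<upsilon> * \<tau>)"
 by (simp add: eqv_iff act_mult)

lemma eqv_sum: "(\<And>x. x \<in> A ==> eqv (s x) (t x)) ==> eqv (sum s A) (sum t A)"
 by (simp add: eqv_iff act_sum)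

lemma eqv_afform_unique: "eqv (afform n a) (afform n b) ==> i \<le> n ==> a i = b i"
 using indep[of "\<lambda>i. a i - b i" i] by (simp add: eqv_def afform_diff)

definition cst :: "nat => nat => nat => 'k" where
 "cst i j = (SOME a. eqv (alph i * alph j) (afform n a))"

lemma cst: "i \<le> n ==> j \<le> n ==> eqv (alph i * alph j) (afform n (cst i j))"
proof -
 assume "i \<le> n" "j \<le> n"
 then obtain a where "act (alph i * alph j - afform n a) f = 0"
  using reduction[OF mult_polys[OF alph_polys alph_polys]] by blast
 then have "\<exists>a. eqv (alph i * alph j) (afform n a)" by (auto simp: eqv_def)
 then show ?thesis unfolding cst_def by (rule someI_ex)
qed

text \<open>In each algebraic axiom both sides are coefficients of the same element of Ap(f),
  compared by \<open>eqv_afform_unique\<close>.\<close>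

sublocale struct_consts n cst
proof (unfold_locales, goal_cases)
 case (1 j k)
 have "eqv (afform n (\<lambda>k. if j = k then 1 else 0)) (afform n (cst 0 j))"
  using cst[OF le0 1(1)] unfolding afform_delta[OF 1(1)] alph_0 mult_1_left .
 from eqv_afform_unique[OF this 1(2), symmetric] show ?case .
next
 case (2 i j k)
 have "eqv (afform n (cst i j)) (afform n (cst j i))"
  using cst[of i j] cst[of j i] 2 by (simp add: eqv_iff mult.commute)
 from eqv_afform_unique[OF this 2(3)] show ?case .
next
 case (3 i j k m)
 have L: "eqv (alph k * (alph i * alph j)) (afform n (\<lambda>m. \<Sum>l\<le>n. cst i j l * cst l k m))"
  if "i \<le> n" "j \<le> n" "k \<le> n" for i j k
 proof -
  have "eqv (alph k * (alph i * alph j)) (alph k * afform n (cst i j))"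
   using that by (intro eqv_mult cst)
  moreover have "alph k * afform n (cst i j) = (\<Sum>l\<le>n. Const (cst i j l) * (alph l * alph k))"
   by (simp add: afform_def sum_distrib_left mult_ac)
  moreover have "eqv (\<Sum>l\<le>n. Const (cst i j l) * (alph l * alph k)) (\<Sum>l\<le>n. Const (cst i j l) * afform n (cst l k))"
   using that by (intro eqv_sum eqv_mult cst) auto
  ultimately show ?thesis by (simp add: eqv_iff afform_sum)
 qed
 have c: "(\<Sum>l\<le>n. cst j k l * cst i l m) = (\<Sum>l\<le>n. cst j k l * cst l i m)"
 proof (intro sum.cong refl)
  fix l assume "l \<in> {..n}"
  then have "eqv (afform n (cst i l)) (afform n (cst l i))"
   using cst[of i l] cst[of l i] 3 by (simp add: eqv_iff mult.commute)
  then show "cst j k l * cst i l m = cst j k l * cst l i m"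
   using eqv_afform_unique[of "cst i l" "cst l i" m] 3 by simp
 qed
 have "eqv (afform n (\<lambda>m. \<Sum>l\<le>n. cst i j l * cst l k m)) (afform n (\<lambda>m. \<Sum>l\<le>n. cst j k l * cst l i m))"
  using L[of i j k] L[of j k i] 3 by (simp add: eqv_iff mult_ac)
 from eqv_afform_unique[OF this 3(4)] show ?case by (simp add: c)
next
 case (4 k)
 then show ?case by (intro exI[of _ "1 / of_nat k"]) simp
qed

section \<open>Derivatives of the powers of f\<close>

definition fder :: "nat => 'k mpoly" where "fder j = act (alph j) f"

lemma fder_polys: "fder j \<in> polys {1..n}" unfolding fder_def by (rule act_polys[OF f_polys])

lemma partial_fder:
 assumes "i \<in> {1..n}" "j \<le> n" shows "partial i (fder j) = (\<Sum>k\<le>n. Const (cst i j k) * fder k)"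
proof -
 have "partial i (fder j) = act (alph i * alph j) f"
  using assms by (simp add: fder_def act_mult act_Var alph_def[of i])
 also have "\<dots> = act (afform n (cst i j)) f" using cst[of i j] assms by (simp add: eqv_iff)
 finally show ?thesis by (simp add: afform_def act_sum act_Const_mult fder_def)
qed

text \<open>Substituting a_j \<circ> f for y_j turns \<open>Delta i\<close> into the partial
  derivative: both composites are derivations along the substitution, and on variables the claim is
  \<open>partial_fder\<close>.\<close>

lemma subst_Delta:
 assumes "i \<in> {1..n}" "P \<in> polys {0..n}"
 shows "peval Const fder (Delta i P) = partial i (peval Const fder P)"
proof -
 interpret h: comm_ring_hom "peval Const fder" by (rule comm_ring_hom_peval[OF comm_ring_hom_Const])
 define E where "E P = peval Const fder (Delta i P) - partial i (peval Const fder P)" for P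
 have "E P = 0"
 proof (rule derivation_eq_0[where h = "peval Const fder" and V = "{0..n}", OF assms(2)])
  show "E (p * q) = peval Const fder p * E q + E p * peval Const fder q" for p q
   by (simp add: E_def Delta_mult h.hom_add h.hom_mult partial_mult right_diff_distrib left_diff_distrib)
  show "E (p + q) = E p + E q" for p q
   by (simp add: E_def Delta_add h.hom_add partial_add)
  show "E (Const a) = 0" for a by (simp add: E_def)
  show "E (Var k) = 0" if "k \<in> {0..n}" for k
   using that assms(1)
   by (simp add: E_def Delta_Var mult_form_def h.hom_sum h.hom_mult peval_Var partial_fder)
 qed
 then show ?thesis by (simp add: E_def)
qed

text \<open>The variable y_0 maps to f itself, so the orbit of y_0^d maps to the derivatives of
  f^d.\<close>

lemma subst_Theta:
 assumes "p \<in> polys {1..n}"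
 shows "peval Const fder (sym_power.Theta n cst d p) = act p (f ^ d)"
proof -
 interpret sym_power n cst d ..
 interpret h: comm_ring_hom "peval Const fder" by (rule comm_ring_hom_peval[OF comm_ring_hom_Const])
 show ?thesis using assms
 proof (induction rule: polys_induct)
  case (Const a)
  have "fder 0 = f" by (simp add: fder_def alph_def)
  then show ?case by (simp add: Theta_Const h.hom_mult h.hom_power peval_Var act_Const)
 next
  case (add p q)
  then show ?case by (simp add: Theta_add h.hom_add act_add)
 next
  case (Var i p)
  then have "peval Const fder (Delta i (Theta p)) = partial i (peval Const fder (Theta p))"
   by (intro subst_Delta forms_polys[OF Theta_forms])
  with Var show ?case by (simp add: Theta_Var_mult act_mult act_Var)
 qed
qed

text \<open>\<open>P\<close> has leading form $x^a$ for the order of vanishing at the origin.\<close>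

definition Lead :: "'k mpoly => (nat \<Rightarrow>\<^sub>0 nat) => bool" where
 "Lead P a \<longleftrightarrow> (\<forall>m. mdeg m \<le> mdeg a \<longrightarrow> lookup P m = (if m = a then 1 else 0))"

lemma Lead_mult:
 assumes "Lead P a" "Lead Q b" shows "Lead (P * Q) (a + b)"
 unfolding Lead_def
proof (intro allI impI)
 fix m :: "nat \<Rightarrow>\<^sub>0 nat" assume m: "mdeg m \<le> mdeg (a + b)"
 define R where "R = P - single a 1"
 define S where "S = Q - single b 1"
 have R: "mdeg a < mdeg k" if "k \<in> keys R" for k
 proof (rule ccontr)
  assume "\<not> mdeg a < mdeg k"
  then have "lookup P k = (if k = a then 1 else 0)" using assms(1) by (simp add: Lead_def)
  then have "lookup R k = 0" by (simp add: R_def lookup_minus lookup_single when_def)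
  with that show False by (simp add: in_keys_iff)
 qed
 have S: "mdeg b < mdeg k" if "k \<in> keys S" for k
 proof (rule ccontr)
  assume "\<not> mdeg b < mdeg k"
  then have "lookup Q k = (if k = b then 1 else 0)" using assms(2) by (simp add: Lead_def)
  then have "lookup S k = 0" by (simp add: S_def lookup_minus lookup_single when_def)
  with that show False by (simp add: in_keys_iff)
 qed
 have z: "lookup (U * V) m = 0" if "\<And>k l. k \<in> keys U ==> l \<in> keys V ==> mdeg a + mdeg b < mdeg k + mdeg l" for U V :: "'k mpoly"
 proof (rule ccontr)
  assume "lookup (U * V) m \<noteq> 0"
  then obtain k l where "k \<in> keys U" "l \<in> keys V" "m = k + l" using keys_mult[of U V] by (auto simp: in_keys_iff[symmetric])
  with that[of k l] m show False by (simp add: mdeg_add)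
 qed
 have "P * Q = single (a + b) 1 + (single a 1 * S + (R * single b 1 + R * S))"
  by (simp add: R_def S_def mult_single algebra_simps)
 moreover have "lookup (single a 1 * S) m = 0" using S by (intro z) auto
 moreover have "lookup (R * single b 1) m = 0" using R by (intro z) auto
 moreover have "lookup (R * S) m = 0" using R S by (intro z add_strict_mono)
 ultimately show "lookup (P * Q) m = (if m = a + b then 1 else 0)"
  by (simp add: lookup_add lookup_single when_def)
qed

text \<open>The inverse Gram matrix combines the derivatives of f into polynomials that start with
  1, x_1, ..., x_n. Distinct monomials of the same degree d in them have distinct leading forms, so
  one of lowest degree cannot cancel.\<close>

lemma subst_fder_inj:
 assumes "P \<in> forms n d" "peval Const fder P = 0" shows "P = 0"
proof -
 obtain W where W0: "\<forall>i\<le>n. \<forall>k\<le>n. (\<Sum>j\<le>n. Mat i j * W j k) = (if i = k then 1 else 0)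
  \<and> (\<Sum>j\<le>n. W i j * Mat j k) = (if i = k then 1 else 0)"
  using Mat_inverse by (elim exE)
 then have MW: "\<And>i k. i \<le> n ==> k \<le> n ==> (\<Sum>j\<le>n. Mat i j * W j k) = (if i = k then 1 else 0)"
  and WM: "\<And>i k. i \<le> n ==> k \<le> n ==> (\<Sum>j\<le>n. W i j * Mat j k) = (if i = k then 1 else 0)"
  by blast+
 define g where "g j = (\<Sum>i\<le>n. Const (W j i) * fder i)" for j
 have gp: "g j \<in> polys {1..n}" for j
  unfolding g_def by (intro sum_polys mult_polys fder_polys Const_polys)
 have gd: "pair (g j) (alph k) = (if j = k then 1 else 0)" if "j \<le> n" "k \<le> n" for j k
 proof -
  have "pair (g j) (alph k) = pair (act (afform n (W j)) f) (alph k)"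
   by (simp add: g_def afform_def act_sum act_Const_mult fder_def)
  then show ?thesis using WM[OF that] by (simp add: pair_act pair_afform)
 qed
 have g_lead: "Lead (g j) (if j = 0 then 0 else single j 1)" if j: "j \<le> n" for j
  unfolding Lead_def
 proof (intro allI impI)
  fix m :: "nat \<Rightarrow>\<^sub>0 nat" assume m: "mdeg m \<le> mdeg (if j = 0 then 0 else single j (1::nat))"
  then have "mdeg m \<le> 1" by (auto split: if_splits)
  then show "lookup (g j) m = (if m = (if j = 0 then 0 else single j 1) then 1 else 0)"
  proof (cases m rule: low_degree_cases)
   case 1
   have "dcoeff (g j) 0 = (if j = 0 then 1 else 0)"
    using gd[OF j, of 0] pair_single[of "g j" 0 1] by (simp add: alph_def)
   with 1 show ?thesis by (auto simp: dcoeff_def dest: arg_cong[of _ _ mdeg])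
  next
   case (2 k)
   then have j0: "j \<noteq> 0" using m by (auto split: if_splits)
   show ?thesis
   proof (cases "k \<in> {1..n}")
    case True
    then have "dcoeff (g j) (single k 1) = (if j = k then 1 else 0)"
     using gd[OF j, of k] pair_single[of "g j" "single k 1" 1] by (simp add: alph_def Var_def)
    moreover have "single k 1 = (single j 1 :: nat \<Rightarrow>\<^sub>0 nat) \<longleftrightarrow> k = j"
     by (metis lookup_single_eq lookup_single_not_eq zero_neq_one)
    ultimately show ?thesis using 2 j0 by (auto simp: dcoeff_def mfact_def)
   next
    case False
    then have "m \<notin> keys (g j)" using gp[of j] 2 by (auto simp: polys_def)
    moreover have "m \<noteq> single j 1"
     using False 2 j j0 by (metis One_nat_def Suc_leI atLeastAtMost_iff lookup_single_eq lookup_single_not_eq not_gr_zero zero_neq_one)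
    ultimately show ?thesis using j0 by (simp add: in_keys_iff)
   qed
  qed
 qed
 have mg: "Lead (mval g m) (m - single 0 (lookup m 0))" if "keys m \<subseteq> {0..n}" for m
  using that
 proof (induction m rule: single_induct)
  case zero
  show ?case by (auto simp: Lead_def lookup_one when_def)
 next
  case (add i m)
  have e: "single i 1 + m - single 0 (lookup (single i 1 + m) 0)
    = (if i = 0 then 0 else single i 1) + (m - single 0 (lookup m 0))"
   by (rule poly_mapping_eqI) (auto simp: lookup_add lookup_minus lookup_single when_def)
  have "Lead (g i * mval g m) ((if i = 0 then 0 else single i 1) + (m - single 0 (lookup m 0)))"
   using add by (intro Lead_mult g_lead) auto
  then show ?case unfolding e by (simp add: mval_add)
 qed
 define P' where "P' = lsubst n Mat P"
 have P': "P' \<in> forms n d" unfolding P'_def by (rule lsubst_form[OF assms(1)])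
 interpret h: comm_ring_hom "peval Const g" by (rule comm_ring_hom_peval[OF comm_ring_hom_Const])
 have fg: "peval Const g (linform n (Mat i)) = fder i" if i: "i \<le> n" for i
 proof -
  have "peval Const g (linform n (Mat i)) = (\<Sum>j\<le>n. \<Sum>k\<le>n. Const (Mat i j * W j k) * fder k)"
   by (simp add: linform_def h.hom_sum h.hom_mult peval_Var) (simp add: g_def sum_distrib_left Const_mult mult.assoc)
  also have "\<dots> = (\<Sum>k\<le>n. Const (\<Sum>j\<le>n. Mat i j * W j k) * fder k)"
   by (subst sum.swap) (simp add: Const_sum sum_distrib_right)
  also have "\<dots> = (\<Sum>k\<le>n. if k = i then fder k else 0)"
   by (intro sum.cong refl) (use i in \<open>auto simp: MW\<close>)
  finally show ?thesis using i by simp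
 qed
 have "peval Const g P' = peval (\<lambda>c. peval Const g (Const c)) (\<lambda>i. peval Const g (linform n (Mat i))) P"
  unfolding P'_def lsubst_def by (rule hom_peval) (auto simp: h.comm_ring_hom_axioms)
 also have "\<dots> = peval Const fder P"
 proof (rule peval_cong)
  fix m i assume "m \<in> keys P" "i \<in> keys m"
  then have "i \<in> {0..n}" using forms_polys[OF assms(1)] unfolding polys_def by blast
  then show "peval Const g (linform n (Mat i)) = fder i" using fg by simp
 qed simp
 finally have g0: "peval Const g P' = 0" using assms(2) by simp
 have "P' = 0"
 proof (rule ccontr)
  assume "P' \<noteq> 0"
  \<comment> \<open>The degree of the leading form after the substitution, in which y_0 contributes
    the constant 1.\<close>
  define ord where "ord m = mdeg (m - single 0 (lookup m 0))" for m :: "nat \<Rightarrow>\<^sub>0 nat"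
  have "Min (ord ` keys P') \<in> ord ` keys P'" using \<open>P' \<noteq> 0\<close> by (intro Min_in) auto
  then obtain m where m: "m \<in> keys P'" "ord m = Min (ord ` keys P')" by auto
  then have mm: "ord m \<le> ord k" if "k \<in> keys P'" for k using that by simp
  have kP: "keys k \<subseteq> {0..n}" "mdeg k = d" if "k \<in> keys P'" for k
   using that P' by (auto simp: forms_def polys_def)
  have lk: "lookup (mval g k) (m - single 0 (lookup m 0)) = (if k = m then 1 else 0)" if k: "k \<in> keys P'" for k
  proof -
   have "m - single 0 (lookup m 0) = k - single 0 (lookup k 0) \<longleftrightarrow> k = m"
   proof
    assume e: "m - single 0 (lookup m 0) = k - single 0 (lookup k 0)"
    have s: "mdeg m = lookup m 0 + mdeg (m - single 0 (lookup m 0))" for m :: "nat \<Rightarrow>\<^sub>0 nat"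
    proof -
     have "m = single 0 (lookup m 0) + (m - single 0 (lookup m 0))"
      by (rule poly_mapping_eqI) (auto simp: lookup_add lookup_minus lookup_single when_def)
     then show ?thesis by (metis mdeg_add mdeg_single)
    qed
    have "lookup m 0 = lookup k 0" using s[of m] s[of k] e kP(2)[OF k] kP(2)[OF m(1)] by simp
    then show "k = m" using e
     by (intro poly_mapping_eqI) (metis (no_types, lifting) lookup_minus lookup_single_not_eq minus_nat.diff_0)
   qed simp
   moreover have "mdeg (m - single 0 (lookup m 0)) \<le> mdeg (k - single 0 (lookup k 0))"
    using mm[OF k] by (simp add: ord_def)
   ultimately show ?thesis using mg[OF kP(1)[OF k]] unfolding Lead_def by simp
  qed
  have "lookup (peval Const g P') (m - single 0 (lookup m 0)) = (\<Sum>k\<in>keys P'. lookup P' k * (if k = m then 1 else 0))"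
   by (simp add: peval_alt lookup_sum lookup_Const_mult lk cong: sum.cong)
  also have "\<dots> = lookup P' m" using m(1) by (simp add: if_distrib[of "(*) _"] cong: if_cong)
  finally show False using g0 m(1) by (simp add: in_keys_iff)
 qed
 then have "lsubst n W P' = 0" by (simp add: lsubst_def peval_def)
 then show ?thesis unfolding P'_def using lsubst_inverse[OF MW forms_polys[OF assms(1)]] by simp
qed

lemma Ann_power: "Ann {1..n} (f ^ d) = {p \<in> polys {1..n}. sym_power.Theta n cst d p = 0}"
proof -
 interpret sym_power n cst d ..
 have "act p (f ^ d) = 0 \<longleftrightarrow> Theta p = 0" if "p \<in> polys {1..n}" for p
 proof
  assume "act p (f ^ d) = 0"
  then show "Theta p = 0" using subst_Theta[OF that, of d] by (intro subst_fder_inj[OF Theta_forms[OF that]]) simp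
 next
  assume "Theta p = 0"
  then show "act p (f ^ d) = 0" using subst_Theta[OF that, of d] by (simp add: peval_def)
 qed
 then show ?thesis by (auto simp: Ann_def)
qed

end

section \<open>Dehomogenization\<close>

lemma comm_ring_hom_dehomogenize: "comm_ring_hom (dehomogenize :: 'a::comm_ring_1 mpoly => _)"
 unfolding dehomogenize_def by (rule comm_ring_hom_peval[OF comm_ring_hom_Const])

lemma dehomogenize_single: "dehomogenize (single m a) = single (m - single 0 (lookup m 0)) (a::'a::comm_ring_1)"
proof -
 have s: "m = single 0 (lookup m 0) + (m - single 0 (lookup m 0))"
  by (rule poly_mapping_eqI) (auto simp: lookup_add lookup_minus lookup_single when_def)
 have eq: "mval (\<lambda>i. if i = 0 then 1 else Var i) m = (mval Var (m - single 0 (lookup m 0)) :: 'a mpoly)"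
 proof -
  have "0 \<notin> keys (m - single 0 (lookup m 0))" by (auto simp: in_keys_iff lookup_minus)
  then have "mval (\<lambda>i. if i = 0 then 1 else Var i) (m - single 0 (lookup m 0)) = (mval Var (m - single 0 (lookup m 0)) :: 'a mpoly)"
   by (intro mval_cong) auto
  then show ?thesis by (subst s) (simp only: mval_add mval_single if_True simp_thms power_one mult_1_left)
 qed
 show ?thesis unfolding dehomogenize_def peval_single[where h = Const, OF Const_0] eq mval_Var
  by (rule single_eq_Const_mult[symmetric])
qed

lemma dehomogenize_Const [simp]: "dehomogenize (Const a) = Const (a::'a::comm_ring_1)"
 by (simp add: dehomogenize_def)

lemma dehomogenize_Var: "dehomogenize (Var i :: 'a::comm_ring_1 mpoly) = alph i"
 by (simp add: dehomogenize_def peval_Var alph_def)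

lemma dehomogenize_polys: "p \<in> polys {0..n} ==> dehomogenize p \<in> polys {1..n}" for p :: "'a::comm_ring_1 mpoly"
proof -
 interpret comm_ring_hom "dehomogenize :: 'a mpoly => _" by (rule comm_ring_hom_dehomogenize)
 show "p \<in> polys {0..n} ==> dehomogenize p \<in> polys {1..n}"
 proof (induction rule: polys_induct)
  case (Var i p)
  have "alph i \<in> polys {1..n}" using Var(1) by (intro alph_polys) simp
  with Var show ?case unfolding hom_mult dehomogenize_Var by (intro mult_polys)
 qed (auto simp: hom_add add_polys)
qed

lemma dehomogenize_id: "p \<in> polys {1..n} ==> dehomogenize p = p" for p :: "'a::comm_ring_1 mpoly"
proof -
 interpret comm_ring_hom "dehomogenize :: 'a mpoly => _" by (rule comm_ring_hom_dehomogenize)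
 show "p \<in> polys {1..n} ==> dehomogenize p = p"
 proof (induction rule: polys_induct)
  case (Var i p)
  then show ?case by (simp add: hom_mult dehomogenize_Var alph_def)
 qed (auto simp: hom_add)
qed

text \<open>Among monomials of one degree the exponent of x_0 is determined by the others, so
  setting x_0 = 1 merges no terms.\<close>

lemma lookup_dehomogenize:
 fixes G :: "'a::comm_ring_1 mpoly"
 assumes "G \<in> forms n D" "mdeg m = D"
 shows "lookup (dehomogenize G) (m - single 0 (lookup m 0)) = lookup G m"
proof -
 interpret comm_ring_hom "dehomogenize :: 'a mpoly => _" by (rule comm_ring_hom_dehomogenize)
 have s: "mdeg m = lookup m 0 + mdeg (m - single 0 (lookup m 0))"
  and s': "m = single 0 (lookup m 0) + (m - single 0 (lookup m 0))" for m :: "nat \<Rightarrow>\<^sub>0 nat"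
 proof -
  show "m = single 0 (lookup m 0) + (m - single 0 (lookup m 0))"
   by (rule poly_mapping_eqI) (auto simp: lookup_add lookup_minus lookup_single when_def)
  then show "mdeg m = lookup m 0 + mdeg (m - single 0 (lookup m 0))" by (metis mdeg_add mdeg_single)
 qed
 have "dehomogenize G = (\<Sum>k\<in>keys G. single (k - single 0 (lookup k 0)) (lookup G k))"
  by (subst sum_singles[symmetric]) (simp only: hom_sum dehomogenize_single)
 then have "lookup (dehomogenize G) (m - single 0 (lookup m 0)) =
   (\<Sum>k\<in>keys G. lookup (single (k - single 0 (lookup k 0)) (lookup G k)) (m - single 0 (lookup m 0)))"
  by (simp only: lookup_sum)
 also have "\<dots> = (\<Sum>k\<in>keys G. if k = m then lookup G k else 0)"
 proof (intro sum.cong refl)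
  fix k assume k: "k \<in> keys G"
  have "k - single 0 (lookup k 0) = m - single 0 (lookup m 0) \<longleftrightarrow> k = m"
  proof
   assume e: "k - single 0 (lookup k 0) = m - single 0 (lookup m 0)"
   have "lookup k 0 = lookup m 0"
    using s[of k] s[of m] e forms_mdeg[OF assms(1) k] assms(2) by simp
   with e have "single 0 (lookup k 0) + (k - single 0 (lookup k 0)) = single 0 (lookup m 0) + (m - single 0 (lookup m 0))"
    by simp
   then show "k = m" by (simp only: s'[symmetric])
  qed simp
  then show "lookup (single (k - single 0 (lookup k 0)) (lookup G k)) (m - single 0 (lookup m 0)) = (if k = m then lookup G k else 0)"
   by (simp add: lookup_single when_def)
 qed
 also have "\<dots> = lookup G m" by (simp add: in_keys_iff)
 finally show ?thesis .
qed

lemma mfact_split: "mfact m = fact (lookup m 0) * mfact (m - single 0 (lookup m 0))" for m :: "nat \<Rightarrow>\<^sub>0 nat"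
proof -
 let ?A = "insert 0 (keys m)"
 have "mfact m = (\<Prod>i\<in>?A. fact (lookup m i))" by (rule mfact_superset) auto
 also have "\<dots> = fact (lookup m 0) * (\<Prod>i\<in>?A - {0}. fact (lookup m i))" by (rule prod.remove) auto
 also have "(\<Prod>i\<in>?A - {0}. fact (lookup m i)) = (\<Prod>i\<in>?A - {0}. fact (lookup (m - single 0 (lookup m 0)) i) :: nat)"
  by (intro prod.cong) (auto simp: lookup_minus lookup_single when_def)
 also have "\<dots> = mfact (m - single 0 (lookup m 0))"
  by (rule mfact_superset[symmetric]) (auto simp: in_keys_iff lookup_minus lookup_single when_def)
 finally show ?thesis .
qed

lemma dcoeff_form:
 fixes G :: "'a::field_char_0 mpoly"
 assumes "G \<in> forms n D"
 shows "dcoeff G m = (if mdeg m = D then fact (lookup m 0) * dcoeff (dehomogenize G) (m - single 0 (lookup m 0)) else 0)"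
proof (cases "mdeg m = D")
 case True
 then show ?thesis using lookup_dehomogenize[OF assms True] by (simp add: dcoeff_def mfact_split[of m] mult_ac)
next
 case False
 then have "m \<notin> keys G" using assms by (auto simp: forms_def)
 with False show ?thesis by (simp add: dcoeff_def in_keys_iff)
qed

lemma lookup_twist: "lookup (twist G) m = lookup G m / fact (lookup m 0)"
proof -
 have "lookup (twist G) m = (\<Sum>k\<in>keys G. if k = m then lookup G k / fact (lookup k 0) else 0)"
  unfolding twist_def lookup_sum by (intro sum.cong) (auto simp: lookup_single when_def)
 then show ?thesis by (simp add: in_keys_iff)
qed

lemma twist_forms: "G \<in> forms n D ==> twist G \<in> forms n D"
 by (auto simp: forms_def polys_def in_keys_iff lookup_twist)

text \<open>The factor 1 / i_0! of the twist cancels the factorial by which, according to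
  \<open>dcoeff_form\<close>, the derivatives of a form differ from those of its
  dehomogenization.\<close>

lemma dcoeff_twist:
 assumes "G \<in> forms n D"
 shows "dcoeff (twist G) m = (if mdeg m = D then dcoeff (dehomogenize G) (m - single 0 (lookup m 0)) else 0)"
proof -
 have "dcoeff (twist G) m = dcoeff G m / fact (lookup m 0)" by (simp add: dcoeff_def lookup_twist)
 then show ?thesis by (simp add: dcoeff_form[OF assms])
qed

text \<open>The twist turns apolarity to \<open>G\<close> into apolarity to its dehomogenization.\<close>

lemma pair_twist:
 assumes "G \<in> forms n D"
 shows "pair (twist G) \<sigma> = pair (dehomogenize G) (dehomogenize (hom_part D \<sigma>))"
proof (induction \<sigma> rule: mpoly_induct)
 case (single m a)
 interpret comm_ring_hom "dehomogenize :: 'a mpoly => _" by (rule comm_ring_hom_dehomogenize)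
 have "hom_part D (single m a) = (if mdeg m = D then single m a else 0)"
  by (rule poly_mapping_eqI) (auto simp: lookup_hom_part lookup_single when_def)
 then show ?case
  by (auto simp: pair_single dcoeff_twist[OF assms] dehomogenize_single)
next
 case (add p q)
 interpret comm_ring_hom "dehomogenize :: 'a mpoly => _" by (rule comm_ring_hom_dehomogenize)
 show ?case using add by (simp add: pair_add hom_part_add hom_add)
qed

text \<open>In a relation between f and its first derivatives the derivatives have smaller degree,
  so the coefficient of f is 0. The remaining derivations commute with setting x_0 = 1, so the
  linear form already annihilates F and conciseness applies.\<close>

lemma encompassing_polyI:
 fixes F :: "'k::field_char_0 mpoly"
 assumes F: "F \<in> forms n e" and conc: "concise {0..n} F" and enc: "encompassing {1..n} (dehomogenize F)"
 shows "encompassing_poly n (dehomogenize F)"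
proof
 let ?f = "dehomogenize F"
 show fp: "?f \<in> polys {1..n}" by (rule dehomogenize_polys[OF forms_polys[OF F]])
 show "encompassing {1..n} ?f" by fact
 fix a i assume a: "act (afform n a) ?f = 0" and i: "i \<le> n"
 have "F \<noteq> 0"
 proof
  assume "F = 0"
  then have "1 \<in> Ann {0..n} F" by (simp add: Ann_def)
  moreover have "total_degree (1::'k mpoly) \<le> 1" by (simp add: total_degree_def)
  ultimately show False using conc unfolding concise_def by (metis zero_neq_one)
 qed
 then obtain m0 where "m0 \<in> keys F" by (metis ex_in_conv keys_eq_empty)
 then have "lookup ?f (m0 - single 0 (lookup m0 0)) \<noteq> 0"
  using lookup_dehomogenize[OF F] forms_mdeg[OF F] by (simp add: in_keys_iff)
 then have "keys ?f \<noteq> {}" by (auto simp: in_keys_iff)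
 then have "Max (mdeg ` keys ?f) \<in> mdeg ` keys ?f" by (intro Max_in) auto
 then obtain m where m: "m \<in> keys ?f" "mdeg m = Max (mdeg ` keys ?f)" by auto
 then have mm: "mdeg k \<le> mdeg m" if "k \<in> keys ?f" for k using that by simp
 have af: "afform n a = Const (a 0) + (\<Sum>i\<in>{1..n}. Const (a i) * Var i)"
  unfolding afform_def by (simp add: atMost_atLeast0 sum.atLeast_Suc_atMost alph_def)
 have a0: "a 0 = 0"
 proof -
  have "dcoeff (act (afform n a) ?f) m = a 0 * dcoeff ?f m + (\<Sum>i\<in>{1..n}. a i * dcoeff ?f (m + single i 1))"
   unfolding af by (simp add: act_add act_Const act_sum act_Const_mult act_Var dcoeff_add dcoeff_sum dcoeff_Const_mult dcoeff_partial)
  moreover have "dcoeff ?f (m + single i 1) = 0" for i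
   using mm[of "m + single i 1"] by (auto simp: dcoeff_def mdeg_add in_keys_iff)
  ultimately have "a 0 * dcoeff ?f m = 0" using a by (simp add: dcoeff_def[of 0])
  then show ?thesis using m(1) by (simp add: dcoeff_def in_keys_iff)
 qed
 define \<sigma> where "\<sigma> = linform n (a(0 := 0))"
 have \<sigma>: "\<sigma> = (\<Sum>i\<in>{1..n}. Const (a i) * Var i)"
  unfolding \<sigma>_def linform_def by (simp add: atMost_atLeast0 sum.atLeast_Suc_atMost)
 have sf: "act \<sigma> ?f = 0" using a unfolding af \<sigma> by (simp add: a0)
 have "act \<sigma> F = 0"
 proof (rule mpoly_eqI_dcoeff)
  fix k :: "nat \<Rightarrow>\<^sub>0 nat"
  have e: "k + single i 1 - single 0 (lookup k 0) = k - single 0 (lookup k 0) + single i 1"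
   and l: "lookup (k + single i 1) 0 = lookup k 0" if "i \<in> {1..n}" for i
   using that by (auto intro!: poly_mapping_eqI simp: lookup_add lookup_minus lookup_single when_def)
  have "dcoeff (act \<sigma> F) k = (\<Sum>i\<in>{1..n}. a i * dcoeff F (k + single i 1))"
   unfolding \<sigma> by (simp add: act_sum act_Const_mult act_Var dcoeff_sum dcoeff_Const_mult dcoeff_partial)
  also have "\<dots> = (\<Sum>i\<in>{1..n}. if mdeg k + 1 = e then fact (lookup k 0) * (a i * dcoeff ?f (k - single 0 (lookup k 0) + single i 1)) else 0)"
   by (intro sum.cong refl) (simp add: dcoeff_form[OF F] mdeg_add e[unfolded One_nat_def] l[unfolded One_nat_def])
  also have "\<dots> = (if mdeg k + 1 = e then fact (lookup k 0) * dcoeff (act \<sigma> ?f) (k - single 0 (lookup k 0)) else 0)"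
   unfolding \<sigma> by (simp add: act_sum act_Const_mult act_Var dcoeff_sum dcoeff_Const_mult dcoeff_partial sum_distrib_left)
  finally show "dcoeff (act \<sigma> F) k = dcoeff 0 k" by (simp add: sf dcoeff_def)
 qed
 moreover have "\<sigma> \<in> polys {0..n}" unfolding \<sigma>_def by (rule forms_polys[OF linform_forms])
 moreover have "total_degree \<sigma> \<le> 1"
  using forms_mdeg[OF linform_forms, of _ n "a(0 := 0)"] by (auto simp: total_degree_def \<sigma>_def)
 ultimately have "\<sigma> = 0" using conc unfolding concise_def Ann_def by blast
 then have "partial i \<sigma> = 0" by simp
 then show "a i = 0" using a0 i by (cases "i = 0") (auto simp: \<sigma>_def partial_linform)
qed

section \<open>Characters of a commutative algebra\<close>

locale char_field = struct_consts n c for n and c :: "nat => nat => nat => 'a::alg_closed_field"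
begin

text \<open>The last clause normalises the values outside the basis, so that distinct characters
  differ at some index \<open>\<le> n\<close>.\<close>

definition is_char :: "(nat => 'a) => bool" where
 "is_char x \<longleftrightarrow> x 0 = 1 \<and> (\<forall>i\<le>n. \<forall>k\<le>n. x i * x k = (\<Sum>l\<le>n. c i k l * x l)) \<and> (\<forall>i>n. x i = 0)"

text \<open>Functionals on the algebra are represented by their values on the basis; \<open>act_fun i\<close> is the
 transpose of multiplication by $a_i$.\<close>

definition act_fun :: "nat => (nat => 'a) => nat => 'a" where
 "act_fun i x k = (\<Sum>l\<le>n. c i k l * x l)"

definition in_span :: "(nat => 'a) => bool" where
 "in_span x \<longleftrightarrow> (\<exists>S w. finite S \<and> (\<forall>y\<in>S. is_char y) \<and> (\<forall>i\<le>n. x i = (\<Sum>y\<in>S. w y * y i)))"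

lemma is_char_0: "is_char x ==> x 0 = 1"
 and is_char_mult: "is_char x ==> i \<le> n ==> k \<le> n ==> x i * x k = (\<Sum>l\<le>n. c i k l * x l)"
 by (simp_all add: is_char_def)

text \<open>Dedekind's argument: evaluating the relation at a_i a_k and subtracting z(a_k) times the
  relation at a_i removes z, and the induction hypothesis applies to the rest.\<close>

lemma chars_independent:
 assumes "finite S" "\<forall>y\<in>S. is_char y" "\<And>i. i \<le> n ==> (\<Sum>y\<in>S. w y * y i) = 0" "y \<in> S"
 shows "w y = 0"
 using assms
proof (induction S arbitrary: w y rule: finite_induct)
 case (insert z S)
 have z: "w x * (x k - z k) = 0" if x: "x \<in> S" and k: "k \<le> n" for x k
 proof (rule insert.IH[of "\<lambda>x. w x * (x k - z k)"])
  fix i assume i: "i \<le> n"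
  have "(\<Sum>y\<in>insert z S. w y * (y i * y k)) = (\<Sum>y\<in>insert z S. \<Sum>l\<le>n. c i k l * (w y * y l))"
  proof (intro sum.cong refl)
   fix y assume "y \<in> insert z S"
   then have "is_char y" using insert.prems(1) by blast
   then have "w y * (y i * y k) = w y * (\<Sum>l\<le>n. c i k l * y l)" using i k by (simp only: is_char_mult)
   then show "w y * (y i * y k) = (\<Sum>l\<le>n. c i k l * (w y * y l))" by (simp add: sum_distrib_left mult.left_commute)
  qed
  also have "\<dots> = (\<Sum>l\<le>n. c i k l * (\<Sum>y\<in>insert z S. w y * y l))"
   by (subst sum.swap) (simp only: sum_distrib_left)
  also have "\<dots> = 0" using insert.prems(2) by (intro sum.neutral) (simp del: sum.insert)
  finally have 1: "(\<Sum>y\<in>insert z S. w y * (y i * y k)) = 0" .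
  have "(\<Sum>y\<in>insert z S. w y * (y k - z k) * y i) =
   (\<Sum>y\<in>insert z S. w y * (y i * y k)) - z k * (\<Sum>y\<in>insert z S. w y * y i)"
   unfolding sum_distrib_left sum_subtractf[symmetric] by (rule sum.cong) (simp_all add: algebra_simps)
  also have "\<dots> = 0" using 1 insert.prems(2)[OF i] by (simp del: sum.insert)
  finally show "(\<Sum>y\<in>S. w y * (y k - z k) * y i) = 0" using insert.hyps by simp
 qed (use insert.prems x in auto)
 have w0: "w x = 0" if x: "x \<in> S" for x
 proof -
  have "x \<noteq> z" using insert.hyps x by auto
  then obtain k where k: "x k \<noteq> z k" by blast
  moreover have "k \<le> n"
  proof (rule ccontr)
   assume "\<not> k \<le> n"
   moreover have "is_char x" "is_char z" using insert.prems(1) x by auto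
   ultimately show False using k by (simp add: is_char_def)
  qed
  ultimately show ?thesis using z[OF x] by auto
 qed
 then have "(\<Sum>y\<in>insert z S. w y * y 0) = w z * z 0" using insert.hyps by simp
 then have "w z = 0" using insert.prems(2)[of 0] insert.prems(1) by (simp add: is_char_0 del: sum.insert)
 with w0 insert.prems(3) show ?case by auto
qed simp

lemma in_span_cong: "in_span x ==> (\<And>i. i \<le> n ==> x i = y i) ==> in_span y"
 unfolding in_span_def by auto

lemma in_span_char: "is_char x ==> in_span x"
 unfolding in_span_def by (intro exI[of _ "{x}"] exI[of _ "\<lambda>_. 1"]) simp

lemma in_span_scale: "in_span x ==> in_span (\<lambda>i. s * x i)"
proof -
 assume "in_span x"
 then obtain S w where "finite S" "\<forall>y\<in>S. is_char y" "\<forall>i\<le>n. x i = (\<Sum>y\<in>S. w y * y i)"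
  unfolding in_span_def by blast
 then show ?thesis unfolding in_span_def
  by (intro exI[of _ S] exI[of _ "\<lambda>y. s * w y"]) (simp add: sum_distrib_left mult.assoc)
qed

lemma in_span_scaleD:
 assumes "in_span (\<lambda>i. s * x i)" "s \<noteq> 0" shows "in_span x"
 by (rule in_span_cong[OF in_span_scale[OF assms(1), of "inverse s"]]) (use assms(2) in simp)

lemma in_span_superset:
 fixes x :: "nat => 'a"
 assumes "finite S" "finite T" "S \<subseteq> T" "\<And>i. i \<le> n ==> x i = (\<Sum>y\<in>S. w y * y i)" "i \<le> n"
 shows "x i = (\<Sum>y\<in>T. (if y \<in> S then w y else 0) * y i)"
proof -
 have "(\<Sum>y\<in>T. (if y \<in> S then w y else 0) * y i) = (\<Sum>y\<in>S. (if y \<in> S then w y else 0) * y i)"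
  using assms(2,3) by (intro sum.mono_neutral_right) auto
 then show ?thesis using assms(4,5) by simp
qed

lemma in_span_add: "in_span x ==> in_span x' ==> in_span (\<lambda>i. x i + x' i)"
proof -
 assume "in_span x" "in_span x'"
 then obtain S w S' w' where 1: "finite S" "\<forall>y\<in>S. is_char y" "\<And>i. i \<le> n ==> x i = (\<Sum>y\<in>S. w y * y i)"
  and 2: "finite S'" "\<forall>y\<in>S'. is_char y" "\<And>i. i \<le> n ==> x' i = (\<Sum>y\<in>S'. w' y * y i)"
  unfolding in_span_def by blast
 have "x i + x' i = (\<Sum>y\<in>S \<union> S'. ((if y \<in> S then w y else 0) + (if y \<in> S' then w' y else 0)) * y i)" if "i \<le> n" for i
  using in_span_superset[of S "S \<union> S'" x w i] in_span_superset[of S' "S \<union> S'" x' w' i] 1 2 that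
  by (simp only: distrib_right sum.distrib finite_Un Un_upper1 Un_upper2)
 with 1 2 show ?thesis unfolding in_span_def
  by (intro exI[of _ "S \<union> S'"] exI[of _ "\<lambda>y. (if y \<in> S then w y else 0) + (if y \<in> S' then w' y else 0)"]) auto
qed

lemma in_span_0: "in_span (\<lambda>i. 0)"
 unfolding in_span_def by (intro exI[of _ "{}"]) auto

lemma in_span_diff: "in_span x ==> in_span x' ==> in_span (\<lambda>i. x i - x' i)"
 using in_span_add[of x "\<lambda>i. -1 * x' i"] in_span_scale[of x' "-1"] by simp

lemma in_span_sum: "finite A ==> (\<And>a. a \<in> A ==> in_span (x a)) ==> in_span (\<lambda>i. \<Sum>a\<in>A. x a i)"
 by (induction A rule: finite_induct) (auto intro: in_span_add in_span_0)

lemma act_fun_char: "is_char x ==> i \<le> n ==> k \<le> n ==> act_fun i x k = x i * x k"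
 by (simp add: act_fun_def is_char_mult)

lemma act_fun_lin: "act_fun i (\<lambda>l. \<Sum>a\<in>A. s a * x a l) k = (\<Sum>a\<in>A. s a * act_fun i (x a) k)"
 unfolding act_fun_def sum_distrib_left by (subst sum.swap) (simp add: mult_ac)

lemma act_fun_cong: "(\<And>l. l \<le> n ==> x l = y l) ==> act_fun i x k = act_fun i y k"
 by (simp add: act_fun_def)

lemma act_fun_diff: "act_fun i (\<lambda>l. x l - s * y l) k = act_fun i x k - s * act_fun i y k"
 by (simp add: act_fun_def right_diff_distrib sum_subtractf sum_distrib_left mult_ac)

lemma in_span_act: "in_span x ==> i \<le> n ==> in_span (act_fun i x)"
proof -
 assume "in_span x" and i: "i \<le> n"
 then obtain S w where S: "finite S" "\<forall>y\<in>S. is_char y" "\<forall>i\<le>n. x i = (\<Sum>y\<in>S. w y * y i)"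
  unfolding in_span_def by blast
 have "act_fun i x k = (\<Sum>y\<in>S. (w y * y i) * y k)" if "k \<le> n" for k
 proof -
  have "act_fun i x k = act_fun i (\<lambda>l. \<Sum>y\<in>S. w y * y l) k" by (rule act_fun_cong) (use S(3) in simp)
  also have "\<dots> = (\<Sum>y\<in>S. w y * act_fun i (\<lambda>l. y l) k)" by (rule act_fun_lin)
  also have "\<dots> = (\<Sum>y\<in>S. (w y * y i) * y k)" using S(2) i that by (intro sum.cong) (auto simp: act_fun_char)
  finally show ?thesis .
 qed
 with S show ?thesis unfolding in_span_def
  by (intro exI[of _ S] exI[of _ "\<lambda>y. w y * y i"]) simp
qed

lemma act_fun_act_fun:
 assumes "i \<le> n" "j \<le> n" "k \<le> n"
 shows "act_fun i (act_fun j x) k = (\<Sum>l\<le>n. c i j l * act_fun l x k)"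
proof -
 have "act_fun i (act_fun j x) k = (\<Sum>m\<le>n. (\<Sum>l\<le>n. c k i l * c j l m) * x m)"
  using assms by (simp add: act_fun_def sum_distrib_left sum_distrib_right comm[of i k] mult.assoc) (rule sum.swap)
 also have "\<dots> = (\<Sum>m\<le>n. (\<Sum>l\<le>n. c j i l * c l k m) * x m)"
 proof (intro sum.cong refl)
  fix m assume "m \<in> {..n}"
  then have m: "m \<le> n" by simp
  have "(\<Sum>l\<le>n. c k i l * c j l m) = (\<Sum>l\<le>n. c i k l * c j l m)"
   using assms by (intro sum.cong) (auto simp: comm[of k i])
  also have "\<dots> = (\<Sum>l\<le>n. c j i l * c l k m)" using assoc[of j i k m] assms m by simp
  finally show "(\<Sum>l\<le>n. c k i l * c j l m) * x m = (\<Sum>l\<le>n. c j i l * c l k m) * x m" by simp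
 qed
 also have "\<dots> = (\<Sum>l\<le>n. c i j l * act_fun l x k)"
  using assms by (simp add: act_fun_def sum_distrib_left sum_distrib_right comm[of i j] mult.assoc) (rule sum.swap)
 finally show ?thesis .
qed

lemma act_fun_commute:
 assumes "i \<le> n" "j \<le> n" "k \<le> n"
 shows "act_fun i (act_fun j x) k = act_fun j (act_fun i x) k"
proof -
 have "(\<Sum>l\<le>n. c i j l * act_fun l x k) = (\<Sum>l\<le>n. c j i l * act_fun l x k)"
  using assms by (intro sum.cong) (auto simp: comm[of i j])
 then show ?thesis using assms by (simp add: act_fun_act_fun)
qed

definition pact :: "nat => 'a poly => (nat => 'a) => nat => 'a" where
 "pact i p x j = (\<Sum>k\<le>degree p. coeff p k * (act_fun i ^^ k) x j)"

lemma pact_superset: "degree p \<le> N ==> pact i p x j = (\<Sum>k\<le>N. coeff p k * (act_fun i ^^ k) x j)"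
 unfolding pact_def by (intro sum.mono_neutral_left) (auto simp: coeff_eq_0)

lemma pact_linear_factor: "pact i ([:-r, 1:] * q) x j = act_fun i (pact i q x) j - r * pact i q x j"
proof -
 let ?N = "degree q"
 have d: "degree ([:-r, 1:] * q) \<le> Suc ?N" using degree_mult_le[of "[:-r, 1:]" q] by simp
 have c: "coeff ([:-r, 1:] * q) k = (case k of 0 => 0 | Suc k' => coeff q k') - r * coeff q k" for k
  by (simp add: coeff_pCons split: nat.split)
 have "pact i ([:-r, 1:] * q) x j = (\<Sum>k\<le>Suc ?N. (case k of 0 => 0 | Suc k' => coeff q k') * (act_fun i ^^ k) x j)
   - r * (\<Sum>k\<le>Suc ?N. coeff q k * (act_fun i ^^ k) x j)"
  unfolding pact_superset[OF d] c by (simp only: left_diff_distrib sum_subtractf sum_distrib_left mult.assoc)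
 also have "(\<Sum>k\<le>Suc ?N. coeff q k * (act_fun i ^^ k) x j) = pact i q x j" by (rule pact_superset[symmetric]) simp
 also have "(\<Sum>k\<le>Suc ?N. (case k of 0 => 0 | Suc k' => coeff q k') * (act_fun i ^^ k) x j)
   = (\<Sum>k\<le>?N. coeff q k * act_fun i ((act_fun i ^^ k) x) j)"
  by (subst sum.atMost_Suc_shift) simp
 also have "\<dots> = act_fun i (pact i q x) j"
  unfolding pact_def[abs_def] by (rule act_fun_lin[symmetric])
 finally show ?thesis .
qed

lemma in_span_pact: "in_span x ==> i \<le> n ==> in_span (pact i p x)"
proof -
 assume x: "in_span x" and i: "i \<le> n"
 have "in_span ((act_fun i ^^ k) x)" for k using x i by (induction k) (auto intro: in_span_act)
 then show ?thesis unfolding pact_def[abs_def] by (intro in_span_sum in_span_scale) auto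
qed

lemma act_fun_pow_commute:
 assumes "i \<le> n" "m \<le> n" "k \<le> n"
 shows "act_fun i ((act_fun m ^^ t) x) k = (act_fun m ^^ t) (act_fun i x) k"
 using assms(3)
proof (induction t arbitrary: k)
 case (Suc t)
 have "act_fun i ((act_fun m ^^ Suc t) x) k = act_fun m (act_fun i ((act_fun m ^^ t) x)) k"
  using act_fun_commute[OF assms(1,2) Suc.prems] by simp
 also have "\<dots> = act_fun m ((act_fun m ^^ t) (act_fun i x)) k" by (rule act_fun_cong) (rule Suc.IH)
 finally show ?case by simp
qed simp

lemma pact_commute:
 assumes "i \<le> n" "m \<le> n" "k \<le> n"
 shows "act_fun i (pact m q x) k - s * pact m q x k = pact m q (\<lambda>l. act_fun i x l - s * x l) k"
proof -
 have l: "(act_fun m ^^ t) (\<lambda>l. act_fun i x l - s * x l) k = (act_fun m ^^ t) (act_fun i x) k - s * (act_fun m ^^ t) x k" for t k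
 proof (induction t arbitrary: k)
  case (Suc t)
  have "act_fun m ((act_fun m ^^ t) (\<lambda>l. act_fun i x l - s * x l)) k
   = act_fun m (\<lambda>l. (act_fun m ^^ t) (act_fun i x) l - s * (act_fun m ^^ t) x l) k"
   by (rule act_fun_cong) (rule Suc)
  then show ?case by (simp add: act_fun_diff)
 qed simp
 have "act_fun i (pact m q x) k = (\<Sum>t\<le>degree q. coeff q t * act_fun i ((act_fun m ^^ t) x) k)"
  unfolding pact_def[abs_def] by (rule act_fun_lin)
 also have "\<dots> = (\<Sum>t\<le>degree q. coeff q t * (act_fun m ^^ t) (act_fun i x) k)"
  using act_fun_pow_commute[OF assms] by simp
 finally show ?thesis
  by (simp add: pact_def l right_diff_distrib sum_subtractf sum_distrib_left mult.left_commute)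
qed

text \<open>Modulo the span of the characters, take a root r of p and write p = (T - r) q. Either q
  also sends x into the span and has smaller degree, or its value at x is the eigenvector sought;
  commutation preserves the earlier eigenvalues.\<close>

lemma eigen_step:
 assumes m: "m \<le> n" and prev: "\<And>i. i < m ==> in_span (\<lambda>k. act_fun i x k - lam i * x k)"
  and x: "\<not> in_span x" and p: "p \<noteq> 0" "in_span (pact m p x)"
 shows "\<exists>x' r. \<not> in_span x' \<and> (\<forall>i<m. in_span (\<lambda>k. act_fun i x' k - lam i * x' k))
  \<and> in_span (\<lambda>k. act_fun m x' k - r * x' k)"
 using p
proof (induction "degree p" arbitrary: p rule: less_induct)
 case less
 have "degree p \<noteq> 0"
 proof
  assume 0: "degree p = 0"
  then have "pact m p x = (\<lambda>j. coeff p 0 * x j)" by (auto simp: pact_def)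
  then have "in_span (\<lambda>j. coeff p 0 * x j)" using less.prems(2) by simp
  moreover have "coeff p 0 \<noteq> 0" using 0 less.prems(1) by (metis leading_coeff_0_iff)
  ultimately show False using x in_span_scaleD by blast
 qed
 then obtain r where "poly p r = 0" using alg_closed_imp_poly_has_root by blast
 then obtain q where q: "p = [:-r, 1:] * q" by (metis dvdE poly_eq_0_iff_dvd)
 have q0: "q \<noteq> 0" using less.prems(1) q by auto
 then have dq: "degree q < degree p" unfolding q by (subst degree_mult_eq) auto
 show ?case
 proof (cases "in_span (pact m q x)")
  case True
  then show ?thesis using less.hyps[OF dq q0] by blast
 next
  case False
  show ?thesis
  proof (intro exI conjI allI impI)
   show "\<not> in_span (pact m q x)" by fact
   show "in_span (\<lambda>k. act_fun m (pact m q x) k - r * pact m q x k)"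
    using less.prems(2) unfolding q by (simp only: pact_linear_factor[abs_def] pact_linear_factor)
   fix i assume i: "i < m"
   have "in_span (pact m q (\<lambda>k. act_fun i x k - lam i * x k))" by (intro in_span_pact prev i m)
   then show "in_span (\<lambda>k. act_fun i (pact m q x) k - lam i * pact m q x k)"
    by (rule in_span_cong) (use i m in \<open>simp add: pact_commute\<close>)
  qed
 qed
qed

lemma eigen_ex:
 assumes x: "\<not> in_span x"
 shows "m \<le> Suc n ==> \<exists>x lam. \<not> in_span x \<and> (\<forall>i<m. in_span (\<lambda>k. act_fun i x k - lam i * x k))"
proof (induction m)
 case 0
 then show ?case using x by blast
next
 case (Suc m)
 then obtain x lam where x: "\<not> in_span x" "\<And>i. i < m ==> in_span (\<lambda>k. act_fun i x k - lam i * x k)" by auto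
 \<comment> \<open>The n + 2 iterates of x, restricted to n + 1 basis indices, are dependent; this
   gives a polynomial that annihilates x.\<close>
 obtain a where a: "\<exists>i\<le>Suc n. a i \<noteq> 0" "\<And>j. j < Suc n ==> (\<Sum>i\<le>Suc n. a i * (act_fun m ^^ i) x j) = 0"
  using linear_dependence[of "Suc n" "\<lambda>i j. (act_fun m ^^ i) x j"] by blast
 define p where "p = (\<Sum>i\<le>Suc n. monom (a i) i)"
 have cp: "coeff p k = (if k \<le> Suc n then a k else 0)" for k
  by (simp add: p_def coeff_sum if_distrib cong: if_cong)
 have "p \<noteq> 0" using a(1) cp by (metis coeff_0)
 moreover have "degree p \<le> Suc n" by (rule degree_le) (simp add: cp)
 then have "pact m p x j = 0" if "j \<le> n" for j
  using a(2)[of j] that by (simp add: pact_superset cp)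
 then have "in_span (pact m p x)" using in_span_cong[OF in_span_0] by metis
 ultimately obtain x' r where "\<not> in_span x'" "\<forall>i<m. in_span (\<lambda>k. act_fun i x' k - lam i * x' k)"
  "in_span (\<lambda>k. act_fun m x' k - r * x' k)"
  using eigen_step[of m x lam p] x Suc.prems by auto
 then have "\<not> in_span x' \<and> (\<forall>i<Suc m. in_span (\<lambda>k. act_fun i x' k - (lam(m := r)) i * x' k))"
  by (auto simp: less_Suc_eq)
 then show ?case by blast
qed

text \<open>Modulo the span of the characters, every functional is a combination of generalized joint
 eigenvectors; without tangent vectors these can be corrected to genuine ones.\<close>

lemma chars_span:
 assumes tangent: "\<And>x \<delta> i. is_char x ==> \<delta> 0 = 0 ==>
   (\<And>i k. i \<le> n ==> k \<le> n ==> x i * \<delta> k + x k * \<delta> i = (\<Sum>l\<le>n. c i k l * \<delta> l)) ==> i \<le> n ==> \<delta> i = 0"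
 shows "in_span x"
proof (rule ccontr)
 assume "\<not> in_span x"
 from eigen_ex[OF this, of "Suc n"] obtain x lam0
  where x: "\<not> in_span x" and u0: "\<And>i. i \<le> n ==> in_span (\<lambda>k. act_fun i x k - lam0 i * x k)"
  by (auto simp: less_Suc_eq_le)
 \<comment> \<open>The eigenvalues are extended by 0 so that \<open>lam\<close> can satisfy
   \<open>is_char\<close>.\<close>
 define lam where "lam i = (if i \<le> n then lam0 i else 0)" for i
 define u where "u i k = act_fun i x k - lam i * x k" for i k
 have u: "in_span (u i)" if "i \<le> n" for i
  using u0[OF that] that by (simp add: u_def[abs_def] lam_def)
 have ax: "act_fun i x k = lam i * x k + u i k" for i k by (simp add: u_def)
 have a0: "act_fun 0 y k = y k" if "k \<le> n" for y k
 proof -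
  have "act_fun 0 y k = (\<Sum>l\<le>n. if l = k then y l else 0)"
   unfolding act_fun_def by (intro sum.cong refl) (use that in \<open>auto simp: unit\<close>)
  then show ?thesis using that by simp
 qed
 have lam_0: "lam 0 = 1"
 proof (rule ccontr)
  assume "lam 0 \<noteq> 1"
  have "in_span (\<lambda>k. (1 - lam 0) * x k)"
   by (rule in_span_cong[OF u[of 0]]) (simp_all add: u_def a0 algebra_simps)
  then show False using \<open>lam 0 \<noteq> 1\<close> x in_span_scaleD by simp
 qed
 have u_0: "u 0 k = 0" if "k \<le> n" for k using that by (simp add: u_def a0 lam_0)
 have aa: "act_fun i (act_fun k x) j = lam k * lam i * x j + lam k * u i j + act_fun i (u k) j" for i k j
 proof -
  have "act_fun i (act_fun k x) j = lam k * act_fun i x j + act_fun i (u k) j"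
  proof -
   have "act_fun k x = (\<lambda>j. lam k * x j + u k j)" by (rule ext) (rule ax)
   then show ?thesis by (simp add: act_fun_def distrib_left sum.distrib sum_distrib_left mult.left_commute)
  qed
  then show ?thesis by (simp add: ax algebra_simps)
 qed
 \<comment> \<open>Two ways of computing the action of a_i a_k on x. The right side lies in the span
   and x does not, so the scalar on the left vanishes and the eigenvalues form a character.\<close>
 have rel: "(lam i * lam k - (\<Sum>l\<le>n. c i k l * lam l)) * x j =
   (\<Sum>l\<le>n. c i k l * u l j) - lam k * u i j - act_fun i (u k) j"
  if "i \<le> n" "k \<le> n" "j \<le> n" for i k j
 proof -
  have "(\<Sum>l\<le>n. c i k l * act_fun l x j) = (\<Sum>l\<le>n. c i k l * lam l) * x j + (\<Sum>l\<le>n. c i k l * u l j)"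
   by (simp add: ax distrib_left sum.distrib sum_distrib_right mult.assoc)
  with act_fun_act_fun[OF that, of x] aa[of i k j] show ?thesis by (simp add: algebra_simps)
 qed
 have lam_mult: "lam i * lam k = (\<Sum>l\<le>n. c i k l * lam l)" if ik: "i \<le> n" "k \<le> n" for i k
 proof (rule ccontr)
  assume ne: "\<not> ?thesis"
  have "in_span (\<lambda>j. (\<Sum>l\<le>n. c i k l * u l j) - lam k * u i j - act_fun i (u k) j)"
   by (intro in_span_diff in_span_sum in_span_scale in_span_act u ik) auto
  then have "in_span (\<lambda>j. (lam i * lam k - (\<Sum>l\<le>n. c i k l * lam l)) * x j)"
   by (rule in_span_cong) (simp add: rel ik)
  then show False using ne x in_span_scaleD by simp
 qed
 have lam_char: "is_char lam" using lam_0 lam_mult by (simp add: is_char_def lam_def)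
 define Q where "Q i S w \<longleftrightarrow> finite S \<and> (\<forall>y\<in>S. is_char y) \<and> (\<forall>k\<le>n. u i k = (\<Sum>y\<in>S. w y * y k))"
  for i S and w :: "(nat => 'a) => 'a"
 define T where "T i = (SOME S. \<exists>w. Q i S w)" for i
 define v where "v i = (SOME w. Q i (T i) w)" for i
 have Tv: "Q i (T i) (v i)" if "i \<le> n" for i
 proof -
  have "\<exists>S w. Q i S w" using u[OF that] unfolding in_span_def Q_def .
  then have "\<exists>w. Q i (T i) w" unfolding T_def by (rule someI_ex)
  then show ?thesis unfolding v_def by (rule someI_ex)
 qed
 have T: "finite (T i)" "y \<in> T i ==> is_char y" "k \<le> n ==> u i k = (\<Sum>y\<in>T i. v i y * y k)"
  if "i \<le> n" for i y k using Tv[OF that] unfolding Q_def by blast+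
 \<comment> \<open>One finite set of characters that serves all the errors
   \<open>u i\<close>.\<close>
 define S where "S = (\<Union>i\<le>n. T i)"
 define w where "w i y = (if y \<in> T i then v i y else 0)" for i y
 have S: "finite S" "\<And>y. y \<in> S ==> is_char y" using T(1,2) by (auto simp: S_def)
 then have S': "\<forall>y\<in>S. is_char y" by blast
 have uw: "u i k = (\<Sum>y\<in>S. w i y * y k)" if "i \<le> n" "k \<le> n" for i k
  unfolding w_def by (rule in_span_superset[of "T i" S "u i" "v i"]) (use T S that in \<open>auto simp: S_def\<close>)
 \<comment> \<open>The relation between the errors, compared at each character by
   independence.\<close>
 have w_rel: "y i * w k y + lam k * w i y = (\<Sum>l\<le>n. c i k l * w l y)" if ik: "i \<le> n" "k \<le> n" and y: "y \<in> S" for i k y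
 proof -
  have "(\<Sum>l\<le>n. c i k l * w l y) - lam k * w i y - w k y * y i = 0"
  proof (rule chars_independent[OF S(1) S' _, where w = "\<lambda>y. (\<Sum>l\<le>n. c i k l * w l y) - lam k * w i y - w k y * y i"])
   fix j assume j: "j \<le> n"
   have 1: "(\<Sum>l\<le>n. c i k l * u l j) = (\<Sum>y\<in>S. (\<Sum>l\<le>n. c i k l * w l y) * y j)"
    using j by (simp add: uw sum_distrib_left sum_distrib_right mult.assoc) (rule sum.swap)
   have 2: "act_fun i (u k) j = (\<Sum>y\<in>S. w k y * y i * y j)"
   proof -
    have "act_fun i (u k) j = act_fun i (\<lambda>l. \<Sum>y\<in>S. w k y * y l) j" by (rule act_fun_cong) (simp add: uw ik)
    also have "\<dots> = (\<Sum>y\<in>S. w k y * act_fun i (\<lambda>l. y l) j)" by (rule act_fun_lin)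
    finally show ?thesis using S(2) ik j by (simp add: act_fun_char mult.assoc)
   qed
   have "(\<Sum>y\<in>S. ((\<Sum>l\<le>n. c i k l * w l y) - lam k * w i y - w k y * y i) * y j)
    = (\<Sum>l\<le>n. c i k l * u l j) - lam k * u i j - act_fun i (u k) j"
    unfolding 1 2 uw[OF ik(1) j] sum_distrib_left sum_subtractf[symmetric]
    by (rule sum.cong) (simp_all add: algebra_simps)
   also have "\<dots> = 0" using rel[OF ik j] lam_mult[OF ik] by simp
   finally show "(\<Sum>y\<in>S. ((\<Sum>l\<le>n. c i k l * w l y) - lam k * w i y - w k y * y i) * y j) = 0" .
  qed (rule y)
  then show ?thesis by (simp add: algebra_simps)
 qed
 have w_0: "w 0 y = 0" if "y \<in> S" for y
  using chars_independent[OF S(1) S', of "w 0"] uw[of 0] u_0 that by simp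
 \<comment> \<open>At y = \<open>lam\<close> the coefficients form a tangent vector, hence vanish.
   At any other y the symmetry of \<open>w_rel\<close> in i and k forces proportionality to
   \<open>lam i - y i\<close>.\<close>
 have ex: "\<exists>\<kappa>. \<forall>i\<le>n. w i y = \<kappa> * (lam i - y i)" if y: "y \<in> S" for y
 proof (cases "y = lam")
  case True
  have "w i y = 0" if "i \<le> n" for i
  proof (rule tangent[where x = y and \<delta> = "\<lambda>i. w i y"])
   show "y i * w k y + y k * w i y = (\<Sum>l\<le>n. c i k l * w l y)" if "i \<le> n" "k \<le> n" for i k
    using w_rel[OF that y] True by simp
  qed (use S y w_0 that in auto)
  then show ?thesis by (intro exI[of _ 0]) simp
 next
  case False
  then obtain k where k: "y k \<noteq> lam k" by blast
  have kn: "k \<le> n"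
  proof (rule ccontr)
   assume "\<not> k \<le> n"
   then show False using k S(2)[OF y] lam_char by (simp add: is_char_def)
  qed
  have "w i y = w k y / (lam k - y k) * (lam i - y i)" if i: "i \<le> n" for i
  proof -
   have "(\<Sum>l\<le>n. c i k l * w l y) = (\<Sum>l\<le>n. c k i l * w l y)"
    using i kn by (intro sum.cong) (auto simp: comm[of i k])
   then have "y i * w k y + lam k * w i y = y k * w i y + lam i * w k y"
    using w_rel[OF i kn y] w_rel[OF kn i y] by simp
   then have "w i y * (lam k - y k) = w k y * (lam i - y i)" by (simp add: algebra_simps)
   then show ?thesis using k by (simp add: field_simps)
  qed
  then show ?thesis by blast
 qed
 then obtain \<kappa> where \<kappa>: "\<And>y i. y \<in> S ==> i \<le> n ==> w i y = \<kappa> y * (lam i - y i)" by metis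
 \<comment> \<open>The correction turns x into a genuine joint eigenvector; such a functional is
   determined by its value at a_0 = 1 and equals \<open>z 0\<close> times
   \<open>lam\<close>.\<close>
 define z where "z k = x k + (\<Sum>y\<in>S. \<kappa> y * y k)" for k
 have ik: "z i = lam i * z 0" if i: "i \<le> n" for i
 proof -
  have c0: "act_fun i y 0 = y i" for y
  proof -
   have "act_fun i y 0 = (\<Sum>l\<le>n. if l = i then y l else 0)"
    unfolding act_fun_def by (intro sum.cong refl) (use i in \<open>auto simp: comm[of i 0] unit\<close>)
   then show ?thesis using i by simp
  qed
  have "z i = act_fun i x 0 + (\<Sum>y\<in>S. \<kappa> y * y i)" by (simp add: z_def c0)
  also have "\<dots> = lam i * x 0 + (\<Sum>y\<in>S. w i y * y 0) + (\<Sum>y\<in>S. \<kappa> y * y i)" by (simp add: ax uw i)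
  also have "(\<Sum>y\<in>S. w i y * y 0) = (\<Sum>y\<in>S. \<kappa> y * (lam i - y i))"
   using S(2) i by (intro sum.cong) (auto simp: \<kappa> is_char_0)
  also have "lam i * x 0 + \<dots> + (\<Sum>y\<in>S. \<kappa> y * y i) = lam i * (x 0 + (\<Sum>y\<in>S. \<kappa> y))"
   by (simp add: algebra_simps sum_subtractf sum_distrib_left)
  also have "x 0 + (\<Sum>y\<in>S. \<kappa> y) = z 0" using S(2) by (simp add: z_def is_char_0)
  finally show ?thesis .
 qed
 have "in_span (\<lambda>k. z 0 * lam k - (\<Sum>y\<in>S. \<kappa> y * y k))"
  by (intro in_span_diff in_span_scale in_span_sum in_span_char lam_char S)
 then have "in_span x"
 proof (rule in_span_cong)
  fix i assume "i \<le> n"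
  then have "z 0 * lam i = z i" by (simp only: ik[of i] mult.commute)
  then show "z 0 * lam i - (\<Sum>y\<in>S. \<kappa> y * y i) = x i" by (simp add: z_def)
 qed
 with x show False by simp
qed

text \<open>Independence allows at most n + 1 characters in a finite set, and spanning requires at
  least n + 1; a spanning set is thus a basis of the dual and its matrix of values is
  invertible.\<close>

lemma split_matrix:
 assumes span: "\<And>x. in_span x"
 obtains ch W where "\<And>j. j \<le> n ==> is_char (ch j)"
  "\<And>i k. i \<le> n ==> k \<le> n ==> (\<Sum>j\<le>n. ch j i * W j k) = (if i = k then 1 else 0)"
  "\<And>i k. i \<le> n ==> k \<le> n ==> (\<Sum>j\<le>n. W i j * ch k j) = (if i = k then 1 else 0)"
proof -
 define Q where "Q i S w \<longleftrightarrow> finite S \<and> (\<forall>y\<in>S. is_char y) \<and> (\<forall>k\<le>n. (if i = k then 1 else 0) = (\<Sum>y\<in>S. w y * y k))"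
  for i :: nat and S and w :: "(nat => 'a) => 'a"
 define T where "T i = (SOME S. \<exists>w. Q i S w)" for i
 define v where "v i = (SOME w. Q i (T i) w)" for i
 have Tv: "Q i (T i) (v i)" for i
 proof -
  have "\<exists>S w. Q i S w" using span[of "\<lambda>k. if i = k then 1 else 0"] unfolding in_span_def Q_def .
  then have "\<exists>w. Q i (T i) w" unfolding T_def by (rule someI_ex)
  then show ?thesis unfolding v_def by (rule someI_ex)
 qed
 have T: "finite (T i)" "y \<in> T i ==> is_char y" "k \<le> n ==> (if i = k then 1 else 0) = (\<Sum>y\<in>T i. v i y * y k)"
  for i y k using Tv[of i] unfolding Q_def by blast+
 define S where "S = (\<Union>i\<le>n. T i)"
 have S: "finite S" "\<And>y. y \<in> S ==> is_char y" using T(1,2) by (auto simp: S_def)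
 then have S': "\<forall>y\<in>S. is_char y" by blast
 obtain g where g: "bij_betw g {..<card S} S" using ex_bij_betw_nat_finite[OF S(1)] by (auto simp: atLeast0LessThan)
 have gS: "g t \<in> S" if "t < card S" for t using g that by (auto simp: bij_betw_def)
 have gsum: "(\<Sum>y\<in>S. h y) = (\<Sum>t<card S. h (g t))" for h :: "(nat => 'a) => 'a"
  using sum.reindex_bij_betw[OF g, of h] by simp
 have ginj: "(\<Sum>t<card S. a t * g t i) = (\<Sum>y\<in>S. a (inv_into {..<card S} g y) * y i)" for a i
  unfolding gsum using g by (intro sum.cong refl) (simp add: bij_betw_def inv_into_f_f)
 have ind: "a t = 0" if "\<And>i. i \<le> n ==> (\<Sum>t<card S. a t * g t i) = 0" "t < card S" for a t
 proof -
  have "a (inv_into {..<card S} g (g t)) = 0"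
   by (rule chars_independent[OF S(1) S' _, where w = "\<lambda>y. a (inv_into {..<card S} g y)"])
     (use that gS in \<open>simp_all flip: ginj\<close>)
  then show ?thesis using that g by (simp add: bij_betw_def inv_into_f_f)
 qed
 have "card S \<ge> Suc n"
 proof (rule ccontr)
  assume "\<not> ?thesis"
  then have cs: "card S \<le> n" by simp
  obtain a where a: "\<exists>i\<le>card S. a i \<noteq> 0"
   "\<And>j. j < card S ==> (\<Sum>i\<le>card S. a i * (if g j \<in> T i then v i (g j) else 0)) = 0"
   using linear_dependence[of "card S" "\<lambda>i j. if g j \<in> T i then v i (g j) else 0"] by blast
  have "a k = 0" if k: "k \<le> card S" for k
  proof -
   have "a k = (\<Sum>i\<le>card S. a i * (if i = k then 1 else 0))"
    using k by (simp add: if_distrib[of "(*) _"] cong: if_cong)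
   also have "\<dots> = (\<Sum>i\<le>card S. a i * (\<Sum>y\<in>S. (if y \<in> T i then v i y else 0) * y k))"
   proof (intro sum.cong refl)
    fix i assume "i \<in> {..card S}"
    then have i: "i \<le> n" using cs by simp
    have "(if i = k then 1 else 0) = (\<Sum>y\<in>S. (if y \<in> T i then v i y else 0) * y k)"
     by (rule in_span_superset[of "T i" S "\<lambda>k. if i = k then 1 else 0" "v i" k])
       (use T S i k cs in \<open>auto simp: S_def\<close>)
    then show "a i * (if i = k then 1 else 0) = a i * (\<Sum>y\<in>S. (if y \<in> T i then v i y else 0) * y k)" by simp
   qed
   also have "\<dots> = (\<Sum>j<card S. (\<Sum>i\<le>card S. a i * (if g j \<in> T i then v i (g j) else 0)) * g j k)"
    unfolding gsum by (simp only: sum_distrib_left sum_distrib_right mult.assoc) (rule sum.swap)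
   also have "\<dots> = 0" using a(2) by (intro sum.neutral) simp
   finally show ?thesis .
  qed
  with a(1) show False by blast
 qed
 moreover have "card S \<le> Suc n"
 proof (rule ccontr)
  assume "\<not> ?thesis"
  then have cs: "Suc n < card S" by simp
  obtain a where a: "\<exists>i\<le>Suc n. a i \<noteq> 0" "\<And>j. j < Suc n ==> (\<Sum>i\<le>Suc n. a i * g i j) = 0"
   using linear_dependence[of "Suc n" g] by blast
  have "(if t \<le> Suc n then a t else 0) = 0" if "t < card S" for t
  proof (rule ind[OF _ that])
   fix i assume "i \<le> n"
   have "(\<Sum>t<card S. (if t \<le> Suc n then a t else 0) * g t i) = (\<Sum>t\<le>Suc n. (if t \<le> Suc n then a t else 0) * g t i)"
    using cs by (intro sum.mono_neutral_right) auto
   also have "\<dots> = (\<Sum>t\<le>Suc n. a t * g t i)" by (rule sum.cong) auto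
   finally show "(\<Sum>t<card S. (if t \<le> Suc n then a t else 0) * g t i) = 0" using a(2) \<open>i \<le> n\<close> by simp
  qed
  then show False using a(1) cs by (metis le_less_trans)
 qed
 ultimately have cS: "card S = Suc n" by simp
 show thesis
 proof (rule matrix_inverse[of "Suc n" g])
  show "a i = 0" if "\<And>j. j < Suc n ==> (\<Sum>i<Suc n. a i * g i j) = 0" "i < Suc n" for a i
   using ind[of a i] that by (simp only: cS less_Suc_eq_le)
 next
  fix W assume W: "\<And>i k. i < Suc n ==> k < Suc n ==> (\<Sum>j<Suc n. g i j * W j k) = (if i = k then 1 else 0)"
   "\<And>i k. i < Suc n ==> k < Suc n ==> (\<Sum>j<Suc n. W i j * g j k) = (if i = k then 1 else 0)"
  show thesis
  proof (rule that[of g "\<lambda>i j. W j i"])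
  show "is_char (g j)" if "j \<le> n" for j using S gS that cS by simp
  show "(\<Sum>j\<le>n. g j i * W k j) = (if i = k then 1 else 0)" if "i \<le> n" "k \<le> n" for i k
   using W(2)[of k i] that by (simp add: lessThan_Suc_atMost mult.commute less_Suc_eq_le eq_commute)
  show "(\<Sum>j\<le>n. W j i * g k j) = (if i = k then 1 else 0)" if "i \<le> n" "k \<le> n" for i k
   using W(1)[of k i] that by (simp add: lessThan_Suc_atMost mult.commute less_Suc_eq_le eq_commute)
  qed
 qed
qed

end

section \<open>Formal points and tangent vectors\<close>

lemma coeff_linear_factor_mult:
 "coeff ([:-r, 1:] * q) k = (case k of 0 => 0 | Suc k' => coeff q k') - r * coeff q k" for r :: "'a::comm_ring_1"
 by (simp add: coeff_pCons split: nat.split)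

text \<open>Over an algebraically closed field p splits, and each factor Y - r vanishes to order at
  most 1 because the linear coefficient of Y is nonzero.\<close>

lemma subdegree_poly_fps_le:
 fixes Y :: "'a::alg_closed_field fps"
 assumes "Y $ 1 \<noteq> 0" "p \<noteq> 0"
 shows "poly (map_poly fps_const p) Y \<noteq> 0 \<and> subdegree (poly (map_poly fps_const p) Y) \<le> degree p"
 using assms(2)
proof (induction "degree p" arbitrary: p)
 case 0
 then obtain a where "p = [:a:]" "a \<noteq> 0" by (metis degree_eq_zeroE pCons_0_0)
 then show ?case by (simp add: map_poly_pCons)
next
 case (Suc k)
 then obtain r where "poly p r = 0" using alg_closed_imp_poly_has_root[of p] by auto
 then obtain q where q: "p = [:-r, 1:] * q" by (metis dvdE poly_eq_0_iff_dvd)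
 have q0: "q \<noteq> 0" using Suc.prems q by auto
 then have dq: "degree p = Suc (degree q)" unfolding q by (subst degree_mult_eq) auto
 have m: "map_poly fps_const ([:-r, 1:] * q) = [:- fps_const r, 1:] * map_poly fps_const q"
  by (rule poly_eqI) (simp only: coeff_map_poly fps_const_0_eq_0 coeff_linear_factor_mult,
    simp split: nat.split add: coeff_map_poly)
 have e: "poly (map_poly fps_const p) Y = (Y - fps_const r) * poly (map_poly fps_const q) Y"
  unfolding q m poly_mult by simp
 have n0: "Y - fps_const r \<noteq> 0" and s: "subdegree (Y - fps_const r) \<le> 1"
 proof -
  have "(Y - fps_const r) $ 1 \<noteq> 0" using assms(1) by simp
  then show "Y - fps_const r \<noteq> 0" "subdegree (Y - fps_const r) \<le> 1"
   by (metis fps_zero_nth) (rule subdegree_leI, fact)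
 qed
 have "poly (map_poly fps_const q) Y \<noteq> 0 \<and> subdegree (poly (map_poly fps_const q) Y) \<le> degree q"
  using Suc dq q0 by simp
 then show ?case unfolding e using n0 s dq by simp
qed

text \<open>The values on a basis $a_0 = 1, a_1, \dots, a_n$ of an algebra homomorphism to the power series modulo
 \<open>X ^ N\<close>.\<close>

definition formal_point :: "nat => (nat => nat => nat => 'a::comm_ring_1) => nat => (nat => 'a fps) => bool" where
 "formal_point n c N Y \<longleftrightarrow> Y 0 = 1 \<and>
  (\<forall>i\<le>n. \<forall>k\<le>n. \<forall>j<N. (Y i * Y k - (\<Sum>l\<le>n. fps_const (c i k l) * Y l)) $ j = 0)"

text \<open>The consequence of smoothness on which the argument rests: formal points lift from
  truncation at X^(N+1) to truncation at X^(N+2). Iteration extends a tangent vector to any finite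
  order.\<close>

definition liftable :: "nat => (nat => nat => nat => 'a::comm_ring_1) => bool" where
 "liftable n c \<longleftrightarrow> (\<forall>N Z. formal_point n c (Suc N) Z \<longrightarrow>
  (\<exists>Y. formal_point n c (Suc (Suc N)) Y \<and> (\<forall>i\<le>n. \<forall>j<Suc N. Y i $ j = Z i $ j)))"

lemma formal_point_cong:
 assumes "formal_point n c N Y" "\<And>i k l. i \<le> n ==> k \<le> n ==> l \<le> n ==> c i k l = c' i k l"
 shows "formal_point n c' N Y"
 unfolding formal_point_def
proof (intro conjI allI impI)
 fix i k j assume "i \<le> n" "k \<le> n" "j < N"
 moreover from this have "(\<Sum>l\<le>n. fps_const (c i k l) * Y l) = (\<Sum>l\<le>n. fps_const (c' i k l) * Y l)"
  by (intro sum.cong refl) (simp add: assms(2))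
 ultimately show "(Y i * Y k - (\<Sum>l\<le>n. fps_const (c' i k l) * Y l)) $ j = 0"
  using assms(1) unfolding formal_point_def by metis
qed (use assms(1) in \<open>simp add: formal_point_def\<close>)

lemma liftable_cong:
 assumes "liftable n c" "\<And>i k l. i \<le> n ==> k \<le> n ==> l \<le> n ==> c i k l = c' i k l"
 shows "liftable n c'"
proof -
 have "formal_point n c N Y \<longleftrightarrow> formal_point n c' N Y" for N Y
  by (intro iffI; erule formal_point_cong) (simp_all add: assms(2))
 then show ?thesis using assms(1) by (simp add: liftable_def)
qed

text \<open>A nonzero tangent vector would lift to a formal point modulo X^(n+2) with a coordinate
  whose linear coefficient is nonzero. A dependence between the powers of a_m gives a polynomial of
  degree at most n + 1 that vanishes at this coordinate to order n + 2, against
  \<open>subdegree_poly_fps_le\<close>.\<close>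

lemma (in char_field) no_tangent_vectors:
 assumes lift: "liftable n c"
  and x: "is_char x" and d0: "\<delta> 0 = 0"
  and d: "\<And>i k. i \<le> n ==> k \<le> n ==> x i * \<delta> k + x k * \<delta> i = (\<Sum>l\<le>n. c i k l * \<delta> l)"
  and m: "m \<le> n"
 shows "\<delta> m = 0"
proof (rule ccontr)
 assume dm: "\<delta> m \<noteq> 0"
 have ex: "\<exists>Z. formal_point n c (Suc (Suc N)) Z \<and> (\<forall>i\<le>n. Z i $ 1 = \<delta> i)" for N
 proof (induction N)
  case 0
  define Z where "Z i = fps_const (x i) + fps_const (\<delta> i) * fps_X" for i
  have "(Z i * Z k - (\<Sum>l\<le>n. fps_const (c i k l) * Z l)) $ j = 0" if "i \<le> n" "k \<le> n" "j < 2" for i k j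
  proof -
   have Z0: "Z i $ 0 = x i" "Z i $ 1 = \<delta> i" for i by (simp_all add: Z_def)
   have s: "(\<Sum>l\<le>n. fps_const (c i k l) * Z l) $ j = (\<Sum>l\<le>n. c i k l * Z l $ j)" for j by (simp add: fps_sum_nth)
   have "j = 0 \<or> j = 1" using that(3) by auto
   then show ?thesis
   proof
    assume "j = 0"
    then show ?thesis using is_char_mult[OF x that(1,2)] by (simp add: s Z0)
   next
    assume "j = 1"
    have "(Z i * Z k) $ 1 = x i * \<delta> k + \<delta> i * x k"
     using Z0 by (simp add: fps_mult_nth)
    moreover have "(\<Sum>l\<le>n. fps_const (c i k l) * Z l) $ 1 = (\<Sum>l\<le>n. c i k l * \<delta> l)" by (simp only: s Z0)
    ultimately show ?thesis using d[OF that(1,2)] \<open>j = 1\<close> by (simp add: mult.commute)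
   qed
  qed
  moreover have "Z 0 = 1" using x d0 by (simp add: Z_def is_char_def)
  moreover have "Z i $ 1 = \<delta> i" for i by (simp add: Z_def)
  ultimately show ?case by (intro exI[of _ Z]) (auto simp: formal_point_def)
 next
  case (Suc N)
  then obtain Z where Z: "formal_point n c (Suc (Suc N)) Z" "\<forall>i\<le>n. Z i $ 1 = \<delta> i" by blast
  then obtain Y where Y: "formal_point n c (Suc (Suc (Suc N))) Y" "\<forall>i\<le>n. \<forall>j<Suc (Suc N). Y i $ j = Z i $ j"
   using lift unfolding liftable_def by blast
  then show ?case using Z(2) by (intro exI[of _ Y]) auto
 qed
 \<comment> \<open>The order n + 2 is chosen to exceed the degree n + 1 of the polynomial p
   below.\<close>
 obtain Z where Z: "Z 0 = 1" "\<And>i. i \<le> n ==> Z i $ 1 = \<delta> i"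
  "\<And>i k j. i \<le> n ==> k \<le> n ==> j < Suc (Suc n) ==> (Z i * Z k - (\<Sum>l\<le>n. fps_const (c i k l) * Z l)) $ j = 0"
  using ex[of n] unfolding formal_point_def by auto
 \<comment> \<open>\<open>v t\<close> holds the coordinates of the power a_m^t in the basis.\<close>
 define v where "v t = ((\<lambda>y l. \<Sum>s\<le>n. y s * c m s l) ^^ t) (\<lambda>l. if l = 0 then 1 else 0)" for t
 have v0: "v 0 = (\<lambda>l. if l = 0 then 1 else 0)" and vS: "v (Suc t) l = (\<Sum>s\<le>n. v t s * c m s l)" for t l
  by (simp_all add: v_def)
 have Zv: "(Z m ^ t - (\<Sum>l\<le>n. fps_const (v t l) * Z l)) $ j = 0" if "j < Suc (Suc n)" for t j
  using that
 proof (induction t arbitrary: j)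
  case 0
  have "(\<Sum>l\<le>n. fps_const (v 0 l) * Z l) = (\<Sum>l\<le>n. if l = 0 then Z l else 0)"
   by (intro sum.cong) (auto simp: v0)
  then show ?case by (simp add: Z)
 next
  case (Suc t)
  have "Z m ^ Suc t - (\<Sum>l\<le>n. fps_const (v (Suc t) l) * Z l) =
   Z m * (Z m ^ t - (\<Sum>l\<le>n. fps_const (v t l) * Z l)) +
   (\<Sum>s\<le>n. fps_const (v t s) * (Z m * Z s - (\<Sum>l\<le>n. fps_const (c m s l) * Z l)))"
  proof -
   have "(\<Sum>l\<le>n. fps_const (v (Suc t) l) * Z l) = (\<Sum>l\<le>n. \<Sum>s\<le>n. fps_const (v t s) * (fps_const (c m s l) * Z l))"
   proof (intro sum.cong refl)
    fix l
    interpret f: comm_ring_hom "fps_const :: 'a => 'a fps" by standard auto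
    have "fps_const (v (Suc t) l) = (\<Sum>s\<le>n. fps_const (v t s) * fps_const (c m s l))"
     unfolding vS by (simp only: f.hom_sum f.hom_mult)
    then show "fps_const (v (Suc t) l) * Z l = (\<Sum>s\<le>n. fps_const (v t s) * (fps_const (c m s l) * Z l))"
     by (simp only: sum_distrib_right mult.assoc)
   qed
   also have "\<dots> = (\<Sum>s\<le>n. fps_const (v t s) * (\<Sum>l\<le>n. fps_const (c m s l) * Z l))"
    unfolding sum_distrib_left by (rule sum.swap)
   finally show ?thesis
    by (simp add: right_diff_distrib sum_subtractf sum_distrib_left mult.left_commute)
  qed
  moreover have "(Z m * (Z m ^ t - (\<Sum>l\<le>n. fps_const (v t l) * Z l))) $ j = 0"
   unfolding fps_mult_nth using Suc by (intro sum.neutral) auto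
  moreover have "(\<Sum>s\<le>n. fps_const (v t s) * (Z m * Z s - (\<Sum>l\<le>n. fps_const (c m s l) * Z l))) $ j = 0"
   unfolding fps_sum_nth fps_mult_left_const_nth using Z(3)[OF m _ Suc.prems] by (intro sum.neutral) auto
  ultimately show ?case by (simp only: fps_add_nth add_0_left)
 qed
 obtain a where a: "\<exists>i\<le>Suc n. a i \<noteq> 0" "\<And>j. j < Suc n ==> (\<Sum>i\<le>Suc n. a i * v i j) = 0"
  using linear_dependence[of "Suc n" v] by blast
 define p where "p = (\<Sum>i\<le>Suc n. monom (a i) i)"
 have cp: "coeff p k = (if k \<le> Suc n then a k else 0)" for k
  by (simp add: p_def coeff_sum if_distrib cong: if_cong)
 have p0: "p \<noteq> 0" using a(1) cp by (metis coeff_0)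
 have dp: "degree p \<le> Suc n" by (rule degree_le) (simp add: cp)
 have "poly (map_poly fps_const p) (Z m) = (\<Sum>t\<le>Suc n. fps_const (a t) * Z m ^ t)"
 proof -
  have "degree (map_poly fps_const p) \<le> Suc n" by (rule degree_le) (simp add: coeff_map_poly cp)
  then have "poly (map_poly fps_const p) (Z m) = (\<Sum>t\<le>Suc n. coeff (map_poly fps_const p) t * Z m ^ t)"
   unfolding poly_altdef by (intro sum.mono_neutral_left) (auto simp: coeff_eq_0)
  then show ?thesis by (simp add: coeff_map_poly cp del: sum.atMost_Suc)
 qed
 moreover have "(\<Sum>t\<le>Suc n. fps_const (a t) * Z m ^ t) $ j = 0" if j: "j < Suc (Suc n)" for j
 proof -
  have "(\<Sum>t\<le>Suc n. fps_const (a t) * Z m ^ t) $ j = (\<Sum>t\<le>Suc n. a t * (Z m ^ t) $ j)"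
   by (simp add: fps_sum_nth del: sum.atMost_Suc)
  also have "\<dots> = (\<Sum>t\<le>Suc n. a t * (\<Sum>l\<le>n. v t l * Z l $ j))"
   using Zv[OF j] by (simp add: fps_sum_nth del: sum.atMost_Suc)
  also have "\<dots> = (\<Sum>l\<le>n. (\<Sum>t\<le>Suc n. a t * v t l) * Z l $ j)"
   by (simp only: sum_distrib_left sum_distrib_right mult.assoc) (rule sum.swap)
  also have "\<dots> = 0" using a(2) by (intro sum.neutral) (simp del: sum.atMost_Suc)
  finally show ?thesis .
 qed
 ultimately have z: "poly (map_poly fps_const p) (Z m) $ j = 0" if "j < Suc (Suc n)" for j using that by simp
 have "Z m $ 1 \<noteq> 0" using Z(2)[OF m] dm by simp
 from subdegree_poly_fps_le[OF this p0] have
  "poly (map_poly fps_const p) (Z m) $ subdegree (poly (map_poly fps_const p) (Z m)) \<noteq> 0"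
  "subdegree (poly (map_poly fps_const p) (Z m)) < Suc (Suc n)" using dp by auto
 with z show False by blast
qed

section \<open>Algebras\<close>

abbreviation RT :: "'a::comm_ring_1 ring" where "RT \<equiv> ring_of_type_algebra"

lemma RT_simps [simp]:
 "carrier RT = UNIV" "x \<otimes>\<^bsub>RT\<^esub> y = x * y" "x \<oplus>\<^bsub>RT\<^esub> y = x + y" "\<one>\<^bsub>RT\<^esub> = 1" "\<zero>\<^bsub>RT\<^esub> = 0"
 by (simp_all add: ring_of_type_algebra_def)

lemma cring_RT: "cring RT" by (rule cring_from_type_algebra)

lemma mpoly_ring_simps [simp]:
 "carrier (mpoly_ring V) = polys V" "x \<otimes>\<^bsub>mpoly_ring V\<^esub> y = x * y" "x \<oplus>\<^bsub>mpoly_ring V\<^esub> y = x + y"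
 "\<one>\<^bsub>mpoly_ring V\<^esub> = 1" "\<zero>\<^bsub>mpoly_ring V\<^esub> = 0"
 by (simp_all add: mpoly_ring_def)

lemma cring_mpoly_ring: "cring (mpoly_ring V)"
proof (rule cringI)
 show "abelian_group (mpoly_ring V)"
  by (rule abelian_groupI)
    (auto simp: add_polys algebra_simps intro!: bexI[of _ "- _"] uminus_polys)
 show "Group.comm_monoid (mpoly_ring V)"
  by unfold_locales (auto simp: mult_polys algebra_simps)
qed (simp add: algebra_simps)

lemma RT_minus [simp]: "\<ominus>\<^bsub>RT\<^esub> x = - x" "x \<ominus>\<^bsub>RT\<^esub> y = x - y"
proof -
 interpret cring "RT :: 'a ring" by (rule cring_RT)
 show *: "\<ominus>\<^bsub>RT\<^esub> x = - x" for x :: 'a by (rule minus_equality) auto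
 show "x \<ominus>\<^bsub>RT\<^esub> y = x - y" by (simp add: a_minus_def *)
qed

lemma mpoly_ring_minus: "y \<in> polys V ==> x \<ominus>\<^bsub>mpoly_ring V\<^esub> y = x - y"
proof -
 interpret cring "mpoly_ring V :: 'a mpoly ring" by (rule cring_mpoly_ring)
 assume "y \<in> polys V"
 then have "\<ominus>\<^bsub>mpoly_ring V\<^esub> y = - y" by (intro minus_equality) (auto simp: uminus_polys)
 then show ?thesis by (simp add: a_minus_def)
qed

lemma ideal_mpoly_ringI:
 assumes "I \<subseteq> polys V" "0 \<in> I" "\<And>p q. p \<in> I ==> q \<in> I ==> p + q \<in> I"
  and m: "\<And>p q. p \<in> I ==> q \<in> polys V ==> q * p \<in> I"
 shows "ideal I (mpoly_ring V)"
proof (rule idealI)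
 interpret cring "mpoly_ring V :: 'a mpoly ring" by (rule cring_mpoly_ring)
 show "ring (mpoly_ring V :: 'a mpoly ring)" ..
 have "\<ominus>\<^bsub>mpoly_ring V\<^esub> p \<in> I" if "p \<in> I" for p
 proof -
  have "p \<in> polys V" using that assms(1) by auto
  then have "\<ominus>\<^bsub>mpoly_ring V\<^esub> p = Const (-1) * p"
   by (intro minus_equality) (auto simp: Const_uminus uminus_polys)
  then show ?thesis using m[OF that] by simp
 qed
 then have inv: "inv\<^bsub>add_monoid (mpoly_ring V)\<^esub> p \<in> I" if "p \<in> I" for p
  using that by (simp only: a_inv_def)
 show "subgroup I (add_monoid (mpoly_ring V))"
  by (rule subgroup.intro) (use assms inv in \<open>simp_all\<close>)
 show "x \<otimes>\<^bsub>mpoly_ring V\<^esub> a \<in> I" "a \<otimes>\<^bsub>mpoly_ring V\<^esub> x \<in> I"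
  if "a \<in> I" "x \<in> carrier (mpoly_ring V)" for a x
  using m[of a x] that by (auto simp: mult.commute)
qed

lemma ideal_mpoly_ringD:
 assumes "ideal I (mpoly_ring V)"
 shows "I \<subseteq> polys V" "0 \<in> I" "\<And>p q. p \<in> I ==> q \<in> I ==> p + q \<in> I"
  "\<And>p q. p \<in> I ==> q \<in> polys V ==> q * p \<in> I" "\<And>p. p \<in> I ==> - p \<in> I"
  "\<And>p q. p \<in> I ==> q \<in> I ==> p - q \<in> I"
proof -
 interpret ideal I "mpoly_ring V" by fact
 show 1: "I \<subseteq> polys V" using a_subset by simp
 show "0 \<in> I" using additive_subgroup.zero_closed[OF is_additive_subgroup] by simp
 show 2: "p + q \<in> I" if "p \<in> I" "q \<in> I" for p q using additive_subgroup.a_closed[OF is_additive_subgroup that] by simp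
 show 3: "q * p \<in> I" if "p \<in> I" "q \<in> polys V" for p q using I_l_closed[OF that(1), of q] that by simp
 show 4: "- p \<in> I" if "p \<in> I" for p using 3[OF that Const_polys[of "-1"]] by (simp add: Const_uminus)
 show "p - q \<in> I" if "p \<in> I" "q \<in> I" for p q using 2[OF that(1) 4[OF that(2)]] by simp
qed

lemma ideal_Ann: "ideal (Ann V F) (mpoly_ring V)" for F :: "'k::field_char_0 mpoly"
proof (rule ideal_mpoly_ringI)
 show "q * p \<in> Ann V F" if "p \<in> Ann V F" "q \<in> polys V" for p q
  using that by (simp add: Ann_def mult_polys act_mult)
qed (auto simp: Ann_def add_polys act_add)

lemma coset_eq_iff:
 assumes "ideal I R" "x \<in> carrier R" "y \<in> carrier R"
 shows "I +>\<^bsub>R\<^esub> x = I +>\<^bsub>R\<^esub> y \<longleftrightarrow> x \<ominus>\<^bsub>R\<^esub> y \<in> I"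
proof -
 interpret ideal I R by fact
 show ?thesis using quotient_eq_iff_same_a_r_cos[OF assms] by simp
qed

lemma mpoly_coset_eq_iff:
 assumes "ideal I (mpoly_ring V)" "x \<in> polys V" "y \<in> polys V"
 shows "I +>\<^bsub>mpoly_ring V\<^esub> x = I +>\<^bsub>mpoly_ring V\<^esub> y \<longleftrightarrow> x - y \<in> I"
 using coset_eq_iff[OF assms(1), of x y] assms(2,3) by (simp add: mpoly_ring_minus)

lemma carrier_Quot: "carrier (R Quot I) = (\<lambda>x. I +>\<^bsub>R\<^esub> x) ` carrier R"
 by (auto simp: FactRing_def A_RCOSETS_def')

lemma cring_surj_image:
 assumes "cring R" "ring S" "h \<in> Ring.ring_hom R S" "h ` carrier R = carrier S"
 shows "cring S"
proof -
 interpret R: cring R by fact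
 interpret S: ring S by fact
 show ?thesis
 proof (unfold_locales)
  fix x y assume "x \<in> carrier S" "y \<in> carrier S"
  then obtain a b where "a \<in> carrier R" "x = h a" "b \<in> carrier R" "y = h b" using assms(4) by blast
  then show "x \<otimes>\<^bsub>S\<^esub> y = y \<otimes>\<^bsub>S\<^esub> x"
   using ring_hom_mult[OF assms(3)] R.m_comm by metis
 qed
qed

lemma ring_hom_zero':
 "h \<in> Ring.ring_hom R S ==> cring R ==> cring S ==> h \<zero>\<^bsub>R\<^esub> = \<zero>\<^bsub>S\<^esub>"
 by (rule ring_hom_zero) (auto simp: cring_def)

lemma (in cring) minus_cancel:
 "u \<in> carrier R ==> p \<in> carrier R ==> q \<in> carrier R ==> (u \<oplus> p) \<ominus> (u \<oplus> q) = p \<ominus> q"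
 by algebra

lemma (in cring) minus_factor:
 "u \<in> carrier R ==> p \<in> carrier R ==> q \<in> carrier R ==> u \<otimes> p \<ominus> u \<otimes> q = u \<otimes> (p \<ominus> q)"
 by algebra

section \<open>Linear combinations and bases in algebras\<close>

locale lin_alg = cring A for A (structure) +
 fixes \<phi> :: "'r::comm_ring_1 => 'a"
 assumes phi: "\<phi> \<in> Ring.ring_hom RT A"
begin

lemma phi_closed [simp, intro]: "\<phi> c \<in> carrier A"
 and phi_add: "\<phi> (c + d) = \<phi> c \<oplus> \<phi> d"
 and phi_mult: "\<phi> (c * d) = \<phi> c \<otimes> \<phi> d"
 and phi_one [simp]: "\<phi> 1 = \<one>"
 using ring_hom_closed[OF phi] ring_hom_add[OF phi] ring_hom_mult[OF phi] ring_hom_one[OF phi] by simp_all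

lemma phi_zero [simp]: "\<phi> 0 = \<zero>"
 using ring_hom_zero'[OF phi cring_RT is_cring] by simp

lemma phi_power: "\<phi> (c ^ k) = \<phi> c [^] k"
 by (induction k) (auto simp: phi_mult m_comm)

definition lin :: "(nat => 'a) => nat => (nat => 'r) => 'a" where
 "lin b N s = (\<Oplus>i\<in>{..<N}. \<phi> (s i) \<otimes> b i)"

context
 fixes b :: "nat => 'a" and N :: nat
 assumes b: "b \<in> {..<N} \<rightarrow> carrier A"
begin

lemma bi: "i < N ==> b i \<in> carrier A" using b by auto

lemma lin_closed [simp]: "lin b N s \<in> carrier A"
 unfolding lin_def using bi by (intro finsum_closed) auto

lemma lin_cong: "(\<And>i. i < N ==> s i = t i) ==> lin b N s = lin b N t"
 unfolding lin_def using bi by (intro finsum_cong') auto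

lemma lin_add: "lin b N (\<lambda>i. s i + t i) = lin b N s \<oplus> lin b N t"
proof -
 have "lin b N (\<lambda>i. s i + t i) = (\<Oplus>i\<in>{..<N}. (\<phi> (s i) \<otimes> b i) \<oplus> (\<phi> (t i) \<otimes> b i))"
  unfolding lin_def using bi by (intro finsum_cong') (auto simp: phi_add l_distr)
 also have "\<dots> = lin b N s \<oplus> lin b N t" unfolding lin_def using bi by (intro finsum_addf) auto
 finally show ?thesis .
qed

lemma lin_scale: "lin b N (\<lambda>i. c * s i) = \<phi> c \<otimes> lin b N s"
proof -
 have "\<phi> c \<otimes> lin b N s = (\<Oplus>i\<in>{..<N}. \<phi> c \<otimes> (\<phi> (s i) \<otimes> b i))"
  unfolding lin_def using bi by (intro finsum_rdistr) auto
 also have "\<dots> = lin b N (\<lambda>i. c * s i)"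
  unfolding lin_def using bi by (intro finsum_cong') (auto simp: phi_mult m_assoc)
 finally show ?thesis by simp
qed

lemma lin_zero: "lin b N (\<lambda>i. 0) = \<zero>"
 using lin_scale[of 0 "\<lambda>i. 0"] by simp

lemma lin_diff: "lin b N (\<lambda>i. s i - t i) = lin b N s \<ominus> lin b N t"
proof -
 have "lin b N s = lin b N (\<lambda>i. s i - t i) \<oplus> lin b N t" unfolding lin_add[symmetric] by simp
 then have "lin b N s \<ominus> lin b N t = (lin b N (\<lambda>i. s i - t i) \<oplus> lin b N t) \<ominus> lin b N t" by simp
 also have "\<dots> = lin b N (\<lambda>i. s i - t i)" by (simp add: a_minus_def a_assoc r_neg)
 finally show ?thesis by simp
qed

lemma lin_unit: "j < N ==> lin b N (\<lambda>i. if j = i then 1 else 0) = b j"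
proof -
 assume j: "j < N"
 have "lin b N (\<lambda>i. if j = i then 1 else 0) = (\<Oplus>i\<in>{..<N}. if j = i then b i else \<zero>)"
  unfolding lin_def using bi by (intro finsum_cong') auto
 also have "\<dots> = b j" using bi j by (intro finsum_singleton) auto
 finally show ?thesis .
qed

lemma lin_lin: fixes M :: nat shows "(\<Oplus>l\<in>{..<M}. \<phi> (s l) \<otimes> lin b N (t l)) = lin b N (\<lambda>k. \<Sum>l<M. s l * t l k)"
proof (induction M)
 case 0
 then show ?case by (simp add: lin_zero)
next
 case (Suc M)
 have "(\<Oplus>l\<in>{..<Suc M}. \<phi> (s l) \<otimes> lin b N (t l)) = \<phi> (s M) \<otimes> lin b N (t M) \<oplus> lin b N (\<lambda>k. \<Sum>l<M. s l * t l k)"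
  unfolding lessThan_Suc using Suc by (subst finsum_insert) auto
 also have "\<dots> = lin b N (\<lambda>k. s M * t M k + (\<Sum>l<M. s l * t l k))"
  by (simp only: lin_add lin_scale)
 finally show ?case by (simp add: add.commute)
qed

lemma lin_mult_right: "x \<in> carrier A ==> lin b N s \<otimes> x = (\<Oplus>i\<in>{..<N}. \<phi> (s i) \<otimes> (b i \<otimes> x))"
proof -
 assume x: "x \<in> carrier A"
 have "lin b N s \<otimes> x = (\<Oplus>i\<in>{..<N}. \<phi> (s i) \<otimes> b i \<otimes> x)"
  unfolding lin_def using bi x by (intro finsum_ldistr) auto
 also have "\<dots> = (\<Oplus>i\<in>{..<N}. \<phi> (s i) \<otimes> (b i \<otimes> x))"
  using bi x by (intro finsum_cong') (auto simp: m_assoc)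
 finally show ?thesis .
qed

lemma lin_mult_table:
 assumes c: "\<And>i j. i < N ==> j < N ==> b i \<otimes> b j = lin b N (c i j)"
 shows "i < N ==> lin b N s \<otimes> b i = lin b N (\<lambda>k. \<Sum>j<N. s j * c j i k)"
  and "lin b N s \<otimes> lin b N t = lin b N (\<lambda>k. \<Sum>i<N. s i * (\<Sum>j<N. t j * c j i k))"
proof -
 show 1: "lin b N s \<otimes> b i = lin b N (\<lambda>k. \<Sum>j<N. s j * c j i k)" if i: "i < N" for i s
 proof -
  have "lin b N s \<otimes> b i = (\<Oplus>j\<in>{..<N}. \<phi> (s j) \<otimes> lin b N (c j i))"
   unfolding lin_mult_right[OF bi[OF i]] using bi i c by (intro finsum_cong') auto
  then show ?thesis by (simp add: lin_lin)
 qed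
 have "lin b N s \<otimes> lin b N t = (\<Oplus>i\<in>{..<N}. \<phi> (s i) \<otimes> lin b N (\<lambda>k. \<Sum>j<N. t j * c j i k))"
  unfolding lin_mult_right[OF lin_closed] using bi 1 by (intro finsum_cong') (auto simp: m_comm[of "b _"])
 then show "lin b N s \<otimes> lin b N t = lin b N (\<lambda>k. \<Sum>i<N. s i * (\<Sum>j<N. t j * c j i k))"
  by (simp add: lin_lin)
qed

end

lemma hom_lin:
 assumes "h \<in> Ring.ring_hom A B" "cring B" "b \<in> {..<N} \<rightarrow> carrier A"
 shows "h (lin b N s) = lin_alg.lin B (\<lambda>c. h (\<phi> c)) (\<lambda>i. h (b i)) N s"
proof -
 interpret B: cring B by fact
 interpret h: ring_hom_cring A B h by unfold_locales fact
 interpret B: lin_alg B "\<lambda>c. h (\<phi> c)"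
  by unfold_locales (auto intro!: ring_hom_memI simp: phi_add phi_mult)
 have bi: "b i \<in> carrier A" if "i < N" for i using assms(3) that by auto
 have "h (lin b N s) = (\<Oplus>\<^bsub>B\<^esub>i\<in>{..<N}. h (\<phi> (s i) \<otimes> b i))"
  unfolding lin_def using bi by (subst h.hom_finsum) (auto simp: o_def)
 also have "\<dots> = B.lin (\<lambda>i. h (b i)) N s"
  unfolding B.lin_def using bi by (intro B.finsum_cong') auto
 finally show ?thesis .
qed

end

locale free_alg = lin_alg A \<phi> for A (structure) and \<phi> :: "'r::comm_ring_1 => 'a" +
 fixes b :: "nat => 'a" and N :: nat
 assumes b: "b \<in> {..<N} \<rightarrow> carrier A"
  and span: "x \<in> carrier A ==> \<exists>s. x = lin b N s"
  and indep: "lin b N s = \<zero> ==> i < N ==> s i = 0"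
begin

lemma lin_inj: "lin b N s = lin b N t ==> i < N ==> s i = t i"
proof -
 assume "lin b N s = lin b N t" and i: "i < N"
 then have "lin b N (\<lambda>i. s i - t i) = \<zero>" by (simp add: lin_diff[OF b] lin_closed[OF b] a_minus_def r_neg)
 from indep[OF this i] show "s i = t i" by simp
qed

definition co :: "'a => nat => 'r" where "co x = (SOME s. x = lin b N s)"

lemma lin_co: "x \<in> carrier A ==> lin b N (co x) = x"
 unfolding co_def using someI_ex[OF span] by metis

lemma co_lin: "i < N ==> co (lin b N s) i = s i"
 by (rule lin_inj[OF lin_co[OF lin_closed[OF b]]])

lemma co_eqI: "x = lin b N s ==> i < N ==> co x i = s i"
 by (simp add: co_lin)

lemma co_add: "x \<in> carrier A ==> y \<in> carrier A ==> i < N ==> co (x \<oplus> y) i = co x i + co y i"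
 by (rule co_eqI) (simp_all only: lin_add[OF b] lin_co)

lemma co_scale: "x \<in> carrier A ==> i < N ==> co (\<phi> c \<otimes> x) i = c * co x i"
 by (rule co_eqI) (simp_all only: lin_scale[OF b] lin_co)

lemma eq_zeroI: "x \<in> carrier A ==> (\<And>i. i < N ==> co x i = 0) ==> x = \<zero>"
 using lin_co[of x] lin_cong[OF b, where s = "co x" and t = "\<lambda>_. 0"] lin_zero[OF b] by simp

end

lemma free_of_rank_iff:
 assumes "lin_alg A \<phi>"
 shows "free_of_rank \<phi> A N \<longleftrightarrow> (\<exists>b. free_alg A \<phi> b N)"
proof
 interpret lin_alg A \<phi> by fact
 assume "free_of_rank \<phi> A N"
 then obtain b where b: "\<forall>i<N. b i \<in> carrier A"
  and u: "\<forall>x\<in>carrier A. \<exists>!c. (\<forall>i\<ge>N. c i = 0) \<and> x = lin b N c"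
  unfolding free_of_rank_def lin_def by blast
 have "free_alg A \<phi> b N"
 proof
  show "\<exists>s. x = lin b N s" if "x \<in> carrier A" for x using u that by blast
  show "s i = 0" if "lin b N s = \<zero>\<^bsub>A\<^esub>" "i < N" for s i
  proof -
   \<comment> \<open>Coefficients from N on are cut off, since the uniqueness in
     \<open>free_of_rank\<close> is among functions that vanish there.\<close>
   let ?s = "\<lambda>i. if i < N then s i else 0"
   have bb: "b \<in> {..<N} \<rightarrow> carrier A" using b by simp
   have "lin b N ?s = lin b N s" by (rule lin_cong[OF bb]) auto
   then have 1: "(\<forall>i\<ge>N. ?s i = 0) \<and> \<zero>\<^bsub>A\<^esub> = lin b N ?s" using that by simp
   have 2: "(\<forall>i\<ge>N. (0::'b) = 0) \<and> \<zero>\<^bsub>A\<^esub> = lin b N (\<lambda>_. 0)" using lin_zero[OF bb] by simp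
   obtain c where "\<And>c'. (\<forall>i\<ge>N. c' i = 0) \<and> \<zero>\<^bsub>A\<^esub> = lin b N c' ==> c' = c"
    using u[rule_format, OF zero_closed] by (elim ex1E) blast
   from this[OF 1] this[OF 2] have "?s = (\<lambda>_. 0)" by simp
   then have "?s i = 0" by (rule fun_cong)
   then show ?thesis using that by simp
  qed
 qed (use b in auto)
 then show "\<exists>b. free_alg A \<phi> b N" by blast
next
 assume "\<exists>b. free_alg A \<phi> b N"
 then obtain b where "free_alg A \<phi> b N" by blast
 then interpret free_alg A \<phi> b N .
 have "\<exists>!c. (\<forall>i\<ge>N. c i = 0) \<and> x = lin b N c" if x: "x \<in> carrier A" for x
 proof (rule ex1I[of _ "\<lambda>i. if i < N then co x i else 0"])
  have "lin b N (\<lambda>i. if i < N then co x i else 0) = lin b N (co x)" by (rule lin_cong[OF b]) auto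
  then show "(\<forall>i\<ge>N. (if i < N then co x i else 0) = 0) \<and> x = lin b N (\<lambda>i. if i < N then co x i else 0)"
   using lin_co[OF x] by simp
  fix c assume c: "(\<forall>i\<ge>N. c i = 0) \<and> x = lin b N c"
  show "c = (\<lambda>i. if i < N then co x i else 0)"
  proof
   fix i show "c i = (if i < N then co x i else 0)" using c co_lin[of i c] by auto
  qed
 qed
 then show "free_of_rank \<phi> A N" unfolding free_of_rank_def lin_def using b by (intro exI[of _ b]) auto
qed

section \<open>Lifting a basis along \<open>t = 0\<close>\<close>

lemma fps_decompose: "f = fps_const (f $ 0) + fps_X * fps_shift 1 f" for f :: "'a::comm_ring_1 fps"
 by (rule fps_ext) (auto simp: fps_X_mult_nth)

locale fps_free_alg = free_alg A \<phi> b r for A :: "'a ring" (structure) and \<phi> :: "'k::field fps => 'a" and b r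
begin

lemma torsion_free: "x \<in> carrier A ==> \<phi> fps_X \<otimes> x = \<zero> ==> x = \<zero>"
proof (rule eq_zeroI)
 fix i assume x: "x \<in> carrier A" "\<phi> fps_X \<otimes> x = \<zero>" and i: "i < r"
 have "fps_X * co x i = co \<zero> i" using co_scale[OF x(1) i, of fps_X] x(2) by simp
 also have "\<dots> = 0" using co_scale[OF zero_closed i, of 0] by simp
 finally show "co x i = 0" by simp
qed

lemma torsion_free_power: fixes k :: nat shows "x \<in> carrier A ==> \<phi> fps_X [^] k \<otimes> x = \<zero> ==> x = \<zero>"
proof (induction k)
 case (Suc k)
 have "\<phi> fps_X [^] Suc k \<otimes> x = \<phi> fps_X [^] k \<otimes> (\<phi> fps_X \<otimes> x)"
  unfolding nat_pow_Suc using Suc.prems(1) by (intro m_assoc) auto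
 also have "\<dots> = \<phi> fps_X \<otimes> (\<phi> fps_X [^] k \<otimes> x)"
  using Suc.prems(1) by (intro m_lcomm) auto
 finally have "\<phi> fps_X \<otimes> (\<phi> fps_X [^] k \<otimes> x) = \<zero>" using Suc.prems(2) by metis
 then have "\<phi> fps_X [^] k \<otimes> x = \<zero>" by (rule torsion_free[rotated]) (simp add: Suc.prems(1))
 then show ?case by (rule Suc.IH[OF Suc.prems(1)])
qed simp

text \<open>Nakayama's lemma over power series, proved by completeness. Expanding x repeatedly
  modulo X gives the coefficients term by term; the remainder is divisible by every power of X, so
  its coordinates in the known basis \<open>b\<close> vanish. Independence follows by dividing a
  relation by X.\<close>

lemma lift_basis:
 assumes a: "a \<in> {..<M} \<rightarrow> carrier A"
  and sp: "\<And>x. x \<in> carrier A ==> \<exists>s y. y \<in> carrier A \<and> x = lin a M (\<lambda>i. fps_const (s i)) \<oplus> \<phi> fps_X \<otimes> y"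
  and ind: "\<And>s y i. y \<in> carrier A ==> lin a M (\<lambda>i. fps_const (s i)) = \<phi> fps_X \<otimes> y ==> i < M ==> s i = 0"
 shows "free_alg A \<phi> a M"
proof
 show "a \<in> {..<M} \<rightarrow> carrier A" by (rule a)
 have dec: "lin a M s = lin a M (\<lambda>i. fps_const (s i $ 0)) \<oplus> \<phi> fps_X \<otimes> lin a M (\<lambda>i. fps_shift 1 (s i))" for s
  unfolding lin_add[OF a, symmetric] lin_scale[OF a, symmetric] by (rule lin_cong[OF a]) (rule fps_decompose)
 show "\<exists>s. x = lin a M s" if x: "x \<in> carrier A" for x
 proof -
  have "\<forall>x. \<exists>sy. x \<in> carrier A \<longrightarrow> snd sy \<in> carrier A \<and> x = lin a M (\<lambda>i. fps_const (fst sy i)) \<oplus> \<phi> fps_X \<otimes> snd sy"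
  proof
   fix x
   show "\<exists>sy. x \<in> carrier A \<longrightarrow> snd sy \<in> carrier A \<and> x = lin a M (\<lambda>i. fps_const (fst sy i)) \<oplus> \<phi> fps_X \<otimes> snd sy"
   proof (cases "x \<in> carrier A")
    case True
    from sp[OF this] obtain s y where "y \<in> carrier A" "x = lin a M (\<lambda>i. fps_const (s i)) \<oplus> \<phi> fps_X \<otimes> y" by blast
    then show ?thesis by (intro exI[of _ "(s, y)"]) simp
   qed simp
  qed
  from choice[OF this] obtain g where g: "\<And>x. x \<in> carrier A ==> snd (g x) \<in> carrier A"
   "\<And>x. x \<in> carrier A ==> x = lin a M (\<lambda>i. fps_const (fst (g x) i)) \<oplus> \<phi> fps_X \<otimes> snd (g x)" by blast
  define xs where "xs k = ((\<lambda>x. snd (g x)) ^^ k) x" for k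
  have xs: "xs k \<in> carrier A" for k by (induction k) (auto simp: xs_def x g(1))
  have xsS: "xs (Suc k) = snd (g (xs k))" for k by (simp add: xs_def)
  define s where "s k i = Abs_fps (\<lambda>m. fst (g (xs (m + k))) i)" for k i
  have sk: "lin a M (s k) = lin a M (\<lambda>i. fps_const (fst (g (xs k)) i)) \<oplus> \<phi> fps_X \<otimes> lin a M (s (Suc k))" for k
   unfolding lin_add[OF a, symmetric] lin_scale[OF a, symmetric]
   by (rule lin_cong[OF a], rule fps_ext) (auto simp: s_def fps_X_mult_nth)
  \<comment> \<open>The error of the expansion that starts at the k-th remainder. It equals X times
    the error at k + 1, hence is divisible by all powers of X.\<close>
  define D where "D k = xs k \<ominus> lin a M (s k)" for k
  have Dc: "D k \<in> carrier A" for k unfolding D_def using xs lin_closed[OF a] by simp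
  have D: "D k = \<phi> fps_X \<otimes> D (Suc k)" for k
  proof -
   have c1: "lin a M (\<lambda>i. fps_const (fst (g (xs k)) i)) \<in> carrier A" "lin a M (s (Suc k)) \<in> carrier A" by (rule lin_closed[OF a])+
   have "D k = (lin a M (\<lambda>i. fps_const (fst (g (xs k)) i)) \<oplus> \<phi> fps_X \<otimes> xs (Suc k)) \<ominus>
     (lin a M (\<lambda>i. fps_const (fst (g (xs k)) i)) \<oplus> \<phi> fps_X \<otimes> lin a M (s (Suc k)))"
    unfolding D_def sk[symmetric] xsS using g(2)[OF xs[of k]] by simp
   also have "\<dots> = \<phi> fps_X \<otimes> (xs (Suc k) \<ominus> lin a M (s (Suc k)))"
    using c1 xs[of "Suc k"] by (subst minus_cancel) (auto simp: minus_factor)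
   finally show ?thesis by (simp add: D_def)
  qed
  have "co (D k) i $ m = 0" if i: "i < r" for k i m
  proof (induction m arbitrary: k)
   case 0
   have "co (D k) i = fps_X * co (D (Suc k)) i" by (subst D) (rule co_scale[OF Dc i])
   then show ?case by (simp add: fps_X_mult_nth)
  next
   case (Suc m)
   have "co (D k) i = fps_X * co (D (Suc k)) i" by (subst D) (rule co_scale[OF Dc i])
   then show ?case using Suc by (simp add: fps_X_mult_nth)
  qed
  then have "D 0 = \<zero>" by (intro eq_zeroI Dc) (auto intro: fps_ext)
  then have "xs 0 = lin a M (s 0)" unfolding D_def using xs[of 0] lin_closed[OF a, of "s 0"]
   by simp
  then have "x = lin a M (s 0)" by (simp add: xs_def)
  then show ?thesis by blast
 qed
 have "lin a M s = \<zero> ==> \<forall>i<M. s i $ m = 0" for s :: "nat => 'k fps" and m :: nat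
 proof (induction m arbitrary: s)
  case 0
  have c: "\<phi> fps_X \<otimes> lin a M (\<lambda>i. fps_shift 1 (s i)) \<in> carrier A" "lin a M (\<lambda>i. fps_const (s i $ 0)) \<in> carrier A"
   using lin_closed[OF a] by simp_all
  have "lin a M (\<lambda>i. fps_const (s i $ 0)) = \<ominus> (\<phi> fps_X \<otimes> lin a M (\<lambda>i. fps_shift 1 (s i)))"
   using dec[of s] 0 c by (metis minus_equality)
  also have "\<dots> = \<phi> fps_X \<otimes> \<ominus> lin a M (\<lambda>i. fps_shift 1 (s i))"
   using lin_closed[OF a] by (simp add: r_minus)
  finally show ?case using ind[of "\<ominus> lin a M (\<lambda>i. fps_shift 1 (s i))" "\<lambda>i. s i $ 0"] lin_closed[OF a] by simp
 next
  case (Suc m)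
  note L = lin_closed[OF a]
  have "lin a M (\<lambda>i. fps_const (s i $ 0)) = \<phi> fps_X \<otimes> \<ominus> lin a M (\<lambda>i. fps_shift 1 (s i))"
  proof -
   have "lin a M (\<lambda>i. fps_const (s i $ 0)) \<oplus> \<phi> fps_X \<otimes> lin a M (\<lambda>i. fps_shift 1 (s i)) = \<zero>"
    using dec[of s] Suc.prems by simp
   then have "lin a M (\<lambda>i. fps_const (s i $ 0)) = \<ominus> (\<phi> fps_X \<otimes> lin a M (\<lambda>i. fps_shift 1 (s i)))"
    using L by (metis minus_equality m_closed phi_closed)
   then show ?thesis using L by (simp add: r_minus)
  qed
  then have z: "s i $ 0 = 0" if "i < M" for i
   using ind[of "\<ominus> lin a M (\<lambda>i. fps_shift 1 (s i))" "\<lambda>i. s i $ 0"] L that by simp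
  have "lin a M (\<lambda>i. fps_const (s i $ 0)) = lin a M (\<lambda>_. 0)" by (rule lin_cong[OF a]) (simp add: z)
  then have "\<phi> fps_X \<otimes> lin a M (\<lambda>i. fps_shift 1 (s i)) = \<zero>"
   using dec[of s] Suc.prems L by (simp add: lin_zero[OF a])
  then have "lin a M (\<lambda>i. fps_shift 1 (s i)) = \<zero>" by (rule torsion_free[OF L])
  from Suc.IH[OF this] show ?case by simp
 qed
 then show "s i = 0" if "lin a M s = \<zero>" "i < M" for s i
  using that by (intro fps_ext) simp
qed

text \<open>Spanning: an element becomes a value of \<iota> after multiplication by a power of X,
  which is invertible in the Laurent series. Independence: a power of X clears the denominators of a
  relation, and A has no X-torsion.\<close>

lemma localize_basis:
 assumes loc: "is_localization A (\<phi> fps_X) B \<iota>" and psi: "\<psi> \<in> Ring.ring_hom RT B"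
  and comp: "\<And>c. \<psi> (fps_to_fls c) = \<iota> (\<phi> c)"
 shows "free_alg B \<psi> (\<lambda>i. \<iota> (b i)) r"
proof -
 have cB: "cring B" and iota: "\<iota> \<in> Ring.ring_hom A B"
  and fr: "\<And>y. y \<in> carrier B ==> \<exists>a\<in>carrier A. \<exists>k::nat. y \<otimes>\<^bsub>B\<^esub> \<iota> (\<phi> fps_X) [^]\<^bsub>B\<^esub> k = \<iota> a"
  and ker: "\<And>a. a \<in> carrier A ==> \<iota> a = \<zero>\<^bsub>B\<^esub> ==> \<exists>k::nat. \<phi> fps_X [^] k \<otimes> a = \<zero>"
  using loc by (auto simp: is_localization_def)
 interpret B: cring B by fact
 interpret B: lin_alg B \<psi> by unfold_locales (rule psi)
 interpret C: lin_alg B "\<lambda>c. \<iota> (\<phi> c)"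
  by unfold_locales (rule ring_hom_memI, auto simp: phi_add phi_mult ring_hom_closed[OF iota]
    ring_hom_add[OF iota] ring_hom_mult[OF iota] ring_hom_one[OF iota])
 have ib: "(\<lambda>i. \<iota> (b i)) \<in> {..<r} \<rightarrow> carrier B" using ring_hom_closed[OF iota] b by auto
 have il: "\<iota> (lin b r s) = B.lin (\<lambda>i. \<iota> (b i)) r (\<lambda>i. fps_to_fls (s i))" for s
  unfolding hom_lin[OF iota cB b] C.lin_def B.lin_def comp ..
 show ?thesis
 proof
  show "(\<lambda>i. \<iota> (b i)) \<in> {..<r} \<rightarrow> carrier B" by (rule ib)
  show "\<exists>s. y = B.lin (\<lambda>i. \<iota> (b i)) r s" if y: "y \<in> carrier B" for y
  proof -
   obtain a k where a: "a \<in> carrier A" "y \<otimes>\<^bsub>B\<^esub> \<iota> (\<phi> fps_X) [^]\<^bsub>B\<^esub> (k::nat) = \<iota> a" using fr[OF y] by blast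
   have X0: "fps_to_fls (fps_X ^ k :: 'k fps) \<noteq> 0" by simp
   have "\<iota> (\<phi> fps_X) [^]\<^bsub>B\<^esub> k = \<psi> (fps_to_fls (fps_X ^ k))"
    unfolding fps_to_fls_power B.phi_power comp ..
   then have "\<iota> a = y \<otimes>\<^bsub>B\<^esub> \<psi> (fps_to_fls (fps_X ^ k))" using a(2) by simp
   then have "\<psi> (inverse (fps_to_fls (fps_X ^ k))) \<otimes>\<^bsub>B\<^esub> \<iota> a
     = \<psi> (inverse (fps_to_fls (fps_X ^ k))) \<otimes>\<^bsub>B\<^esub> (y \<otimes>\<^bsub>B\<^esub> \<psi> (fps_to_fls (fps_X ^ k)))" by (rule arg_cong)
   also have "\<dots> = y \<otimes>\<^bsub>B\<^esub> \<psi> (fps_to_fls (fps_X ^ k) * inverse (fps_to_fls (fps_X ^ k)))"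
    unfolding mult.commute[of "fps_to_fls _"] B.phi_mult using y by (intro B.m_lcomm) auto
   also have "fps_to_fls (fps_X ^ k :: 'k fps) * inverse (fps_to_fls (fps_X ^ k)) = 1" using X0 by (rule right_inverse)
   finally have "y = \<psi> (inverse (fps_to_fls (fps_X ^ k))) \<otimes>\<^bsub>B\<^esub> \<iota> (lin b r (co a))"
    using y lin_co[OF a(1)] by simp
   also have "\<dots> = B.lin (\<lambda>i. \<iota> (b i)) r (\<lambda>i. inverse (fps_to_fls (fps_X ^ k)) * fps_to_fls (co a i))"
    by (simp only: il B.lin_scale[OF ib])
   finally show ?thesis by blast
  qed
  show "s i = 0" if s: "B.lin (\<lambda>i. \<iota> (b i)) r s = \<zero>\<^bsub>B\<^esub>" and i: "i < r" for s i
  proof -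
   have "- int (\<Sum>i<r. nat (- fls_subdegree (s i))) \<le> fls_subdegree (s i)" if "i < r" for i
   proof -
    have "nat (- fls_subdegree (s i)) \<le> (\<Sum>i<r. nat (- fls_subdegree (s i)))"
     using that by (intro member_le_sum) auto
    then show ?thesis by linarith
   qed
   then obtain k where k: "\<And>i. i < r ==> - int k \<le> fls_subdegree (s i)" by blast
   define t where "t i = fls_regpart (fls_X ^ k * s i)" for i
   have t: "fps_to_fls (t i) = fls_X ^ k * s i" if "i < r" for i
   proof (cases "s i = 0")
    case False
    have "fls_subdegree (fls_X ^ k * s i) = int k + fls_subdegree (s i)"
     using False by (simp add: fls_subdegree_pow)
    then have "fls_subdegree (fls_X ^ k * s i) \<ge> 0" using k[OF that] by simp
    then show ?thesis unfolding t_def by (rule fls_regpart_to_fls_trivial)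
   qed (simp add: t_def)
   have "\<iota> (lin b r t) = B.lin (\<lambda>i. \<iota> (b i)) r (\<lambda>i. fls_X ^ k * s i)"
    unfolding il by (rule B.lin_cong[OF ib]) (rule t)
   also have "\<dots> = \<zero>\<^bsub>B\<^esub>" by (simp add: B.lin_scale[OF ib] s)
   finally obtain m where "\<phi> fps_X [^] (m::nat) \<otimes> lin b r t = \<zero>" using ker[OF lin_closed[OF b]] by blast
   then have "lin b r t = \<zero>" by (rule torsion_free_power[OF lin_closed[OF b]])
   then have "t i = 0" by (rule indep[OF _ i])
   then have "fls_X ^ k * s i = 0" using t[OF i] by simp
   then show ?thesis by simp
  qed
 qed
qed

end

section \<open>Quotient rings and lifting of homomorphisms\<close>

lemma quot_hom: "ideal I R ==> (\<lambda>x. I +>\<^bsub>R\<^esub> x) \<in> Ring.ring_hom R (R Quot I)"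
 by (rule ideal.rcos_ring_hom)

text \<open>A quotient realised on the values of an encoding \<open>e\<close> that separates exactly
  the classes modulo \<open>I\<close>. It moves quotients to the carrier types that
  \<open>smoothable\<close> and \<open>formally_smooth\<close> prescribe.\<close>

lemma image_ring_quotient:
 assumes "cring R" "ideal I R" "\<And>x y. x \<in> carrier R ==> y \<in> carrier R ==> e x = e y \<longleftrightarrow> x \<ominus>\<^bsub>R\<^esub> y \<in> I"
 shows "cring (image_ring e R)" "e \<in> Ring.ring_hom R (image_ring e R)"
proof -
 interpret cring R by fact
 have w: "weak_ring_morphism e I R" by (rule weak_ring_morphismI[OF assms(2,3)])
 show h: "e \<in> Ring.ring_hom R (image_ring e R)" by (rule weak_ring_morphism_is_hom[OF w])
 show "cring (image_ring e R)"
  by (rule cring_surj_image[OF assms(1) image_ring_is_ring[OF w] h]) (simp add: image_ring_carrier)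
qed

lemma (in cring) minus_hom:
 assumes "h \<in> Ring.ring_hom R S" "cring S" "x \<in> carrier R" "y \<in> carrier R"
 shows "h (x \<ominus> y) = h x \<ominus>\<^bsub>S\<^esub> h y"
proof -
 interpret S: cring S by fact
 interpret h: ring_hom_cring R S h by unfold_locales fact
 show ?thesis using assms(3,4) by (simp add: a_minus_def)
qed

lemma (in cring) add_minus_cancel: "x \<in> carrier R ==> y \<in> carrier R ==> y \<oplus> (x \<ominus> y) = x"
 by algebra

lemma (in cring) m_rotate: "x \<in> carrier R ==> y \<in> carrier R ==> z \<in> carrier R ==> x \<otimes> y \<otimes> z = y \<otimes> z \<otimes> x"
 by algebra

lemma ideal_image:
 assumes "cring R" "cring S" "h \<in> Ring.ring_hom R S" "h ` carrier R = carrier S" "ideal J R"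
 shows "ideal (h ` J) S"
proof -
 interpret R: cring R by fact
 interpret S: cring S by fact
 interpret h: ring_hom_cring R S h by unfold_locales fact
 interpret J: ideal J R by fact
 have Jc: "j \<in> J ==> j \<in> carrier R" for j using J.a_subset by auto
 show ?thesis
 proof (rule idealI)
  show "ring S" ..
  show "subgroup (h ` J) (add_monoid S)"
  proof (rule subgroup.intro)
   show "h ` J \<subseteq> carrier (add_monoid S)" using Jc by auto
   show "\<one>\<^bsub>add_monoid S\<^esub> \<in> h ` J"
    using imageI[OF additive_subgroup.zero_closed[OF J.is_additive_subgroup], of h] by simp
  next
   fix x y assume "x \<in> h ` J" "y \<in> h ` J"
   then obtain i j where "i \<in> J" "j \<in> J" "x = h i" "y = h j" by blast
   then show "x \<otimes>\<^bsub>add_monoid S\<^esub> y \<in> h ` J"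
    using imageI[OF additive_subgroup.a_closed[OF J.is_additive_subgroup, of i j], of h] Jc by simp
  next
   fix x assume "x \<in> h ` J"
   then obtain j where j: "j \<in> J" "x = h j" by blast
   then have "\<ominus>\<^bsub>S\<^esub> x = h (\<ominus>\<^bsub>R\<^esub> j)" using Jc by simp
   moreover have "\<ominus>\<^bsub>R\<^esub> j \<in> J" by (rule additive_subgroup.a_inv_closed[OF J.is_additive_subgroup j(1)])
   ultimately show "inv\<^bsub>add_monoid S\<^esub> x \<in> h ` J" unfolding a_inv_def[symmetric] by blast
  qed
 next
  fix a x assume a: "a \<in> h ` J" and x: "x \<in> carrier S"
  then obtain j y where j: "j \<in> J" "a = h j" and y: "y \<in> carrier R" "x = h y" using assms(4) by blast
  have "y \<otimes>\<^bsub>R\<^esub> j \<in> J" "j \<otimes>\<^bsub>R\<^esub> y \<in> J" using J.I_l_closed J.I_r_closed j y by auto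
  moreover have "x \<otimes>\<^bsub>S\<^esub> a = h (y \<otimes>\<^bsub>R\<^esub> j)" "a \<otimes>\<^bsub>S\<^esub> x = h (j \<otimes>\<^bsub>R\<^esub> y)" using j y Jc by simp_all
  ultimately show "x \<otimes>\<^bsub>S\<^esub> a \<in> h ` J" "a \<otimes>\<^bsub>S\<^esub> x \<in> h ` J" by simp_all
 qed
qed

text \<open>\<open>formally_smooth\<close> quantifies over algebras on the type
  \<open>'r mpoly\<close>; the encoding \<open>e\<close> places the quotient by \<open>I\<close>
  there. The homomorphisms to the quotients by \<open>J\<close> and \<open>I\<close> are given by
  representatives \<open>w\<close> and \<open>v\<close>, which obey the homomorphism laws up to
  \<open>J\<close> and up to \<open>I\<close>.\<close>

lemma formally_smooth_lift:
 fixes \<eta> :: "'r::comm_ring_1 => 'e::comm_ring_1" and e :: "'e => 'r mpoly"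
 assumes fs: "formally_smooth \<psi> B" and psi: "\<psi> \<in> Ring.ring_hom RT B" and cB: "cring B"
  and \<eta>: "comm_ring_hom \<eta>"
  and I: "ideal I RT" and J: "ideal J RT" and IJ: "I \<subseteq> J"
  and sq: "\<And>x y. x \<in> J ==> y \<in> J ==> x * y \<in> I"
  and e: "\<And>x y. e x = e y \<longleftrightarrow> x - y \<in> I"
  and w1: "w \<one>\<^bsub>B\<^esub> - 1 \<in> J" and w\<psi>: "\<And>c. w (\<psi> c) - \<eta> c \<in> J"
  and wa: "\<And>x y. x \<in> carrier B ==> y \<in> carrier B ==> w (x \<oplus>\<^bsub>B\<^esub> y) - (w x + w y) \<in> J"
  and wm: "\<And>x y. x \<in> carrier B ==> y \<in> carrier B ==> w (x \<otimes>\<^bsub>B\<^esub> y) - w x * w y \<in> J"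
 shows "\<exists>v. (\<forall>x\<in>carrier B. \<forall>y\<in>carrier B. v (x \<oplus>\<^bsub>B\<^esub> y) - (v x + v y) \<in> I \<and> v (x \<otimes>\<^bsub>B\<^esub> y) - v x * v y \<in> I)
  \<and> (\<forall>c. v (\<psi> c) - \<eta> c \<in> I) \<and> (\<forall>x\<in>carrier B. v x - w x \<in> J)"
proof -
 interpret \<eta>: comm_ring_hom \<eta> by fact
 interpret B: cring B by fact
 define C where "C = image_ring e (RT :: 'e ring)"
 have C: "cring C" "e \<in> Ring.ring_hom RT C"
  using image_ring_quotient[OF cring_RT I, of e] e unfolding C_def by simp_all
 have cC: "carrier C = range e" by (simp add: C_def image_ring_carrier)
 interpret C: cring C by (rule C(1))
 have em: "e x \<otimes>\<^bsub>C\<^esub> e y = e (x * y)" and ea: "e x \<oplus>\<^bsub>C\<^esub> e y = e (x + y)" and e1: "\<one>\<^bsub>C\<^esub> = e 1"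
  and e0: "\<zero>\<^bsub>C\<^esub> = e 0" and ed: "e x \<ominus>\<^bsub>C\<^esub> e y = e (x - y)" for x y
  using ring_hom_mult[OF C(2), of x y] ring_hom_add[OF C(2), of x y] ring_hom_one[OF C(2)]
   ring_hom_zero'[OF C(2) cring_RT C(1)] cring.minus_hom[OF cring_RT C(2,1), of x y] by simp_all
 define M where "M = e ` J"
 have M: "ideal M C" unfolding M_def by (rule ideal_image[OF cring_RT C _ J]) (simp add: cC)
 have MJ: "e x \<in> M \<longleftrightarrow> x \<in> J" for x
 proof (rule iffI)
  assume "e x \<in> M"
  then obtain j where j: "j \<in> J" "e x = e j" by (auto simp: M_def)
  then have "x - j \<in> J" using e IJ by blast
  then have "(x - j) + j \<in> J" using additive_subgroup.a_closed[OF ideal.axioms(1)[OF J], of "x - j" j] j(1) by simp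
  then show "x \<in> J" by simp
 qed (simp add: M_def)
 have Msq: "x \<otimes>\<^bsub>C\<^esub> y = \<zero>\<^bsub>C\<^esub>" if "x \<in> M" "y \<in> M" for x y
  using that sq e0 em e unfolding M_def by fastforce
 have cos: "M +>\<^bsub>C\<^esub> e x = M +>\<^bsub>C\<^esub> e y \<longleftrightarrow> x - y \<in> J" for x y
  using coset_eq_iff[OF M, of "e x" "e y"] by (simp add: cC ed MJ)
 define \<chi> where "\<chi> c = e (\<eta> c)" for c
 have \<chi>: "is_algebra \<chi> C" unfolding is_algebra_def
  by (intro conjI C(1) ring_hom_memI)
    (simp_all add: \<chi>_def cC em ea e1 \<eta>.hom_mult \<eta>.hom_add)
 note q = quot_hom[OF M]
 have wu: "(\<lambda>b. M +>\<^bsub>C\<^esub> e (w b)) \<in> alg_hom \<psi> B (quot_map \<chi> C M) (C Quot M)"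
  unfolding alg_hom_def quot_map_def mem_Collect_eq
 proof (intro conjI allI ring_hom_memI)
  show "M +>\<^bsub>C\<^esub> e (w x) \<in> carrier (C Quot M)" for x using ring_hom_closed[OF q] by (simp add: cC)
  show "M +>\<^bsub>C\<^esub> e (w (x \<otimes>\<^bsub>B\<^esub> y)) = (M +>\<^bsub>C\<^esub> e (w x)) \<otimes>\<^bsub>C Quot M\<^esub> (M +>\<^bsub>C\<^esub> e (w y))"
   if "x \<in> carrier B" "y \<in> carrier B" for x y
   unfolding cos[THEN iffD2, OF wm[OF that]] using ring_hom_mult[OF q, of "e (w x)" "e (w y)"] by (simp add: cC em)
  show "M +>\<^bsub>C\<^esub> e (w (x \<oplus>\<^bsub>B\<^esub> y)) = (M +>\<^bsub>C\<^esub> e (w x)) \<oplus>\<^bsub>C Quot M\<^esub> (M +>\<^bsub>C\<^esub> e (w y))"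
   if "x \<in> carrier B" "y \<in> carrier B" for x y
   unfolding cos[THEN iffD2, OF wa[OF that]] using ring_hom_add[OF q, of "e (w x)" "e (w y)"] by (simp add: cC ea)
  show "M +>\<^bsub>C\<^esub> e (w \<one>\<^bsub>B\<^esub>) = \<one>\<^bsub>C Quot M\<^esub>" 
   unfolding cos[THEN iffD2, OF w1] using ring_hom_one[OF q] by (simp add: e1)
  show "M +>\<^bsub>C\<^esub> e (w (\<psi> c)) = M +>\<^bsub>C\<^esub> \<chi> c" for c unfolding \<chi>_def cos by (rule w\<psi>)
 qed
 have Msq': "\<forall>x\<in>M. \<forall>y\<in>M. x \<otimes>\<^bsub>C\<^esub> y = \<zero>\<^bsub>C\<^esub>" using Msq by blast
 obtain v0 where v0: "v0 \<in> alg_hom \<psi> B \<chi> C" "\<forall>b\<in>carrier B. M +>\<^bsub>C\<^esub> v0 b = M +>\<^bsub>C\<^esub> e (w b)"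
  using fs[unfolded formally_smooth_def, rule_format, OF wu conjI[OF \<chi> conjI[OF M Msq']]] by blast
 have h: "v0 \<in> Ring.ring_hom B C" and hc: "\<And>c. v0 (\<psi> c) = \<chi> c" using v0(1) by (auto simp: alg_hom_def)
 define v where "v b = (SOME x. e x = v0 b)" for b
 have v: "e (v b) = v0 b" if "b \<in> carrier B" for b
 proof -
  have "\<exists>x. e x = v0 b" using ring_hom_closed[OF h that] unfolding cC by auto
  then show ?thesis unfolding v_def by (rule someI_ex)
 qed
 show ?thesis
 proof (intro exI[of _ v] conjI ballI allI)
  show "v (x \<oplus>\<^bsub>B\<^esub> y) - (v x + v y) \<in> I" if "x \<in> carrier B" "y \<in> carrier B" for x y
   using that ring_hom_add[OF h that] by (simp add: v flip: e ea)
  show "v (x \<otimes>\<^bsub>B\<^esub> y) - v x * v y \<in> I" if "x \<in> carrier B" "y \<in> carrier B" for x y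
   using that ring_hom_mult[OF h that] by (simp add: v flip: e em)
  show "v (\<psi> c) - \<eta> c \<in> I" for c
   using ring_hom_closed[OF psi, of c] hc[of c] by (simp add: v \<chi>_def flip: e)
  show "v x - w x \<in> J" if "x \<in> carrier B" for x
   using v0(2)[rule_format, OF that] v[OF that] cos by metis
 qed
qed

section \<open>Truncated power series and their encoding\<close>

definition fps_trunc_ideal :: "nat => 'a::comm_ring_1 fps set" where
 "fps_trunc_ideal N = {f. \<forall>j<N. f $ j = 0}"

lemma fps_trunc_ideal_add: "f \<in> fps_trunc_ideal N ==> g \<in> fps_trunc_ideal N ==> f + g \<in> fps_trunc_ideal N"
 and fps_trunc_ideal_diff: "f \<in> fps_trunc_ideal N ==> g \<in> fps_trunc_ideal N ==> f - g \<in> fps_trunc_ideal N"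
 and fps_trunc_ideal_uminus: "f \<in> fps_trunc_ideal N ==> - f \<in> fps_trunc_ideal N"
 and fps_trunc_ideal_0: "0 \<in> fps_trunc_ideal N"
 by (simp_all add: fps_trunc_ideal_def)

lemma fps_trunc_ideal_mult: "g \<in> fps_trunc_ideal N ==> f * g \<in> fps_trunc_ideal N"
 by (auto simp: fps_trunc_ideal_def fps_mult_nth intro!: sum.neutral)

lemma fps_trunc_ideal_mult': "g \<in> fps_trunc_ideal N ==> g * f \<in> fps_trunc_ideal N"
 using fps_trunc_ideal_mult[of g N f] by (simp add: mult.commute)

lemma fps_trunc_ideal_sum: "(\<And>x. x \<in> A ==> f x \<in> fps_trunc_ideal N) ==> sum f A \<in> fps_trunc_ideal N"
 by (auto simp: fps_trunc_ideal_def fps_sum_nth intro!: sum.neutral)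

lemma fps_trunc_ideal: "ideal (fps_trunc_ideal N) RT"
proof (rule idealI)
 show "ring RT" by (rule cring.axioms(1)[OF cring_RT])
 show "subgroup (fps_trunc_ideal N) (add_monoid RT)"
  by (rule subgroup.intro, unfold a_inv_def[symmetric])
    (auto simp: fps_trunc_ideal_add fps_trunc_ideal_0 fps_trunc_ideal_uminus)
qed (simp_all add: fps_trunc_ideal_mult fps_trunc_ideal_mult')

lemma fps_trunc_ideal_square:
 assumes "f \<in> fps_trunc_ideal N" "g \<in> fps_trunc_ideal N" "N \<ge> 1"
 shows "f * g \<in> fps_trunc_ideal (Suc N)"
proof -
 have "f $ i * g $ (j - i) = 0" if "j \<le> N" "i \<le> j" for i j
  using assms that by (cases "i < N") (auto simp: fps_trunc_ideal_def)
 then show ?thesis by (auto simp: fps_trunc_ideal_def fps_mult_nth less_Suc_eq_le intro!: sum.neutral)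
qed

text \<open>An algebraic element is coded by a nonzero polynomial over the base field of which it is
  a root, together with its number among the finitely many roots, stored as an extra lowest
  coefficient. The numbers embed in the base field by characteristic zero.\<close>

lemma alg_closure_encoding: "\<exists>g :: 'l::field_char_0 alg_closure => 'l poly. inj g"
proof -
 define p where "p x = (SOME p. p \<noteq> 0 \<and> poly (map_poly to_ac p) x = 0)" for x :: "'l alg_closure"
 have p: "p x \<noteq> 0 \<and> poly (map_poly to_ac (p x)) x = 0" for x
 proof -
  obtain q :: "'l poly" where "q \<noteq> 0" "poly (map_poly to_ac q) x = 0" by (rule alg_closure_algebraic)
  then show ?thesis unfolding p_def by (intro someI_ex[of "\<lambda>p. p \<noteq> 0 \<and> poly (map_poly to_ac p) x = 0"]) blast
 qed
 have "finite {x. poly (map_poly to_ac q) x = 0}" if "q \<noteq> 0" for q :: "'l poly"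
 proof (rule poly_roots_finite)
  have "coeff (map_poly to_ac q) (degree q) \<noteq> 0" using that by (simp add: coeff_map_poly)
  then show "map_poly to_ac q \<noteq> 0" by (metis coeff_0)
 qed
 then have "\<exists>h. inj_on (h :: _ => nat) {x. poly (map_poly to_ac q) x = 0}" if "q \<noteq> 0" for q :: "'l poly"
  using that finite_imp_inj_to_nat_seg by blast
 then have h: "inj_on (SOME h. inj_on (h :: _ => nat) {x. poly (map_poly to_ac q) x = 0}) {x. poly (map_poly to_ac q) x = 0}"
  if "q \<noteq> 0" for q :: "'l poly" using that by (metis (mono_tags, lifting) someI_ex)
 define h where "h q = (SOME h. inj_on (h :: _ => nat) {x. poly (map_poly to_ac q) x = 0})" for q :: "'l poly"
 have "inj (\<lambda>x. pCons (of_nat (h (p x) x)) (p x))"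
 proof (rule injI)
  fix x y assume "pCons (of_nat (h (p x) x)) (p x) = pCons (of_nat (h (p y) y)) (p y)"
  then have "p x = p y" "h (p x) x = h (p y) y" unfolding pCons_eq_iff of_nat_eq_iff by blast+
  then have "p x = p y" "h (p x) x = h (p x) y" by metis+
  moreover have "inj_on (h (p x)) {z. poly (map_poly to_ac (p x)) z = 0}" unfolding h_def using p by (intro h) blast
  ultimately show "x = y" using p[of x] p[of y] by (auto dest: inj_onD)
 qed
 then show ?thesis by blast
qed

lemma fps_trunc_encoding:
 "\<exists>e :: 'l::field_char_0 alg_closure fps => 'l mpoly. \<forall>x y. e x = e y \<longleftrightarrow> x - y \<in> fps_trunc_ideal N"
proof -
 obtain g :: "'l alg_closure => 'l poly" where g: "inj g" using alg_closure_encoding by blast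
 \<comment> \<open>The i-th coefficient of the code of the j-th series coefficient sits at exponent
   \<open>Suc i\<close> of the variable j: with exponent 0 the monomials for different j would
   coincide.\<close>
 define e :: "'l alg_closure fps => 'l mpoly" where
  "e x = (\<Sum>j<N. \<Sum>i\<le>degree (g (x $ j)). single (single j (Suc i)) (coeff (g (x $ j)) i))" for x
 have l: "lookup (e x) (single j (Suc i)) = coeff (g (x $ j)) i" if "j < N" for x j i
 proof -
  have s: "single j' (Suc i') = single j (Suc i) \<longleftrightarrow> j' = j \<and> i' = i" for j' i'
   by (metis lookup_single_eq lookup_single_not_eq nat.inject nat.distinct(1))
  have "lookup (e x) (single j (Suc i)) = (\<Sum>j'<N. \<Sum>i'\<le>degree (g (x $ j')). if j' = j \<and> i' = i then coeff (g (x $ j')) i' else 0)"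
   unfolding e_def lookup_sum by (intro sum.cong refl) (simp only: lookup_single when_def s)
  also have "\<dots> = (\<Sum>j'<N. if j' = j then (\<Sum>i'\<le>degree (g (x $ j)). if i' = i then coeff (g (x $ j)) i' else 0) else 0)"
   by (intro sum.cong refl) (auto intro!: sum.neutral)
  also have "\<dots> = (\<Sum>i'\<le>degree (g (x $ j)). if i' = i then coeff (g (x $ j)) i' else 0)" using that by (subst sum.delta) auto
  also have "\<dots> = coeff (g (x $ j)) i" by (subst sum.delta) (auto simp: coeff_eq_0)
  finally show ?thesis .
 qed
 have "e x = e y \<longleftrightarrow> x - y \<in> fps_trunc_ideal N" for x y
 proof
  assume "e x = e y"
  then have "g (x $ j) = g (y $ j)" if "j < N" for j using l[OF that] by (intro poly_eqI) metis
  then show "x - y \<in> fps_trunc_ideal N" using g by (auto simp: fps_trunc_ideal_def dest: injD)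
 next
  assume "x - y \<in> fps_trunc_ideal N"
  then show "e x = e y" unfolding e_def by (intro sum.cong refl) (auto simp: fps_trunc_ideal_def)
 qed
 then show ?thesis by blast
qed

lemma comm_ring_hom_fps_const_to_ac: "comm_ring_hom (\<lambda>c. fps_const (to_ac c))"
 by unfold_locales (simp_all add: fps_const_mult[symmetric] del: fps_const_mult)

text \<open>A formal point modulo X^N is a homomorphism from B to truncated power series over the
  algebraic closure. Formal smoothness, applied through the encoding, lifts it by one order; the
  values on the basis form the new point.\<close>

lemma smooth_lift:
 fixes g :: "nat => nat => nat => 'l::field_char_0"
 assumes fa: "free_alg B \<psi> bs (Suc n)" and fs: "formally_smooth \<psi> B" and b0: "bs 0 = \<one>\<^bsub>B\<^esub>"
  and tab: "\<And>i j. i \<le> n ==> j \<le> n ==> bs i \<otimes>\<^bsub>B\<^esub> bs j = lin_alg.lin B \<psi> bs (Suc n) (g i j)"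
 shows "liftable n (\<lambda>i j k. to_ac (g i j k))"
 unfolding liftable_def
proof (intro allI impI)
 fix N' and Z :: "nat => 'l alg_closure fps"
 assume fp: "formal_point n (\<lambda>i j k. to_ac (g i j k)) (Suc N') Z"
 define N where "N = Suc N'"
 have N: "N \<ge> 1" and Z0: "Z 0 = 1" using fp by (simp_all add: N_def formal_point_def)
 have Z: "Z i * Z k - (\<Sum>l\<le>n. fps_const (to_ac (g i k l)) * Z l) \<in> fps_trunc_ideal N" if "i \<le> n" "k \<le> n" for i k
  using fp that unfolding formal_point_def fps_trunc_ideal_def N_def by blast
 interpret B: free_alg B \<psi> bs "Suc n" by fact
 define \<eta> :: "'l => 'l alg_closure fps" where "\<eta> c = fps_const (to_ac c)" for c
 interpret \<eta>: comm_ring_hom \<eta> unfolding \<eta>_def by (rule comm_ring_hom_fps_const_to_ac)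
 obtain e :: "'l alg_closure fps => 'l mpoly" where e: "\<And>x y. e x = e y \<longleftrightarrow> x - y \<in> fps_trunc_ideal (Suc N)"
  using fps_trunc_encoding by blast
 define w where "w x = (\<Sum>i<Suc n. \<eta> (B.co x i) * Z i)" for x
 have wlin: "w (B.lin bs (Suc n) s) = (\<Sum>i<Suc n. \<eta> (s i) * Z i)" for s
  unfolding w_def by (intro sum.cong refl) (simp add: B.co_lin)
 have \<psi>lin: "\<psi> c = B.lin bs (Suc n) (\<lambda>i. c * (if 0 = i then 1 else 0))" for c
  unfolding B.lin_scale[OF B.b] B.lin_unit[OF B.b zero_less_Suc] b0 by simp
 have w\<psi>: "w (\<psi> c) = \<eta> c" for c
  unfolding \<psi>lin[of c] wlin by (subst sum.lessThan_Suc_shift) (simp add: Z0)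
 have w1: "w \<one>\<^bsub>B\<^esub> = 1" using w\<psi>[of 1] by simp
 have wa: "w (x \<oplus>\<^bsub>B\<^esub> y) = w x + w y" if "x \<in> carrier B" "y \<in> carrier B" for x y
  unfolding w_def sum.distrib[symmetric]
  by (intro sum.cong refl) (simp add: B.co_add[OF that] \<eta>.hom_add distrib_right)
 have wm: "w (x \<otimes>\<^bsub>B\<^esub> y) - w x * w y \<in> fps_trunc_ideal N" if x: "x \<in> carrier B" "y \<in> carrier B" for x y
 proof -
  have "x \<otimes>\<^bsub>B\<^esub> y = B.lin bs (Suc n) (B.co x) \<otimes>\<^bsub>B\<^esub> B.lin bs (Suc n) (B.co y)" using x by (simp only: B.lin_co)
  also have "\<dots> = B.lin bs (Suc n) (\<lambda>k. \<Sum>i<Suc n. B.co x i * (\<Sum>j<Suc n. B.co y j * g j i k))"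
   by (rule B.lin_mult_table(2)[OF B.b]) (simp add: tab)
  finally have "w (x \<otimes>\<^bsub>B\<^esub> y) = (\<Sum>k<Suc n. \<eta> (\<Sum>i<Suc n. B.co x i * (\<Sum>j<Suc n. B.co y j * g j i k)) * Z k)"
   using wlin by simp
  also have "\<dots> = (\<Sum>k<Suc n. \<Sum>i<Suc n. \<Sum>j<Suc n. \<eta> (B.co x i) * \<eta> (B.co y j) * (\<eta> (g j i k) * Z k))"
   by (simp only: \<eta>.hom_sum \<eta>.hom_mult sum_distrib_left sum_distrib_right mult.assoc)
  also have "\<dots> = (\<Sum>i<Suc n. \<Sum>j<Suc n. \<Sum>k<Suc n. \<eta> (B.co x i) * \<eta> (B.co y j) * (\<eta> (g j i k) * Z k))"
   by (subst sum.swap) (rule sum.cong[OF refl], rule sum.swap)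
  also have "\<dots> = (\<Sum>i<Suc n. \<Sum>j<Suc n. \<eta> (B.co x i) * \<eta> (B.co y j) * (\<Sum>k<Suc n. \<eta> (g j i k) * Z k))"
   by (simp only: sum_distrib_left)
  finally have 1: "w (x \<otimes>\<^bsub>B\<^esub> y) = \<dots>" .
  have 2: "w x * w y = (\<Sum>i<Suc n. \<Sum>j<Suc n. \<eta> (B.co x i) * \<eta> (B.co y j) * (Z j * Z i))"
   unfolding w_def sum_product by (intro sum.cong refl) (simp only: ac_simps)
  have "w (x \<otimes>\<^bsub>B\<^esub> y) - w x * w y = (\<Sum>i<Suc n. \<Sum>j<Suc n. \<eta> (B.co x i) * \<eta> (B.co y j) * ((\<Sum>k<Suc n. \<eta> (g j i k) * Z k) - Z j * Z i))"
   unfolding 1 2 by (simp only: sum_subtractf right_diff_distrib)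
  also have "\<dots> \<in> fps_trunc_ideal N"
  proof (intro fps_trunc_ideal_sum fps_trunc_ideal_mult)
   fix i j assume "i \<in> {..<Suc n}" "j \<in> {..<Suc n}"
   then have "- (Z j * Z i - (\<Sum>k\<le>n. \<eta> (g j i k) * Z k)) \<in> fps_trunc_ideal N"
    using Z[of j i] unfolding \<eta>_def by (intro fps_trunc_ideal_uminus) auto
   then show "(\<Sum>k<Suc n. \<eta> (g j i k) * Z k) - Z j * Z i \<in> fps_trunc_ideal N" by (simp add: lessThan_Suc_atMost)
  qed
  finally show ?thesis .
 qed
 let ?I = "fps_trunc_ideal (Suc N) :: 'l alg_closure fps set" and ?J = "fps_trunc_ideal N :: 'l alg_closure fps set"
 have sub: "?I \<subseteq> ?J" by (auto simp: fps_trunc_ideal_def)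
 have w1': "w \<one>\<^bsub>B\<^esub> - 1 \<in> ?J" and w\<psi>': "\<And>c. w (\<psi> c) - \<eta> c \<in> ?J"
  and wa': "\<And>x y. x \<in> carrier B ==> y \<in> carrier B ==> w (x \<oplus>\<^bsub>B\<^esub> y) - (w x + w y) \<in> ?J"
  by (simp_all add: w1 w\<psi> wa fps_trunc_ideal_0)
 have "\<exists>v. (\<forall>x\<in>carrier B. \<forall>y\<in>carrier B. v (x \<oplus>\<^bsub>B\<^esub> y) - (v x + v y) \<in> ?I \<and> v (x \<otimes>\<^bsub>B\<^esub> y) - v x * v y \<in> ?I)
  \<and> (\<forall>c. v (\<psi> c) - \<eta> c \<in> ?I) \<and> (\<forall>x\<in>carrier B. v x - w x \<in> ?J)"
  by (rule formally_smooth_lift[where w = w and e = e, OF fs B.phi B.is_cring \<eta>.comm_ring_hom_axioms fps_trunc_ideal fps_trunc_ideal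
   sub fps_trunc_ideal_square[OF _ _ N] e w1' w\<psi>' wa' wm])
 then obtain v where va: "\<And>x y. x \<in> carrier B ==> y \<in> carrier B ==> v (x \<oplus>\<^bsub>B\<^esub> y) - (v x + v y) \<in> ?I"
  and vm: "\<And>x y. x \<in> carrier B ==> y \<in> carrier B ==> v (x \<otimes>\<^bsub>B\<^esub> y) - v x * v y \<in> ?I"
  and v\<psi>: "\<And>c. v (\<psi> c) - \<eta> c \<in> ?I" and vw: "\<And>x. x \<in> carrier B ==> v x - w x \<in> ?J"
  by blast
 have IJ: "f \<in> ?J" if "f \<in> ?I" for f using that by (auto simp: fps_trunc_ideal_def)
 have vlin: "v (B.lin bs M s) - (\<Sum>l<M. \<eta> (s l) * v (bs l)) \<in> ?I" if "M \<le> Suc n" for M s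
  using that
 proof (induction M)
  case 0
  have "v (\<psi> 0) - \<eta> 0 \<in> ?I" by (rule v\<psi>)
  then show ?case by (simp add: B.lin_def)
 next
  case (Suc M)
  have bM: "bs M \<in> carrier B" and bM': "bs \<in> {..<M} \<rightarrow> carrier B" using B.b Suc.prems by auto
  have l: "B.lin bs (Suc M) s = \<psi> (s M) \<otimes>\<^bsub>B\<^esub> bs M \<oplus>\<^bsub>B\<^esub> B.lin bs M s"
   unfolding B.lin_def lessThan_Suc using bM bM' by (subst B.finsum_insert) auto
  have c: "\<psi> (s M) \<otimes>\<^bsub>B\<^esub> bs M \<in> carrier B" "B.lin bs M s \<in> carrier B" using bM B.lin_closed[OF bM'] by auto
  have "v (B.lin bs (Suc M) s) - (\<Sum>l<Suc M. \<eta> (s l) * v (bs l)) =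
   (v (\<psi> (s M) \<otimes>\<^bsub>B\<^esub> bs M \<oplus>\<^bsub>B\<^esub> B.lin bs M s) - (v (\<psi> (s M) \<otimes>\<^bsub>B\<^esub> bs M) + v (B.lin bs M s)))
   + (v (\<psi> (s M) \<otimes>\<^bsub>B\<^esub> bs M) - v (\<psi> (s M)) * v (bs M)) + v (bs M) * (v (\<psi> (s M)) - \<eta> (s M))
   + (v (B.lin bs M s) - (\<Sum>l<M. \<eta> (s l) * v (bs l)))"
   unfolding l by (simp add: algebra_simps)
  also have "\<dots> \<in> ?I" using Suc bM c
   by (intro fps_trunc_ideal_add fps_trunc_ideal_mult va vm v\<psi>) auto
  finally show ?case .
 qed
 \<comment> \<open>\<open>v\<close> preserves the unit only up to the ideal, whereas
   \<open>formal_point\<close> demands the value 1 exactly.\<close>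
 define Y where "Y i = (if i = 0 then 1 else v (bs i))" for i
 have bi: "bs i \<in> carrier B" if "i \<le> n" for i using B.b that by auto
 have Yv: "Y i - v (bs i) \<in> ?I" for i
  using fps_trunc_ideal_uminus[OF v\<psi>[of 1]] by (simp add: Y_def b0 fps_trunc_ideal_0)
 have "Y i - Z i \<in> ?J" if i: "i \<le> n" for i
 proof -
  have wb: "w (bs i) = Z i"
  proof -
   have "w (bs i) = (\<Sum>k<Suc n. \<eta> (if i = k then 1 else 0) * Z k)"
    using wlin[of "\<lambda>k. if i = k then 1 else 0"] B.lin_unit[OF B.b, of i] i by simp
   also have "\<dots> = (\<Sum>k<Suc n. if i = k then Z k else 0)" by (intro sum.cong) auto
   also have "\<dots> = Z i" using i by (subst sum.delta') auto
   finally show ?thesis .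
  qed
  have "Y i - Z i = (Y i - v (bs i)) + (v (bs i) - w (bs i))" by (simp add: wb)
  also have "\<dots> \<in> ?J" by (intro fps_trunc_ideal_add IJ Yv vw bi i)
  finally show ?thesis .
 qed
 moreover have "Y i * Y k - (\<Sum>l\<le>n. \<eta> (g i k l) * Y l) \<in> ?I" if i: "i \<le> n" "k \<le> n" for i k
 proof -
  have "Y i * Y k - (\<Sum>l\<le>n. \<eta> (g i k l) * Y l) = Y i * (Y k - v (bs k)) + v (bs k) * (Y i - v (bs i))
   - (v (bs i \<otimes>\<^bsub>B\<^esub> bs k) - v (bs i) * v (bs k))
   + (v (B.lin bs (Suc n) (g i k)) - (\<Sum>l\<le>n. \<eta> (g i k l) * v (bs l)))
   - (\<Sum>l\<le>n. \<eta> (g i k l) * (Y l - v (bs l)))"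
   unfolding tab[OF i] by (simp add: algebra_simps sum_subtractf)
  also have "\<dots> \<in> ?I"
  proof -
   have 1: "v (B.lin bs (Suc n) (g i k)) - (\<Sum>l\<le>n. \<eta> (g i k l) * v (bs l)) \<in> ?I"
    using vlin[of "Suc n" "g i k"] unfolding lessThan_Suc_atMost by simp
   have 2: "v (bs i \<otimes>\<^bsub>B\<^esub> bs k) - v (bs i) * v (bs k) \<in> ?I" by (rule vm[OF bi[OF i(1)] bi[OF i(2)]])
   have 3: "(\<Sum>l\<le>n. \<eta> (g i k l) * (Y l - v (bs l))) \<in> ?I"
    by (rule fps_trunc_ideal_sum, rule fps_trunc_ideal_mult, rule Yv)
   show ?thesis
    by (rule fps_trunc_ideal_diff[OF fps_trunc_ideal_add[OF fps_trunc_ideal_diff[OF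
     fps_trunc_ideal_add[OF fps_trunc_ideal_mult[OF Yv] fps_trunc_ideal_mult[OF Yv]] 2] 1] 3])
  qed
  finally show ?thesis .
 qed
 moreover have "Y 0 = 1" by (simp add: Y_def)
 ultimately show "\<exists>Y. formal_point n (\<lambda>i j k. to_ac (g i j k)) (Suc (Suc N')) Y \<and> (\<forall>i\<le>n. \<forall>j<Suc N'. Y i $ j = Z i $ j)"
  unfolding formal_point_def \<eta>_def fps_trunc_ideal_def N_def mem_Collect_eq fps_sub_nth right_minus_eq
  by (intro exI[of _ Y] conjI allI impI) blast+
qed

lemma quot_PIdl_eq_iff:
 assumes "cring A" "s \<in> carrier A" "x \<in> carrier A" "y \<in> carrier A"
 shows "PIdl\<^bsub>A\<^esub> s +>\<^bsub>A\<^esub> x = PIdl\<^bsub>A\<^esub> s +>\<^bsub>A\<^esub> y \<longleftrightarrow> (\<exists>z\<in>carrier A. x \<ominus>\<^bsub>A\<^esub> y = s \<otimes>\<^bsub>A\<^esub> z)"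
proof -
 interpret cring A by fact
 have "x \<ominus>\<^bsub>A\<^esub> y \<in> PIdl\<^bsub>A\<^esub> s \<longleftrightarrow> (\<exists>z\<in>carrier A. x \<ominus>\<^bsub>A\<^esub> y = s \<otimes>\<^bsub>A\<^esub> z)"
  unfolding cgenideal_def using m_comm assms(2) by auto
 then show ?thesis using coset_eq_iff[OF cgenideal_ideal[OF assms(2)] assms(3,4)] by simp
qed

declare One_nat_def [simp del]

text \<open>Lifts of 1, \<alpha>_1, ..., \<alpha>_n to the smoothing algebra are a basis by
  \<open>lift_basis\<close>. Their structure constants specialise to those of Ap(f) at t = 0, and
  over K((t)) they describe the smooth generic fibre, to which \<open>smooth_lift\<close>
  applies.\<close>

theorem (in encompassing_poly) smoothable_struct_consts:
 assumes "smoothable (Ap_map {1..n} f) (Ap {1..n} f)"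
 obtains c :: "nat => nat => nat => 'k fps" where "struct_consts n c"
  "\<And>i j k. i \<le> n ==> j \<le> n ==> k \<le> n ==> c i j k $ 0 = cst i j k"
  "liftable n (\<lambda>i j k. to_ac (fps_to_fls (c i j k)))"
proof -
 obtain \<phi> :: "'k fps => nat => 'k fps" and A and \<psi> :: "'k fls => nat => 'k fls" and B \<iota> r where
  alg: "is_algebra \<phi> A" and fr: "free_of_rank \<phi> A r"
  and iso: "alg_isomorphic (\<lambda>c. quot_map \<phi> A (PIdl\<^bsub>A\<^esub> (\<phi> fps_X)) (fps_const c)) (A Quot (PIdl\<^bsub>A\<^esub> (\<phi> fps_X)))
    (Ap_map {1..n} f) (Ap {1..n} f)"
  and loc: "is_localization A (\<phi> fps_X) B \<iota>" and algB: "is_algebra \<psi> B"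
  and comp: "\<forall>c. \<psi> (fps_to_fls c) = \<iota> (\<phi> c)" and sm: "smooth_algebra \<psi> B"
  using assms unfolding smoothable_def Let_def by blast
 have cA: "cring A" and phi: "\<phi> \<in> Ring.ring_hom RT A" and psi: "\<psi> \<in> Ring.ring_hom RT B"
  using alg algB by (auto simp: is_algebra_def)
 have fs: "formally_smooth \<psi> B" using sm by (simp add: smooth_algebra_def)
 interpret A: lin_alg A \<phi> by (intro lin_alg.intro cA lin_alg_axioms.intro phi)
 have "\<exists>b. free_alg A \<phi> b r" using fr free_of_rank_iff[OF A.lin_alg_axioms] by blast
 then obtain b0 where "free_alg A \<phi> b0 r" by blast
 then interpret F0: free_alg A \<phi> b0 r .
 interpret F0: fps_free_alg A \<phi> b0 r ..
 define t where "t = PIdl\<^bsub>A\<^esub> (\<phi> fps_X)"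
 have tI: "ideal t A" unfolding t_def by (rule A.cgenideal_ideal) simp
 define R where "R = (mpoly_ring {1..n} :: 'k mpoly ring)"
 define I where "I = Ann {1..n} f"
 have cR: "cring R" unfolding R_def by (rule cring_mpoly_ring)
 have II: "ideal I R" unfolding I_def R_def by (rule ideal_Ann)
 define cl where "cl p = I +>\<^bsub>R\<^esub> p" for p
 define Q where "Q = R Quot I"
 have Ap: "Ap {1..n} f = Q" "Ap_map {1..n} f c = cl (Const c)" for c
  by (simp_all add: Ap_def Ap_map_def Q_def R_def I_def cl_def quot_map_def)
 have cQ: "cring Q" unfolding Q_def by (rule ideal.quotient_is_cring[OF II cR])
 interpret Q: cring Q by (rule cQ)
 have clh: "cl \<in> Ring.ring_hom R Q" unfolding cl_def Q_def by (rule quot_hom[OF II])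
 have cl_mult: "cl p \<otimes>\<^bsub>Q\<^esub> cl q = cl (p * q)" and cl_add: "cl p \<oplus>\<^bsub>Q\<^esub> cl q = cl (p + q)"
  if "p \<in> polys {1..n}" "q \<in> polys {1..n}" for p q
  using ring_hom_mult[OF clh, of p q] ring_hom_add[OF clh, of p q] that by (simp_all add: R_def)
 have cl_closed: "p \<in> polys {1..n} ==> cl p \<in> carrier Q" for p using ring_hom_closed[OF clh, of p] by (simp add: R_def)
 have cl_eq: "cl p = cl q \<longleftrightarrow> eqv p q" if "p \<in> polys {1..n}" "q \<in> polys {1..n}" for p q
  using mpoly_coset_eq_iff[OF II[unfolded R_def] that] that
  by (simp add: cl_def R_def I_def Ann_def eqv_def diff_polys)
 obtain h where h: "h \<in> alg_hom (\<lambda>c. quot_map \<phi> A t (fps_const c)) (A Quot t) (Ap_map {1..n} f) Q"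
  and hb: "bij_betw h (carrier (A Quot t)) (carrier Q)"
  using iso unfolding alg_isomorphic_def t_def[symmetric] Ap by blast
 have hh: "h \<in> Ring.ring_hom (A Quot t) Q" and hc: "\<And>c. h (t +>\<^bsub>A\<^esub> \<phi> (fps_const c)) = cl (Const c)"
  using h unfolding alg_hom_def quot_map_def Ap mem_Collect_eq by blast+
 define \<pi> where "\<pi> x = h (t +>\<^bsub>A\<^esub> x)" for x
 have \<pi>: "\<pi> \<in> Ring.ring_hom A Q" unfolding \<pi>_def
  using ring_hom_trans[OF quot_hom[OF tI] hh] by (simp add: comp_def)
 interpret \<pi>: ring_hom_cring A Q \<pi> by unfold_locales (rule \<pi>)
 have \<pi>_eq: "\<pi> x = \<pi> y \<longleftrightarrow> (\<exists>z\<in>carrier A. x \<ominus>\<^bsub>A\<^esub> y = \<phi> fps_X \<otimes>\<^bsub>A\<^esub> z)"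
  if "x \<in> carrier A" "y \<in> carrier A" for x y
 proof -
  have "t +>\<^bsub>A\<^esub> x \<in> carrier (A Quot t)" "t +>\<^bsub>A\<^esub> y \<in> carrier (A Quot t)" using that unfolding carrier_Quot by auto
  then have "\<pi> x = \<pi> y \<longleftrightarrow> t +>\<^bsub>A\<^esub> x = t +>\<^bsub>A\<^esub> y"
   using bij_betw_imp_inj_on[OF hb] unfolding \<pi>_def by (auto dest: inj_onD)
  then show ?thesis unfolding t_def using quot_PIdl_eq_iff[OF cA _ that, of "\<phi> fps_X"] by simp
 qed
 have \<pi>_surj: "\<exists>x\<in>carrier A. \<pi> x = y" if "y \<in> carrier Q" for y
 proof -
  have "y \<in> h ` carrier (A Quot t)" using that hb by (simp add: bij_betw_def)
  then show ?thesis unfolding carrier_Quot \<pi>_def by auto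
 qed
 have \<pi>X: "\<pi> (\<phi> fps_X \<otimes>\<^bsub>A\<^esub> z) = \<zero>\<^bsub>Q\<^esub>" if "z \<in> carrier A" for z
 proof -
  have "\<phi> fps_X \<otimes>\<^bsub>A\<^esub> z \<ominus>\<^bsub>A\<^esub> \<zero>\<^bsub>A\<^esub> = \<phi> fps_X \<otimes>\<^bsub>A\<^esub> z" using that by (simp add: a_minus_def)
  then have "\<pi> (\<phi> fps_X \<otimes>\<^bsub>A\<^esub> z) = \<pi> \<zero>\<^bsub>A\<^esub>" using that by (subst \<pi>_eq) auto
  then show ?thesis by simp
 qed
 have \<pi>\<phi>: "\<pi> (\<phi> g) = cl (Const (g $ 0))" for g
 proof -
  have "\<phi> g = \<phi> (fps_const (g $ 0)) \<oplus>\<^bsub>A\<^esub> \<phi> fps_X \<otimes>\<^bsub>A\<^esub> \<phi> (fps_shift 1 g)"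
   by (subst fps_decompose) (simp only: A.phi_add A.phi_mult)
  then have "\<pi> (\<phi> g) = \<pi> (\<phi> (fps_const (g $ 0))) \<oplus>\<^bsub>Q\<^esub> \<zero>\<^bsub>Q\<^esub>" by (simp only: \<pi>.hom_add A.phi_closed A.m_closed \<pi>X)
  then show ?thesis using hc by (simp add: \<pi>_def cl_closed)
 qed
 \<comment> \<open>The unit is lifted to the unit itself, as \<open>struct_consts\<close> requires
   a_0 = 1.\<close>
 define a where "a i = (if i = 0 then \<one>\<^bsub>A\<^esub> else SOME x. x \<in> carrier A \<and> \<pi> x = cl (alph i))" for i
 have a: "a i \<in> carrier A \<and> \<pi> (a i) = cl (alph i)" if i: "i \<le> n" for i
 proof (cases "i = 0")
  case True
  have "\<one>\<^bsub>Q\<^esub> = cl 1" using ring_hom_one[OF clh] by (simp add: R_def)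
  with True show ?thesis by (simp add: a_def alph_0)
 next
  case False
  have "\<exists>x. x \<in> carrier A \<and> \<pi> x = cl (alph i)" using \<pi>_surj[OF cl_closed[OF alph_polys[OF i]]] by blast
  then have "(SOME x. x \<in> carrier A \<and> \<pi> x = cl (alph i)) \<in> carrier A \<and>
   \<pi> (SOME x. x \<in> carrier A \<and> \<pi> x = cl (alph i)) = cl (alph i)" by (rule someI_ex)
  with False show ?thesis by (simp add: a_def)
 qed
 have aA: "a \<in> {..<Suc n} \<rightarrow> carrier A" using a by auto
 have \<pi>lin: "\<pi> (A.lin a M s) = cl (\<Sum>i<M. Const (s i $ 0) * alph i)" if "M \<le> Suc n" for M s
  using that
 proof (induction M)
  case 0
  have "\<zero>\<^bsub>Q\<^esub> = cl 0" using ring_hom_zero'[OF clh cR cQ] by (simp add: R_def)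
  then show ?case by (simp add: A.lin_def)
 next
  case (Suc M)
  have aM: "a M \<in> carrier A" "\<pi> (a M) = cl (alph M)" and aM': "a \<in> {..<M} \<rightarrow> carrier A" using a Suc.prems by auto
  have l: "A.lin a (Suc M) s = \<phi> (s M) \<otimes>\<^bsub>A\<^esub> a M \<oplus>\<^bsub>A\<^esub> A.lin a M s"
   unfolding A.lin_def lessThan_Suc using aM aM' by (subst A.finsum_insert) auto
  have ap: "alph i \<in> polys {1..n}" if "i < Suc M" for i by (rule alph_polys) (use that Suc.prems in simp)
  have p: "alph M \<in> polys {1..n}" "(\<Sum>i<M. Const (s i $ 0) * alph i) \<in> polys {1..n}"
   by (rule ap, simp) (rule sum_polys, rule mult_polys[OF Const_polys ap], simp)
  have "\<pi> (A.lin a (Suc M) s) = cl (Const (s M $ 0)) \<otimes>\<^bsub>Q\<^esub> cl (alph M) \<oplus>\<^bsub>Q\<^esub> cl (\<Sum>i<M. Const (s i $ 0) * alph i)"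
   unfolding l using Suc aM A.lin_closed[OF aM'] by (simp add: \<pi>\<phi>)
  also have "\<dots> = cl (\<Sum>i<Suc M. Const (s i $ 0) * alph i)"
   unfolding cl_mult[OF Const_polys p(1)] cl_add[OF mult_polys[OF Const_polys p(1)] p(2)] by (simp add: add.commute)
  finally show ?case .
 qed
 have \<pi>lin': "\<pi> (A.lin a (Suc n) s) = cl (afform n (\<lambda>i. s i $ 0))" for s
  using \<pi>lin[of "Suc n" s] by (simp add: afform_def lessThan_Suc_atMost)
 note ac = A.lin_closed[OF aA]
 have "free_alg A \<phi> a (Suc n)"
 proof (rule F0.lift_basis[OF aA])
  fix x assume x: "x \<in> carrier A"
  obtain \<sigma> where \<sigma>: "\<sigma> \<in> polys {1..n}" "\<pi> x = cl \<sigma>"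
   using \<pi>.hom_closed[OF x] unfolding Q_def carrier_Quot by (auto simp: R_def cl_def)
  obtain s where s: "act (\<sigma> - afform n s) f = 0" by (rule reduction[OF \<sigma>(1)])
  have "\<pi> x = \<pi> (A.lin a (Suc n) (\<lambda>i. fps_const (s i)))"
   using s \<sigma> by (simp add: \<pi>lin' cl_eq afform_polys eqv_def)
  then obtain z where z: "z \<in> carrier A" "x \<ominus>\<^bsub>A\<^esub> A.lin a (Suc n) (\<lambda>i. fps_const (s i)) = \<phi> fps_X \<otimes>\<^bsub>A\<^esub> z"
   using \<pi>_eq[OF x ac] by blast
  have "x = A.lin a (Suc n) (\<lambda>i. fps_const (s i)) \<oplus>\<^bsub>A\<^esub> (x \<ominus>\<^bsub>A\<^esub> A.lin a (Suc n) (\<lambda>i. fps_const (s i)))"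
   by (rule A.add_minus_cancel[OF x ac, symmetric])
  with z have "z \<in> carrier A \<and> x = A.lin a (Suc n) (\<lambda>i. fps_const (s i)) \<oplus>\<^bsub>A\<^esub> \<phi> fps_X \<otimes>\<^bsub>A\<^esub> z" by simp
  then show "\<exists>s y. y \<in> carrier A \<and> x = A.lin a (Suc n) (\<lambda>i. fps_const (s i)) \<oplus>\<^bsub>A\<^esub> \<phi> fps_X \<otimes>\<^bsub>A\<^esub> y" by blast
 next
  fix s y i assume y: "y \<in> carrier A" "A.lin a (Suc n) (\<lambda>i. fps_const (s i)) = \<phi> fps_X \<otimes>\<^bsub>A\<^esub> y" and i: "i < Suc n"
  have "cl (afform n s) = \<zero>\<^bsub>Q\<^esub>" using \<pi>X[OF y(1)] \<pi>lin'[of "\<lambda>i. fps_const (s i)"] y(2) by simp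
  also have "\<dots> = cl 0" using ring_hom_zero'[OF clh cR cQ] by (simp add: R_def)
  finally have "act (afform n s) f = 0" by (simp add: cl_eq afform_polys eqv_def)
  then show "s i = 0" using i by (intro indep) auto
 qed
 then interpret F: free_alg A \<phi> a "Suc n" .
 interpret F: fps_free_alg A \<phi> a "Suc n" ..
 define c where "c i j = F.co (a i \<otimes>\<^bsub>A\<^esub> a j)" for i j
 have ai: "i \<le> n ==> a i \<in> carrier A" for i using a by blast
 have tab: "a i \<otimes>\<^bsub>A\<^esub> a j = A.lin a (Suc n) (c i j)" if "i \<le> n" "j \<le> n" for i j
  unfolding c_def using that ai by (intro F.lin_co[symmetric]) auto
 have tab3: "(a i \<otimes>\<^bsub>A\<^esub> a j) \<otimes>\<^bsub>A\<^esub> a k = A.lin a (Suc n) (\<lambda>m. \<Sum>l<Suc n. c i j l * c l k m)"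
  if "i \<le> n" "j \<le> n" "k \<le> n" for i j k
  unfolding tab[OF that(1,2)] using that(3) by (intro A.lin_mult_table(1)[OF aA]) (auto simp: tab)
 show thesis
 proof (rule that[of c])
  show "struct_consts n c"
  proof (unfold_locales, goal_cases)
   case (1 j k)
   have "a 0 \<otimes>\<^bsub>A\<^esub> a j = A.lin a (Suc n) (\<lambda>i. if j = i then 1 else 0)"
    using ai[OF 1(1)] A.lin_unit[OF aA, of j] 1(1) by (simp add: a_def)
   then show ?case unfolding c_def using 1(2) by (subst F.co_eqI) auto
  next
   case (2 i j k)
   show ?case unfolding c_def using A.m_comm[OF ai[OF 2(1)] ai[OF 2(2)]] by simp
  next
   case (3 i j k m)
   have e: "a i \<otimes>\<^bsub>A\<^esub> a j \<otimes>\<^bsub>A\<^esub> a k = a j \<otimes>\<^bsub>A\<^esub> a k \<otimes>\<^bsub>A\<^esub> a i"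
    by (rule A.m_rotate[OF ai[OF 3(1)] ai[OF 3(2)] ai[OF 3(3)]])
   have "(\<Sum>l<Suc n. c i j l * c l k m) = (\<Sum>l<Suc n. c j k l * c l i m)"
    using F.lin_inj[OF e[unfolded tab3[OF 3(1,2,3)] tab3[OF 3(2,3,1)]], of m] 3(4) by simp
   also have "\<dots> = (\<Sum>l<Suc n. c j k l * c i l m)"
    unfolding c_def using A.m_comm ai 3(1) by (intro sum.cong refl) (metis lessThan_iff less_Suc_eq_le)
   finally show ?case by (simp add: lessThan_Suc_atMost)
  next
   case (4 k)
   have "of_nat k * fps_const (1 / of_nat k) = (1 :: 'k fps)" using 4 by (simp add: fps_of_nat[symmetric])
   then show ?case by blast
  qed
  show "c i j k $ 0 = cst i j k" if "i \<le> n" "j \<le> n" "k \<le> n" for i j k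
  proof -
   have "cl (afform n (\<lambda>k. c i j k $ 0)) = \<pi> (a i \<otimes>\<^bsub>A\<^esub> a j)" using tab[OF that(1,2)] \<pi>lin'[of "c i j"] by simp
   also have "\<dots> = cl (alph i * alph j)" using a that by (simp add: cl_mult alph_polys)
   finally have "eqv (afform n (\<lambda>k. c i j k $ 0)) (alph i * alph j)"
    using cl_eq afform_polys mult_polys alph_polys that by blast
   then have "eqv (afform n (\<lambda>k. c i j k $ 0)) (afform n (cst i j))" using cst[OF that(1,2)] by (simp add: eqv_iff)
   from eqv_afform_unique[OF this that(3)] show ?thesis .
  qed
 next
  have iota: "\<iota> \<in> Ring.ring_hom A B" and cB: "cring B" using loc by (auto simp: is_localization_def)
  have fa: "free_alg B \<psi> (\<lambda>i. \<iota> (a i)) (Suc n)"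
   using F.localize_basis[OF loc psi] comp by blast
  interpret B: lin_alg B \<psi> by (intro lin_alg.intro cB lin_alg_axioms.intro psi)
  interpret C: lin_alg B "\<lambda>c. \<iota> (\<phi> c)"
   using ring_hom_trans[OF phi iota] by (intro lin_alg.intro cB lin_alg_axioms.intro) (simp add: comp_def)
  show "liftable n (\<lambda>i j k. to_ac (fps_to_fls (c i j k)))"
  proof (rule smooth_lift[OF fa fs])
   show "\<iota> (a 0) = \<one>\<^bsub>B\<^esub>" using ring_hom_one[OF iota] by (simp add: a_def)
   show "\<iota> (a i) \<otimes>\<^bsub>B\<^esub> \<iota> (a j) = B.lin (\<lambda>i. \<iota> (a i)) (Suc n) (\<lambda>l. fps_to_fls (c i j l))" if "i \<le> n" "j \<le> n" for i j
   proof -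
    have "\<iota> (a i) \<otimes>\<^bsub>B\<^esub> \<iota> (a j) = \<iota> (A.lin a (Suc n) (c i j))"
     using ring_hom_mult[OF iota] ai that tab[OF that] by metis
    also have "\<dots> = B.lin (\<lambda>i. \<iota> (a i)) (Suc n) (\<lambda>l. fps_to_fls (c i j l))"
     unfolding A.hom_lin[OF iota cB aA] C.lin_def B.lin_def using comp by simp
    finally show ?thesis .
   qed
  qed
 qed
qed

section \<open>Split algebras are formally smooth\<close>

lemma factor_hom:
 assumes h: "h \<in> Ring.ring_hom P A" and k: "k \<in> Ring.ring_hom P Q" and surj: "carrier A \<subseteq> h ` carrier P" and P: "ring P"
  and e: "\<And>p q. p \<in> carrier P ==> q \<in> carrier P ==> h p = h q ==> k p = k q"
 shows "\<exists>g\<in>Ring.ring_hom A Q. \<forall>p\<in>carrier P. g (h p) = k p"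
proof -
 interpret P: ring P by fact
 define s where "s x = (SOME p. p \<in> carrier P \<and> h p = x)" for x
 have s: "s (h p) \<in> carrier P \<and> h (s (h p)) = h p" if "p \<in> carrier P" for p
  unfolding s_def by (rule someI_ex) (use that in blast)
 have g: "k (s (h p)) = k p" if "p \<in> carrier P" for p using e[OF _ that] s[OF that] by blast
 show ?thesis
 proof (rule bexI[of _ "\<lambda>x. k (s x)"])
  show "\<forall>p\<in>carrier P. k (s (h p)) = k p" using g by blast
  show "(\<lambda>x. k (s x)) \<in> Ring.ring_hom A Q"
  proof (rule ring_hom_memI)
   fix x assume "x \<in> carrier A"
   then obtain p where p: "p \<in> carrier P" "x = h p" using surj by auto
   then show "k (s x) \<in> carrier Q" using g ring_hom_closed[OF k] by simp
   fix y assume "y \<in> carrier A"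
   then obtain q where q: "q \<in> carrier P" "y = h q" using surj by auto
   have "x \<otimes>\<^bsub>A\<^esub> y = h (p \<otimes>\<^bsub>P\<^esub> q)" "x \<oplus>\<^bsub>A\<^esub> y = h (p \<oplus>\<^bsub>P\<^esub> q)"
    using p q ring_hom_mult[OF h] ring_hom_add[OF h] by simp_all
   then show "k (s (x \<otimes>\<^bsub>A\<^esub> y)) = k (s x) \<otimes>\<^bsub>Q\<^esub> k (s y)" "k (s (x \<oplus>\<^bsub>A\<^esub> y)) = k (s x) \<oplus>\<^bsub>Q\<^esub> k (s y)"
    using p q g ring_hom_mult[OF k] ring_hom_add[OF k] by simp_all
  next
   show "k (s \<one>\<^bsub>A\<^esub>) = \<one>\<^bsub>Q\<^esub>" using g[of "\<one>\<^bsub>P\<^esub>"] ring_hom_one[OF h] ring_hom_one[OF k] by simp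
  qed
 qed
qed

lemma factor_iso:
 assumes h: "h \<in> Ring.ring_hom P A" and k: "k \<in> Ring.ring_hom P Q" and P: "ring P"
  and surj: "h ` carrier P = carrier A" "k ` carrier P = carrier Q"
  and e: "\<And>p q. p \<in> carrier P ==> q \<in> carrier P ==> h p = h q \<longleftrightarrow> k p = k q"
 shows "\<exists>g\<in>Ring.ring_hom A Q. (\<forall>p\<in>carrier P. g (h p) = k p) \<and> bij_betw g (carrier A) (carrier Q)"
proof -
 have s1: "carrier A \<subseteq> h ` carrier P" using surj by simp
 have e1: "\<And>p q. p \<in> carrier P ==> q \<in> carrier P ==> h p = h q ==> k p = k q" using e by simp
 obtain g where g: "g \<in> Ring.ring_hom A Q" "\<And>p. p \<in> carrier P ==> g (h p) = k p"
  using factor_hom[OF h k s1 P e1] by blast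
 have "bij_betw g (carrier A) (carrier Q)"
  unfolding bij_betw_def inj_on_def surj[symmetric] using g(2) e by (auto simp: image_image)
 then show ?thesis using g by blast
qed

lemma (in cring) taylor_step:
 "\<lbrakk>a \<in> carrier R; t \<in> carrier R; e \<in> carrier R; x \<in> carrier R; y \<in> carrier R\<rbrakk> \<Longrightarrow>
  a \<oplus> (t \<oplus> e) \<otimes> (x \<oplus> y \<otimes> e) = (a \<oplus> t \<otimes> x) \<oplus> (x \<oplus> t \<otimes> y) \<otimes> e \<oplus> y \<otimes> (e \<otimes> e)"
 by algebra

lemma (in cring) add_mult_step:
 "\<lbrakk>a \<in> carrier R; t \<in> carrier R; x \<in> carrier R; y \<in> carrier R; b \<in> carrier R\<rbrakk> \<Longrightarrow>
  (a \<oplus> t \<otimes> x) \<oplus> (b \<oplus> t \<otimes> y) = (a \<oplus> b) \<oplus> t \<otimes> (x \<oplus> y)"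
 by algebra

lemma (in cring) mult_mult_step:
 "\<lbrakk>a \<in> carrier R; t \<in> carrier R; x \<in> carrier R; y \<in> carrier R\<rbrakk> \<Longrightarrow>
  a \<otimes> y \<oplus> t \<otimes> (x \<otimes> y) = (a \<oplus> t \<otimes> x) \<otimes> y"
 by algebra

text \<open>Since b inverts y up to m, the correction -b x leaves the error -m x, which
  vanishes.\<close>

lemma (in cring) newton_step:
 "\<lbrakk>x \<in> carrier R; b \<in> carrier R; y \<in> carrier R; m \<in> carrier R; b \<otimes> y = \<one> \<oplus> m; m \<otimes> x = \<zero>\<rbrakk> \<Longrightarrow>
  x \<oplus> y \<otimes> (\<ominus> (b \<otimes> x)) = \<zero>"
proof -
 assume a: "x \<in> carrier R" "b \<in> carrier R" "y \<in> carrier R" "m \<in> carrier R" "b \<otimes> y = \<one> \<oplus> m" "m \<otimes> x = \<zero>"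
 have "x \<oplus> y \<otimes> (\<ominus> (b \<otimes> x)) = x \<ominus> (b \<otimes> y) \<otimes> x" using a(1-4) by algebra
 also have "\<dots> = \<ominus> (m \<otimes> x)" unfolding a(5) using a(1-4) by algebra
 finally show ?thesis using a(6) by simp
qed

section \<open>Polynomial evaluation and separable algebras\<close>

context lin_alg
begin

definition pev :: "'a => 'r poly => 'a" where
 "pev t p = fold_coeffs (\<lambda>a x. \<phi> a \<oplus> t \<otimes> x) p \<zero>"

context fixes t assumes t: "t \<in> carrier A"
begin

lemma pev_0 [simp]: "pev t 0 = \<zero>" by (simp add: pev_def)

lemma pev_pCons: "pev t (pCons a p) = \<phi> a \<oplus> t \<otimes> pev t p"
 unfolding pev_def using t by (cases "p = 0 \<and> a = 0") auto

lemma pev_closed [simp]: "pev t p \<in> carrier A"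
 using t by (induction p) (auto simp: pev_pCons)

lemma pev_const: "pev t [:c:] = \<phi> c" using t by (simp add: pev_pCons)

lemma pev_1: "pev t 1 = \<one>" unfolding one_pCons pev_const by simp

lemma pev_add: "pev t (p + q) = pev t p \<oplus> pev t q"
 using t by (induction p q rule: poly_induct2) (auto simp: pev_pCons phi_add intro!: add_mult_step[symmetric])

lemma pev_smult: "pev t (smult c p) = \<phi> c \<otimes> pev t p"
 using t by (induction p) (auto simp: pev_pCons phi_mult r_distr m_lcomm)

lemma pev_mult: "pev t (p * q) = pev t p \<otimes> pev t q"
 using t by (induction p) (auto simp: pev_pCons pev_add pev_smult mult_mult_step)

lemma pev_hom: "pev t \<in> Ring.ring_hom RT A"
 by (rule ring_hom_memI) (auto simp: pev_mult pev_add pev_1)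

lemma pev_lin: "pev t (\<Sum>l<M. Polynomial.monom (s l) l) = lin (\<lambda>l. t [^] l) M s" for M :: nat
proof (induction M)
 case (Suc M)
 have m: "pev t (Polynomial.monom c k) = \<phi> c \<otimes> t [^] k" for c and k :: nat
  using t by (induction k) (auto simp: monom_0 monom_Suc pev_pCons m_ac)
 have "lin (\<lambda>l. t [^] l) (Suc M) s = \<phi> (s M) \<otimes> t [^] M \<oplus> lin (\<lambda>l. t [^] l) M s"
  unfolding lin_def lessThan_Suc using t by (subst finsum_insert) auto
 with Suc t show ?case by (simp add: pev_add m a_comm)
qed (simp add: lin_def)

end

lemma hom_pev:
 assumes h: "h \<in> Ring.ring_hom A B" and cB: "cring B" and t: "t \<in> carrier A"
 shows "h (pev t p) = lin_alg.pev B (\<lambda>c. h (\<phi> c)) (h t) p"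
proof -
 interpret B: lin_alg B "\<lambda>c. h (\<phi> c)"
  using ring_hom_trans[OF phi h] by (intro lin_alg.intro cB lin_alg_axioms.intro) (simp add: comp_def)
 have ht: "h t \<in> carrier B" by (rule ring_hom_closed[OF h t])
 show ?thesis
 proof (induction p)
  case 0
  show ?case using ring_hom_zero'[OF h is_cring cB] by (simp add: pev_0[OF t] B.pev_0[OF ht])
 next
  case (pCons a p)
  then show ?case unfolding pev_pCons[OF t] B.pev_pCons[OF ht]
   using t by (simp add: ring_hom_add[OF h] ring_hom_mult[OF h])
 qed
qed

end

lemma pev_taylor:
 fixes \<phi> :: "'r::idom => 'a"
 assumes "lin_alg A \<phi>" and t: "t \<in> carrier A" and e: "e \<in> carrier A" "e \<otimes>\<^bsub>A\<^esub> e = \<zero>\<^bsub>A\<^esub>"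
 shows "lin_alg.pev A \<phi> (t \<oplus>\<^bsub>A\<^esub> e) p = lin_alg.pev A \<phi> t p \<oplus>\<^bsub>A\<^esub> lin_alg.pev A \<phi> t (pderiv p) \<otimes>\<^bsub>A\<^esub> e"
proof -
 interpret lin_alg A \<phi> by fact
 have te: "t \<oplus>\<^bsub>A\<^esub> e \<in> carrier A" using t e by simp
 show ?thesis
 proof (induction p)
  case 0
  then show ?case using e by (simp add: pderiv_0 pev_0[OF te] pev_0[OF t])
 next
  case (pCons a p)
  have "pev (t \<oplus>\<^bsub>A\<^esub> e) (pCons a p) = \<phi> a \<oplus>\<^bsub>A\<^esub> (t \<oplus>\<^bsub>A\<^esub> e) \<otimes>\<^bsub>A\<^esub> (pev t p \<oplus>\<^bsub>A\<^esub> pev t (pderiv p) \<otimes>\<^bsub>A\<^esub> e)"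
   unfolding pev_pCons[OF te] pCons.IH ..
  also have "\<dots> = pev t (pCons a p) \<oplus>\<^bsub>A\<^esub> pev t (pderiv (pCons a p)) \<otimes>\<^bsub>A\<^esub> e"
   using t e by (subst taylor_step) (auto simp: pev_pCons[OF t] pev_add[OF t] pderiv_pCons pev_closed[OF t])
  finally show ?case .
 qed
qed

lemma free_alg_dependent:
 fixes \<phi> :: "'r::field => 'a"
 assumes "free_alg A \<phi> b N" and x: "\<And>l. l \<le> N ==> x l \<in> carrier A"
 shows "\<exists>s. (\<exists>i\<le>N. s i \<noteq> 0) \<and> lin_alg.lin A \<phi> x (Suc N) s = \<zero>\<^bsub>A\<^esub>"
proof -
 interpret free_alg A \<phi> b N by fact
 obtain s where s: "\<exists>i\<le>N. s i \<noteq> 0" "\<And>j. j < N ==> (\<Sum>i\<le>N. s i * co (x i) j) = 0"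
  by (rule linear_dependence[of N "\<lambda>i. co (x i)"]) blast
 have "lin x (Suc N) s = (\<Oplus>\<^bsub>A\<^esub>l\<in>{..<Suc N}. \<phi> (s l) \<otimes>\<^bsub>A\<^esub> lin b N (co (x l)))"
  unfolding lin_def[of x] using x by (intro finsum_cong') (auto simp: lin_co)
 also have "\<dots> = lin b N (\<lambda>k. \<Sum>l<Suc N. s l * co (x l) k)" by (rule lin_lin[OF b])
 also have "\<dots> = lin b N (\<lambda>k. 0)" by (rule lin_cong[OF b]) (use s(2) in \<open>simp add: lessThan_Suc_atMost del: sum.lessThan_Suc\<close>)
 finally have "lin x (Suc N) s = \<zero>\<^bsub>A\<^esub>" by (simp add: lin_zero[OF b])
 with s(1) show ?thesis by blast
qed

text \<open>A model of a separable algebra: N homomorphisms to a field extension separate the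
  elements of an N-dimensional algebra, and \<theta> is a primitive element. The extension is
  allowed because splitting is known only over the algebraic closure.\<close>

locale split_alg = free_alg B \<psi> b N for B :: "'b ring" (structure) and \<psi> :: "'l::field_char_0 => 'b" and b N +
 fixes S :: "'m set" and ev :: "'m => 'b => 'e::field" and to :: "'l => 'e" and \<theta> :: 'b
 assumes S: "finite S" "card S = N"
  and ev: "\<mu> \<in> S ==> ev \<mu> \<in> Ring.ring_hom B RT"
  and ev_psi: "\<mu> \<in> S ==> ev \<mu> (\<psi> c) = to c"
  and separated: "x \<in> carrier B ==> (\<And>\<mu>. \<mu> \<in> S ==> ev \<mu> x = 0) ==> x = \<zero>"
  and theta: "\<theta> \<in> carrier B" "inj_on (\<lambda>\<mu>. ev \<mu> \<theta>) S"
  and to: "comm_ring_hom to"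
begin

interpretation to: comm_ring_hom to by (rule to)

lemma to_inj: "to x = 0 \<longleftrightarrow> x = 0"
proof
 assume "to x = 0"
 show "x = 0"
 proof (rule ccontr)
  assume "x \<noteq> 0"
  then have "to x * to (inverse x) = 1" by (simp flip: to.hom_mult)
  with \<open>to x = 0\<close> show False by simp
 qed
qed simp

lemma ev_pev: "\<mu> \<in> S ==> x \<in> carrier B ==> ev \<mu> (pev x p) = poly (map_poly to p) (ev \<mu> x)"
proof -
 assume \<mu>: "\<mu> \<in> S" and x: "x \<in> carrier B"
 show ?thesis
 proof (induction p)
  case 0
  show ?case using ring_hom_zero'[OF ev[OF \<mu>] is_cring cring_RT] x by (simp add: pev_0)
 next
  case (pCons a p)
  then show ?case using x ring_hom_add[OF ev[OF \<mu>]] ring_hom_mult[OF ev[OF \<mu>]] ev_psi[OF \<mu>]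
   by (simp add: pev_pCons[OF x] map_poly_pCons pev_closed[OF x])
 qed
qed

lemma degree_map_to: "Polynomial.degree (map_poly to p) = Polynomial.degree p"
 by (rule degree_map_poly) (simp add: to_inj)

lemma pev_eq_0_low:
 assumes "Polynomial.degree p < N" "\<And>\<mu>. \<mu> \<in> S ==> poly (map_poly to p) (ev \<mu> \<theta>) = 0"
 shows "p = 0"
proof (rule ccontr)
 assume p: "p \<noteq> 0"
 then have p': "map_poly to p \<noteq> 0" by (metis coeff_map_poly degree_0 coeff_0 leading_coeff_0_iff to.hom_zero to_inj)
 have "card S = card ((\<lambda>\<mu>. ev \<mu> \<theta>) ` S)" by (rule card_image[OF theta(2), symmetric])
 also have "\<dots> \<le> card {x. poly (map_poly to p) x = 0}"
  using assms(2) by (intro card_mono poly_roots_finite p') auto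
 also have "\<dots> \<le> Polynomial.degree p" using card_poly_roots_bound[OF p'] by (simp add: degree_map_to)
 finally show False using assms(1) S(2) by simp
qed

text \<open>The N elements d \<theta>^l together with y are dependent. The coefficient of y is
  nonzero: otherwise a polynomial of degree below N would vanish at N distinct values. For d = 1
  this shows that \<theta> generates; for the derivative of its minimal polynomial it gives an
  inverse.\<close>

lemma lin_solve:
 assumes d: "d \<in> carrier B" "\<And>\<mu>. \<mu> \<in> S ==> ev \<mu> d \<noteq> 0" and y: "y \<in> carrier B"
 obtains p where "Polynomial.degree p < N \<or> p = 0" "d \<otimes> pev \<theta> p = y"
proof -
 define x where "x l = (if l < N then d \<otimes> \<theta> [^] l else y)" for l
 have xc: "x l \<in> carrier B" for l using d y theta by (simp add: x_def)
 obtain s where s: "\<exists>i\<le>N. s i \<noteq> 0" and 0: "lin x (Suc N) s = \<zero>"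
  using free_alg_dependent[OF free_alg_axioms, of x] xc by auto
 define p where "p = (\<Sum>l<N. Polynomial.monom (s l) l)"
 have cp: "Polynomial.coeff p l = s l" if "l < N" for l
 proof -
  have "Polynomial.coeff p l = (\<Sum>l'<N. if l' = l then s l' else 0)" unfolding p_def coeff_sum by (intro sum.cong) auto
  then show ?thesis using that by simp
 qed
 have dp: "Polynomial.degree p < N \<or> p = 0"
 proof (cases N)
  case (Suc M)
  have "Polynomial.degree p \<le> M" unfolding p_def Suc
   by (rule degree_sum_le) (auto intro: order_trans[OF degree_monom_le])
  then show ?thesis using Suc by simp
 qed (simp add: p_def)
 have th: "(\<lambda>l. \<theta> [^] l) \<in> {..<N} \<rightarrow> carrier B" for N :: nat using theta by auto
 have "lin x (Suc N) s = \<psi> (s N) \<otimes> y \<oplus> (\<Oplus>l\<in>{..<N}. \<psi> (s l) \<otimes> (\<theta> [^] l \<otimes> d))"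
 proof -
  have "(\<Oplus>l\<in>{..<N}. \<psi> (s l) \<otimes> x l) = (\<Oplus>l\<in>{..<N}. \<psi> (s l) \<otimes> (\<theta> [^] l \<otimes> d))"
   by (rule finsum_cong') (use theta d in \<open>auto simp: x_def m_comm\<close>)
  moreover have "lin x (Suc N) s = \<psi> (s N) \<otimes> x N \<oplus> (\<Oplus>l\<in>{..<N}. \<psi> (s l) \<otimes> x l)"
   unfolding lin_def lessThan_Suc using xc by (subst finsum_insert) auto
  ultimately show ?thesis by (simp add: x_def)
 qed
 also have "(\<Oplus>l\<in>{..<N}. \<psi> (s l) \<otimes> (\<theta> [^] l \<otimes> d)) = pev \<theta> p \<otimes> d"
  unfolding p_def pev_lin[OF theta(1)] by (rule lin_mult_right[OF th d(1), symmetric])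
 finally have 1: "\<psi> (s N) \<otimes> y \<oplus> pev \<theta> p \<otimes> d = \<zero>" using 0 by simp
 have pc: "pev \<theta> p \<in> carrier B" by (rule pev_closed[OF theta(1)])
 have sN: "s N \<noteq> 0"
 proof
  assume z: "s N = 0"
  then have z': "pev \<theta> p \<otimes> d = \<zero>" using 1 y pc d by simp
  have "poly (map_poly to p) (ev \<mu> \<theta>) = 0" if "\<mu> \<in> S" for \<mu>
  proof -
   have "ev \<mu> (pev \<theta> p) * ev \<mu> d = 0"
    using ring_hom_mult[OF ev[OF that] pc d(1)] ring_hom_zero'[OF ev[OF that] is_cring cring_RT] z' by simp
   then show ?thesis using d(2)[OF that] ev_pev[OF that theta(1)] by simp
  qed
  then have "p = 0" using pev_eq_0_low dp by blast
  then have "s l = 0" if "l \<le> N" for l using cp[of l] that z by (cases "l = N") auto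
  then show False using s(1) by blast
 qed
 define k where "k = - inverse (s N)"
 show thesis
 proof (rule that[of "smult k p"])
  show "Polynomial.degree (smult k p) < N \<or> smult k p = 0" using dp by auto
  have "\<psi> k \<otimes> (\<psi> (s N) \<otimes> y \<oplus> pev \<theta> p \<otimes> d) = \<zero>" unfolding 1 by simp
  moreover have "\<psi> k \<otimes> (\<psi> (s N) \<otimes> y \<oplus> pev \<theta> p \<otimes> d) = \<psi> k \<otimes> \<psi> (s N) \<otimes> y \<oplus> d \<otimes> (\<psi> k \<otimes> pev \<theta> p)"
   using y pc d by (simp add: r_distr m_assoc m_ac)
  moreover have "\<psi> k \<otimes> \<psi> (s N) = \<ominus> \<one>"
  proof -
   have "\<psi> k \<otimes> \<psi> (s N) \<oplus> \<one> = \<psi> (k * s N + 1)" by (simp only: phi_add phi_mult phi_one)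
   also have "\<dots> = \<zero>" using sN by (simp add: k_def)
   finally show ?thesis using phi_closed by (metis m_closed minus_equality one_closed)
  qed
  ultimately have "\<ominus> y \<oplus> d \<otimes> pev \<theta> (smult k p) = \<zero>"
   using y pc d by (simp add: pev_smult[OF theta(1)] l_minus)
  then show "d \<otimes> pev \<theta> (smult k p) = y"
   using y d pev_closed[OF theta(1)] by (metis a_comm a_inv_closed m_closed minus_equality minus_minus)
 qed
qed

text \<open>The algebra is L[T]/(q) with q separable of degree N. A homomorphism is lifted by
  lifting the image of \<theta> arbitrarily and making one Newton step, which gives an exact root of
  q because products in the ideal vanish.\<close>

lemma formally_smooth: "formally_smooth \<psi> B"
proof -
 have one: "ev \<mu> \<one> \<noteq> 0" if "\<mu> \<in> S" for \<mu> using ring_hom_one[OF ev[OF that]] by simp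
 have surj: "\<exists>p. pev \<theta> p = y" if "y \<in> carrier B" for y
  using lin_solve[OF one_closed one that] pev_closed[OF theta(1)] by (metis l_one)
 \<comment> \<open>Writing \<theta>^N in lower powers yields a monic q of degree N that vanishes at
   \<theta>.\<close>
 obtain r where r: "Polynomial.degree r < N \<or> r = 0" "pev \<theta> r = pev \<theta> (Polynomial.monom 1 N)"
  using lin_solve[OF one_closed one pev_closed[OF theta(1), of "Polynomial.monom 1 N"]] pev_closed[OF theta(1)] by (metis l_one)
 define q where "q = Polynomial.monom 1 N - r"
 have cq: "Polynomial.coeff q N = 1" using r(1) by (auto simp: q_def coeff_eq_0)
 have q0: "q \<noteq> 0" using cq by auto
 have dq: "Polynomial.degree q = N"
 proof (rule antisym)
  show "Polynomial.degree q \<le> N" unfolding q_def using r(1) by (intro degree_diff_le) (auto simp: degree_monom_le)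
  show "N \<le> Polynomial.degree q" using cq by (intro le_degree) simp
 qed
 have pq: "pev \<theta> q = \<zero>"
 proof -
  have "pev \<theta> (q + r) = pev \<theta> r" using r(2) by (simp add: q_def)
  then show ?thesis using pev_closed[OF theta(1)] by (metis add.l_cancel_one' pev_add[OF theta(1)] a_comm)
 qed
 have qroot: "poly (map_poly to q) (ev \<mu> \<theta>) = 0" if "\<mu> \<in> S" for \<mu>
  using ev_pev[OF that theta(1), of q] ring_hom_zero'[OF ev[OF that] is_cring cring_RT] by (simp add: pq)
 have dvd: "q dvd p" if "pev \<theta> p = \<zero>" for p
 proof -
  have d: "Polynomial.degree (p mod q) < N \<or> p mod q = 0" using degree_mod_less[OF q0, of p] dq by auto
  have "pev \<theta> p = pev \<theta> q \<otimes> pev \<theta> (p div q) \<oplus> pev \<theta> (p mod q)"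
   unfolding pev_mult[OF theta(1), symmetric] pev_add[OF theta(1), symmetric] by simp
  then have z: "pev \<theta> (p mod q) = \<zero>" using that pev_closed[OF theta(1)] by (simp add: pq)
  have "poly (map_poly to (p mod q)) (ev \<mu> \<theta>) = 0" if "\<mu> \<in> S" for \<mu>
   using ev_pev[OF that theta(1), of "p mod q"] ring_hom_zero'[OF ev[OF that] is_cring cring_RT] by (simp add: z)
  then have "p mod q = 0" using d pev_eq_0_low by blast
  then show ?thesis by auto
 qed
 \<comment> \<open>A double root would leave a cofactor of degree N - 1 with N distinct
   roots.\<close>
 have q': "ev \<mu> (pev \<theta> (pderiv q)) \<noteq> 0" if \<mu>: "\<mu> \<in> S" for \<mu>
 proof
  assume "ev \<mu> (pev \<theta> (pderiv q)) = 0"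
  let ?Q = "map_poly to q" and ?a = "ev \<mu> \<theta>"
  have pd: "map_poly to (pderiv q) = pderiv ?Q"
   by (rule poly_eqI) (simp add: coeff_map_poly coeff_pderiv to.hom_mult hom_of_nat[OF to] del: of_nat_Suc)
  then have d0: "poly (pderiv ?Q) ?a = 0" using \<open>ev \<mu> (pev \<theta> (pderiv q)) = 0\<close> ev_pev[OF \<mu> theta(1), of "pderiv q"] by simp
  obtain g where g: "?Q = [:- ?a, 1:] * g" using qroot[OF \<mu>] by (metis dvdE poly_eq_0_iff_dvd)
  have Q0: "?Q \<noteq> 0" using cq coeff_map_poly[of to q N] by auto
  have g0: "g \<noteq> 0" using g Q0 by auto
  have "Polynomial.degree ?Q = Suc (Polynomial.degree g)" unfolding g using g0 by (subst degree_mult_eq) auto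
  then have dg: "Suc (Polynomial.degree g) = N" using dq by (simp add: degree_map_to)
  have ga: "poly g ?a = 0" using d0 unfolding g pderiv_mult by (simp add: pderiv_pCons)
  have "poly g (ev \<nu> \<theta>) = 0" if \<nu>: "\<nu> \<in> S" for \<nu>
  proof (cases "\<nu> = \<mu>")
   case False
   then have "ev \<nu> \<theta> \<noteq> ?a" using theta(2) \<mu> \<nu> by (auto dest: inj_onD)
   moreover have "(ev \<nu> \<theta> - ?a) * poly g (ev \<nu> \<theta>) = 0" using qroot[OF \<nu>] unfolding g by (simp add: algebra_simps)
   ultimately show ?thesis by simp
  qed (simp add: ga)
  then have "card ((\<lambda>\<mu>. ev \<mu> \<theta>) ` S) \<le> card {x. poly g x = 0}"
   by (intro card_mono poly_roots_finite g0) auto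
  also have "\<dots> \<le> Polynomial.degree g" by (rule card_poly_roots_bound[OF g0])
  finally show False using dg S(2) card_image[OF theta(2)] by simp
 qed
 obtain w where w: "pev \<theta> (pderiv q) \<otimes> pev \<theta> w = \<one>"
  using lin_solve[OF pev_closed[OF theta(1)] q' one_closed] by metis
 show ?thesis unfolding formally_smooth_def
 proof (intro allI ballI impI)
  fix C :: "'l mpoly ring" and \<chi> M u
  assume u: "u \<in> alg_hom \<psi> B (quot_map \<chi> C M) (C Quot M)"
   and as: "is_algebra \<chi> C \<and> ideal M C \<and> (\<forall>x\<in>M. \<forall>y\<in>M. x \<otimes>\<^bsub>C\<^esub> y = \<zero>\<^bsub>C\<^esub>)"
  have cC: "cring C" and chi: "\<chi> \<in> Ring.ring_hom RT C" and M: "ideal M C"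
   and sq: "\<And>x y. x \<in> M ==> y \<in> M ==> x \<otimes>\<^bsub>C\<^esub> y = \<zero>\<^bsub>C\<^esub>" using as by (auto simp: is_algebra_def)
  have uh: "u \<in> Ring.ring_hom B (C Quot M)" and uc: "u (\<psi> c) = M +>\<^bsub>C\<^esub> \<chi> c" for c using u by (auto simp: alg_hom_def quot_map_def)
  interpret C: lin_alg C \<chi> by (intro lin_alg.intro cC lin_alg_axioms.intro chi)
  interpret M: ideal M C by fact
  have Mc: "x \<in> M ==> x \<in> carrier C" for x using M.a_subset by auto
  have cQ: "cring (C Quot M)" by (rule ideal.quotient_is_cring[OF M cC])
  note qh = quot_hom[OF M]
  obtain T where T: "T \<in> carrier C" "u \<theta> = M +>\<^bsub>C\<^esub> T"
   using ring_hom_closed[OF uh theta(1)] unfolding carrier_Quot by auto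
  have up: "u (pev \<theta> p) = M +>\<^bsub>C\<^esub> C.pev T p" for p
   unfolding hom_pev[OF uh cQ theta(1)] C.hom_pev[OF qh cC[THEN ideal.quotient_is_cring[OF M]] T(1)] uc T(2) ..
  have Mz: "x \<in> M" if "M +>\<^bsub>C\<^esub> x = M +>\<^bsub>C\<^esub> y" "y \<in> M" "x \<in> carrier C" for x y
  proof -
   have "x \<ominus>\<^bsub>C\<^esub> y \<in> M" using coset_eq_iff[OF M that(3) Mc[OF that(2)]] that(1) by simp
   then have "y \<oplus>\<^bsub>C\<^esub> (x \<ominus>\<^bsub>C\<^esub> y) \<in> M" using that(2) by (intro M.a_closed)
   then show ?thesis using C.add_minus_cancel[OF that(3) Mc[OF that(2)]] by simp
  qed
  define e0 where "e0 = C.pev T q"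
  have e0: "e0 \<in> M"
  proof (rule Mz[of _ "\<zero>\<^bsub>C\<^esub>"])
   have "u \<zero> = M +>\<^bsub>C\<^esub> \<zero>\<^bsub>C\<^esub>"
    using ring_hom_zero'[OF uh is_cring cQ] ring_hom_zero'[OF qh cC cQ] by simp
   then show "M +>\<^bsub>C\<^esub> e0 = M +>\<^bsub>C\<^esub> \<zero>\<^bsub>C\<^esub>" unfolding e0_def up[symmetric] pq .
  qed (simp_all add: e0_def C.pev_closed[OF T(1)] M.zero_closed)
  define y where "y = C.pev T (pderiv q)"
  define b' where "b' = C.pev T w"
  have yb: "y \<in> carrier C" "b' \<in> carrier C" by (simp_all add: y_def b'_def C.pev_closed[OF T(1)])
  define m where "m = b' \<otimes>\<^bsub>C\<^esub> y \<ominus>\<^bsub>C\<^esub> \<one>\<^bsub>C\<^esub>"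
  have m: "m \<in> M"
  proof -
   have "M +>\<^bsub>C\<^esub> (b' \<otimes>\<^bsub>C\<^esub> y) = u (pev \<theta> (w * pderiv q))" unfolding up y_def b'_def C.pev_mult[OF T(1)] ..
   also have "\<dots> = u (pev \<theta> 1)" using w pev_closed[OF theta(1)] by (simp add: pev_mult[OF theta(1)] pev_1[OF theta(1)] m_comm)
   also have "\<dots> = M +>\<^bsub>C\<^esub> \<one>\<^bsub>C\<^esub>" unfolding up C.pev_1[OF T(1)] ..
   finally show ?thesis unfolding m_def using coset_eq_iff[OF M] yb by simp
  qed
  \<comment> \<open>The Newton correction: minus the value of q at T, times \<open>b'\<close>, an
    inverse of the derivative at T up to an element of the ideal.\<close>
  define e where "e = \<ominus>\<^bsub>C\<^esub> (b' \<otimes>\<^bsub>C\<^esub> e0)"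
  have eM: "e \<in> M" unfolding e_def using e0 yb by (intro M.a_inv_closed M.I_l_closed)
  have ec: "e \<in> carrier C" "e0 \<in> carrier C" "m \<in> carrier C" using Mc eM e0 m by auto
  define T' where "T' = T \<oplus>\<^bsub>C\<^esub> e"
  have T': "T' \<in> carrier C" using T ec by (simp add: T'_def)
  have "C.pev T' q = e0 \<oplus>\<^bsub>C\<^esub> y \<otimes>\<^bsub>C\<^esub> e"
   unfolding T'_def e0_def y_def by (rule pev_taylor[OF C.lin_alg_axioms T(1) ec(1) sq[OF eM eM]])
  also have "\<dots> = \<zero>\<^bsub>C\<^esub>" unfolding e_def
  proof (rule C.newton_step[OF ec(2) yb(2,1) ec(3) _ sq[OF m e0]])
   show "b' \<otimes>\<^bsub>C\<^esub> y = \<one>\<^bsub>C\<^esub> \<oplus>\<^bsub>C\<^esub> m" unfolding m_def using C.add_minus_cancel[OF C.m_closed[OF yb(2,1)] C.one_closed] by simp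
  qed
  finally have qT: "C.pev T' q = \<zero>\<^bsub>C\<^esub>" .
  have fac: "C.pev T' p = C.pev T' p'" if "pev \<theta> p = pev \<theta> p'" for p p'
  proof -
   have "pev \<theta> (p - p') = \<zero>"
   proof -
    have "pev \<theta> ((p - p') + p') = pev \<theta> p'" using that by simp
    then show ?thesis using pev_closed[OF theta(1)] by (metis add.l_cancel_one' pev_add[OF theta(1)] a_comm)
   qed
   then obtain v where "p - p' = q * v" using dvd by (auto elim: dvdE)
   then have "p = p' + q * v" by (simp add: algebra_simps)
   then show ?thesis using C.pev_closed[OF T'] by (simp add: C.pev_add[OF T'] C.pev_mult[OF T'] qT)
  qed
  have sub: "carrier B \<subseteq> pev \<theta> ` carrier RT" using surj by force
  have rRT: "ring (RT :: 'l poly ring)" by (rule cring.axioms(1)[OF cring_RT])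
  obtain v where v: "v \<in> Ring.ring_hom B C" "\<forall>p\<in>carrier RT. v (pev \<theta> p) = C.pev T' p"
   using factor_hom[OF pev_hom[OF theta(1)] C.pev_hom[OF T'] sub rRT fac] by blast
  have v2: "v (pev \<theta> p) = C.pev T' p" for p using v(2) by simp
  show "\<exists>v\<in>alg_hom \<psi> B \<chi> C. \<forall>b\<in>carrier B. M +>\<^bsub>C\<^esub> v b = u b"
  proof (intro bexI[of _ v] ballI)
   show "v \<in> alg_hom \<psi> B \<chi> C"
    using v(1) v2[of "[:_:]"] by (auto simp: alg_hom_def pev_const[OF theta(1)] C.pev_const[OF T'])
   have TT': "M +>\<^bsub>C\<^esub> T' = M +>\<^bsub>C\<^esub> T"
   proof -
    have "T' \<ominus>\<^bsub>C\<^esub> T = e" using C.minus_cancel[OF T(1) ec(1) C.zero_closed] T ec by (simp add: T'_def a_minus_def)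
    then show ?thesis using coset_eq_iff[OF M T' T(1)] eM by simp
   qed
   fix y assume "y \<in> carrier B"
   then obtain p where p: "y = pev \<theta> p" using surj by metis
   show "M +>\<^bsub>C\<^esub> v y = u y" unfolding p v2 up C.hom_pev[OF qh cQ T'] C.hom_pev[OF qh cQ T(1)] TT' ..
  qed
 qed
qed

end

section \<open>The apolar algebra of a power\<close>

lemma mapc_polys: "comm_ring_hom h ==> p \<in> polys V ==> mapc h p \<in> polys V"
proof -
 assume h: "comm_ring_hom h" and p: "p \<in> polys V"
 interpret h: comm_ring_hom h by (rule h)
 have "keys (mapc h p) \<subseteq> keys p" by (auto simp: in_keys_iff lookup_mapc[OF h])
 then show ?thesis using p by (auto simp: polys_def)
qed

lemma mapc_ring_hom: "comm_ring_hom h ==> mapc h \<in> Ring.ring_hom (mpoly_ring V) (mpoly_ring V)"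
proof -
 assume h: "comm_ring_hom h"
 interpret m: comm_ring_hom "mapc h" by (rule comm_ring_hom_mapc[OF h])
 show ?thesis by (rule ring_hom_memI) (simp_all add: mapc_polys[OF h] m.hom_mult m.hom_add)
qed

lemma sum_singles_superset:
 assumes "finite A" "keys p \<subseteq> A" shows "(\<Sum>m\<in>A. single m (lookup p m)) = p"
proof -
 have "(\<Sum>m\<in>A. single m (lookup p m)) = (\<Sum>m\<in>keys p. single m (lookup p m))"
  using assms by (intro sum.mono_neutral_right) (auto simp: in_keys_iff)
 then show ?thesis by (simp add: sum_singles)
qed

context sym_power
begin

definition form_mono :: "nat => nat \<Rightarrow>\<^sub>0 nat" where
 "form_mono = (SOME g. bij_betw g {..<card (form_monomials n d)} (form_monomials n d))"

lemma form_mono: "bij_betw form_mono {..<card (form_monomials n d)} (form_monomials n d)"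
 unfolding form_mono_def using ex_bij_betw_nat_finite[OF finite_form_monomials[of n d]]
 by (intro someI_ex[where P = "\<lambda>g. bij_betw g {..<card (form_monomials n d)} (form_monomials n d)"]) (simp add: atLeast0LessThan)

text \<open>The class of p modulo the kernel of \<open>Theta\<close> is coded by the coefficients of
  \<open>Theta p\<close>, padded by 0. This places the quotient on the type \<open>nat => 'r\<close>
  on which \<open>smoothable\<close> expects its witnesses.\<close>

definition enc :: "'r mpoly => nat => 'r" where
 "enc p i = (if i < card (form_monomials n d) then lookup (Theta p) (form_mono i) else 0)"

lemma enc_eq_iff:
 assumes "p \<in> polys {1..n}" "q \<in> polys {1..n}"
 shows "enc p = enc q \<longleftrightarrow> Theta (p - q) = 0"
proof
 assume e: "enc p = enc q"
 have "lookup (Theta p) m = lookup (Theta q) m" for m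
 proof (cases "m \<in> form_monomials n d")
  case True
  then obtain i where "i < card (form_monomials n d)" "m = form_mono i" using form_mono by (force simp: bij_betw_def)
  then show ?thesis using fun_cong[OF e, of i] by (simp add: enc_def)
 next
  case False
  then have "m \<notin> keys (Theta p)" "m \<notin> keys (Theta q)"
   using Theta_forms[OF assms(1)] Theta_forms[OF assms(2)] by (auto simp: forms_def polys_def form_monomials_def)
  then show ?thesis by (simp add: in_keys_iff)
 qed
 then have "Theta p = Theta q" by (rule poly_mapping_eqI)
 then show "Theta (p - q) = 0" by (simp add: Theta_diff)
next
 assume "Theta (p - q) = 0"
 then have "Theta p = Theta q" by (simp add: Theta_diff)
 then show "enc p = enc q" by (simp add: enc_def fun_eq_iff)
qed

definition pow_alg :: "(nat => 'r) ring" where "pow_alg = image_ring enc (mpoly_ring {1..n})"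

lemma ideal_kernel: "ideal {p \<in> polys {1..n}. Theta p = 0} (mpoly_ring {1..n})"
 by (rule ideal_mpoly_ringI) (auto simp: add_polys mult_polys Theta_add Theta_ideal)

lemma pow_alg: "cring pow_alg" "enc \<in> Ring.ring_hom (mpoly_ring {1..n}) pow_alg"
proof -
 have e: "enc p = enc q \<longleftrightarrow> p \<ominus>\<^bsub>mpoly_ring {1..n}\<^esub> q \<in> {p \<in> polys {1..n}. Theta p = 0}"
  if "p \<in> carrier (mpoly_ring {1..n})" "q \<in> carrier (mpoly_ring {1..n})" for p q
  using that by (simp add: mpoly_ring_minus diff_polys enc_eq_iff)
 show "cring pow_alg" "enc \<in> Ring.ring_hom (mpoly_ring {1..n}) pow_alg"
  unfolding pow_alg_def by (rule image_ring_quotient[OF cring_mpoly_ring ideal_kernel e]; simp)+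
qed

lemma carrier_pow_alg: "carrier pow_alg = enc ` polys {1..n}"
 by (simp add: pow_alg_def image_ring_carrier)

text \<open>By the normal forms the monomials of degree at most d are a basis of any quotient by the
  kernel of \<open>Theta\<close>. The presentation \<open>h\<close> is left arbitrary because
  \<open>pow_alg\<close> and the chart ring of the embedded scheme are both such quotients.\<close>

lemma free_alg_quotient:
 assumes cA: "cring A" and h: "h \<in> Ring.ring_hom (mpoly_ring {1..n}) A" and surj: "h ` polys {1..n} = carrier A"
  and ker: "\<And>p q. p \<in> polys {1..n} ==> q \<in> polys {1..n} ==> h p = h q \<longleftrightarrow> Theta (p - q) = 0"
 shows "lin_alg A (\<lambda>r. h (Const r))" "\<exists>b. free_alg A (\<lambda>r. h (Const r)) b ((n + d) choose d)"
proof -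
 have hm: "h (p * q) = h p \<otimes>\<^bsub>A\<^esub> h q" and ha: "h (p + q) = h p \<oplus>\<^bsub>A\<^esub> h q" 
  if "p \<in> polys {1..n}" "q \<in> polys {1..n}" for p q
  using that ring_hom_mult[OF h, of p q] ring_hom_add[OF h, of p q] by simp_all
 have hc: "h p \<in> carrier A" if "p \<in> polys {1..n}" for p using that ring_hom_closed[OF h, of p] by simp
 have h0: "h 0 = \<zero>\<^bsub>A\<^esub>" and h1: "h 1 = \<one>\<^bsub>A\<^esub>" using ring_hom_zero'[OF h cring_mpoly_ring cA] ring_hom_one[OF h] by simp_all
 interpret cring A by (rule cA)
 show L: "lin_alg A (\<lambda>r. h (Const r))"
 proof (intro lin_alg.intro cA lin_alg_axioms.intro ring_hom_memI)
  show "h (Const (x \<otimes>\<^bsub>RT\<^esub> y)) = h (Const x) \<otimes>\<^bsub>A\<^esub> h (Const y)" for x y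
   using hm[OF Const_polys Const_polys] by (simp add: Const_mult)
  show "h (Const (x \<oplus>\<^bsub>RT\<^esub> y)) = h (Const x) \<oplus>\<^bsub>A\<^esub> h (Const y)" for x y
   using ha[OF Const_polys Const_polys] by (simp add: Const_add)
 qed (simp_all add: hc h1)
 interpret lin_alg A "\<lambda>r. h (Const r)" by (rule L)
 let ?N = "(n + d) choose d"
 obtain g where g: "bij_betw g {..<?N} (monomials n d)"
  using ex_bij_betw_nat_finite[OF finite_monomials[of n d]] by (auto simp: atLeast0LessThan card_monomials)
 have gm: "g i \<in> monomials n d" if "i < ?N" for i using g that by (auto simp: bij_betw_def)
 have gp: "single (g i) a \<in> polys {1..n}" if "i < ?N" for i and a :: 'r
  using gm[OF that] by (auto simp: polys_def monomials_def)
 define b where "b i = h (single (g i) 1)" for i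
 have b: "b \<in> {..<?N} \<rightarrow> carrier A" unfolding b_def using gp hc by blast
 have lin: "lin b M s = h (\<Sum>i<M. single (g i) (s i))" if "M \<le> ?N" for M s
  using that
 proof (induction M)
  case 0
  then show ?case by (simp add: lin_def h0)
 next
  case (Suc M)
  have bM: "b M \<in> carrier A" "b \<in> {..<M} \<rightarrow> carrier A" using b Suc.prems by auto
  have "lin b (Suc M) s = h (Const (s M)) \<otimes>\<^bsub>A\<^esub> b M \<oplus>\<^bsub>A\<^esub> lin b M s"
   unfolding lin_def lessThan_Suc using bM by (subst finsum_insert) auto
  also have "\<dots> = h (Const (s M) * single (g M) 1) \<oplus>\<^bsub>A\<^esub> h (\<Sum>i<M. single (g i) (s i))"
  proof -
   have M: "M < ?N" "M \<le> ?N" using Suc.prems by simp_all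
   show ?thesis unfolding Suc.IH[OF M(2)] hm[OF Const_polys gp[OF M(1)]] b_def[of M] ..
  qed
  also have "\<dots> = h (\<Sum>i<Suc M. single (g i) (s i))"
   using Suc.prems gp by (subst ha[symmetric]) (auto simp: add.commute single_eq_Const_mult[symmetric] intro!: sum_polys)
  finally show ?case .
 qed
 have look: "lookup (\<Sum>i<?N. single (g i) (s i)) (g j) = s j" if j: "j < ?N" for s :: "nat => 'r" and j
 proof -
  have "g i = g j \<longleftrightarrow> i = j" if "i < ?N" for i using g that j by (auto simp: bij_betw_def dest: inj_onD)
  then have "lookup (\<Sum>i<?N. single (g i) (s i)) (g j) = (\<Sum>i<?N. if i = j then s i else 0)"
   unfolding lookup_sum by (intro sum.cong) (auto simp: lookup_single when_def)
  then show ?thesis using j by simp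
 qed
 have "free_alg A (\<lambda>r. h (Const r)) b ?N"
 proof
  show "b \<in> {..<?N} \<rightarrow> carrier A" by (rule b)
  show "\<exists>s. x = lin b ?N s" if "x \<in> carrier A" for x
  proof -
   have "x \<in> h ` polys {1..n}" unfolding surj by (rule that)
   then obtain p where p: "p \<in> polys {1..n}" "x = h p" by blast
   obtain q where q: "q \<in> polys {1..n}" "\<And>m. m \<in> keys q ==> m \<in> monomials n d" "Theta q = Theta p"
    by (rule normal_form_ex[OF p(1)]) blast
   have "x = h q" using ker[OF p(1) q(1)] p(2) q(3) by (simp add: Theta_diff)
   also have "q = (\<Sum>m\<in>monomials n d. single m (lookup q m))"
    by (rule sum_singles_superset[symmetric]) (use q(2) in auto)
   also have "\<dots> = (\<Sum>i<?N. single (g i) (lookup q (g i)))" by (rule sum.reindex_bij_betw[OF g, symmetric])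
   finally have "x = lin b ?N (\<lambda>i. lookup q (g i))" by (simp only: lin[OF order_refl])
   then show ?thesis by blast
  qed
  show "s i = 0" if z: "lin b ?N s = \<zero>\<^bsub>A\<^esub>" and i: "i < ?N" for s i
  proof -
   let ?q = "\<Sum>i<?N. single (g i) (s i)"
   have qp: "?q \<in> polys {1..n}" using gp by (intro sum_polys) simp
   have T: "Theta ?q = 0" using z lin[of ?N s] h0 ker[OF qp zero_polys] by simp
   have "m \<in> monomials n d" if mq: "m \<in> keys ?q" for m
   proof -
    have "keys ?q \<subseteq> (\<Union>i<?N. keys (single (g i) (s i)))" by (rule keys_sum)
    then obtain i where "i < ?N" "m \<in> keys (single (g i) (s i))" using mq by blast
    then show ?thesis using gm[of i] by (auto split: if_splits)
   qed
   then have "?q = 0" by (rule normal_form_unique[OF _ T])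
   then show ?thesis using look[OF i, of s] by simp
  qed
 qed
 then show "\<exists>b. free_alg A (\<lambda>r. h (Const r)) b ((n + d) choose d)" by blast
qed

definition pow_map :: "'r => nat => 'r" where "pow_map r = enc (Const r)"

lemma lin_alg_pow_alg: "lin_alg pow_alg pow_map"
 and free_alg_pow_alg: "\<exists>b. free_alg pow_alg pow_map b ((n + d) choose d)"
 unfolding pow_map_def using free_alg_quotient[OF pow_alg _ enc_eq_iff] by (simp_all add: carrier_pow_alg)

lemma generate_pow_alg: "carrier pow_alg = generate_ring pow_alg (range pow_map \<union> (\<lambda>i. enc (Var i)) ` {1..n})"
proof
 interpret cring pow_alg by (rule pow_alg(1))
 have V: "Var i \<in> polys {1..n}" if "i \<in> {1..n}" for i using that by (rule Var_polys)
 show "generate_ring pow_alg (range pow_map \<union> (\<lambda>i. enc (Var i)) ` {1..n}) \<subseteq> carrier pow_alg"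
  by (rule generate_ring_incl) (auto simp: carrier_pow_alg pow_map_def intro!: V)
 have "enc p \<in> generate_ring pow_alg (range pow_map \<union> (\<lambda>i. enc (Var i)) ` {1..n})" if "p \<in> polys {1..n}" for p
  using that
 proof (induction rule: polys_induct)
  case (Const c)
  then show ?case by (intro generate_ring.incl) (simp add: pow_map_def)
 next
  case (add p q)
  then show ?case using ring_hom_add[OF pow_alg(2), of p q] by (simp add: generate_ring.eng_add)
 next
  case (Var i p)
  have "enc (Var i) \<in> generate_ring pow_alg (range pow_map \<union> (\<lambda>i. enc (Var i)) ` {1..n})"
   using Var by (intro generate_ring.incl) blast
  moreover have "enc (Var i * p) = enc (Var i) \<otimes>\<^bsub>pow_alg\<^esub> enc p"
   using ring_hom_mult[OF pow_alg(2), of "Var i" p] V[OF Var(1)] Var(2) by simp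
  ultimately show ?case using Var by (simp only: generate_ring.eng_mult)
 qed
 then show "carrier pow_alg \<subseteq> generate_ring pow_alg (range pow_map \<union> (\<lambda>i. enc (Var i)) ` {1..n})"
  by (auto simp: carrier_pow_alg)
qed

end

section \<open>Base change and smoothing of the power algebra\<close>

lemma Theta_mapc_eq_0:
 assumes "struct_consts n c" "comm_ring_hom h" "inj h" "p \<in> polys {1..n}"
 shows "sym_power.Theta n (\<lambda>i j k. h (c i j k)) d (mapc h p) = 0 \<longleftrightarrow> sym_power.Theta n c d p = 0"
proof -
 interpret h: comm_ring_hom h by fact
 have "h x = 0 \<longleftrightarrow> x = 0" for x using injD[OF assms(3), of x 0] by auto
 then have "mapc h P = 0 \<longleftrightarrow> P = 0" for P by (simp add: poly_mapping_eq_iff fun_eq_iff lookup_mapc[OF assms(2)])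
 then show ?thesis using Theta_mapc[OF assms(1,2,4), of d] by metis
qed

lemma comm_ring_hom_to_ac: "comm_ring_hom to_ac" by unfold_locales simp_all

lemma comm_ring_hom_fps_to_fls: "comm_ring_hom (fps_to_fls :: 'a::field fps => 'a fls)"
 by unfold_locales (simp_all add: fls_times_fps_to_fls)

lemma comm_ring_hom_fps_nth_0: "comm_ring_hom (\<lambda>f :: 'a::field fps. f $ 0)"
 by unfold_locales simp_all

lemma comm_ring_hom_fps_const: "comm_ring_hom (fps_const :: 'a::field => 'a fps)"
 by unfold_locales simp_all

text \<open>For two distinct points the sums differ by a nonzero polynomial in s, so finitely many s
  are excluded. A natural number s lets \<open>formally_smooth_pow_alg\<close> define the element
  over the base field, although the points live over the closure.\<close>

lemma (in split_power) primitive_element: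
 "\<exists>s::nat. inj_on (\<lambda>\<mu>. \<Sum>i\<in>{1..n}. of_nat s ^ i * rho \<mu> i) (form_monomials n d)"
proof -
 let ?S = "form_monomials n d"
 define P where "P \<mu> \<nu> = (\<Sum>i\<in>{1..n}. Polynomial.monom (rho \<mu> i - rho \<nu> i) i)" for \<mu> \<nu>
 define Q where "Q = (\<Prod>(\<mu>, \<nu>)\<in>{(\<mu>, \<nu>). \<mu> \<in> ?S \<and> \<nu> \<in> ?S \<and> \<mu> \<noteq> \<nu>}. P \<mu> \<nu>)"
 have fin: "finite {(\<mu>, \<nu>). \<mu> \<in> ?S \<and> \<nu> \<in> ?S \<and> \<mu> \<noteq> \<nu>}"
  by (rule finite_subset[of _ "?S \<times> ?S"]) auto
 have P0: "P \<mu> \<nu> \<noteq> 0" if "\<mu> \<in> ?S" "\<nu> \<in> ?S" "\<mu> \<noteq> \<nu>" for \<mu> \<nu>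
 proof
  assume z: "P \<mu> \<nu> = 0"
  have "rho \<mu> i = rho \<nu> i" if "i \<in> {1..n}" for i
  proof -
   have "coeff (P \<mu> \<nu>) i = (\<Sum>j\<in>{1..n}. if j = i then rho \<mu> j - rho \<nu> j else 0)"
    unfolding P_def coeff_sum by (intro sum.cong) auto
   then show ?thesis using that z by simp
  qed
  then show False using rho_inj that by blast
 qed
 have "Q \<noteq> 0" unfolding Q_def using fin P0 by (auto simp: prod_zero_iff)
 then have fQ: "finite {x. poly Q x = 0}" by (rule poly_roots_finite)
 have "\<exists>s::nat. poly Q (of_nat s) \<noteq> 0"
 proof (rule ccontr)
  assume "\<not> (\<exists>s::nat. poly Q (of_nat s) \<noteq> 0)"
  then have "range of_nat \<subseteq> {x. poly Q x = 0}" by auto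
  from finite_imageD[OF finite_subset[OF this fQ]] show False by (simp add: inj_of_nat)
 qed
 then obtain s :: nat where s: "poly Q (of_nat s) \<noteq> 0" by blast
 have "inj_on (\<lambda>\<mu>. \<Sum>i\<in>{1..n}. of_nat s ^ i * rho \<mu> i) ?S"
 proof (rule inj_onI, rule ccontr)
  fix \<mu> \<nu> assume a: "\<mu> \<in> ?S" "\<nu> \<in> ?S" "\<mu> \<noteq> \<nu>"
   and e: "(\<Sum>i\<in>{1..n}. of_nat s ^ i * rho \<mu> i) = (\<Sum>i\<in>{1..n}. of_nat s ^ i * rho \<nu> i)"
  have "poly (P \<mu> \<nu>) (of_nat s) = 0"
   using e by (simp add: P_def poly_sum poly_monom right_diff_distrib sum_subtractf mult.commute[of _ "of_nat s ^ _"])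
  then have "poly Q (of_nat s) = 0" unfolding Q_def poly_prod
   using a by (subst prod_zero_iff[OF fin]) (auto intro!: bexI[of _ "(\<mu>, \<nu>)"])
  with s show False by simp
 qed
 then show ?thesis by blast
qed

text \<open>Over the closure the kernel of \<open>Theta\<close> is the ideal of the points
  \<open>rho \<mu>\<close>, so evaluation at them factors through the algebra over the base field
  and separates its elements.\<close>

lemma formally_smooth_pow_alg:
 fixes c :: "nat => nat => nat => 'l::field_char_0"
 assumes "struct_consts n c" and sp: "split_power n (\<lambda>i j k. to_ac (c i j k)) ch W"
 shows "formally_smooth (sym_power.pow_map n c d) (sym_power.pow_alg n c d)"
proof -
 interpret A: sym_power n c d unfolding sym_power_def by fact
 interpret E: split_power n d "\<lambda>i j k. to_ac (c i j k)" ch W by fact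
 let ?S = "form_monomials n d"
 obtain b where "free_alg A.pow_alg A.pow_map b ((n + d) choose d)" using A.free_alg_pow_alg by blast
 then interpret F: free_alg A.pow_alg A.pow_map b "(n + d) choose d" .
 define k where "k \<mu> p = peval to_ac (E.rho \<mu>) p" for \<mu> p
 have k: "comm_ring_hom (k \<mu>)" for \<mu> unfolding k_def by (rule comm_ring_hom_peval[OF comm_ring_hom_to_ac])
 have kh: "k \<mu> \<in> Ring.ring_hom (mpoly_ring {1..n}) RT" for \<mu>
 proof -
  interpret k: comm_ring_hom "k \<mu>" by (rule k)
  show ?thesis by (rule ring_hom_memI) (simp_all add: k.hom_mult k.hom_add)
 qed
 have Theta0: "A.Theta p = 0 \<longleftrightarrow> (\<forall>\<mu>\<in>?S. k \<mu> p = 0)" if "p \<in> polys {1..n}" for p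
 proof -
  have "A.Theta p = 0 \<longleftrightarrow> E.Theta (mapc to_ac p) = 0"
   using Theta_mapc_eq_0[OF assms(1) comm_ring_hom_to_ac inj_to_ac that] by simp
  also have "\<dots> \<longleftrightarrow> (\<forall>\<mu>\<in>?S. peval (\<lambda>c. c) (E.rho \<mu>) (mapc to_ac p) = 0)"
   by (rule E.Theta_eq_0_iff[OF mapc_polys[OF comm_ring_hom_to_ac that]])
  finally show ?thesis by (simp add: k_def peval_mapc[OF comm_ring_hom_id comm_ring_hom_to_ac])
 qed
 have "\<exists>g\<in>Ring.ring_hom A.pow_alg RT. \<forall>p\<in>carrier (mpoly_ring {1..n}). g (A.enc p) = k \<mu> p" if "\<mu> \<in> ?S" for \<mu>
 proof (rule factor_hom[OF A.pow_alg(2) kh])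
  show "carrier A.pow_alg \<subseteq> A.enc ` carrier (mpoly_ring {1..n})" by (simp add: A.carrier_pow_alg)
  show "ring (mpoly_ring {1..n})" by (rule cring.axioms(1)[OF cring_mpoly_ring])
  fix p q :: "'l mpoly" assume pq: "p \<in> carrier (mpoly_ring {1..n})" "q \<in> carrier (mpoly_ring {1..n})" "A.enc p = A.enc q"
  then have pq': "p \<in> polys {1..n}" "q \<in> polys {1..n}" by simp_all
  interpret k: comm_ring_hom "k \<mu>" by (rule k)
  have "k \<mu> (p - q) = 0" using pq(3) A.enc_eq_iff[OF pq'] Theta0[OF diff_polys[OF pq']] that by blast
  then show "k \<mu> p = k \<mu> q" by (simp add: k.hom_minus)
 qed
 then obtain ev where ev: "\<And>\<mu>. \<mu> \<in> ?S ==> ev \<mu> \<in> Ring.ring_hom A.pow_alg RT"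
  "\<And>\<mu> p. \<mu> \<in> ?S ==> p \<in> polys {1..n} ==> ev \<mu> (A.enc p) = k \<mu> p" by (simp add: Bex_def) metis
 obtain s :: nat where s: "inj_on (\<lambda>\<mu>. \<Sum>i\<in>{1..n}. of_nat s ^ i * E.rho \<mu> i) ?S" using E.primitive_element by blast
 define th :: "'l mpoly" where "th = (\<Sum>i\<in>{1..n}. Const (of_nat s ^ i) * Var i)"
 have th: "th \<in> polys {1..n}" unfolding th_def by (intro sum_polys mult_polys Const_polys Var_polys)
 have kth: "k \<mu> th = (\<Sum>i\<in>{1..n}. of_nat s ^ i * E.rho \<mu> i)" for \<mu>
 proof -
  interpret k: comm_ring_hom "k \<mu>" by (rule k)
  show ?thesis unfolding th_def k.hom_sum k.hom_mult by (simp add: k_def peval_Var)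
 qed
 interpret split_alg A.pow_alg A.pow_map b "(n + d) choose d" ?S ev to_ac "A.enc th"
 proof (intro split_alg.intro split_alg_axioms.intro F.free_alg_axioms)
  show "finite ?S" by simp
  show "card ?S = (n + d) choose d" by (rule card_form_monomials)
  show "ev \<mu> \<in> Ring.ring_hom A.pow_alg RT" if "\<mu> \<in> ?S" for \<mu> by (rule ev(1)[OF that])
  show "ev \<mu> (A.pow_map x) = to_ac x" if "\<mu> \<in> ?S" for \<mu> x
   using ev(2)[OF that Const_polys] by (simp add: A.pow_map_def k_def)
  show "x = \<zero>\<^bsub>A.pow_alg\<^esub>" if x: "x \<in> carrier A.pow_alg" and z: "\<And>\<mu>. \<mu> \<in> ?S ==> ev \<mu> x = 0" for x
  proof -
   obtain p where p: "p \<in> polys {1..n}" "x = A.enc p" using x by (auto simp: A.carrier_pow_alg)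
   have "A.Theta p = 0" unfolding Theta0[OF p(1)] using z ev(2) p by simp
   then have "x = A.enc 0" using A.enc_eq_iff[OF p(1) zero_polys] p(2) by simp
   also have "\<dots> = \<zero>\<^bsub>A.pow_alg\<^esub>" using ring_hom_zero'[OF A.pow_alg(2) cring_mpoly_ring A.pow_alg(1)] by simp
   finally show ?thesis .
  qed
  show "A.enc th \<in> carrier A.pow_alg" using th by (simp add: A.carrier_pow_alg)
  show "inj_on (\<lambda>\<mu>. ev \<mu> (A.enc th)) ?S" using s by (simp add: ev(2)[OF _ th] kth cong: inj_on_cong)
  show "comm_ring_hom to_ac" by (rule comm_ring_hom_to_ac)
 qed
 show ?thesis by (rule formally_smooth)
qed

text \<open>Smoothness excludes tangent vectors at every character, so the characters over the
  closure of K((t)) span the dual and split the algebra.\<close>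

theorem (in encompassing_poly) split_family:
 assumes "smoothable (Ap_map {1..n} f) (Ap {1..n} f)"
 obtains c ch W where "struct_consts n c" "\<And>i j k. c i j k $ 0 = cst i j k"
  "\<And>d. split_power n (\<lambda>i j k. to_ac (fps_to_fls (c i j k))) ch W"
proof -
 obtain c0 :: "nat => nat => nat => 'k fps" where c0: "struct_consts n c0"
  and c00: "\<And>i j k. i \<le> n ==> j \<le> n ==> k \<le> n ==> c0 i j k $ 0 = cst i j k"
  and lift0: "liftable n (\<lambda>i j k. to_ac (fps_to_fls (c0 i j k)))"
  by (rule smoothable_struct_consts[OF assms]) blast
 \<comment> \<open>Values outside the index range are replaced so that the specialisation at t = 0
   is an identity of functions, which lets \<open>Theta_mapc\<close> be rewritten to
   \<open>cst\<close>.\<close>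
 define c where "c i j k = (if i \<le> n \<and> j \<le> n \<and> k \<le> n then c0 i j k else fps_const (cst i j k))" for i j k
 have cc: "c i j k = c0 i j k" if "i \<le> n" "j \<le> n" "k \<le> n" for i j k using that by (simp add: c_def)
 have c: "struct_consts n c"
 proof -
  interpret S: struct_consts n c0 by fact
  show ?thesis
  proof (unfold_locales, goal_cases)
   case (1 j k) then show ?case by (simp add: cc S.unit)
  next
   case (2 i j k) then show ?case using S.comm by (simp add: cc)
  next
   case (3 i j k m)
   then show ?case using S.assoc[OF 3] by (simp add: cc)
  next
   case (4 k) then show ?case by (rule S.nat_inverse)
  qed
 qed
 let ?h = "\<lambda>x :: 'k fps. to_ac (fps_to_fls x)"
 have h: "comm_ring_hom ?h" by (rule comm_ring_hom_comp[OF comm_ring_hom_to_ac comm_ring_hom_fps_to_fls])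
 have ch: "struct_consts n (\<lambda>i j k. ?h (c i j k))" by (rule struct_consts_hom[OF c h])
 interpret C: char_field n "\<lambda>i j k. ?h (c i j k)" unfolding char_field_def by (rule ch)
 have lift: "liftable n (\<lambda>i j k. ?h (c i j k))" by (rule liftable_cong[OF lift0]) (simp add: cc)
 have tangent: "\<delta> i = 0" if x: "C.is_char x" and d0: "\<delta> 0 = 0"
   and d: "\<And>i k. i \<le> n ==> k \<le> n ==> x i * \<delta> k + x k * \<delta> i = (\<Sum>l\<le>n. ?h (c i k l) * \<delta> l)" and i: "i \<le> n" for x \<delta> i
  by (rule C.no_tangent_vectors[where x = x and \<delta> = \<delta> and m = i, OF lift x d0 d i])
 have span: "C.in_span x" for x by (rule C.chars_span) (rule tangent, assumption+)
 obtain chr W where chr: "\<And>j. j \<le> n ==> C.is_char (chr j)"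
  "\<And>i k. i \<le> n ==> k \<le> n ==> (\<Sum>j\<le>n. chr j i * W j k) = (if i = k then 1 else 0)"
  "\<And>i k. i \<le> n ==> k \<le> n ==> (\<Sum>j\<le>n. W i j * chr k j) = (if i = k then 1 else 0)"
  by (rule C.split_matrix[OF span]) blast
 show thesis
 proof (rule that[OF c])
  show "c i j k $ 0 = cst i j k" for i j k using c00 by (simp add: c_def)
  fix d
  show "split_power n (\<lambda>i j k. ?h (c i j k)) chr W"
   unfolding split_power_def split_power_axioms_def sym_power_def
   using ch chr(2,3) C.is_char_0[OF chr(1)] C.is_char_mult[OF chr(1)] by blast
 qed
qed

lemma fls_common_denominator:
 fixes p :: "'k::field fls mpoly"
 obtains k q where "Const (fls_X ^ k) * p = mapc fps_to_fls q" "keys q \<subseteq> keys p"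
proof -
 define k where "k = (\<Sum>m\<in>keys p. nat (- fls_subdegree (lookup p m)))"
 define q where "q = (\<Sum>m\<in>keys p. single m (fls_regpart (fls_X ^ k * lookup p m)))"
 have lq: "lookup q m = (if m \<in> keys p then fls_regpart (fls_X ^ k * lookup p m) else 0)" for m
 proof -
  have "lookup q m = (\<Sum>m'\<in>keys p. if m' = m then fls_regpart (fls_X ^ k * lookup p m') else 0)"
   unfolding q_def lookup_sum by (intro sum.cong) (auto simp: lookup_single when_def)
  then show ?thesis by simp
 qed
 have "fps_to_fls (fls_regpart (fls_X ^ k * lookup p m)) = fls_X ^ k * lookup p m" if m: "m \<in> keys p" for m
 proof (rule fls_regpart_to_fls_trivial)
  have "nat (- fls_subdegree (lookup p m)) \<le> k" unfolding k_def by (rule member_le_sum[OF m]) auto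
  then have "- int k \<le> fls_subdegree (lookup p m)" by linarith
  then show "0 \<le> fls_subdegree (fls_X ^ k * lookup p m)" using m by (simp add: fls_subdegree_pow in_keys_iff)
 qed
 then have "Const (fls_X ^ k) * p = mapc fps_to_fls q"
  by (intro poly_mapping_eqI) (auto simp: lookup_Const_mult lookup_mapc[OF comm_ring_hom_fps_to_fls] lq in_keys_iff)
 moreover have "keys q \<subseteq> keys p" by (auto simp: in_keys_iff lq split: if_splits)
 ultimately show thesis by (rule that)
qed

lemma keys_subset_polys: "keys q \<subseteq> keys p ==> p \<in> polys V ==> q \<in> polys V"
 by (auto simp: polys_def)

text \<open>The witnesses are the power algebras of the deformed structure constants over K[[t]] and
  over K((t)). The first is free with special fibre Ap(f^d); the second is its localisation and is
  smooth because it splits over the closure.\<close>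

theorem (in encompassing_poly) smoothable_power:
 assumes "smoothable (Ap_map {1..n} f) (Ap {1..n} f)"
 shows "smoothable (Ap_map {1..n} (f ^ d)) (Ap {1..n} (f ^ d))"
proof -
 obtain c ch W where c: "struct_consts n c" and c0: "\<And>i j k. c i j k $ 0 = cst i j k"
  and sp: "\<And>d. split_power n (\<lambda>i j k. to_ac (fps_to_fls (c i j k))) ch W"
  by (rule split_family[OF assms]) blast
 let ?F = "fps_to_fls :: 'k fps => 'k fls"
 note F = comm_ring_hom_fps_to_fls[where 'a = 'k]
 have cL: "struct_consts n (\<lambda>i j k. ?F (c i j k))" by (rule struct_consts_hom[OF c F])
 interpret A: sym_power n c d unfolding sym_power_def by (rule c)
 interpret B: sym_power n "\<lambda>i j k. ?F (c i j k)" d unfolding sym_power_def by (rule cL)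
 interpret K: sym_power n cst d ..
 let ?P = "mpoly_ring {1..n} :: 'k fps mpoly ring"
 have rP: "ring ?P" by (rule cring.axioms(1)[OF cring_mpoly_ring])
 interpret LA: lin_alg A.pow_alg A.pow_map by (rule A.lin_alg_pow_alg)
 interpret LB: lin_alg B.pow_alg B.pow_map by (rule B.lin_alg_pow_alg)
 have kh: "(\<lambda>p. B.enc (mapc ?F p)) \<in> Ring.ring_hom ?P B.pow_alg"
  using ring_hom_trans[OF mapc_ring_hom[OF F] B.pow_alg(2)] by (simp add: comp_def)
 have Fe: "A.enc p = A.enc q \<longleftrightarrow> B.enc (mapc ?F p) = B.enc (mapc ?F q)" if "p \<in> polys {1..n}" "q \<in> polys {1..n}" for p q
 proof -
  interpret m: comm_ring_hom "mapc ?F" by (rule comm_ring_hom_mapc[OF F])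
  have "inj ?F" by (rule injI) simp
  from Theta_mapc_eq_0[OF c F this diff_polys[OF that], of d] show ?thesis
   by (simp add: A.enc_eq_iff[OF that] B.enc_eq_iff[OF mapc_polys[OF F that(1)] mapc_polys[OF F that(2)]] m.hom_minus)
 qed
 have "\<exists>g\<in>Ring.ring_hom A.pow_alg B.pow_alg. \<forall>p\<in>carrier ?P. g (A.enc p) = B.enc (mapc ?F p)"
  by (rule factor_hom[OF A.pow_alg(2) kh _ rP]) (simp_all add: A.carrier_pow_alg Fe)
 then obtain \<iota> where \<iota>: "\<iota> \<in> Ring.ring_hom A.pow_alg B.pow_alg" "\<And>p. p \<in> polys {1..n} ==> \<iota> (A.enc p) = B.enc (mapc ?F p)"
  by auto
 have comp: "B.pow_map (?F x) = \<iota> (A.pow_map x)" for x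
  by (simp add: A.pow_map_def B.pow_map_def \<iota>(2)[OF Const_polys] mapc_Const[OF F])
 have enc0: "A.enc 0 = \<zero>\<^bsub>A.pow_alg\<^esub>" "B.enc 0 = \<zero>\<^bsub>B.pow_alg\<^esub>"
  using ring_hom_zero'[OF A.pow_alg(2) cring_mpoly_ring A.pow_alg(1)]
   ring_hom_zero'[OF B.pow_alg(2) cring_mpoly_ring B.pow_alg(1)] by simp_all
 have X: "\<iota> (A.pow_map fps_X) = B.pow_map fls_X" using comp[of fps_X] by simp
 have algA: "is_algebra A.pow_map A.pow_alg" and algB: "is_algebra B.pow_map B.pow_alg"
  unfolding is_algebra_def using LA.phi LB.phi A.pow_alg(1) B.pow_alg(1) by blast+
 have loc: "is_localization A.pow_alg (A.pow_map fps_X) B.pow_alg \<iota>"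
  unfolding is_localization_def
 proof (intro conjI ballI impI B.pow_alg(1) \<iota>(1))
  have "B.pow_map fls_X \<otimes>\<^bsub>B.pow_alg\<^esub> B.pow_map (inverse fls_X) = \<one>\<^bsub>B.pow_alg\<^esub>"
   unfolding LB.phi_mult[symmetric] by (simp add: right_inverse[OF fls_X_nonzero] del: fls_inverse_X)
  moreover from this have "B.pow_map (inverse fls_X) \<otimes>\<^bsub>B.pow_alg\<^esub> B.pow_map fls_X = \<one>\<^bsub>B.pow_alg\<^esub>"
   by (subst LB.m_comm) (simp_all only: LB.phi_closed)
  ultimately show "\<iota> (A.pow_map fps_X) \<in> Units B.pow_alg" unfolding X Units_def
   by (intro CollectI conjI bexI[of _ "B.pow_map (inverse fls_X)"] LB.phi_closed)
 next
  fix y assume "y \<in> carrier B.pow_alg"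
  then obtain p where p: "p \<in> polys {1..n}" "y = B.enc p" by (auto simp: B.carrier_pow_alg)
  obtain k q where q: "Const (fls_X ^ k) * p = mapc ?F q" "keys q \<subseteq> keys p" by (rule fls_common_denominator)
  have qp: "q \<in> polys {1..n}" by (rule keys_subset_polys[OF q(2) p(1)])
  have "y \<otimes>\<^bsub>B.pow_alg\<^esub> \<iota> (A.pow_map fps_X) [^]\<^bsub>B.pow_alg\<^esub> k = B.enc p \<otimes>\<^bsub>B.pow_alg\<^esub> B.enc (Const (fls_X ^ k))"
   unfolding X LB.phi_power[symmetric] p(2) by (simp add: B.pow_map_def)
  also have "\<dots> = B.enc (Const (fls_X ^ k) * p)"
   using ring_hom_mult[OF B.pow_alg(2), of p "Const (fls_X ^ k)"] p(1) by (simp add: mult.commute)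
  also have "\<dots> = \<iota> (A.enc q)" unfolding q(1) \<iota>(2)[OF qp] ..
  finally show "\<exists>a\<in>carrier A.pow_alg. \<exists>k::nat. y \<otimes>\<^bsub>B.pow_alg\<^esub> \<iota> (A.pow_map fps_X) [^]\<^bsub>B.pow_alg\<^esub> k = \<iota> a"
   using qp by (auto simp: A.carrier_pow_alg)
 next
  fix a assume a: "a \<in> carrier A.pow_alg" "\<iota> a = \<zero>\<^bsub>B.pow_alg\<^esub>"
  then obtain p where p: "p \<in> polys {1..n}" "a = A.enc p" by (auto simp: A.carrier_pow_alg)
  have "B.enc (mapc ?F p) = B.enc (mapc ?F 0)"
   using a(2) enc0 unfolding p(2) \<iota>(2)[OF p(1)] by (simp add: mapc_def peval_def)
  then have "a = \<zero>\<^bsub>A.pow_alg\<^esub>" using Fe[OF p(1) zero_polys] enc0 p(2) by simp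
  then show "\<exists>k::nat. A.pow_map fps_X [^]\<^bsub>A.pow_alg\<^esub> k \<otimes>\<^bsub>A.pow_alg\<^esub> a = \<zero>\<^bsub>A.pow_alg\<^esub>"
   using LA.phi_closed by (intro exI[of _ 0]) simp
 qed
 have sm: "smooth_algebra B.pow_map B.pow_alg" unfolding smooth_algebra_def
 proof (intro conjI algB exI[of _ "(\<lambda>i. B.enc (Var i)) ` {1..n}"])
  show "(\<lambda>i. B.enc (Var i)) ` {1..n} \<subseteq> carrier B.pow_alg"
   unfolding B.carrier_pow_alg using Var_polys by blast
  show "formally_smooth B.pow_map B.pow_alg"
   by (rule formally_smooth_pow_alg[OF cL sp])
 qed (simp_all add: B.generate_pow_alg)
 define t where "t = PIdl\<^bsub>A.pow_alg\<^esub> (A.pow_map fps_X)"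
 have t: "ideal t A.pow_alg" unfolding t_def by (rule LA.cgenideal_ideal) simp
 let ?e = "\<lambda>g :: 'k fps. g $ 0"
 note e = comm_ring_hom_fps_nth_0[where 'a = 'k]
 interpret e: comm_ring_hom "mapc ?e" by (rule comm_ring_hom_mapc[OF e])
 define R where "R = (mpoly_ring {1..n} :: 'k mpoly ring)"
 define I where "I = Ann {1..n} (f ^ d)"
 have II: "ideal I R" unfolding I_def R_def by (rule ideal_Ann)
 have Ap: "Ap {1..n} (f ^ d) = R Quot I" "Ap_map {1..n} (f ^ d) x = I +>\<^bsub>R\<^esub> Const x" for x
  by (simp_all add: Ap_def Ap_map_def R_def I_def quot_map_def)
 have h: "(\<lambda>p. t +>\<^bsub>A.pow_alg\<^esub> A.enc p) \<in> Ring.ring_hom ?P (A.pow_alg Quot t)"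
  using ring_hom_trans[OF A.pow_alg(2) quot_hom[OF t]] by (simp add: comp_def)
 have k: "(\<lambda>p. I +>\<^bsub>R\<^esub> mapc ?e p) \<in> Ring.ring_hom ?P (R Quot I)"
  using ring_hom_trans[OF mapc_ring_hom[OF e, of "{1..n}"] quot_hom[OF II[unfolded R_def]]] by (simp add: comp_def R_def)
 have Theta0: "K.Theta (mapc ?e p) = mapc ?e (A.Theta p)" if "p \<in> polys {1..n}" for p
  using Theta_mapc[OF c e that, of d] by (simp add: c0)
 \<comment> \<open>Equality modulo t in the family and equality in Ap(f^d) both amount to the
   vanishing of \<open>Theta\<close> at t = 0.\<close>
 have main: "t +>\<^bsub>A.pow_alg\<^esub> A.enc p = t +>\<^bsub>A.pow_alg\<^esub> A.enc q \<longleftrightarrow> I +>\<^bsub>R\<^esub> mapc ?e p = I +>\<^bsub>R\<^esub> mapc ?e q"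
  if pq: "p \<in> polys {1..n}" "q \<in> polys {1..n}" for p q
 proof -
  define r where "r = p - q"
  have r: "r \<in> polys {1..n}" unfolding r_def by (rule diff_polys[OF pq])
  have encX: "A.pow_map fps_X \<otimes>\<^bsub>A.pow_alg\<^esub> A.enc s = A.enc (Const fps_X * s)" if "s \<in> polys {1..n}" for s
   using ring_hom_mult[OF A.pow_alg(2), of "Const fps_X" s] that by (simp add: A.pow_map_def)
  have encr: "A.enc p \<ominus>\<^bsub>A.pow_alg\<^esub> A.enc q = A.enc r"
   using cring.minus_hom[OF cring_mpoly_ring A.pow_alg(2,1), of p q] pq by (simp add: mpoly_ring_minus r_def)
  have "t +>\<^bsub>A.pow_alg\<^esub> A.enc p = t +>\<^bsub>A.pow_alg\<^esub> A.enc q \<longleftrightarrow>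
   (\<exists>z\<in>carrier A.pow_alg. A.enc r = A.pow_map fps_X \<otimes>\<^bsub>A.pow_alg\<^esub> z)"
   unfolding t_def encr[symmetric] using pq by (intro quot_PIdl_eq_iff[OF A.pow_alg(1) LA.phi_closed]) (simp_all add: A.carrier_pow_alg)
  also have "\<dots> \<longleftrightarrow> (\<exists>s\<in>polys {1..n}. A.Theta (r - Const fps_X * s) = 0)"
   unfolding A.carrier_pow_alg using encX A.enc_eq_iff[OF r mult_polys[OF Const_polys]] by auto
  also have "\<dots> \<longleftrightarrow> K.Theta (mapc ?e r) = 0"
  proof
   assume "\<exists>s\<in>polys {1..n}. A.Theta (r - Const fps_X * s) = 0"
   then obtain s where s: "s \<in> polys {1..n}" "A.Theta (r - Const fps_X * s) = 0" by blast
   have "mapc ?e (r - Const fps_X * s) = mapc ?e r"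
    by (simp add: e.hom_minus e.hom_mult mapc_Const[OF e])
   then show "K.Theta (mapc ?e r) = 0"
    using Theta0[OF diff_polys[OF r mult_polys[OF Const_polys[of fps_X] s(1)]]] s(2) by simp
  next
   assume z: "K.Theta (mapc ?e r) = 0"
   \<comment> \<open>The normal form of r reduces at t = 0 to a normal form in the kernel, hence to
     0 by uniqueness; so all its coefficients are divisible by t.\<close>
   obtain q' where q': "q' \<in> polys {1..n}" "\<And>m. m \<in> keys q' ==> m \<in> monomials n d" "A.Theta q' = A.Theta r"
    by (rule A.normal_form_ex[OF r]) blast
   have "K.Theta (mapc ?e q') = 0" using Theta0[OF q'(1)] Theta0[OF r] q'(3) z by simp
   moreover have "m \<in> monomials n d" if "m \<in> keys (mapc ?e q')" for m
    using that q'(2)[of m] by (cases "m \<in> keys q'") (auto simp: in_keys_iff lookup_mapc[OF e])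
   ultimately have m0: "mapc ?e q' = 0" by (intro K.normal_form_unique[of "mapc ?e q'"]) blast+
   define s where "s = (\<Sum>m\<in>keys q'. single m (fps_shift 1 (lookup q' m)))"
   have sp: "s \<in> polys {1..n}" unfolding s_def using q'(1) by (intro sum_polys) (auto simp: polys_def split: if_splits)
   have "q' = Const fps_X * s"
   proof -
    have "Const fps_X * s = (\<Sum>m\<in>keys q'. single m (fps_X * fps_shift 1 (lookup q' m)))"
     unfolding s_def sum_distrib_left by (intro sum.cong refl) (simp add: Const_def mult_single)
    also have "\<dots> = (\<Sum>m\<in>keys q'. single m (lookup q' m))"
    proof (intro sum.cong refl arg_cong2[where f = single])
     fix m
     have "lookup q' m $ 0 = 0" using m0 lookup_mapc[OF e, of q' m] by simp
     then show "fps_X * fps_shift 1 (lookup q' m) = lookup q' m" using fps_decompose[of "lookup q' m"] by simp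
    qed
    finally show ?thesis by (simp add: sum_singles)
   qed
   then have "A.Theta (r - Const fps_X * s) = 0" using q'(3) by (simp add: A.Theta_diff)
   then show "\<exists>s\<in>polys {1..n}. A.Theta (r - Const fps_X * s) = 0" using sp by blast
  qed
  also have "\<dots> \<longleftrightarrow> mapc ?e r \<in> I" unfolding I_def Ann_power using mapc_polys[OF e r] by simp
  also have "\<dots> \<longleftrightarrow> I +>\<^bsub>R\<^esub> mapc ?e p = I +>\<^bsub>R\<^esub> mapc ?e q"
   using mpoly_coset_eq_iff[OF II[unfolded R_def] mapc_polys[OF e pq(1)] mapc_polys[OF e pq(2)]]
   by (simp add: R_def r_def e.hom_minus)
  finally show ?thesis .
 qed
 have surjh: "(\<lambda>p. t +>\<^bsub>A.pow_alg\<^esub> A.enc p) ` carrier ?P = carrier (A.pow_alg Quot t)"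
  unfolding carrier_Quot A.carrier_pow_alg by (simp add: image_image)
 have "p \<in> mapc ?e ` polys {1..n}" if "p \<in> polys {1..n}" for p
 proof
  show "p = mapc ?e (mapc fps_const p)"
   by (rule poly_mapping_eqI) (simp add: lookup_mapc[OF e] lookup_mapc[OF comm_ring_hom_fps_const])
  show "mapc fps_const p \<in> polys {1..n}" by (rule mapc_polys[OF comm_ring_hom_fps_const that])
 qed
 then have img: "mapc ?e ` polys {1..n} = polys {1..n}" using mapc_polys[OF e] by blast
 have surjk: "(\<lambda>p. I +>\<^bsub>R\<^esub> mapc ?e p) ` carrier ?P = carrier (R Quot I)"
 proof -
  have "(\<lambda>p. I +>\<^bsub>R\<^esub> mapc ?e p) ` polys {1..n} = (\<lambda>x. I +>\<^bsub>R\<^esub> x) ` mapc ?e ` polys {1..n}" by (simp only: image_image)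
  then show ?thesis unfolding carrier_Quot img by (simp add: R_def)
 qed
 have "\<exists>g\<in>Ring.ring_hom (A.pow_alg Quot t) (R Quot I). (\<forall>p\<in>carrier ?P. g (t +>\<^bsub>A.pow_alg\<^esub> A.enc p) = I +>\<^bsub>R\<^esub> mapc ?e p)
  \<and> bij_betw g (carrier (A.pow_alg Quot t)) (carrier (R Quot I))"
  by (rule factor_iso[OF h k rP surjh surjk]) (simp add: main)
 then obtain g where g: "g \<in> Ring.ring_hom (A.pow_alg Quot t) (R Quot I)"
  "\<And>p. p \<in> polys {1..n} ==> g (t +>\<^bsub>A.pow_alg\<^esub> A.enc p) = I +>\<^bsub>R\<^esub> mapc ?e p"
  "bij_betw g (carrier (A.pow_alg Quot t)) (carrier (R Quot I))" by auto
 have iso: "alg_isomorphic (\<lambda>c. quot_map A.pow_map A.pow_alg t (fps_const c)) (A.pow_alg Quot t)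
    (Ap_map {1..n} (f ^ d)) (Ap {1..n} (f ^ d))"
  unfolding alg_isomorphic_def alg_hom_def mem_Collect_eq Ap(1) quot_map_def
  using g by (intro bexI[of _ g] conjI CollectI allI) (simp_all add: Ap(2) A.pow_map_def mapc_Const[OF e])
 show ?thesis unfolding smoothable_def Let_def
  using algA free_of_rank_iff[OF A.lin_alg_pow_alg] A.free_alg_pow_alg iso[unfolded t_def] loc algB comp sm by blast
qed

section \<open>Projective Nullstellensatz\<close>

definition homogeneous_ideal :: "nat => 'k::field mpoly set => bool" where
 "homogeneous_ideal n Q \<longleftrightarrow> ideal Q (mpoly_ring {0..n}) \<and> (\<forall>p\<in>Q. \<forall>e. hom_part e p \<in> Q)"

text \<open>Only finitely many memberships are involved, so for the union of a chain of ideals they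
  already hold in one member; the Zorn argument depends on this.\<close>

definition irrelevant :: "nat => 'k::field mpoly set => bool" where
 "irrelevant n Q \<longleftrightarrow> (\<forall>i\<le>n. \<exists>N. Var i ^ N \<in> Q)"

lemma homogeneous_idealD:
 assumes "homogeneous_ideal n Q"
 shows "p \<in> Q ==> p \<in> polys {0..n}" "0 \<in> Q" "p \<in> Q ==> q \<in> Q ==> p + q \<in> Q" "p \<in> Q ==> q \<in> Q ==> p - q \<in> Q"
  "p \<in> Q ==> s \<in> polys {0..n} ==> s * p \<in> Q" "p \<in> Q ==> s \<in> polys {0..n} ==> p * s \<in> Q"
  "p \<in> Q ==> hom_part e p \<in> Q"
 using assms ideal_mpoly_ringD[of Q "{0..n}"] unfolding homogeneous_ideal_def by (auto simp: mult.commute)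

lemma homogeneous_ideal_sum:
 "homogeneous_ideal n Q ==> (\<And>x. x \<in> A ==> f x \<in> Q) ==> sum f A \<in> Q"
 by (induction A rule: infinite_finite_induct) (auto simp: homogeneous_idealD)

lemma Var_power: "Var i ^ k = (single (single i k) 1 :: 'a::comm_semiring_1 mpoly)"
proof (induction k)
 case (Suc k)
 then show ?case by (simp add: Var_def mult_single single_add[symmetric] Suc_eq_plus1_left power_add)
qed simp

text \<open>Pigeonhole: in a monomial of degree above the sum of the \<open>N i\<close>, some
  exponent reaches its bound.\<close>

lemma irrelevant_forms:
 assumes Q: "homogeneous_ideal n Q" and irr: "irrelevant n Q"
 obtains N where "\<And>e q. N \<le> e ==> q \<in> forms n e ==> q \<in> Q"
proof -
 obtain N where N: "\<And>i. i \<le> n ==> Var i ^ N i \<in> Q" using irr unfolding irrelevant_def by metis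
 have s: "single m c \<in> Q" if m: "keys m \<subseteq> {0..n}" "(\<Sum>i\<le>n. N i) < mdeg m" for m and c :: 'a
 proof -
  have "\<exists>i\<le>n. N i \<le> lookup m i"
  proof (rule ccontr)
   assume "\<not> (\<exists>i\<le>n. N i \<le> lookup m i)"
   then have "(\<Sum>i\<le>n. lookup m i) \<le> (\<Sum>i\<le>n. N i)" by (intro sum_mono) (meson atMost_iff nle_le)
   then show False using m mdeg_superset[of "{0..n}" m] by (simp add: atMost_atLeast0)
  qed
  then obtain i where i: "i \<le> n" "N i \<le> lookup m i" by blast
  have "m = single i (N i) + (m - single i (N i))"
   using i(2) by (intro poly_mapping_eqI) (auto simp: lookup_add lookup_minus lookup_single when_def)
  then have "single m c = Var i ^ N i * single (m - single i (N i)) c"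
  proof -
   have "Var i ^ k = (single (single i k) 1 :: 'a mpoly)" for k by (rule Var_power)
   then show ?thesis using \<open>m = _\<close> by (simp add: mult_single)
  qed
  moreover have "single (m - single i (N i)) c \<in> polys {0..n}"
   using m(1) by (intro single_polys) (auto simp: in_keys_iff lookup_minus)
  ultimately show ?thesis using homogeneous_idealD(6)[OF Q N[OF i(1)]] by simp
 qed
 show thesis
 proof (rule that[of "Suc (\<Sum>i\<le>n. N i)"])
  fix e and q :: "'a mpoly" assume e: "Suc (\<Sum>i\<le>n. N i) \<le> e" and q: "q \<in> forms n e"
  have "(\<Sum>m\<in>keys q. single m (lookup q m)) \<in> Q"
   using q e by (intro homogeneous_ideal_sum[OF Q] s) (auto simp: forms_def polys_def)
  then show "q \<in> Q" by (simp only: sum_singles)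
 qed
qed

definition adjoin :: "nat => 'k::field mpoly set => 'k mpoly => 'k mpoly set" where
 "adjoin n Q g = {p + g * s | p s. p \<in> Q \<and> s \<in> polys {0..n}}"

lemma adjoinI: "p \<in> Q ==> s \<in> polys {0..n} ==> p + g * s \<in> adjoin n Q g"
 by (auto simp: adjoin_def)

lemma ideal_adjoin:
 assumes Q: "ideal Q (mpoly_ring {0..n})" and g: "g \<in> polys {0..n}"
 shows "ideal (adjoin n Q g) (mpoly_ring {0..n})"
proof (rule ideal_mpoly_ringI)
 note QD = ideal_mpoly_ringD[OF Q]
 show "adjoin n Q g \<subseteq> polys {0..n}" using QD(1) g by (auto simp: adjoin_def intro!: add_polys mult_polys)
 show "0 \<in> adjoin n Q g" using adjoinI[OF QD(2) zero_polys, where g = g and n = n] by simp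
 show "x + y \<in> adjoin n Q g" if xy: "x \<in> adjoin n Q g" "y \<in> adjoin n Q g" for x y
 proof -
  obtain p s p' s' where "p \<in> Q" "p' \<in> Q" "s \<in> polys {0..n}" "s' \<in> polys {0..n}" "x = p + g * s" "y = p' + g * s'"
   using xy unfolding adjoin_def by blast
  then show ?thesis using adjoinI[OF QD(3) add_polys, of p p' s n s' g] by (simp add: algebra_simps)
 qed
 show "y * x \<in> adjoin n Q g" if xy: "x \<in> adjoin n Q g" "y \<in> polys {0..n}" for x y
 proof -
  obtain p s where "p \<in> Q" "s \<in> polys {0..n}" "x = p + g * s" using xy(1) unfolding adjoin_def by blast
  then show ?thesis using adjoinI[OF QD(4) mult_polys, of p y y n s g] xy(2) by (simp add: algebra_simps)
 qed
qed

lemma adjoin_subset: "ideal Q (mpoly_ring {0..n}) ==> Q \<subseteq> adjoin n Q g"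
 using adjoinI[OF _ zero_polys, where Q = Q and g = g and n = n] by auto

lemma adjoin_self: "ideal Q (mpoly_ring {0..n}) ==> g \<in> adjoin n Q g"
 using adjoinI[OF ideal_mpoly_ringD(2) one_polys, where Q = Q and g = g and n = n] by auto

lemma homogeneous_adjoin:
 assumes Q: "homogeneous_ideal n Q" and g: "g \<in> forms n e"
 shows "homogeneous_ideal n (adjoin n Q g)"
 unfolding homogeneous_ideal_def
proof (intro conjI ballI allI)
 have QI: "ideal Q (mpoly_ring {0..n})" using Q by (simp add: homogeneous_ideal_def)
 show "ideal (adjoin n Q g) (mpoly_ring {0..n})" by (rule ideal_adjoin[OF QI forms_polys[OF g]])
 fix x j assume "x \<in> adjoin n Q g"
 then obtain p s where ps: "p \<in> Q" "s \<in> polys {0..n}" "x = p + g * s" unfolding adjoin_def by blast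
 have "hom_part (j - e) s \<in> polys {0..n}" by (rule forms_polys[OF hom_part_forms[OF ps(2)]])
 then show "hom_part j x \<in> adjoin n Q g"
  unfolding ps(3) hom_part_add hom_part_form_mult[OF g]
  using adjoinI[OF homogeneous_idealD(7)[OF Q ps(1), of j], where g = g and n = n, of "hom_part (j - e) s"]
   adjoinI[OF homogeneous_idealD(7)[OF Q ps(1), of j] zero_polys, where g = g and n = n] by simp
qed

text \<open>A homogeneous ideal maximal among the non-irrelevant ones is the ideal of a point: it is prime, and
 adjoining a variable \<open>l\<close> outside it bounds the dimensions of the graded pieces of the quotient, so that
 every binary form in a variable and \<open>l\<close> of large degree has a multiple in it.\<close>

locale maximal_homogeneous =
 fixes n :: nat and P :: "'k::alg_closed_field mpoly set"
 assumes P: "homogeneous_ideal n P" and not_irr: "\<not> irrelevant n P"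
  and maximal: "homogeneous_ideal n Q ==> P \<subseteq> Q ==> \<not> irrelevant n Q ==> Q = P"
begin

lemma PI: "ideal P (mpoly_ring {0..n})" using P by (simp add: homogeneous_ideal_def)

lemmas PD = homogeneous_idealD[OF P]

lemma unit_cancel: "c \<noteq> 0 ==> Const c * p \<in> P ==> p \<in> P"
proof -
 assume c: "c \<noteq> 0" and p: "Const c * p \<in> P"
 have "Const (inverse c) * (Const c * p) \<in> P" by (rule PD(5)[OF p]) simp
 moreover have "Const (inverse c) * (Const c * p) = p"
  unfolding mult.assoc[symmetric] Const_mult[symmetric] left_inverse[OF c] by simp
 ultimately show ?thesis by simp
qed

lemma adjoin_irrelevant: "g \<in> forms n e ==> g \<notin> P ==> irrelevant n (adjoin n P g)"
 using maximal[OF homogeneous_adjoin[OF P]] adjoin_subset[OF PI] adjoin_self[OF PI] by blast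

text \<open>By maximality, adjoining a or b makes the ideal irrelevant; the product of the two
  resulting expressions for powers of a variable then lies in P.\<close>

lemma prime:
 assumes a: "a \<in> forms n j" and b: "b \<in> forms n k" and ab: "a * b \<in> P" shows "a \<in> P \<or> b \<in> P"
proof (rule ccontr)
 assume "\<not> (a \<in> P \<or> b \<in> P)"
 then have ia: "irrelevant n (adjoin n P a)" and ib: "irrelevant n (adjoin n P b)"
  using adjoin_irrelevant a b by blast+
 have "irrelevant n P" unfolding irrelevant_def
 proof (intro allI impI)
  fix i assume i: "i \<le> n"
  obtain N M where "Var i ^ N \<in> adjoin n P a" "Var i ^ M \<in> adjoin n P b" using ia ib i unfolding irrelevant_def by blast
  then obtain p s p' s' where ps: "p \<in> P" "p' \<in> P" "s \<in> polys {0..n}" "s' \<in> polys {0..n}"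
   "Var i ^ N = p + a * s" "Var i ^ M = p' + b * s'" unfolding adjoin_def by blast
  have "Var i ^ (N + M) = (p' + b * s') * p + (a * s) * p' + (s * s') * (a * b)"
   unfolding power_add ps(5,6) by (simp add: algebra_simps)
  also have "\<dots> \<in> P"
  proof (intro PD(3))
   show "(p' + b * s') * p \<in> P"
    by (rule PD(5)[OF ps(1) add_polys[OF PD(1)[OF ps(2)] mult_polys[OF forms_polys[OF b] ps(4)]]])
   show "a * s * p' \<in> P" by (rule PD(5)[OF ps(2) mult_polys[OF forms_polys[OF a] ps(3)]])
   show "s * s' * (a * b) \<in> P" by (rule PD(5)[OF ab mult_polys[OF ps(3,4)]])
  qed
  finally show "\<exists>N. Var i ^ N \<in> P" by blast
 qed
 with not_irr show False by simp
qed

lemma point: "\<exists>a. (\<exists>i\<le>n. a i \<noteq> 0) \<and> (\<forall>\<sigma>\<in>P. peval (\<lambda>c. c) a \<sigma> = 0)"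
proof -
 obtain i0 where i0: "i0 \<le> n" "\<And>N. Var i0 ^ N \<notin> P" using not_irr unfolding irrelevant_def by blast
 define l :: "'k mpoly" where "l = Var i0"
 have l: "l \<in> forms n 1" unfolding l_def by (rule Var_forms[OF i0(1)])
 have lk: "l ^ k \<in> forms n k" for k using power_forms[OF l, of k] by simp
 have lP: "l ^ k \<notin> P" for k unfolding l_def by (rule i0(2))
 \<comment> \<open>From degree N on every form lies in P + (l). Dividing by l repeatedly,
   \<open>red\<close> makes each such form congruent to a power of l times a form of degree
   N.\<close>
 obtain N where N: "\<And>e q. N \<le> e ==> q \<in> forms n e ==> q \<in> adjoin n P l"
  by (rule irrelevant_forms[OF homogeneous_adjoin[OF P l] adjoin_irrelevant[OF l]]) (use lP[of 1] in auto)
 have red: "\<exists>q'\<in>forms n N. q - l ^ t * q' \<in> P" if "q \<in> forms n (N + t)" for q t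
  using that
 proof (induction t arbitrary: q)
  case 0
  then show ?case using PD(2) by (intro bexI[of _ q]) auto
 next
  case (Suc t)
  have "q \<in> adjoin n P l" by (rule N[OF _ Suc.prems]) simp
  then obtain p s where ps: "p \<in> P" "s \<in> polys {0..n}" "q = p + l * s" unfolding adjoin_def by blast
  have q: "q = hom_part (N + Suc t) p + l * hom_part (N + t) s"
   using hom_part_of_form[OF Suc.prems, of "N + Suc t"] unfolding ps(3) hom_part_add hom_part_form_mult[OF l] by simp
  obtain q' where q': "q' \<in> forms n N" "hom_part (N + t) s - l ^ t * q' \<in> P"
   using Suc.IH[OF hom_part_forms[OF ps(2)]] by blast
  have "q - l ^ Suc t * q' = hom_part (N + Suc t) p + l * (hom_part (N + t) s - l ^ t * q')"
   by (subst q) (simp add: algebra_simps)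
  also have "\<dots> \<in> P" by (intro PD(3) PD(7) PD(5) ps(1) q'(2) forms_polys[OF l])
  finally show ?case using q'(1) by blast
 qed
 have ex: "\<exists>a. Var i - Const a * l \<in> P" if i: "i \<le> n" for i
 proof -
  \<comment> \<open>M is the dimension of the forms of degree N. The M + 1 monomials of degree M in
    \<open>Var i\<close> and l, times l^N, reduce to l^M times such forms and are therefore
    dependent modulo P.\<close>
  define M where "M = card (form_monomials n N)"
  obtain g where g: "bij_betw g {..<M} (form_monomials n N)"
   using ex_bij_betw_nat_finite[OF finite_form_monomials[of n N]] by (auto simp: M_def atLeast0LessThan)
  define w where "w j = l ^ N * (Var i ^ j * l ^ (M - j))" for j
  have w: "w j \<in> forms n (N + M)" if "j \<le> M" for j
  proof -
   have "Var i ^ j * l ^ (M - j) \<in> forms n (j + (M - j))"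
    using mult_forms[OF power_forms[OF Var_forms[OF i], of j] lk[of "M - j"]] by simp
   then show ?thesis unfolding w_def using mult_forms[OF lk[of N]] that by simp
  qed
  have "\<forall>j. \<exists>q. j \<le> M \<longrightarrow> q \<in> forms n N \<and> w j - l ^ M * q \<in> P" using red[OF w] by blast
  then obtain q where q: "\<And>j. j \<le> M ==> q j \<in> forms n N" "\<And>j. j \<le> M ==> w j - l ^ M * q j \<in> P"
   unfolding choice_iff by blast
  obtain s where s: "\<exists>j\<le>M. s j \<noteq> 0" "\<And>j. j < M ==> (\<Sum>t\<le>M. s t * lookup (q t) (g j)) = 0"
   by (rule linear_dependence[of M "\<lambda>t j. lookup (q t) (g j)"]) blast
  have q0: "(\<Sum>t\<le>M. Const (s t) * q t) = 0"
  proof (rule poly_mapping_eqI)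
   fix m
   have lk: "lookup (\<Sum>t\<le>M. Const (s t) * q t) m = (\<Sum>t\<le>M. s t * lookup (q t) m)"
    by (simp add: lookup_sum lookup_Const_mult)
   show "lookup (\<Sum>t\<le>M. Const (s t) * q t) m = lookup 0 m"
   proof (cases "m \<in> form_monomials n N")
    case True
    then obtain j where "j < M" "m = g j" using g by (auto simp: bij_betw_def)
    then show ?thesis using s(2)[of j] unfolding lk by simp
   next
    case False
    then have "m \<notin> keys (q t)" if "t \<le> M" for t using q(1)[OF that] by (auto simp: forms_def polys_def form_monomials_def)
    then show ?thesis unfolding lk by (auto simp: in_keys_iff intro!: sum.neutral)
   qed
  qed
  have "l ^ N * (\<Sum>t\<le>M. Const (s t) * (Var i ^ t * l ^ (M - t))) =
   (\<Sum>t\<le>M. Const (s t) * (w t - l ^ M * q t)) + l ^ M * (\<Sum>t\<le>M. Const (s t) * q t)"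
   by (simp add: w_def sum_distrib_left sum_subtractf right_diff_distrib mult.left_commute)
  also have "\<dots> \<in> P" unfolding q0 mult_zero_right add_0_right using q(2)
   by (intro homogeneous_ideal_sum[OF P] PD(5)) auto
  finally have "l ^ N * (\<Sum>t\<le>M. Const (s t) * (Var i ^ t * l ^ (M - t))) \<in> P" .
  moreover have "(\<Sum>t\<le>M. Const (s t) * (Var i ^ t * l ^ (M - t))) \<in> forms n M"
  proof (intro sum_forms Const_mult_forms)
   fix t assume "t \<in> {..M}"
   then show "Var i ^ t * l ^ (M - t) \<in> forms n M"
    using mult_forms[OF power_forms[OF Var_forms[OF i], of t] lk[of "M - t"]] by simp
  qed
  ultimately have bP: "(\<Sum>t\<le>M. Const (s t) * (Var i ^ t * l ^ (M - t))) \<in> P"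
   using prime[OF lk[of N]] lP by blast
  define f where "f = (\<Sum>t\<le>M. Polynomial.monom (s t) t)"
  have cf: "coeff f t = s t" if "t \<le> M" for t
  proof -
   have "coeff f t = (\<Sum>t'\<le>M. if t' = t then s t' else 0)" unfolding f_def coeff_sum by (intro sum.cong) auto
   then show ?thesis using that by simp
  qed
  \<comment> \<open>A binary form splits into linear factors; by primality one of them lies in P,
    and it involves \<open>Var i\<close> because no power of l lies in P.\<close>
  have fac: "\<exists>a. Var i - Const a * l \<in> P"
   if "f \<noteq> 0" "degree f \<le> M" "(\<Sum>t\<le>M. Const (coeff f t) * (Var i ^ t * l ^ (M - t))) \<in> P" for f M
   using that
  proof (induction M arbitrary: f)
   case 0
   have "Const (coeff f 0) * l ^ 0 \<in> P" using 0 by simp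
   moreover have "coeff f 0 \<noteq> 0" using 0 by (metis le_zero_eq leading_coeff_0_iff)
   ultimately show ?case using lP[of 0] unit_cancel by blast
  next
   case (Suc M)
   show ?case
   proof (cases "degree f = 0")
    case True
    then have "coeff f t = 0" if "t > 0" for t using that by (simp add: coeff_eq_0)
    then have "(\<Sum>t\<le>Suc M. Const (coeff f t) * (Var i ^ t * l ^ (Suc M - t))) = (\<Sum>t\<in>{0}. Const (coeff f t) * (Var i ^ t * l ^ (Suc M - t)))"
     by (intro sum.mono_neutral_right) auto
    then have "Const (coeff f 0) * l ^ Suc M \<in> P" using Suc.prems(3) by simp
    moreover have "coeff f 0 \<noteq> 0" using Suc.prems(1) True by (metis leading_coeff_0_iff)
    ultimately show ?thesis using lP[of "Suc M"] unit_cancel by blast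
   next
    case False
    then obtain r where "poly f r = 0" using alg_closed_imp_poly_has_root[of f] by auto
    then obtain h where h: "f = [:-r, 1:] * h" by (metis dvdE poly_eq_0_iff_dvd)
    have h0: "h \<noteq> 0" using Suc.prems(1) h by auto
    then have dh: "degree f = Suc (degree h)" unfolding h by (subst degree_mult_eq) auto
    have dh': "degree h \<le> M" using dh Suc.prems(2) by simp
    let ?H = "\<Sum>t\<le>M. Const (coeff h t) * (Var i ^ t * l ^ (M - t))"
    have c: "coeff f t = (case t of 0 => 0 | Suc u => coeff h u) - r * coeff h t" for t
     unfolding h by (rule coeff_linear_factor_mult)
    have "(\<Sum>t\<le>Suc M. Const (coeff f t) * (Var i ^ t * l ^ (Suc M - t))) =
     (\<Sum>t\<le>Suc M. Const (case t of 0 => 0 | Suc u => coeff h u) * (Var i ^ t * l ^ (Suc M - t)))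
     - (\<Sum>t\<le>Suc M. Const (r * coeff h t) * (Var i ^ t * l ^ (Suc M - t)))"
     unfolding c Const_diff left_diff_distrib sum_subtractf ..
    also have "(\<Sum>t\<le>Suc M. Const (case t of 0 => 0 | Suc u => coeff h u) * (Var i ^ t * l ^ (Suc M - t))) = Var i * ?H"
     by (subst sum.atMost_Suc_shift) (simp add: sum_distrib_left mult_ac)
    also have "(\<Sum>t\<le>Suc M. Const (r * coeff h t) * (Var i ^ t * l ^ (Suc M - t))) = Const r * l * ?H"
    proof -
     have "coeff h (Suc M) = 0" using dh' by (simp add: coeff_eq_0)
     then have "(\<Sum>t\<le>Suc M. Const (r * coeff h t) * (Var i ^ t * l ^ (Suc M - t))) =
      (\<Sum>t\<le>M. Const (r * coeff h t) * (Var i ^ t * l ^ (Suc M - t)))" by simp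
     also have "\<dots> = Const r * l * ?H" unfolding sum_distrib_left
      by (intro sum.cong refl) (simp add: Suc_diff_le Const_mult mult_ac)
     finally show ?thesis .
    qed
    finally have "(Var i - Const r * l) * ?H \<in> P" using Suc.prems(3) by (simp add: left_diff_distrib)
    moreover have "Var i - Const r * l \<in> forms n 1"
     using diff_forms[OF Var_forms[OF i] Const_mult_forms[OF l]] .
    moreover have "?H \<in> forms n M"
    proof (intro sum_forms Const_mult_forms)
     fix t assume "t \<in> {..M}"
     then show "Var i ^ t * l ^ (M - t) \<in> forms n M"
      using mult_forms[OF power_forms[OF Var_forms[OF i], of t] lk[of "M - t"]] by simp
    qed
    ultimately have "Var i - Const r * l \<in> P \<or> ?H \<in> P" using prime by blast
    then show ?thesis using Suc.IH[OF h0 dh'] by blast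
   qed
  qed
  have "degree f \<le> M" unfolding f_def by (rule degree_sum_le) (auto intro: order_trans[OF degree_monom_le])
  moreover have "f \<noteq> 0" using s(1) cf by auto
  moreover have "(\<Sum>t\<le>M. Const (coeff f t) * (Var i ^ t * l ^ (M - t))) \<in> P" using bP by (simp add: cf)
  ultimately show ?thesis by (intro fac)
 qed
 define a where "a i = (if i = i0 then 1 else SOME a. Var i - Const a * l \<in> P)" for i
 have a: "Var i - Const (a i) * l \<in> P" if "i \<le> n" for i
 proof (cases "i = i0")
  case True
  then show ?thesis using PD(2) by (simp add: a_def l_def)
 next
  case False
  have "Var i - Const (SOME a. Var i - Const a * l \<in> P) * l \<in> P" using ex[OF that] by (rule someI_ex)
  with False show ?thesis by (simp add: a_def)
 qed
 \<comment> \<open>Modulo P each variable is a multiple of l, so a form of degree e becomes its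
   value at a times l^e.\<close>
 have mono: "single m 1 - Const (mval a m) * l ^ mdeg m \<in> P" if "keys m \<subseteq> {0..n}" for m
  using that
 proof (induction m rule: single_induct)
  case zero
  then show ?case using PD(2) by (simp add: Const_def)
 next
  case (add i m)
  have "single (single i 1 + m) 1 - Const (mval a (single i 1 + m)) * l ^ mdeg (single i 1 + m)
   = Var i * (single m 1 - Const (mval a m) * l ^ mdeg m) + (Const (mval a m) * l ^ mdeg m) * (Var i - Const (a i) * l)"
   unfolding Var_mult_single[symmetric] mval_add mdeg_add by (simp add: Const_mult power_add algebra_simps)
  also have "\<dots> \<in> P"
   using add a[of i] forms_polys[OF lk] by (intro PD(3) PD(5) mult_polys Var_polys) auto
  finally show ?case .
 qed
 have form: "peval (\<lambda>c. c) a \<sigma> = 0" if \<sigma>: "\<sigma> \<in> P" "\<sigma> \<in> forms n e" for \<sigma> e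
 proof (rule ccontr)
  assume nz: "peval (\<lambda>c. c) a \<sigma> \<noteq> 0"
  have k: "keys m \<subseteq> {0..n}" "mdeg m = e" if "m \<in> keys \<sigma>" for m using \<sigma>(2) that by (auto simp: forms_def polys_def)
  have "\<sigma> - Const (peval (\<lambda>c. c) a \<sigma>) * l ^ e = (\<Sum>m\<in>keys \<sigma>. Const (lookup \<sigma> m) * (single m 1 - Const (mval a m) * l ^ mdeg m))"
  proof -
   have "Const (peval (\<lambda>c. c) a \<sigma>) * l ^ e = (\<Sum>m\<in>keys \<sigma>. Const (lookup \<sigma> m) * (Const (mval a m) * l ^ mdeg m))"
    unfolding peval_alt Const_sum sum_distrib_right by (intro sum.cong refl) (simp add: k(2) Const_mult mult.assoc)
   then show ?thesis by (subst (1) mpoly_eq_sum) (simp only: right_diff_distrib sum_subtractf)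
  qed
  also have "\<dots> \<in> P" using mono k(1) by (intro homogeneous_ideal_sum[OF P] PD(5)) auto
  finally have "\<sigma> - (\<sigma> - Const (peval (\<lambda>c. c) a \<sigma>) * l ^ e) \<in> P" using \<sigma>(1) by (rule PD(4)[rotated])
  then have "Const (peval (\<lambda>c. c) a \<sigma>) * l ^ e \<in> P" by simp
  then show False using nz lP[of e] unit_cancel by blast
 qed
 have "peval (\<lambda>c. c) a \<sigma> = 0" if \<sigma>: "\<sigma> \<in> P" for \<sigma>
 proof -
  interpret h: comm_ring_hom "peval (\<lambda>c. c) a" by (rule comm_ring_hom_peval[OF comm_ring_hom_id])
  obtain N where N: "\<And>m. m \<in> keys \<sigma> ==> mdeg m \<le> N" by (rule degree_bound[of \<sigma>]) blast
  have "peval (\<lambda>c. c) a (\<Sum>e\<le>N. hom_part e \<sigma>) = (\<Sum>e\<le>N. peval (\<lambda>c. c) a (hom_part e \<sigma>))" by (rule h.hom_sum)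
  also have "\<dots> = 0" using form[OF PD(7)[OF \<sigma>] hom_part_forms[OF PD(1)[OF \<sigma>]]] by simp
  finally show ?thesis by (simp only: sum_hom_part[OF N])
 qed
 moreover have "a i0 \<noteq> 0" by (simp add: a_def)
 ultimately show ?thesis using i0(1) by blast
qed

end

text \<open>Zorn's lemma gives a maximal homogeneous ideal that is not irrelevant; its point is a
  zero of J.\<close>

theorem projective_nullstellensatz:
 fixes J :: "'k::alg_closed_field mpoly set"
 assumes J: "homogeneous_ideal n J" and ni: "\<not> irrelevant n J"
 obtains a where "\<exists>i\<le>n. a i \<noteq> 0" "\<And>\<sigma>. \<sigma> \<in> J ==> peval (\<lambda>c. c) a \<sigma> = 0"
proof -
 define A where "A = {Q. homogeneous_ideal n Q \<and> J \<subseteq> Q \<and> \<not> irrelevant n Q}"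
 have "\<exists>P\<in>A. \<forall>Q\<in>A. P \<subseteq> Q \<longrightarrow> Q = P"
 proof (rule subset_Zorn_nonempty)
  show "A \<noteq> {}" using assms by (auto simp: A_def)
  fix C assume C: "C \<noteq> {}" "subset.chain A C"
  have CA: "Q \<in> C ==> homogeneous_ideal n Q \<and> J \<subseteq> Q \<and> \<not> irrelevant n Q" for Q
   using C(2) by (auto simp: A_def subset.chain_def)
  have CH: "Q \<in> C ==> homogeneous_ideal n Q" for Q using CA by blast
  have "ideal (\<Union>C) (mpoly_ring {0..n})"
  proof (rule ideal_mpoly_ringI)
   show "\<Union>C \<subseteq> polys {0..n}" using homogeneous_idealD(1)[OF CH] by blast
   show "0 \<in> \<Union>C" using C(1) homogeneous_idealD(2)[OF CH] by blast
   show "p + q \<in> \<Union>C" if pq: "p \<in> \<Union>C" "q \<in> \<Union>C" for p q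
   proof -
    have fin: "finite {p, q}" and sub: "{p, q} \<subseteq> \<Union>C" using pq by simp_all
    obtain Q where "Q \<in> C" "{p, q} \<subseteq> Q" by (rule finite_subset_Union_chain[OF fin sub C])
    then show ?thesis using homogeneous_idealD(3)[OF CH] by blast
   qed
   show "q * p \<in> \<Union>C" if "p \<in> \<Union>C" "q \<in> polys {0..n}" for p q
    using that homogeneous_idealD(5)[OF CH] by blast
  qed
  then have H: "homogeneous_ideal n (\<Union>C)"
   using homogeneous_idealD(7)[OF CH] unfolding homogeneous_ideal_def by blast
  have "\<not> irrelevant n (\<Union>C)"
  proof
   assume "irrelevant n (\<Union>C)"
   then obtain N where N: "\<And>i. i \<le> n ==> Var i ^ N i \<in> \<Union>C" unfolding irrelevant_def by metis
   have fin: "finite ((\<lambda>i. Var i ^ N i) ` {..n})" and sub: "(\<lambda>i. Var i ^ N i) ` {..n} \<subseteq> \<Union>C"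
    using N by (simp_all add: image_subset_iff)
   obtain Q where Q: "Q \<in> C" "(\<lambda>i. Var i ^ N i) ` {..n} \<subseteq> Q"
    by (rule finite_subset_Union_chain[OF fin sub C])
   have "Var i ^ N i \<in> Q" if "i \<le> n" for i using Q(2) that by (simp add: image_subset_iff)
   then have "irrelevant n Q" unfolding irrelevant_def by blast
   then show False using CA[OF Q(1)] by blast
  qed
  then show "\<Union>C \<in> A" using H C(1) CA by (auto simp: A_def)
 qed
 then obtain P where PA: "P \<in> A" and max: "\<And>Q. Q \<in> A ==> P \<subseteq> Q ==> Q = P" by blast
 interpret maximal_homogeneous n P
 proof
  show "homogeneous_ideal n P" "\<not> irrelevant n P" using PA by (simp_all add: A_def)
  show "Q = P" if "homogeneous_ideal n Q" "P \<subseteq> Q" "\<not> irrelevant n Q" for Q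
  proof (rule max[OF _ that(2)])
   have "J \<subseteq> P" using PA by (simp add: A_def)
   then have "J \<subseteq> Q" using that(2) by (rule order_trans)
   then show "Q \<in> A" using that by (simp add: A_def)
  qed
 qed
 obtain a where a: "\<exists>i\<le>n. a i \<noteq> 0" "\<forall>\<sigma>\<in>P. peval (\<lambda>c. c) a \<sigma> = 0" using point by blast
 have "J \<subseteq> P" using PA by (simp add: A_def)
 show thesis
 proof (rule that[OF a(1)])
  show "peval (\<lambda>c. c) a \<sigma> = 0" if "\<sigma> \<in> J" for \<sigma> using a(2) \<open>J \<subseteq> P\<close> that by blast
 qed
qed

section \<open>Lower bounds for ranks\<close>

lemma lin_alg_mpoly_ring: "lin_alg (mpoly_ring V) (Const :: 'a::comm_ring_1 => _)"
 by (intro lin_alg.intro cring_mpoly_ring lin_alg_axioms.intro ring_hom_memI) (simp_all add: Const_mult Const_add)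

lemma lin_mpoly_ring:
 fixes p :: "nat => 'a::comm_ring_1 mpoly"
 assumes "\<And>i. i < M ==> p i \<in> polys V"
 shows "lin_alg.lin (mpoly_ring V) Const p M s = (\<Sum>i<M. Const (s i) * p i)"
proof -
 interpret lin_alg "mpoly_ring V :: 'a mpoly ring" Const by (rule lin_alg_mpoly_ring)
 show "lin p M s = (\<Sum>i<M. Const (s i) * p i)"
  using assms
 proof (induction M)
  case (Suc M)
  have "p i \<in> polys V" if "i \<le> M" for i using Suc.prems that by simp
  then have "lin p (Suc M) s = Const (s M) * p M + lin p M s"
   unfolding lin_def lessThan_Suc by (subst finsum_insert) (auto simp: mult_polys)
  then show ?case using Suc by (simp add: add.commute)
 qed (simp add: lin_def)
qed

lemma lin_quotient:
 assumes "h \<in> Ring.ring_hom (mpoly_ring V) A" "cring A" "\<And>i. i < M ==> p i \<in> polys V"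
 shows "lin_alg.lin A (\<lambda>c. h (Const c)) (\<lambda>i. h (p i)) M s = h (\<Sum>i<M. Const (s i) * p i)"
 using lin_alg.hom_lin[OF lin_alg_mpoly_ring assms(1,2), where b = p and N = M and s = s]
  lin_mpoly_ring[OF assms(3)] assms(3) by auto

text \<open>The catalecticant of G in degree k has rank at most r. Stated for arbitrary tuples of r
  + 1 forms, the condition follows from linear dependence in a space of dimension r and passes to
  limits through determinants.\<close>

definition dependent_derivs :: "nat => nat => nat => 'k::field_char_0 mpoly => bool" where
 "dependent_derivs n k r G \<longleftrightarrow> (\<forall>\<sigma>. (\<forall>i\<le>r. \<sigma> i \<in> forms n k) \<longrightarrow>
   (\<exists>a. (\<exists>i\<le>r. a i \<noteq> 0) \<and> act (\<Sum>i\<le>r. Const (a i) * \<sigma> i) G = 0))"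

lemma dependent_derivs_mono:
 assumes "dependent_derivs n k r G" "r \<le> r'" shows "dependent_derivs n k r' G"
 unfolding dependent_derivs_def
proof (intro allI impI)
 fix \<sigma> :: "nat => 'a mpoly" assume "\<forall>i\<le>r'. \<sigma> i \<in> forms n k"
 then have "\<forall>i\<le>r. \<sigma> i \<in> forms n k" using assms(2) by auto
 then obtain a where a: "\<exists>i\<le>r. a i \<noteq> 0" "act (\<Sum>i\<le>r. Const (a i) * \<sigma> i) G = 0"
  using assms(1) unfolding dependent_derivs_def by blast
 have "(\<Sum>i\<le>r'. Const (if i \<le> r then a i else 0) * \<sigma> i) = (\<Sum>i\<le>r. Const (a i) * \<sigma> i)"
  using assms(2) by (intro sum.mono_neutral_cong_right) auto
 then show "\<exists>a. (\<exists>i\<le>r'. a i \<noteq> 0) \<and> act (\<Sum>i\<le>r'. Const (a i) * \<sigma> i) G = 0"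
  using a assms(2) by (intro exI[of _ "\<lambda>i. if i \<le> r then a i else 0"]) auto
qed

lemma pair_linform_power:
 fixes a :: "nat => 'a::field_char_0"
 assumes "\<sigma> \<in> polys {0..n}"
 shows "pair (linform n a ^ D) \<sigma> = fact D * peval (\<lambda>c. c) a (hom_part D \<sigma>)"
proof -
 have "pair (linform n a ^ D) \<sigma> = (\<Sum>m\<in>keys \<sigma>. if mdeg m = D then lookup \<sigma> m * (fact D * mval a m) else 0)"
  unfolding pair_def
 proof (intro sum.cong refl)
  fix m assume m: "m \<in> keys \<sigma>"
  show "lookup \<sigma> m * dcoeff (linform n a ^ D) m = (if mdeg m = D then lookup \<sigma> m * (fact D * mval a m) else 0)"
  proof (cases "mdeg m = D")
   case True
   then show ?thesis using assms m by (simp add: dcoeff_linform_power polys_def)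
  next
   case False
   then show ?thesis by (simp add: dcoeff_def lookup_linform_power form_monomials_def)
  qed
 qed
 also have "\<dots> = (\<Sum>m\<in>{m\<in>keys \<sigma>. mdeg m = D}. lookup \<sigma> m * (fact D * mval a m))"
  by (rule sum.inter_filter[symmetric]) simp
 also have "{m\<in>keys \<sigma>. mdeg m = D} = keys (hom_part D \<sigma>)" by (rule Set.set_eqI) (simp add: in_keys_iff lookup_hom_part)
 also have "(\<Sum>m\<in>keys (hom_part D \<sigma>). lookup \<sigma> m * (fact D * mval a m)) = fact D * peval (\<lambda>c. c) a (hom_part D \<sigma>)"
  unfolding peval_alt sum_distrib_left
  by (intro sum.cong refl) (auto simp: in_keys_iff lookup_hom_part split: if_splits)
 finally show ?thesis .
qed

text \<open>Among r + 1 forms some combination vanishes at the r points given by the linear forms,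
  and such a combination annihilates each power.\<close>

lemma waring_dependent:
 fixes c :: "nat => 'k::field_char_0"
 assumes L: "\<And>i. i < r ==> L i \<in> forms n 1"
 shows "dependent_derivs n k r (\<Sum>i<r. Const (c i) * L i ^ D)"
 unfolding dependent_derivs_def
proof (intro allI impI)
 fix \<sigma> :: "nat => 'k mpoly" assume \<sigma>: "\<forall>i\<le>r. \<sigma> i \<in> forms n k"
 have "\<forall>j. \<exists>a. j < r \<longrightarrow> L j = linform n a" using form_is_linform[OF L] by metis
 then obtain A where A: "\<And>j. j < r ==> L j = linform n (A j)" unfolding choice_iff by blast
 obtain s where s: "\<exists>i\<le>r. s i \<noteq> 0" "\<And>j. j < r ==> (\<Sum>i\<le>r. s i * peval (\<lambda>c. c) (A j) (\<sigma> i)) = 0"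
  by (rule linear_dependence[of r "\<lambda>i j. peval (\<lambda>c. c) (A j) (\<sigma> i)"]) blast
 define \<tau> where "\<tau> = (\<Sum>i\<le>r. Const (s i) * \<sigma> i)"
 have \<tau>: "\<tau> \<in> forms n k" unfolding \<tau>_def using \<sigma> by (intro sum_forms Const_mult_forms) auto
 have "act \<tau> (L j ^ D) = 0" if j: "j < r" for j
  unfolding act_eq_0_iff A[OF j]
 proof (intro allI, rule pair_polys_suffices)
  show "linform n (A j) ^ D \<in> polys {0..n}" by (rule power_polys[OF forms_polys[OF linform_forms]])
  fix \<rho> :: "'k mpoly" assume \<rho>: "\<rho> \<in> polys {0..n}"
  interpret h: comm_ring_hom "peval (\<lambda>c. c) (A j)" by (rule comm_ring_hom_peval[OF comm_ring_hom_id])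
  have "peval (\<lambda>c. c) (A j) \<tau> = 0"
   using s(2)[OF j] by (simp add: \<tau>_def h.hom_sum h.hom_mult)
  then show "pair (linform n (A j) ^ D) (\<tau> * \<rho>) = 0"
   using pair_linform_power[OF mult_polys[OF forms_polys[OF \<tau>] \<rho>]] by (simp add: hom_part_form_mult[OF \<tau>] h.hom_mult)
 qed
 then have "act \<tau> (\<Sum>i<r. Const (c i) * L i ^ D) = 0" by (simp add: act_sum_right act_Const_mult_right)
 then show "\<exists>a. (\<exists>i\<le>r. a i \<noteq> 0) \<and> act (\<Sum>i\<le>r. Const (a i) * \<sigma> i) (\<Sum>i<r. Const (c i) * L i ^ D) = 0"
  using s(1) unfolding \<tau>_def by blast
qed

text \<open>The scheme avoids l = 0, so by the Nullstellensatz I + (l) contains all forms of some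
  degree. If l p lies in I, each of these forms multiplies p into I, and saturation gives p
  itself.\<close>

lemma chart_cancel:
 fixes I :: "'k::alg_closed_field mpoly set"
 assumes cs: "closed_subscheme n I" and l: "in_chart n I l" and \<tau>: "\<tau> \<in> polys {0..n}" and lt: "l ^ t * \<tau> \<in> I"
 shows "\<tau> \<in> I"
proof -
 have I: "homogeneous_ideal n I" and sat: "\<And>p k. p \<in> polys {0..n} ==> (\<And>q. q \<in> forms n k ==> q * p \<in> I) ==> p \<in> I"
  using cs unfolding closed_subscheme_def homogeneous_ideal_def by blast+
 have II: "ideal I (mpoly_ring {0..n})" using I by (simp add: homogeneous_ideal_def)
 note ID = homogeneous_idealD[OF I]
 have lf: "l \<in> forms n 1" and chart: "\<And>a. \<exists>i\<le>n. a i \<noteq> 0 ==> (\<And>\<sigma>. \<sigma> \<in> I ==> peval (\<lambda>c. c) a \<sigma> = 0) ==> peval (\<lambda>c. c) a l \<noteq> 0"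
  using l unfolding in_chart_def by blast+
 have J: "homogeneous_ideal n (adjoin n I l)" by (rule homogeneous_adjoin[OF I lf])
 have "irrelevant n (adjoin n I l)"
 proof (rule ccontr)
  assume "\<not> irrelevant n (adjoin n I l)"
  then obtain a where a: "\<exists>i\<le>n. a i \<noteq> 0" "\<And>\<sigma>. \<sigma> \<in> adjoin n I l ==> peval (\<lambda>c. c) a \<sigma> = 0"
   by (rule projective_nullstellensatz[OF J]) blast
  then show False using chart[OF a(1)] adjoin_subset[OF II, of l] adjoin_self[OF II, of l] by blast
 qed
 then obtain N where N: "\<And>e q. N \<le> e ==> q \<in> forms n e ==> q \<in> adjoin n I l"
  by (rule irrelevant_forms[OF J]) blast
 have step: "p \<in> I" if p: "p \<in> polys {0..n}" "l * p \<in> I" for p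
 proof (rule sat[OF p(1), of N])
  fix q :: "'k mpoly" assume "q \<in> forms n N"
  then have "q \<in> adjoin n I l" using N by blast
  then obtain g s where gs: "g \<in> I" "s \<in> polys {0..n}" "q = g + l * s" unfolding adjoin_def by blast
  have "q * p = p * g + s * (l * p)" unfolding gs(3) by (simp add: algebra_simps)
  also have "\<dots> \<in> I" by (rule ID(3)[OF ID(5)[OF gs(1) p(1)] ID(5)[OF p(2) gs(2)]])
  finally show "q * p \<in> I" .
 qed
 show ?thesis using lt
 proof (induction t)
  case (Suc t)
  have "l * (l ^ t * \<tau>) \<in> I" using Suc.prems by (simp add: mult.assoc)
  then have "l ^ t * \<tau> \<in> I" by (rule step[OF mult_polys[OF power_polys[OF forms_polys[OF lf]] \<tau>]])
  then show ?case by (rule Suc.IH)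
 qed simp
qed

text \<open>Homogenising the membership relation with powers of l puts a power of l times the form
  into I, and \<open>chart_cancel\<close> removes that power. So forms of one degree modulo I embed
  in the chart ring.\<close>

lemma chart_ideal_form:
 fixes I :: "'k::alg_closed_field mpoly set"
 assumes cs: "closed_subscheme n I" and l: "in_chart n I l" and \<tau>: "\<tau> \<in> forms n k" "\<tau> \<in> chart_ideal n I l"
 shows "\<tau> \<in> I"
proof -
 have I: "homogeneous_ideal n I" using cs unfolding closed_subscheme_def homogeneous_ideal_def by blast
 have II: "ideal I (mpoly_ring {0..n})" using I by (simp add: homogeneous_ideal_def)
 note ID = homogeneous_idealD[OF I]
 have lf: "l \<in> forms n 1" using l unfolding in_chart_def by blast
 have l1: "l - 1 \<in> polys {0..n}" using forms_polys[OF lf] by (intro diff_polys) auto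
 interpret R: cring "mpoly_ring {0..n} :: 'k mpoly ring" by (rule cring_mpoly_ring)
 have "chart_ideal n I l \<subseteq> adjoin n I (l - 1)" unfolding chart_ideal_def
  using adjoin_subset[OF II] adjoin_self[OF II] by (intro R.genideal_minimal ideal_adjoin[OF II l1]) auto
 then obtain g h where gh: "g \<in> I" "h \<in> polys {0..n}" "\<tau> = g + (l - 1) * h" using \<tau>(2) unfolding adjoin_def by blast
 obtain N where N: "\<And>m. m \<in> keys h ==> mdeg m \<le> N" by (rule degree_bound[of h]) blast
 \<comment> \<open>M exceeds the degrees of h and of the form, so multiplication of h by l pushes no
   term out of the sum in \<open>T\<close>.\<close>
 define M where "M = Suc (N + k)"
 have hM: "hom_part M h = 0"
 proof (rule poly_mapping_eqI)
  fix m
  have "m \<notin> keys h" if "mdeg m = M" using N[of m] that by (auto simp: M_def)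
  then show "lookup (hom_part M h) m = lookup 0 m" by (auto simp: lookup_hom_part in_keys_iff)
 qed
 \<comment> \<open>Homogenisation in degree M by powers of l, under which l h and h agree.\<close>
 define T where "T p = (\<Sum>e\<le>M. l ^ (M - e) * hom_part e p)" for p
 have "T \<tau> = (\<Sum>e\<le>M. if e = k then l ^ (M - k) * \<tau> else 0)"
  unfolding T_def hom_part_of_form[OF \<tau>(1)] by (intro sum.cong) auto
 also have "\<dots> = l ^ (M - k) * \<tau>" by (simp add: M_def)
 finally have T1: "T \<tau> = l ^ (M - k) * \<tau>" .
 have T2: "T g \<in> I" unfolding T_def
  using forms_polys[OF lf] by (intro homogeneous_ideal_sum[OF I] ID(5) ID(7) gh(1) power_polys)
 have "T (l * h) = T h"
 proof -
  have "T (l * h) = (\<Sum>e\<le>M. if 1 \<le> e then l ^ (M - e) * (l * hom_part (e - 1) h) else 0)"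
   unfolding T_def hom_part_form_mult[OF lf] by (intro sum.cong) auto
  also have "\<dots> = (\<Sum>e<M. l ^ (M - e) * hom_part e h)"
  proof -
   have "(\<Sum>e\<le>Suc K. if 1 \<le> e then l ^ (Suc K - e) * (l * hom_part (e - 1) h) else 0) = (\<Sum>e<Suc K. l ^ (Suc K - e) * hom_part e h)" for K
    unfolding sum.atMost_Suc_shift lessThan_Suc_atMost
    by (simp, intro sum.cong refl) (simp add: Suc_diff_le mult_ac)
   then show ?thesis unfolding M_def .
  qed
  also have "\<dots> = T h" unfolding T_def using hM by (simp add: lessThan_Suc_atMost[symmetric])
  finally show ?thesis .
 qed
 moreover have "\<tau> + h = g + l * h" using gh(3) by (simp add: algebra_simps)
 moreover have Tadd: "T (p + q) = T p + T q" for p q unfolding T_def hom_part_add distrib_left sum.distrib ..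
 ultimately have "T \<tau> = T g" by (metis add_right_cancel)
 then have "l ^ (M - k) * \<tau> \<in> I" using T1 T2 by simp
 then show ?thesis by (rule chart_cancel[OF cs l forms_polys[OF \<tau>(1)]])
qed

text \<open>The chart ring has dimension r, so r + 1 forms are dependent in it; the vanishing
  combination is a form, lies in I by \<open>chart_ideal_form\<close>, and annihilates G by
  apolarity.\<close>

lemma cactus_dependent:
 fixes I :: "'k::{alg_closed_field,field_char_0} mpoly set"
 assumes fs: "finite_subscheme n I r" and ap: "apolar n I G"
 shows "dependent_derivs n k r G"
 unfolding dependent_derivs_def
proof (intro allI impI)
 fix \<sigma> :: "nat => 'k mpoly" assume \<sigma>: "\<forall>i\<le>r. \<sigma> i \<in> forms n k"
 obtain l where cs: "closed_subscheme n I" and l: "in_chart n I l"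
  and fr: "free_of_rank (chart_map n I l) (chart_ring n I l) r" using fs unfolding finite_subscheme_def by blast
 interpret R: cring "mpoly_ring {0..n} :: 'k mpoly ring" by (rule cring_mpoly_ring)
 have lf: "l \<in> polys {0..n}" using l unfolding in_chart_def by (auto intro: forms_polys)
 have Ip: "I \<subseteq> polys {0..n}" using cs ideal_mpoly_ringD(1) unfolding closed_subscheme_def by blast
 have ci: "ideal (chart_ideal n I l) (mpoly_ring {0..n})"
  unfolding chart_ideal_def using Ip lf by (intro R.genideal_ideal) (auto intro: diff_polys)
 define h where "h p = chart_ideal n I l +>\<^bsub>mpoly_ring {0..n}\<^esub> p" for p
 have h: "h \<in> Ring.ring_hom (mpoly_ring {0..n}) (chart_ring n I l)"
  unfolding h_def chart_ring_def by (rule quot_hom[OF ci])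
 have cC: "cring (chart_ring n I l)" unfolding chart_ring_def by (rule ideal.quotient_is_cring[OF ci cring_mpoly_ring])
 have cm: "chart_map n I l = (\<lambda>c. h (Const c))" by (simp add: fun_eq_iff chart_map_def quot_map_def h_def)
 have "lin_alg (chart_ring n I l) (chart_map n I l)" unfolding cm
  using ring_hom_trans[OF lin_alg.phi[OF lin_alg_mpoly_ring] h] by (intro lin_alg.intro cC lin_alg_axioms.intro) (simp add: comp_def)
 then obtain b where fa: "free_alg (chart_ring n I l) (chart_map n I l) b r" using fr free_of_rank_iff by blast
 have \<sigma>p: "\<sigma> i \<in> polys {0..n}" if "i \<le> r" for i using \<sigma> that by (auto intro: forms_polys)
 obtain s where s: "\<exists>i\<le>r. s i \<noteq> 0" "lin_alg.lin (chart_ring n I l) (chart_map n I l) (\<lambda>i. h (\<sigma> i)) (Suc r) s = \<zero>\<^bsub>chart_ring n I l\<^esub>"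
  using free_alg_dependent[OF fa, of "\<lambda>i. h (\<sigma> i)"] ring_hom_closed[OF h] \<sigma>p by auto
 define \<tau> where "\<tau> = (\<Sum>i\<le>r. Const (s i) * \<sigma> i)"
 have \<tau>: "\<tau> \<in> forms n k" unfolding \<tau>_def using \<sigma> by (intro sum_forms Const_mult_forms) auto
 have "h \<tau> = h 0"
  using s(2) lin_quotient[OF h cC, of "Suc r" \<sigma> s] \<sigma>p ring_hom_zero'[OF h cring_mpoly_ring cC]
  unfolding cm \<tau>_def lessThan_Suc_atMost by simp
 then have "\<tau> \<in> chart_ideal n I l"
  using mpoly_coset_eq_iff[OF ci forms_polys[OF \<tau>] zero_polys] unfolding h_def by simp
 then have "\<tau> \<in> I" by (rule chart_ideal_form[OF cs l \<tau>])
 then have "act \<tau> G = 0" using ap unfolding apolar_def Ann_def by blast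
 then show "\<exists>a. (\<exists>i\<le>r. a i \<noteq> 0) \<and> act (\<Sum>i\<le>r. Const (a i) * \<sigma> i) G = 0" using s(1) unfolding \<tau>_def by blast
qed

lemma vector_space_mpoly: "vector_space (\<lambda>c (p :: 'k::field mpoly). Const c * p)"
 by unfold_locales (simp_all add: algebra_simps Const_add Const_mult)

lemma independent_family:
 fixes u :: "'i => 'k::field mpoly"
 assumes A: "finite A" and u0: "\<forall>a. (\<Sum>i\<in>A. Const (a i) * u i) = 0 \<longrightarrow> (\<forall>i\<in>A. a i = 0)"
 shows "inj_on u A" "\<not> module.dependent (\<lambda>c p. Const c * p) (u ` A)"
proof -
 interpret V: vector_space "\<lambda>c (p :: 'k mpoly). Const c * p" by (rule vector_space_mpoly)
 have u: "a i = 0" if "(\<Sum>i\<in>A. Const (a i) * u i) = 0" "i \<in> A" for a i using u0 that by blast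
 show inj: "inj_on u A"
 proof (rule inj_onI, rule ccontr)
  fix i j assume ij: "i \<in> A" "j \<in> A" "u i = u j" "i \<noteq> j"
  let ?a = "\<lambda>t. if t = i then 1 else if t = j then - 1 else (0::'k)"
  have "(\<Sum>t\<in>A. Const (?a t) * u t) = (\<Sum>t\<in>A. (if t = i then u t else 0) - (if t = j then u t else 0))"
   using ij(4) by (intro sum.cong) (auto simp: Const_uminus)
  also have "\<dots> = 0" using A ij by (simp add: sum_subtractf)
  finally show False using u[of ?a i] ij(1) by simp
 qed
 have "v \<in> u ` A ==> c v = 0" if z: "(\<Sum>v\<in>u ` A. Const (c v) * v) = 0" for c v
 proof -
  have "(\<Sum>i\<in>A. Const (c (u i)) * u i) = 0" using z unfolding sum.reindex[OF inj] by simp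
  then show "v \<in> u ` A ==> c v = 0" using u[of "\<lambda>i. c (u i)"] by blast
 qed
 then show "\<not> V.dependent (u ` A)" unfolding V.dependent_finite[OF finite_imageI[OF A]] by blast
qed

text \<open>If r + 1 derivatives of H are independent, take functionals dual to them. The
  determinant of their values on the corresponding derivatives of G is a polynomial in the
  coefficients of G that vanishes on S and equals 1 at H.\<close>

lemma dependent_derivs_closed:
 fixes H :: "'k::field_char_0 mpoly"
 assumes S: "S \<subseteq> forms n D" "\<And>G. G \<in> S ==> dependent_derivs n k r G" and H: "H \<in> zariski_closure (forms n D) S"
 shows "dependent_derivs n k r H"
proof (rule ccontr)
 assume "\<not> dependent_derivs n k r H"
 then obtain \<sigma> where \<sigma>: "\<forall>i\<le>r. \<sigma> i \<in> forms n k"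
  and ind: "\<And>a. act (\<Sum>i\<le>r. Const (a i) * \<sigma> i) H = 0 ==> \<forall>i\<le>r. a i = 0"
  unfolding dependent_derivs_def by blast
 interpret V: vector_space "\<lambda>c (p :: 'k mpoly). Const c * p" by (rule vector_space_mpoly)
 interpret VP: vector_space_pair "\<lambda>c (p :: 'k mpoly). Const c * p" "(*) :: 'k => 'k => 'k"
  by unfold_locales (simp_all add: algebra_simps)
 define u where "u i = act (\<sigma> i) H" for i
 have lin: "act (\<Sum>i\<le>r. Const (a i) * \<sigma> i) G = (\<Sum>i\<le>r. Const (a i) * act (\<sigma> i) G)" for a G
  by (simp add: act_sum act_Const_mult)
 have "\<forall>a. (\<Sum>i\<in>{..r}. Const (a i) * u i) = 0 \<longrightarrow> (\<forall>i\<in>{..r}. a i = 0)"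
  using ind unfolding lin u_def by auto
 note fam = independent_family[of "{..r}" u, OF finite_atMost this]
 have "\<exists>g. Vector_Spaces.linear (\<lambda>c (p :: 'k mpoly). Const c * p) (*) g \<and> (\<forall>x\<in>u ` {..r}. g x = (if x = u j then 1 else 0))" for j
  by (rule VP.linear_independent_extend) (use fam in blast)
 then obtain el where el: "\<And>j. Vector_Spaces.linear (\<lambda>c (p :: 'k mpoly). Const c * p) (*) (el j)"
  "\<And>j i. i \<le> r ==> el j (u i) = (if u i = u j then 1 else 0)" by (metis atMost_iff image_eqI)
 \<comment> \<open>A matrix entry as a linear form in the coefficients of G; its variables are
   indexed by monomials.\<close>
 define E :: "nat => nat => ((nat \<Rightarrow>\<^sub>0 nat) \<Rightarrow>\<^sub>0 nat) \<Rightarrow>\<^sub>0 'k" where "E i j = (\<Sum>m\<in>form_monomials n D. single (single m 1) (el j (act (\<sigma> i) (single m 1))))" for i j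
 have E: "peval (\<lambda>c. c) (lookup G) (E i j) = el j (act (\<sigma> i) G)" if G: "G \<in> forms n D" for G i j
 proof -
  interpret h: comm_ring_hom "peval (\<lambda>c. c) (lookup G) :: (((nat \<Rightarrow>\<^sub>0 nat) \<Rightarrow>\<^sub>0 nat) \<Rightarrow>\<^sub>0 'k) => 'k"
   by (rule comm_ring_hom_peval[OF comm_ring_hom_id])
  have sub: "keys G \<subseteq> form_monomials n D" using G by (auto simp: forms_def polys_def form_monomials_def)
  have "el j (act (\<sigma> i) (\<Sum>m\<in>form_monomials n D. single m (lookup G m)))
   = (\<Sum>m\<in>form_monomials n D. el j (act (\<sigma> i) (single m (lookup G m))))"
   unfolding act_sum_right VP.linear_sum[OF el(1)] ..
  also have "\<dots> = (\<Sum>m\<in>form_monomials n D. el j (act (\<sigma> i) (single m 1)) * lookup G m)"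
  proof (intro sum.cong refl)
   fix m
   have "act (\<sigma> i) (single m (lookup G m)) = Const (lookup G m) * act (\<sigma> i) (single m 1)"
    by (subst act_Const_mult_right[symmetric]) (simp add: Const_def mult_single)
   then show "el j (act (\<sigma> i) (single m (lookup G m))) = el j (act (\<sigma> i) (single m 1)) * lookup G m"
    by (simp only: VP.linear_scale[OF el(1)]) (rule mult.commute)
  qed
  also have "\<dots> = peval (\<lambda>c. c) (lookup G) (E i j)" unfolding E_def h.hom_sum by (simp add: peval_single)
  finally show ?thesis by (simp only: sum_singles_superset[OF finite_form_monomials sub])
 qed
 define \<phi> where "\<phi> = det (mat (Suc r) (Suc r) (\<lambda>(j, i). E i j))"
 have \<phi>: "peval (\<lambda>c. c) (lookup G) \<phi> = det (mat (Suc r) (Suc r) (\<lambda>(j, i). el j (act (\<sigma> i) G)))" if G: "G \<in> forms n D" for G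
 proof -
  interpret h: comm_ring_hom "peval (\<lambda>c. c) (lookup G) :: (((nat \<Rightarrow>\<^sub>0 nat) \<Rightarrow>\<^sub>0 nat) \<Rightarrow>\<^sub>0 'k) => 'k"
   by (rule comm_ring_hom_peval[OF comm_ring_hom_id])
  have "map_mat (peval (\<lambda>c. c) (lookup G)) (mat (Suc r) (Suc r) (\<lambda>(j, i). E i j)) = mat (Suc r) (Suc r) (\<lambda>(j, i). el j (act (\<sigma> i) G))"
   by (rule eq_matI) (auto simp: E[OF G])
  then show ?thesis unfolding \<phi>_def h.hom_det[symmetric] by simp
 qed
 have "S \<subseteq> zero_locus (forms n D) {\<phi>}"
 proof
  fix G assume G: "G \<in> S"
  then have Gf: "G \<in> forms n D" using S(1) by blast
  obtain a where a: "\<exists>i\<le>r. a i \<noteq> 0" "act (\<Sum>i\<le>r. Const (a i) * \<sigma> i) G = 0"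
   using S(2)[OF G] \<sigma> unfolding dependent_derivs_def by blast
  let ?A = "mat (Suc r) (Suc r) (\<lambda>(j, i). el j (act (\<sigma> i) G))"
  have "?A *\<^sub>v vec (Suc r) a = 0\<^sub>v (Suc r)"
  proof (rule eq_vecI)
   fix j assume j: "j < dim_vec (0\<^sub>v (Suc r) :: 'k vec)"
   have "vec_index (?A *\<^sub>v vec (Suc r) a) j = (\<Sum>i\<le>r. a i * el j (act (\<sigma> i) G))"
    using j by (simp add: scalar_prod_def atLeast0LessThan lessThan_Suc_atMost mult.commute del: sum.lessThan_Suc)
   also have "\<dots> = el j (act (\<Sum>i\<le>r. Const (a i) * \<sigma> i) G)"
    unfolding lin VP.linear_sum[OF el(1)] by (intro sum.cong refl) (simp add: VP.linear_scale[OF el(1)])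
   also have "\<dots> = 0" unfolding a(2) by (rule VP.linear_0[OF el(1)])
   finally show "vec_index (?A *\<^sub>v vec (Suc r) a) j = vec_index (0\<^sub>v (Suc r)) j" using j by simp
  qed simp
  moreover have "vec (Suc r) a \<noteq> 0\<^sub>v (Suc r)"
  proof
   assume z: "vec (Suc r) a = 0\<^sub>v (Suc r)"
   have "a i = 0" if "i \<le> r" for i using arg_cong[OF z, of "\<lambda>v. vec_index v i"] that by simp
   then show False using a(1) by blast
  qed
  ultimately have "det ?A = 0" by (subst det_0_iff_vec_prod_zero[of _ "Suc r"]) (auto intro!: exI[of _ "vec (Suc r) a"])
  then show "G \<in> zero_locus (forms n D) {\<phi>}" using Gf by (simp add: zero_locus_def \<phi>)
 qed
 then have Hz: "H \<in> zero_locus (forms n D) {\<phi>}" using H unfolding zariski_closure_def by blast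
 then have Hf: "H \<in> forms n D" and H0: "peval (\<lambda>c. c) (lookup H) \<phi> = 0" by (auto simp: zero_locus_def)
 have "mat (Suc r) (Suc r) (\<lambda>(j, i). el j (act (\<sigma> i) H)) = 1\<^sub>m (Suc r)"
  using el(2) inj_on_eq_iff[OF fam(1)] by (intro eq_matI) (auto simp: u_def[symmetric])
 then show False using H0 \<phi>[OF Hf] by simp
qed

lemma Inf_enat_le:
 assumes "Inf {enat r |r. P r} \<le> enat r" obtains r' where "r' \<le> r" "P r'"
proof -
 have ne: "{enat r |r. P r} \<noteq> {}"
 proof
  assume "{enat r |r. P r} = {}"
  with assms show False by (simp only: Inf_enat_def) simp
 qed
 then have "Inf {enat r |r. P r} \<in> {enat r |r. P r}" unfolding Inf_enat_def using LeastI_ex[of "\<lambda>x. x \<in> {enat r |r. P r}"] by auto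
 then obtain r' where "Inf {enat r |r. P r} = enat r'" "P r'" by blast
 then show thesis using that assms by simp
qed

lemma waring_rank_dependent:
 fixes G :: "'k::field_char_0 mpoly"
 assumes "waring_rank n D G \<le> enat r" shows "dependent_derivs n k r G"
proof -
 obtain r' where "r' \<le> r" "\<exists>c L. (\<forall>i<r'. L i \<in> forms n 1) \<and> G = (\<Sum>i<r'. Const (c i) * L i ^ D)"
  using assms unfolding waring_rank_def by (rule Inf_enat_le)
 then show ?thesis using waring_dependent dependent_derivs_mono by blast
qed

lemma cactus_rank_dependent:
 fixes G :: "'k::{alg_closed_field,field_char_0} mpoly"
 assumes "cactus_rank n G \<le> enat r" shows "dependent_derivs n k r G"
proof -
 obtain r' where "r' \<le> r" "\<exists>I. finite_subscheme n I r' \<and> apolar n I G"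
  using assms unfolding cactus_rank_def by (rule Inf_enat_le)
 then show ?thesis using cactus_dependent dependent_derivs_mono by blast
qed

lemma smoothable_rank_dependent:
 fixes G :: "'k::{alg_closed_field,field_char_0} mpoly"
 assumes "smoothable_rank n G \<le> enat r" shows "dependent_derivs n k r G"
proof -
 obtain r' where "r' \<le> r" "\<exists>I. finite_subscheme n I r' \<and> smoothable_subscheme n I \<and> apolar n I G"
  using assms unfolding smoothable_rank_def by (rule Inf_enat_le)
 then show ?thesis using cactus_dependent dependent_derivs_mono by blast
qed

lemma border_rank_dependent:
 fixes H :: "'k::field_char_0 mpoly"
 assumes "border_rank n D H \<le> enat r" shows "dependent_derivs n k r H"
proof -
 obtain r' where r': "r' \<le> r" "H \<in> zariski_closure (forms n D) {G \<in> forms n D. waring_rank n D G \<le> enat r'}"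
  using assms unfolding border_rank_def by (rule Inf_enat_le)
 have "dependent_derivs n k r' H"
  by (rule dependent_derivs_closed[OF _ _ r'(2)]) (auto intro: waring_rank_dependent)
 then show ?thesis by (rule dependent_derivs_mono[OF _ r'(1)])
qed

lemma border_cactus_rank_dependent:
 fixes H :: "'k::{alg_closed_field,field_char_0} mpoly"
 assumes "border_cactus_rank n D H \<le> enat r" shows "dependent_derivs n k r H"
proof -
 obtain r' where r': "r' \<le> r" "H \<in> zariski_closure (forms n D) {G \<in> forms n D. cactus_rank n G \<le> enat r'}"
  using assms unfolding border_cactus_rank_def by (rule Inf_enat_le)
 have "dependent_derivs n k r' H"
  by (rule dependent_derivs_closed[OF _ _ r'(2)]) (auto intro: cactus_rank_dependent)
 then show ?thesis by (rule dependent_derivs_mono[OF _ r'(1)])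
qed

section \<open>Powers of an encompassing form\<close>

definition homogenization :: "nat => 'a::comm_ring_1 mpoly => 'a mpoly" where
 "homogenization K q = (\<Sum>m\<in>keys q. single (single 0 (K - mdeg m) + m) (lookup q m))"

lemma homogenization:
 assumes "q \<in> polys {1..n}" "\<And>m. m \<in> keys q ==> mdeg m \<le> K"
 shows "homogenization K q \<in> forms n K" "dehomogenize (homogenization K q) = q"
proof -
 interpret deh: comm_ring_hom "dehomogenize :: 'a mpoly => _" by (rule comm_ring_hom_dehomogenize)
 have k: "keys m \<subseteq> {1..n}" "lookup m 0 = 0" if "m \<in> keys q" for m
 proof -
  show "keys m \<subseteq> {1..n}" using that assms(1) by (simp add: polys_def)
  then show "lookup m 0 = 0" by (auto simp: in_keys_iff)
 qed
 show "homogenization K q \<in> forms n K" unfolding homogenization_def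
 proof (intro sum_forms single_forms)
  fix m assume m: "m \<in> keys q"
  show "keys (single 0 (K - mdeg m) + m) \<subseteq> {0..n}"
  proof -
   have "keys (single 0 (K - mdeg m)) \<subseteq> {0..n}" "keys m \<subseteq> {0..n}" using k(1)[OF m] by auto
   then show ?thesis using keys_add[of "single 0 (K - mdeg m)" m] by blast
  qed
  show "mdeg (single 0 (K - mdeg m) + m) = K" using assms(2)[OF m] by (simp add: mdeg_add)
 qed
 have "dehomogenize (homogenization K q) = (\<Sum>m\<in>keys q. single m (lookup q m))"
  unfolding homogenization_def deh.hom_sum dehomogenize_single
  by (intro sum.cong refl) (simp add: lookup_add k(2))
 then show "dehomogenize (homogenization K q) = q" by (simp only: sum_singles)
qed

text \<open>A linear form in at least two variables is annihilated by a nonzero linear operator, and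
  a constant by every variable. The bound makes d at most half of d * e.\<close>

lemma concise_degree:
 fixes F :: "'k::field_char_0 mpoly"
 assumes F: "F \<in> forms n e" "concise {0..n} F" and n: "n \<ge> 1" shows "e \<ge> 2"
proof (rule ccontr)
 assume "\<not> 2 \<le> e"
 have bad: False if "\<sigma> \<in> polys {0..n}" "act \<sigma> F = 0" "\<sigma> \<noteq> 0" "\<And>m. m \<in> keys \<sigma> ==> mdeg m \<le> 1" for \<sigma>
 proof -
  have "total_degree \<sigma> \<le> 1" unfolding total_degree_def using that(4) by (subst Max_le_iff) auto
  then show False using that F(2) unfolding concise_def Ann_def by blast
 qed
 have V: "mdeg m \<le> 1" if "m \<in> keys (Var i :: 'k mpoly)" for m i using that by (auto simp: Var_def)
 have V0: "Var 0 \<noteq> (0 :: 'k mpoly)" by (metis Var_def lookup_single_eq lookup_zero zero_neq_one)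
 have nz: "partial 0 F \<noteq> 0" using bad[of "Var 0", OF Var_polys _ V0 V] by (auto simp: act_Var)
 have "e = 1"
 proof (rule ccontr)
  assume "e \<noteq> 1"
  then have e0: "e = 0" using \<open>\<not> 2 \<le> e\<close> by simp
  have "partial 0 F = 0"
  proof (rule poly_mapping_eqI)
   fix m :: "nat \<Rightarrow>\<^sub>0 nat"
   have "mdeg (m + single 0 1) \<noteq> 0" by (simp add: mdeg_add)
   then have "m + single 0 1 \<notin> keys F" using F(1) e0 by (auto simp: forms_def)
   then show "lookup (partial 0 F) m = lookup 0 m" by (simp add: lookup_partial in_keys_iff)
  qed
  with nz show False by simp
 qed
 then obtain a where a: "F = linform n a" using form_is_linform[of F n] F(1) by blast
 have p: "partial 0 F = Const (a 0)" "partial 1 F = Const (a 1)" unfolding a by (rule partial_linform, use n in simp)+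
 have a0: "a 0 \<noteq> 0" using nz p by auto
 let ?\<sigma> = "Const (a 1) * Var 0 - Const (a 0) * Var 1"
 have s: "Const c * Var i = single (single i 1) c" for c :: 'k and i by (simp add: Const_def Var_def mult_single)
 show False
 proof (rule bad)
  show "?\<sigma> \<in> polys {0..n}" using n by (intro diff_polys mult_polys Const_polys Var_polys) auto
  have "act ?\<sigma> F + act (Const (a 0) * Var 1) F = act (Const (a 1) * Var 0) F"
   by (simp only: act_add[symmetric] diff_add_cancel)
  then have "act ?\<sigma> F = Const (a 1) * partial 0 F - Const (a 0) * partial 1 F"
   by (simp only: act_Const_mult act_Var eq_diff_eq)
  then show "act ?\<sigma> F = 0" by (simp add: p mult.commute)
  have ne: "single 0 1 \<noteq> (single 1 1 :: nat \<Rightarrow>\<^sub>0 nat)" by (metis lookup_single_eq lookup_single_not_eq zero_neq_one)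
  then have "lookup ?\<sigma> (single 1 1) = - a 0" unfolding s by (simp add: lookup_minus lookup_single when_def)
  then show "?\<sigma> \<noteq> 0" using a0 by auto
  fix m assume "m \<in> keys ?\<sigma>"
  then have "m \<in> keys (Const (a 1) * Var 0) \<or> m \<in> keys (Const (a 0) * Var 1)"
   by (auto simp: in_keys_iff lookup_minus)
  then show "mdeg m \<le> 1" unfolding s by (metis (no_types) insert_iff empty_iff keys_single mdeg_single order_refl)
 qed
qed

lemma act_Var_power_eq_0:
 fixes g :: "'a::field_char_0 mpoly" shows "\<exists>M. act (Var i ^ M) g = 0"
proof -
 obtain N where N: "\<And>m. m \<in> keys g ==> mdeg m \<le> N" by (rule degree_bound[of g]) blast
 have V: "Var i ^ M = single (single i M) (1::'a)" for M
  by (rule Var_power)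
 have "act (Var i ^ Suc N) g = 0"
 proof (rule mpoly_eqI_dcoeff)
  fix c
  have "single i (Suc N) + c \<notin> keys g" using N[of "single i (Suc N) + c"] by (auto simp: mdeg_add)
  then show "dcoeff (act (Var i ^ Suc N) g) c = dcoeff 0 c"
   unfolding dcoeff_act V by (simp add: mult_single pair_single dcoeff_def in_keys_iff)
 qed
 then show ?thesis by blast
qed

locale form_power = encompassing_poly n f for n and f :: "'k::{alg_closed_field,field_char_0} mpoly" +
 fixes F :: "'k mpoly" and e d :: nat
 assumes F: "F \<in> forms n e" and f: "f = dehomogenize F" and conc: "concise {0..n} F" and d: "d \<ge> 1"
begin

sublocale K: sym_power n cst d ..

definition H :: "'k mpoly" where "H = twist (F ^ d)"
abbreviation "J \<equiv> Ann {1..n} (f ^ d)"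
abbreviation "E \<equiv> embedded_ideal n J"
abbreviation "N \<equiv> (n + d) choose d"

interpretation deh: comm_ring_hom "dehomogenize :: 'k mpoly => _" by (rule comm_ring_hom_dehomogenize)

lemma Fd: "F ^ d \<in> forms n (d * e)" by (rule power_forms[OF F])

lemma H_form: "H \<in> forms n (d * e)" unfolding H_def by (rule twist_forms[OF Fd])

lemma pair_H: "pair H \<sigma> = pair (f ^ d) (dehomogenize (hom_part (d * e) \<sigma>))"
 unfolding H_def pair_twist[OF Fd] by (simp add: deh.hom_power f)

lemma fd_polys: "f ^ d \<in> polys {1..n}" by (rule power_polys[OF f_polys])

lemma J: "ideal J (mpoly_ring {1..n})" by (rule ideal_Ann)

lemmas JD = ideal_mpoly_ringD[OF J]

lemma J_sum: "(\<And>x. x \<in> A ==> g x \<in> J) ==> sum g A \<in> J"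
 by (induction A rule: infinite_finite_induct) (use JD(2,3) in auto)

text \<open>\<open>pair_H\<close> translates pairings with H into pairings with f^d after
  dehomogenization, where J annihilates.\<close>

lemma form_apolar:
 assumes \<sigma>: "\<sigma> \<in> forms n k" "dehomogenize \<sigma> \<in> J" shows "act \<sigma> H = 0"
 unfolding act_eq_0_iff
proof (intro allI, rule pair_polys_suffices[OF forms_polys[OF H_form]])
 fix \<tau> :: "'k mpoly" assume \<tau>: "\<tau> \<in> polys {0..n}"
 show "pair H (\<sigma> * \<tau>) = 0"
  unfolding pair_H hom_part_form_mult[OF \<sigma>(1)] using \<sigma>(2) by (auto simp: deh.hom_mult Ann_iff)
qed

section \<open>The embedded scheme and its coordinate ring\<close>

lemma E_iff_form: "\<sigma> \<in> forms n k ==> \<sigma> \<in> E \<longleftrightarrow> dehomogenize \<sigma> \<in> J"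
 unfolding embedded_ideal_def using JD(2) hom_part_of_form[of \<sigma> n k] forms_polys[of \<sigma> n k] by (auto split: if_splits)

lemma apolar_E: "apolar n E H"
 unfolding apolar_def
proof
 fix \<sigma> assume "\<sigma> \<in> E"
 then have \<sigma>: "\<sigma> \<in> polys {0..n}" "\<And>j. dehomogenize (hom_part j \<sigma>) \<in> J" by (auto simp: embedded_ideal_def)
 obtain M where M: "\<And>m. m \<in> keys \<sigma> ==> mdeg m \<le> M" by (rule degree_bound[of \<sigma>]) blast
 have "act (\<Sum>j\<le>M. hom_part j \<sigma>) H = (\<Sum>j\<le>M. act (hom_part j \<sigma>) H)" by (rule act_sum)
 also have "\<dots> = 0" using form_apolar[OF hom_part_forms[OF \<sigma>(1)] \<sigma>(2)] by simp
 finally show "\<sigma> \<in> Ann {0..n} H" using \<sigma>(1) by (simp add: Ann_def sum_hom_part[OF M])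
qed

lemma ideal_E: "ideal E (mpoly_ring {0..n})"
proof (rule ideal_mpoly_ringI)
 show "E \<subseteq> polys {0..n}" "0 \<in> E" using JD(2) by (auto simp: embedded_ideal_def)
 show "p + q \<in> E" if "p \<in> E" "q \<in> E" for p q
  using that JD(3) by (auto simp: embedded_ideal_def add_polys hom_part_add deh.hom_add)
 fix p q :: "'k mpoly" assume p: "p \<in> E" and q: "q \<in> polys {0..n}"
 obtain M where M: "\<And>m. m \<in> keys q ==> mdeg m \<le> M" by (rule degree_bound[of q]) blast
 have "dehomogenize (hom_part j (q * p)) \<in> J" for j
 proof -
  have "hom_part j ((\<Sum>i\<le>M. hom_part i q) * p) = (\<Sum>i\<le>M. if i \<le> j then hom_part i q * hom_part (j - i) p else 0)"
   unfolding sum_distrib_right hom_part_sum hom_part_form_mult[OF hom_part_forms[OF q]] ..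
  then have "dehomogenize (hom_part j (q * p)) =
   (\<Sum>i\<le>M. dehomogenize (if i \<le> j then hom_part i q * hom_part (j - i) p else 0))"
   by (simp only: sum_hom_part[OF M] deh.hom_sum)
  also have "\<dots> \<in> J"
   using p JD(2) JD(4) dehomogenize_polys[OF forms_polys[OF hom_part_forms[OF q]]]
   by (intro J_sum) (auto simp: embedded_ideal_def deh.hom_mult)
  finally show ?thesis .
 qed
 then show "q * p \<in> E" using p q by (auto simp: embedded_ideal_def mult_polys)
qed

text \<open>The ideal is saturated because \<open>Var 0\<close> dehomogenizes to 1, so
  multiplication by its powers can be undone.\<close>

lemma closed_E: "closed_subscheme n E"
 unfolding closed_subscheme_def
proof (intro conjI ballI allI impI ideal_E)
 show "hom_part j p \<in> E" if "p \<in> E" for p j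
 proof -
  have p: "p \<in> polys {0..n}" "dehomogenize (hom_part j p) \<in> J" using that by (auto simp: embedded_ideal_def)
  then show ?thesis using E_iff_form[OF hom_part_forms[OF p(1)]] by blast
 qed
 fix p :: "'k mpoly" assume p: "p \<in> polys {0..n}" "\<exists>k. \<forall>q\<in>forms n k. q * p \<in> E"
 then obtain k where k: "\<And>q. q \<in> forms n k ==> q * p \<in> E" by blast
 have V: "(Var 0 ^ k :: 'k mpoly) \<in> forms n k" using power_forms[OF Var_forms[of 0 n], of k] by simp
 have "dehomogenize (hom_part j p) \<in> J" for j
 proof -
  have "dehomogenize (hom_part (j + k) (Var 0 ^ k * p)) \<in> J" using k[OF V] by (auto simp: embedded_ideal_def)
  then show ?thesis unfolding hom_part_form_mult[OF V] by (simp add: deh.hom_mult deh.hom_power dehomogenize_Var alph_0)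
 qed
 then show "p \<in> E" using p(1) by (simp add: embedded_ideal_def)
qed

lemma Var_power_E: "i \<in> {1..n} ==> \<exists>M. Var i ^ M \<in> E"
proof -
 assume i: "i \<in> {1..n}"
 obtain M where M: "act (Var i ^ M) (f ^ d) = 0" using act_Var_power_eq_0 by blast
 have V: "(Var i ^ M :: 'k mpoly) \<in> polys {1..n}" by (rule power_polys[OF Var_polys[OF i]])
 have Vf: "(Var i ^ M :: 'k mpoly) \<in> forms n M" using power_forms[OF Var_forms[of i n], of M] i by simp
 have "Var i ^ M \<in> J" using M V by (simp add: Ann_def)
 then have "dehomogenize (Var i ^ M) \<in> J" by (simp only: dehomogenize_id[OF V])
 then show ?thesis using E_iff_form[OF Vf] by blast
qed

text \<open>Each \<alpha>_i with i \<ge> 1 acts nilpotently on f^d, so E contains a power of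
  \<open>Var i\<close>; its zeros can only lie at the point (1 : 0 : ... : 0).\<close>

lemma chart_E: "in_chart n E (Var 0)"
 unfolding in_chart_def
proof (intro conjI allI impI)
 show "Var 0 \<in> forms n 1" by (rule Var_forms) simp
 fix a :: "nat => 'k" assume a: "(\<exists>i\<le>n. a i \<noteq> 0) \<and> (\<forall>\<sigma>\<in>E. peval (\<lambda>c. c) a \<sigma> = 0)"
 then obtain i where i: "i \<le> n" "a i \<noteq> 0" by blast
 interpret h: comm_ring_hom "peval (\<lambda>c. c) a" by (rule comm_ring_hom_peval[OF comm_ring_hom_id])
 show "peval (\<lambda>c. c) a (Var 0) \<noteq> 0"
 proof (cases "i = 0")
  case True
  then show ?thesis using i by (simp add: peval_Var)
 next
  case False
  then obtain M where "Var i ^ M \<in> E" using Var_power_E[of i] i(1) by auto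
  then have "peval (\<lambda>c. c) a (Var i ^ M) = 0" using a by blast
  then show ?thesis using i(2) by (simp add: h.hom_power peval_Var)
 qed
qed

definition CI :: "'k mpoly set" where "CI = chart_ideal n E (Var 0)"

lemma polys_1_0: "p \<in> polys {1..n} ==> p \<in> polys {0..n}" for p :: "'k mpoly"
 by (rule polys_mono) auto

lemma ideal_CI: "ideal CI (mpoly_ring {0..n})"
 and E_CI: "E \<subseteq> CI" and Var0_CI: "Var 0 - 1 \<in> CI"
proof -
 interpret R: cring "mpoly_ring {0..n} :: 'k mpoly ring" by (rule cring_mpoly_ring)
 have "E \<union> {Var 0 - 1} \<subseteq> carrier (mpoly_ring {0..n})"
  using ideal_mpoly_ringD(1)[OF ideal_E] by (auto intro!: diff_polys Var_polys)
 from R.genideal_ideal[OF this] R.genideal_self[OF this]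
 show "ideal CI (mpoly_ring {0..n})" "E \<subseteq> CI" "Var 0 - 1 \<in> CI" by (auto simp: CI_def chart_ideal_def)
qed

lemma CI_dehomogenize: "p \<in> polys {0..n} ==> p - dehomogenize p \<in> CI"
proof (induction rule: polys_induct)
 note CD = ideal_mpoly_ringD[OF ideal_CI]
 case (Const c)
 then show ?case using CD(2) by simp
next
 note CD = ideal_mpoly_ringD[OF ideal_CI]
 case (add p q)
 have "p + q - dehomogenize (p + q) = (p - dehomogenize p) + (q - dehomogenize q)" by (simp add: deh.hom_add)
 then show ?case using CD(3) add by metis
next
 note CD = ideal_mpoly_ringD[OF ideal_CI]
 case (Var i p)
 show ?case
 proof (cases "i = 0")
  case True
  have "Var i * p - dehomogenize (Var i * p) = p * (Var 0 - 1) + (p - dehomogenize p)"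
   by (simp add: True deh.hom_mult dehomogenize_Var alph_0 algebra_simps)
  then show ?thesis using CD(3)[OF CD(4)[OF Var0_CI Var(2)] Var(3)] by simp
 next
  case False
  have "Var i * p - dehomogenize (Var i * p) = Var i * (p - dehomogenize p)"
   using False by (simp add: deh.hom_mult dehomogenize_Var alph_def algebra_simps)
  then show ?thesis using CD(4)[OF Var(3) Var_polys[OF Var(1)]] by simp
 qed
qed

text \<open>Modulo \<open>CI\<close> a polynomial is congruent to its dehomogenization, and this to
  its homogenization, which lies in E when the dehomogenization lies in J. The chart ring is thereby
  identified with Ap(f^d).\<close>

lemma CI_iff: "p \<in> polys {0..n} ==> p \<in> CI \<longleftrightarrow> dehomogenize p \<in> J"
proof
 interpret R: cring "mpoly_ring {0..n} :: 'k mpoly ring" by (rule cring_mpoly_ring)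
 assume "p \<in> CI"
 have "CI \<subseteq> {p \<in> polys {0..n}. dehomogenize p \<in> J}"
  unfolding CI_def chart_ideal_def
 proof (rule R.genideal_minimal)
  show "ideal {p \<in> polys {0..n}. dehomogenize p \<in> J} (mpoly_ring {0..n})"
   by (rule ideal_mpoly_ringI) (use JD(2-4) in \<open>auto simp: deh.hom_add deh.hom_mult add_polys mult_polys dehomogenize_polys\<close>)
  have "dehomogenize p \<in> J" if "p \<in> E" for p
  proof -
   obtain M where M: "\<And>m. m \<in> keys p ==> mdeg m \<le> M" by (rule degree_bound[of p]) blast
   have "dehomogenize (\<Sum>j\<le>M. hom_part j p) \<in> J" unfolding deh.hom_sum
    using that by (intro J_sum) (auto simp: embedded_ideal_def)
   then show ?thesis by (simp only: sum_hom_part[OF M])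
  qed
  then show "E \<union> {Var 0 - 1} \<subseteq> {p \<in> polys {0..n}. dehomogenize p \<in> J}"
   using JD(2) by (auto simp: embedded_ideal_def deh.hom_minus dehomogenize_Var alph_0 intro!: diff_polys Var_polys)
 qed
 then show "dehomogenize p \<in> J" using \<open>p \<in> CI\<close> by blast
next
 note CD = ideal_mpoly_ringD[OF ideal_CI]
 assume p: "p \<in> polys {0..n}" "dehomogenize p \<in> J"
 let ?q = "dehomogenize p"
 have q: "?q \<in> polys {1..n}" by (rule dehomogenize_polys[OF p(1)])
 obtain M where M: "\<And>m. m \<in> keys ?q ==> mdeg m \<le> M" by (rule degree_bound[of ?q]) blast
 note h = homogenization[OF q M]
 have 1: "homogenization M ?q \<in> CI" using E_iff_form[OF h(1)] h(2) p(2) E_CI by auto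
 have 2: "homogenization M ?q - ?q \<in> CI" using CI_dehomogenize[OF forms_polys[OF h(1)]] by (simp add: h(2))
 have "p = (p - ?q) + (homogenization M ?q - (homogenization M ?q - ?q))" by simp
 then show "p \<in> CI" using CD(3)[OF CI_dehomogenize[OF p(1)] CD(6)[OF 1 2]] by simp
qed

lemma chart_hom: "(\<lambda>p. CI +>\<^bsub>mpoly_ring {0..n}\<^esub> p) \<in> Ring.ring_hom (mpoly_ring {0..n}) (chart_ring n E (Var 0))"
 unfolding chart_ring_def CI_def[symmetric] by (rule quot_hom[OF ideal_CI])

lemma cring_chart: "cring (chart_ring n E (Var 0))"
 unfolding chart_ring_def CI_def[symmetric] by (rule ideal.quotient_is_cring[OF ideal_CI cring_mpoly_ring])

lemma chart_map: "chart_map n E (Var 0) = (\<lambda>c. CI +>\<^bsub>mpoly_ring {0..n}\<^esub> Const c)"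
 by (simp add: fun_eq_iff chart_map_def quot_map_def CI_def)

lemma chart_eq_iff: "p \<in> polys {0..n} ==> q \<in> polys {0..n} ==>
  CI +>\<^bsub>mpoly_ring {0..n}\<^esub> p = CI +>\<^bsub>mpoly_ring {0..n}\<^esub> q \<longleftrightarrow> dehomogenize (p - q) \<in> J"
 by (simp add: mpoly_coset_eq_iff[OF ideal_CI] CI_iff diff_polys)

lemma chart_surj: "(\<lambda>p. CI +>\<^bsub>mpoly_ring {0..n}\<^esub> p) ` polys {0..n} = carrier (chart_ring n E (Var 0))"
 by (simp add: chart_ring_def CI_def carrier_Quot)

lemma finite_E: "finite_subscheme n E N"
proof -
 let ?h = "\<lambda>p. CI +>\<^bsub>mpoly_ring {0..n}\<^esub> p"
 have h: "?h \<in> Ring.ring_hom (mpoly_ring {1..n}) (chart_ring n E (Var 0))"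
 proof (rule ring_hom_memI)
  show "?h x \<in> carrier (chart_ring n E (Var 0))" if "x \<in> carrier (mpoly_ring {1..n})" for x
   using that polys_1_0 ring_hom_closed[OF chart_hom, of x] by simp
  show "?h (x \<otimes>\<^bsub>mpoly_ring {1..n}\<^esub> y) = ?h x \<otimes>\<^bsub>chart_ring n E (Var 0)\<^esub> ?h y"
   "?h (x \<oplus>\<^bsub>mpoly_ring {1..n}\<^esub> y) = ?h x \<oplus>\<^bsub>chart_ring n E (Var 0)\<^esub> ?h y"
   if "x \<in> carrier (mpoly_ring {1..n})" "y \<in> carrier (mpoly_ring {1..n})" for x y
   using that polys_1_0 ring_hom_mult[OF chart_hom, of x y] ring_hom_add[OF chart_hom, of x y] by simp_all
 qed (use ring_hom_one[OF chart_hom] in simp)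
 have s: "?h ` polys {1..n} = carrier (chart_ring n E (Var 0))"
 proof
  show "?h ` polys {1..n} \<subseteq> carrier (chart_ring n E (Var 0))" using ring_hom_closed[OF h] by auto
  show "carrier (chart_ring n E (Var 0)) \<subseteq> ?h ` polys {1..n}"
  proof
   fix x assume "x \<in> carrier (chart_ring n E (Var 0))"
   then obtain p where p: "p \<in> polys {0..n}" "x = ?h p" using chart_surj by blast
   have dp: "dehomogenize p \<in> polys {1..n}" by (rule dehomogenize_polys[OF p(1)])
   have "x = ?h (dehomogenize p)" unfolding p(2)
    using mpoly_coset_eq_iff[OF ideal_CI p(1) polys_1_0[OF dp]] CI_dehomogenize[OF p(1)] by simp
   then show "x \<in> ?h ` polys {1..n}" using dp by blast
  qed
 qed
 have k: "?h p = ?h q \<longleftrightarrow> K.Theta (p - q) = 0" if "p \<in> polys {1..n}" "q \<in> polys {1..n}" for p q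
  using chart_eq_iff[OF polys_1_0 polys_1_0, OF that] diff_polys[OF that]
  by (simp add: dehomogenize_id[OF diff_polys[OF that]] Ann_power)
 have "free_of_rank (chart_map n E (Var 0)) (chart_ring n E (Var 0)) N"
  using free_of_rank_iff[OF K.free_alg_quotient(1)[OF cring_chart h s k]] K.free_alg_quotient(2)[OF cring_chart h s k]
  by (simp add: chart_map)
 then show ?thesis unfolding finite_subscheme_def using closed_E chart_E by blast
qed

text \<open>Ap(f^d) and the chart ring are quotients of one polynomial ring with the same kernel, so
  the isomorphism of the special fibre can be composed with the one between them.\<close>

lemma smoothable_E:
 assumes "smoothable (Ap_map {1..n} (f ^ d)) (Ap {1..n} (f ^ d))" shows "smoothable_subscheme n E"
proof -
 let ?P = "mpoly_ring {0..n} :: 'k mpoly ring" and ?R = "mpoly_ring {1..n} :: 'k mpoly ring"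
 have dh: "dehomogenize \<in> Ring.ring_hom ?P ?R"
  by (rule ring_hom_memI) (simp_all add: dehomogenize_polys deh.hom_mult deh.hom_add)
 have h: "(\<lambda>p. J +>\<^bsub>?R\<^esub> dehomogenize p) \<in> Ring.ring_hom ?P (Ap {1..n} (f ^ d))"
  using ring_hom_trans[OF dh quot_hom[OF J]] by (simp add: comp_def Ap_def)
 have img: "dehomogenize ` polys {0..n} = (polys {1..n} :: 'k mpoly set)"
 proof
  show "dehomogenize ` polys {0..n} \<subseteq> (polys {1..n} :: 'k mpoly set)" using dehomogenize_polys by blast
  show "(polys {1..n} :: 'k mpoly set) \<subseteq> dehomogenize ` polys {0..n}"
  proof
   fix p :: "'k mpoly" assume "p \<in> polys {1..n}"
   then show "p \<in> dehomogenize ` polys {0..n}" using polys_1_0 by (intro image_eqI[of _ _ p]) (simp_all add: dehomogenize_id)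
  qed
 qed
 have hs: "(\<lambda>p. J +>\<^bsub>?R\<^esub> dehomogenize p) ` carrier ?P = carrier (Ap {1..n} (f ^ d))"
 proof -
  have "(\<lambda>p. J +>\<^bsub>?R\<^esub> dehomogenize p) ` polys {0..n} = (\<lambda>x. J +>\<^bsub>?R\<^esub> x) ` dehomogenize ` polys {0..n}" by (simp only: image_image)
  then show ?thesis unfolding Ap_def carrier_Quot img by simp
 qed
 have ks: "(\<lambda>p. CI +>\<^bsub>?P\<^esub> p) ` carrier ?P = carrier (chart_ring n E (Var 0))" using chart_surj by simp
 have eq: "J +>\<^bsub>?R\<^esub> dehomogenize p = J +>\<^bsub>?R\<^esub> dehomogenize q \<longleftrightarrow> CI +>\<^bsub>?P\<^esub> p = CI +>\<^bsub>?P\<^esub> q"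
  if "p \<in> carrier ?P" "q \<in> carrier ?P" for p q
  using that by (simp add: mpoly_coset_eq_iff[OF J] chart_eq_iff dehomogenize_polys deh.hom_minus)
 obtain g where g: "g \<in> Ring.ring_hom (Ap {1..n} (f ^ d)) (chart_ring n E (Var 0))"
  "\<forall>p\<in>carrier ?P. g (J +>\<^bsub>?R\<^esub> dehomogenize p) = CI +>\<^bsub>?P\<^esub> p"
  "bij_betw g (carrier (Ap {1..n} (f ^ d))) (carrier (chart_ring n E (Var 0)))"
  using factor_iso[OF h chart_hom cring.axioms(1)[OF cring_mpoly_ring] hs ks eq] by blast
 have gc: "g (Ap_map {1..n} (f ^ d) c) = chart_map n E (Var 0) c" for c
  using bspec[OF g(2), of "Const c"] by (simp add: Ap_map_def quot_map_def chart_map)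
 obtain \<phi> :: "'k fps => nat => 'k fps" and A and \<psi> :: "'k fls => nat => 'k fls" and B \<iota> r where
  sm: "is_algebra \<phi> A \<and> free_of_rank \<phi> A r" and
  iso: "alg_isomorphic (\<lambda>c. quot_map \<phi> A (PIdl\<^bsub>A\<^esub> (\<phi> fps_X)) (fps_const c)) (A Quot (PIdl\<^bsub>A\<^esub> (\<phi> fps_X)))
    (Ap_map {1..n} (f ^ d)) (Ap {1..n} (f ^ d))" and
  sm': "is_localization A (\<phi> fps_X) B \<iota> \<and> is_algebra \<psi> B \<and> (\<forall>c. \<psi> (fps_to_fls c) = \<iota> (\<phi> c)) \<and> smooth_algebra \<psi> B"
  using assms unfolding smoothable_def Let_def by blast
 have "alg_isomorphic (\<lambda>c. quot_map \<phi> A (PIdl\<^bsub>A\<^esub> (\<phi> fps_X)) (fps_const c)) (A Quot (PIdl\<^bsub>A\<^esub> (\<phi> fps_X)))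
    (chart_map n E (Var 0)) (chart_ring n E (Var 0))"
 proof -
  obtain k where k: "k \<in> alg_hom (\<lambda>c. quot_map \<phi> A (PIdl\<^bsub>A\<^esub> (\<phi> fps_X)) (fps_const c)) (A Quot (PIdl\<^bsub>A\<^esub> (\<phi> fps_X)))
    (Ap_map {1..n} (f ^ d)) (Ap {1..n} (f ^ d))"
   "bij_betw k (carrier (A Quot (PIdl\<^bsub>A\<^esub> (\<phi> fps_X)))) (carrier (Ap {1..n} (f ^ d)))"
   using iso unfolding alg_isomorphic_def by blast
  then have "g \<circ> k \<in> alg_hom (\<lambda>c. quot_map \<phi> A (PIdl\<^bsub>A\<^esub> (\<phi> fps_X)) (fps_const c)) (A Quot (PIdl\<^bsub>A\<^esub> (\<phi> fps_X)))
    (chart_map n E (Var 0)) (chart_ring n E (Var 0))"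
   using ring_hom_trans[OF _ g(1)] by (auto simp: alg_hom_def gc)
  then show ?thesis unfolding alg_isomorphic_def using bij_betw_trans[OF k(2) g(3)] by blast
 qed
 then have "smoothable (chart_map n E (Var 0)) (chart_ring n E (Var 0))"
  unfolding smoothable_def Let_def using sm sm' by blast
 then show ?thesis unfolding smoothable_subscheme_def using chart_E by blast
qed

section \<open>The middle catalecticant\<close>

definition mid :: nat where "mid = d * e div 2"

text \<open>By \<open>concise_degree\<close> d is at most half of d * e when n \<ge> 1, and for n =
  0 only the monomial 1 occurs. So normal forms can be homogenised both to the middle degree and to
  its complement.\<close>

lemma mid: "m \<in> monomials n d ==> mdeg m \<le> mid" "m \<in> monomials n d ==> mdeg m \<le> d * e - mid" "mid \<le> d * e"
proof -
 have *: "mdeg m \<le> mid \<and> mdeg m \<le> d * e - mid" if m: "m \<in> monomials n d"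
 proof (cases "n = 0")
  case True
  then have "m = 0" using m by (auto simp: monomials_def)
  then show ?thesis by simp
 next
  case False
  then have "e \<ge> 2" using concise_degree[OF F conc] by simp
  then have "d * 2 \<le> d * e" by simp
  then have "d * 2 div 2 \<le> d * e div 2" by (rule div_le_mono)
  then have 1: "d \<le> d * e div 2" by simp
  have "x div 2 \<le> x - x div 2" for x :: nat by linarith
  then have "d \<le> d * e - d * e div 2" using 1 by (rule order_trans[rotated])
  with 1 m show ?thesis unfolding mid_def monomials_def by auto
 qed
 show "m \<in> monomials n d ==> mdeg m \<le> mid" "m \<in> monomials n d ==> mdeg m \<le> d * e - mid" "mid \<le> d * e"
  using * by (auto simp: mid_def)
qed

definition hm :: "(nat \<Rightarrow>\<^sub>0 nat) => 'k mpoly" where "hm m = single (single 0 (mid - mdeg m) + m) 1"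

lemma hm:
 assumes "m \<in> monomials n d" shows "hm m \<in> forms n mid" "dehomogenize (hm m) = single m 1"
proof -
 have m: "single m 1 \<in> polys {1..n}" using assms by (intro single_polys) (simp add: monomials_def)
 have "hm m = homogenization mid (single m 1)" by (simp add: hm_def homogenization_def)
 then show "hm m \<in> forms n mid" "dehomogenize (hm m) = single m 1"
  using homogenization[OF m, of mid] mid(1)[OF assms] by (auto split: if_splits)
qed

text \<open>A combination that annihilates H pairs to zero with the homogenised normal forms of
  complementary degree, so its dehomogenization annihilates f^d; being a normal form, it is
  zero.\<close>

lemma hm_independent:
 assumes "act (\<Sum>m\<in>monomials n d. Const (c m) * hm m) H = 0" "m \<in> monomials n d" shows "c m = 0"
proof -
 define \<tau> where "\<tau> = (\<Sum>m\<in>monomials n d. Const (c m) * hm m)"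
 have \<tau>: "\<tau> \<in> forms n mid" unfolding \<tau>_def by (intro sum_forms Const_mult_forms hm(1))
 have d\<tau>: "dehomogenize \<tau> = (\<Sum>m\<in>monomials n d. single m (c m))"
  unfolding \<tau>_def deh.hom_sum deh.hom_mult by (intro sum.cong refl) (simp add: hm(2) single_eq_Const_mult[symmetric])
 have d\<tau>p: "dehomogenize \<tau> \<in> polys {1..n}" by (rule dehomogenize_polys[OF forms_polys[OF \<tau>]])
 have "pair (f ^ d) (dehomogenize \<tau> * \<rho>) = 0" if \<rho>: "\<rho> \<in> polys {1..n}" for \<rho>
 proof -
  obtain q where q: "q \<in> polys {1..n}" "\<And>m. m \<in> keys q ==> m \<in> monomials n d" "K.Theta q = K.Theta \<rho>"
   by (rule K.normal_form_ex[OF \<rho>]) blast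
  have "\<rho> - q \<in> J" unfolding Ann_power using \<rho> q by (simp add: diff_polys K.Theta_diff)
  then have "pair (f ^ d) ((\<rho> - q) * dehomogenize \<tau>) = 0" unfolding Ann_iff by blast
  moreover have "pair (f ^ d) (dehomogenize \<tau> * q) = 0"
  proof -
   note h = homogenization[OF q(1), of "d * e - mid"]
   have hq: "homogenization (d * e - mid) q \<in> forms n (d * e - mid)" "dehomogenize (homogenization (d * e - mid) q) = q"
    using h q(2) mid(2) by blast+
   have "pair H (\<tau> * homogenization (d * e - mid) q) = 0" using assms(1) unfolding \<tau>_def[symmetric] act_eq_0_iff by blast
   moreover have "hom_part (d * e) (\<tau> * homogenization (d * e - mid) q) = \<tau> * homogenization (d * e - mid) q"
    using hom_part_of_form[OF mult_forms[OF \<tau> hq(1)], of "d * e"] mid(3) by simp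
   ultimately show ?thesis unfolding pair_H by (simp add: deh.hom_mult hq(2))
  qed
  moreover have "dehomogenize \<tau> * \<rho> = (\<rho> - q) * dehomogenize \<tau> + dehomogenize \<tau> * q" by (simp add: algebra_simps)
  ultimately show ?thesis by (simp only: pair_add add_0_left)
 qed
 then have "act (dehomogenize \<tau>) (f ^ d) = 0"
  unfolding act_eq_0_iff by (intro allI, rule pair_polys_suffices[OF fd_polys])
 then have T: "K.Theta (dehomogenize \<tau>) = 0" using Ann_power[of d] d\<tau>p by (auto simp: Ann_def)
 have lk: "lookup (dehomogenize \<tau>) m = (if m \<in> monomials n d then c m else 0)" for m
 proof -
  have "lookup (dehomogenize \<tau>) m = (\<Sum>m'\<in>monomials n d. if m' = m then c m' else 0)"
   unfolding d\<tau> lookup_sum by (intro sum.cong) (auto simp: lookup_single when_def)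
  then show ?thesis by simp
 qed
 have "m \<in> monomials n d" if "m \<in> keys (dehomogenize \<tau>)" for m using that by (auto simp: in_keys_iff lk split: if_splits)
 then have "dehomogenize \<tau> = 0" by (rule K.normal_form_unique[OF _ T])
 then show ?thesis using lk[of m] assms(2) by simp
qed

text \<open>A form and the homogenised normal form of its dehomogenization differ by an element that
  annihilates H.\<close>

lemma hm_span:
 assumes "\<sigma> \<in> forms n mid" shows "\<exists>c. act \<sigma> H = (\<Sum>m\<in>monomials n d. Const (c m) * act (hm m) H)"
proof -
 have \<sigma>p: "dehomogenize \<sigma> \<in> polys {1..n}" by (rule dehomogenize_polys[OF forms_polys[OF assms]])
 obtain q where q: "q \<in> polys {1..n}" "\<And>m. m \<in> keys q ==> m \<in> monomials n d" "K.Theta q = K.Theta (dehomogenize \<sigma>)"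
  by (rule K.normal_form_ex[OF \<sigma>p]) blast
 define \<tau> where "\<tau> = (\<Sum>m\<in>monomials n d. Const (lookup q m) * hm m)"
 have \<tau>: "\<tau> \<in> forms n mid" unfolding \<tau>_def by (intro sum_forms Const_mult_forms hm(1))
 have "dehomogenize \<tau> = (\<Sum>m\<in>monomials n d. single m (lookup q m))"
  unfolding \<tau>_def deh.hom_sum deh.hom_mult by (intro sum.cong refl) (simp add: hm(2) single_eq_Const_mult[symmetric])
 also have "\<dots> = q" by (rule sum_singles_superset) (use q(2) in auto)
 finally have "dehomogenize (\<sigma> - \<tau>) \<in> J"
  using q(1,3) \<sigma>p by (simp add: deh.hom_minus Ann_power diff_polys K.Theta_diff)
 then have "act (\<sigma> - \<tau>) H = 0" by (rule form_apolar[OF diff_forms[OF assms \<tau>]])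
 then have "act \<sigma> H = act \<tau> H" using act_add[of "\<sigma> - \<tau>" \<tau> H] by simp
 also have "\<dots> = (\<Sum>m\<in>monomials n d. Const (lookup q m) * act (hm m) H)" by (simp add: \<tau>_def act_sum act_Const_mult)
 finally show ?thesis by blast
qed

lemma middle_catalecticant: "middle_catalecticant_rank n (d * e) H = N"
proof -
 interpret V: vector_space "\<lambda>c (p :: 'k mpoly). Const c * p" by (rule vector_space_mpoly)
 let ?u = "\<lambda>m. act (hm m) H" and ?M = "monomials n d"
 have "\<forall>a. (\<Sum>m\<in>?M. Const (a m) * ?u m) = 0 \<longrightarrow> (\<forall>m\<in>?M. a m = 0)"
  using hm_independent by (simp add: act_sum act_Const_mult)
 note fam = independent_family[OF finite_monomials this]
 have "V.span (?u ` ?M) = V.span ((\<lambda>\<sigma>. act \<sigma> H) ` forms n mid)"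
 proof (rule antisym)
  show "V.span (?u ` ?M) \<subseteq> V.span ((\<lambda>\<sigma>. act \<sigma> H) ` forms n mid)" using hm(1) by (intro V.span_mono) auto
  show "V.span ((\<lambda>\<sigma>. act \<sigma> H) ` forms n mid) \<subseteq> V.span (?u ` ?M)"
  proof (rule V.span_minimal)
   show "(\<lambda>\<sigma>. act \<sigma> H) ` forms n mid \<subseteq> V.span (?u ` ?M)"
   proof
    fix x assume "x \<in> (\<lambda>\<sigma>. act \<sigma> H) ` forms n mid"
    then obtain c where "x = (\<Sum>m\<in>?M. Const (c m) * ?u m)" using hm_span by blast
    then show "x \<in> V.span (?u ` ?M)" by (simp only:) (intro V.span_sum V.span_scale V.span_base imageI)
   qed
  qed (rule V.subspace_span)
 qed
 then have "V.dim ((\<lambda>\<sigma>. act \<sigma> H) ` forms n mid) = card (?u ` ?M)" using fam(2) by (rule V.dim_eq_card)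
 then show ?thesis by (simp add: middle_catalecticant_rank_def mid_def card_image[OF fam(1)] card_monomials)
qed

lemma not_dependent: "r < N ==> \<not> dependent_derivs n mid r H"
proof
 assume r: "r < N" and dep: "dependent_derivs n mid r H"
 obtain g where g: "bij_betw g {..<N} (monomials n d)"
  using ex_bij_betw_nat_finite[OF finite_monomials[of n d]] by (auto simp: atLeast0LessThan card_monomials)
 have gm: "g i \<in> monomials n d" if "i < N" for i using g that by (auto simp: bij_betw_def)
 have "\<forall>i\<le>r. hm (g i) \<in> forms n mid" using r gm hm(1) by auto
 then have "\<exists>a. (\<exists>i\<le>r. a i \<noteq> 0) \<and> act (\<Sum>i\<le>r. Const (a i) * hm (g i)) H = 0"
  using dep[unfolded dependent_derivs_def, THEN spec[of _ "\<lambda>i. hm (g i)"]] by simp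
 then obtain a where a: "\<exists>i\<le>r. a i \<noteq> 0" "act (\<Sum>i\<le>r. Const (a i) * hm (g i)) H = 0" by blast
 define c where "c m = (if inv_into {..<N} g m \<le> r then a (inv_into {..<N} g m) else 0)" for m
 have cg: "c (g i) = (if i \<le> r then a i else 0)" if "i < N" for i
  using that bij_betw_inv_into_left[OF g] by (simp add: c_def)
 have "(\<Sum>m\<in>monomials n d. Const (c m) * hm m) = (\<Sum>i<N. Const (c (g i)) * hm (g i))"
  by (rule sum.reindex_bij_betw[OF g, symmetric])
 also have "\<dots> = (\<Sum>i\<le>r. Const (a i) * hm (g i))"
  using r by (intro sum.mono_neutral_cong_right) (auto simp: cg)
 finally have z: "act (\<Sum>m\<in>monomials n d. Const (c m) * hm m) H = 0" using a(2) by simp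
 have "a i = 0" if "i \<le> r" for i using hm_independent[OF z gm, of i] cg[of i] that r by simp
 then show False using a(1) by blast
qed

end

section \<open>Upper bound for the border rank\<close>

text \<open>Uniqueness of expansions in base B; it makes the Kronecker substitution injective on the
  monomials of a fixed polynomial.\<close>

lemma digits_unique:
 fixes a b :: "nat => nat"
 assumes "\<And>i. i < V ==> a i < B" "\<And>i. i < V ==> b i < B" "(\<Sum>i<V. a i * B ^ i) = (\<Sum>i<V. b i * B ^ i)" "i < V"
 shows "a i = b i"
 using assms
proof (induction V arbitrary: a b i)
 case (Suc V)
 have s: "(\<Sum>i<Suc V. c i * B ^ i) = c 0 + B * (\<Sum>i<V. c (Suc i) * B ^ i)" for c
  by (subst sum.lessThan_Suc_shift) (simp add: sum_distrib_left mult_ac)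
 have e: "a 0 + B * (\<Sum>i<V. a (Suc i) * B ^ i) = b 0 + B * (\<Sum>i<V. b (Suc i) * B ^ i)"
  using Suc.prems(3) unfolding s .
 have l: "a 0 < B" "b 0 < B" using Suc.prems(1,2) by simp_all
 have 0: "a 0 = b 0" using arg_cong[OF e, of "\<lambda>x. x mod B"] l by simp
 then have "(\<Sum>i<V. a (Suc i) * B ^ i) = (\<Sum>i<V. b (Suc i) * B ^ i)" using e l by simp
 then have "a (Suc j) = b (Suc j)" if "j < V" for j
  using Suc.IH[of "\<lambda>i. a (Suc i)" "\<lambda>i. b (Suc i)" j] Suc.prems(1,2) that by simp
 then show ?case using 0 Suc.prems(4) by (cases i) auto
qed simp

text \<open>Kronecker substitution.\<close>

lemma mpoly_zero_function:
 fixes \<Phi> :: "'k::field_char_0 mpoly"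
 assumes z: "\<And>s. peval (\<lambda>c. c) s \<Phi> = 0" shows "\<Phi> = 0"
proof (rule ccontr)
 assume "\<Phi> \<noteq> 0"
 then obtain m0 where m0: "m0 \<in> keys \<Phi>" by (metis keys_eq_empty all_not_in_conv)
 \<comment> \<open>V exceeds all indices of variables and B all exponents, so exponent vectors
   become numerals in base B.\<close>
 define V where "V = Suc (Max (insert 0 (\<Union>(keys ` keys \<Phi>))))"
 define B where "B = Suc (\<Sum>m\<in>keys \<Phi>. mdeg m)"
 have V: "keys m \<subseteq> {..<V}" if "m \<in> keys \<Phi>" for m
 proof
  fix i assume "i \<in> keys m"
  then have "i \<le> Max (insert 0 (\<Union>(keys ` keys \<Phi>)))" using that by (intro Max_ge) auto
  then show "i \<in> {..<V}" by (simp add: V_def)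
 qed
 have B: "lookup m i < B" if "m \<in> keys \<Phi>" for m i
 proof -
  have "mdeg m \<le> (\<Sum>m\<in>keys \<Phi>. mdeg m)" using that by (intro member_le_sum) auto
  then show ?thesis using lookup_le_mdeg[of m i] by (simp add: B_def)
 qed
 define val where "val m = (\<Sum>i<V. lookup m i * B ^ i)" for m :: "nat \<Rightarrow>\<^sub>0 nat"
 have inj: "m = k" if mk: "m \<in> keys \<Phi>" "k \<in> keys \<Phi>" "val m = val k" for m k
 proof (rule poly_mapping_eqI)
  fix i
  show "lookup m i = lookup k i"
  proof (cases "i < V")
   case True
   then show ?thesis using digits_unique[of V "lookup m" B "lookup k" i] B mk by (simp add: val_def)
  next
   case False
   then have "i \<notin> keys m" "i \<notin> keys k" using V mk by auto
   then show ?thesis by (simp add: in_keys_iff)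
  qed
 qed
 define P where "P = (\<Sum>m\<in>keys \<Phi>. Polynomial.monom (lookup \<Phi> m) (val m))"
 have "poly P t = 0" for t
 proof -
  have "mval (\<lambda>i. t ^ B ^ i) m = t ^ val m" if "m \<in> keys \<Phi>" for m
  proof -
   have "mval (\<lambda>i. t ^ B ^ i) m = (\<Prod>i<V. (t ^ B ^ i) ^ lookup m i)" using V[OF that] by (intro mval_superset) auto
   then show ?thesis by (simp add: val_def power_sum power_mult[symmetric] mult.commute)
  qed
  then have "poly P t = peval (\<lambda>c. c) (\<lambda>i. t ^ B ^ i) \<Phi>"
   unfolding P_def peval_alt poly_sum by (intro sum.cong) (auto simp: poly_monom)
  then show ?thesis using z by simp
 qed
 then have P0: "P = 0" using poly_all_0_iff_0 by blast
 have "coeff P (val m0) = (\<Sum>m\<in>keys \<Phi>. if m = m0 then lookup \<Phi> m else 0)"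
  unfolding P_def coeff_sum by (intro sum.cong refl) (use inj m0 in auto)
 then have "lookup \<Phi> m0 = 0" using P0 m0 by simp
 then show False using m0 by (simp add: in_keys_iff)
qed

lemma peval_at_0: "peval (\<lambda>c. c) (\<lambda>_. 0) p = lookup p (0 :: nat \<Rightarrow>\<^sub>0 nat)" for p :: "'k::comm_ring_1 mpoly"
proof -
 have "mval (\<lambda>_. 0) m = (if m = 0 then 1 else (0::'k))" for m :: "nat \<Rightarrow>\<^sub>0 nat"
 proof (cases "m = 0")
  case False
  then obtain i where "i \<in> keys m" by (metis keys_eq_empty all_not_in_conv)
  then have "\<exists>i\<in>keys m. (0::'k) ^ lookup m i = 0" by (intro bexI[of _ i]) (auto simp: in_keys_iff power_0_left)
  then show ?thesis using False by (simp add: mval_def prod_zero)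
 qed simp
 then have "peval (\<lambda>c. c) (\<lambda>_. 0) p = (\<Sum>m\<in>keys p. if m = 0 then lookup p m else 0)"
  unfolding peval_alt by (intro sum.cong) auto
 then show ?thesis by (simp add: in_keys_iff)
qed

lemma hom_mval: "comm_ring_hom h ==> h (mval s m) = mval (\<lambda>i. h (s i)) m"
proof -
 assume "comm_ring_hom h"
 then interpret h: comm_ring_hom h .
 show ?thesis by (simp add: mval_def h.hom_prod h.hom_power)
qed

text \<open>The coefficients of a general linear combination of \<open>N\<close> powers of linear forms, as polynomials in
 the parameters: the variable with index \<open>prod_encode (p, 0)\<close> is the weight of the \<open>p\<close>-th power, and
 \<open>prod_encode (p, Suc i)\<close> is the \<open>i\<close>-th coordinate of its base.\<close>

definition secant_coeff :: "nat => nat => nat => (nat \<Rightarrow>\<^sub>0 nat) => 'k::field_char_0 mpoly" where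
 "secant_coeff N n D m = (if m \<in> form_monomials n D then \<Sum>p<N. Var (prod_encode (p, 0)) *
   (Const (fact D / of_nat (mfact m)) * mval (\<lambda>i. Var (prod_encode (p, Suc i))) m) else 0)"

lemma peval_secant_coeff:
 assumes "comm_ring_hom h"
 shows "peval h s (secant_coeff N n D m) = (if m \<in> form_monomials n D then \<Sum>p<N. s (prod_encode (p, 0)) *
   (h (fact D / of_nat (mfact m)) * mval (\<lambda>i. s (prod_encode (p, Suc i))) m) else 0)"
proof -
 interpret h: comm_ring_hom h by fact
 interpret p: comm_ring_hom "peval h s" by (rule comm_ring_hom_peval[OF assms])
 show ?thesis
  by (simp add: secant_coeff_def p.hom_sum p.hom_mult hom_mval[OF p.comm_ring_hom_axioms] peval_Var)
qed

lemma lookup_secant: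
 "lookup (\<Sum>p<N. Const (s (prod_encode (p, 0))) * linform n (\<lambda>i. s (prod_encode (p, Suc i))) ^ D) m
  = peval (\<lambda>c. c) s (secant_coeff N n D m)" for s :: "nat => 'k::field_char_0"
 unfolding peval_secant_coeff[OF comm_ring_hom_id] lookup_sum lookup_Const_mult lookup_linform_power
 by simp

lemma keys_drop_0: "keys m \<subseteq> {0..n} ==> keys (m - single 0 (lookup m 0)) \<subseteq> {1..n}" for m :: "nat \<Rightarrow>\<^sub>0 nat"
proof
 fix i assume m: "keys m \<subseteq> {0..n}" and "i \<in> keys (m - single 0 (lookup m 0))"
 then have "i \<in> keys m" "i \<noteq> 0" by (auto simp: in_keys_iff lookup_minus lookup_single when_def split: if_splits)
 then show "i \<in> {1..n}" using m by (auto simp: Suc_le_eq One_nat_def)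
qed

context form_power
begin

text \<open>A coefficient of H is, up to a factorial, a derivative of f^d at the origin; by
  \<open>subst_Theta\<close> this is \<open>Theta\<close> of a monomial, evaluated at the values of
  a_i \<circ> f there.\<close>

lemma lookup_H: "m \<in> form_monomials n (d * e) ==> lookup H m =
  1 / of_nat (mfact m) * peval (\<lambda>c. c) (\<lambda>i. lookup (fder i) 0) (K.Theta (single (m - single 0 (lookup m 0)) 1))"
proof -
 assume m: "m \<in> form_monomials n (d * e)"
 let ?m = "m - single 0 (lookup m 0)"
 have km: "keys ?m \<subseteq> {1..n}" using m by (intro keys_drop_0) (simp add: form_monomials_def)
 have p: "single ?m 1 \<in> polys {1..n}" by (rule single_polys[OF km])
 interpret g: comm_ring_hom "peval (\<lambda>c. c) (\<lambda>_. 0) :: 'k mpoly => 'k" by (rule comm_ring_hom_peval[OF comm_ring_hom_id])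
 have "dehomogenize (F ^ d) = f ^ d"
 proof -
  interpret deh: comm_ring_hom "dehomogenize :: 'k mpoly => _" by (rule comm_ring_hom_dehomogenize)
  show ?thesis by (simp add: deh.hom_power f)
 qed
 then have "dcoeff H m = dcoeff (f ^ d) ?m"
  unfolding H_def dcoeff_twist[OF Fd] using m by (simp add: form_monomials_def)
 also have "\<dots> = dcoeff (act (single ?m 1) (f ^ d)) 0" by (simp add: dcoeff_act mult_single pair_single)
 also have "\<dots> = lookup (peval Const fder (K.Theta (single ?m 1))) 0" by (simp add: subst_Theta[OF p] dcoeff_def)
 also have "\<dots> = peval (\<lambda>c. c) (\<lambda>_. 0) (peval Const fder (K.Theta (single ?m 1)))" by (rule peval_at_0[symmetric])
 also have "\<dots> = peval (\<lambda>c. c) (\<lambda>i. lookup (fder i) 0) (K.Theta (single ?m 1))"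
  by (subst hom_peval[OF g.comm_ring_hom_axioms]) (simp_all add: peval_at_0 Const_def)
 finally show ?thesis by (simp add: dcoeff_def field_simps)
qed

text \<open>By \<open>peval_Theta\<close> each deformed coefficient of H is a weighted sum over the
  N points, hence a coefficient of a sum of N powers of linear forms over the closure of K((t)).
  Every equation for sums of N powers over K is an identity in the parameters, so it holds for the
  deformation and, at t = 0, for H.\<close>

lemma border_rank_upper:
 assumes "smoothable (Ap_map {1..n} f) (Ap {1..n} f)"
 shows "border_rank n (d * e) H \<le> enat N"
proof -
 define D where "D = d * e"
 obtain c ch W where c: "struct_consts n c" and c0: "\<And>i j k. c i j k $ 0 = cst i j k"
  and sp: "\<And>d. split_power n (\<lambda>i j k. to_ac (fps_to_fls (c i j k))) ch W"
  by (rule split_family[OF assms]) blast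
 define q where "q x = to_ac (fps_to_fls x)" for x :: "'k fps"
 have q: "comm_ring_hom q" unfolding q_def by (rule comm_ring_hom_comp[OF comm_ring_hom_to_ac comm_ring_hom_fps_to_fls])
 interpret q: comm_ring_hom q by (rule q)
 have q_inj: "q x = 0 \<longleftrightarrow> x = 0" for x by (simp add: q_def)
 interpret A: sym_power n c d unfolding sym_power_def by (rule c)
 interpret S: split_power n d "\<lambda>i j k. q (c i j k)" ch W unfolding q_def by (rule sp)
 define h where "h x = q (fps_const x)" for x :: 'k
 have h: "comm_ring_hom h" unfolding h_def by (rule comm_ring_hom_comp[OF q comm_ring_hom_fps_const])
 interpret h: comm_ring_hom h by (rule h)
 define b where "b i = lookup (fder i) 0" for i
 \<comment> \<open>The weights that express the functional b, the evaluation of a_i \<circ> f at the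
   origin, in the basis of characters.\<close>
 define \<kappa> where "\<kappa> j = (\<Sum>k\<le>n. W j k * h (b k))" for j
 have \<kappa>: "(\<Sum>j\<le>n. ch j i * \<kappa> j) = h (b i)" if i: "i \<le> n" for i
 proof -
  have "(\<Sum>j\<le>n. ch j i * \<kappa> j) = (\<Sum>k\<le>n. \<Sum>j\<le>n. ch j i * W j k * h (b k))"
   unfolding \<kappa>_def sum_distrib_left by (subst sum.swap) (simp only: mult.assoc)
  also have "\<dots> = (\<Sum>k\<le>n. if i = k then h (b k) else 0)"
   unfolding sum_distrib_right[symmetric] using S.XW[OF i] by (intro sum.cong) auto
  finally show ?thesis using i by simp
 qed
 define w where "w \<mu> = fact d / of_nat (mfact \<mu>) * mval \<kappa> \<mu>" for \<mu>
 obtain g where g: "bij_betw g {..<N} (form_monomials n d)"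
  using ex_bij_betw_nat_finite[OF finite_form_monomials[of n d]] by (auto simp: atLeast0LessThan card_form_monomials)
 \<comment> \<open>The parameters of the deformed sum: the weights are divided by D! because each
   D-th power carries that factor, and the bases have coordinate 0 equal to 1 and the points as
   affine coordinates.\<close>
 define s0 where "s0 i = (case prod_decode i of (p, 0) => w (g p) / fact D
   | (p, Suc j) => if j = 0 then 1 else S.rho (g p) j)" for i
 \<comment> \<open>The expression of \<open>lookup_H\<close> with deformed structure constants. Its
   values are power series, although the coordinates of the points lie in the closure of
   K((t)).\<close>
 define x where "x m = (if m \<in> form_monomials n D then fps_const (1 / of_nat (mfact m)) *
   peval (\<lambda>c. c) (\<lambda>i. fps_const (b i)) (A.Theta (single (m - single 0 (lookup m 0)) 1)) else 0)" for m
 have m': "single (m - single 0 (lookup m 0)) 1 \<in> polys {1..n}" if "m \<in> form_monomials n D" for m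
  using that by (intro single_polys keys_drop_0) (simp add: form_monomials_def)
 have sx: "peval h s0 (secant_coeff N n D m) = q (x m)" for m
 proof (cases "m \<in> form_monomials n D")
  case True
  let ?m = "m - single 0 (lookup m 0)"
  have mv: "mval (\<lambda>i. s0 (prod_encode (p, Suc i))) m = mval (S.rho (g p)) ?m" for p
  proof -
   have "m = single 0 (lookup m 0) + ?m"
    by (rule poly_mapping_eqI) (auto simp: lookup_add lookup_minus lookup_single when_def)
   then have "mval (\<lambda>i. s0 (prod_encode (p, Suc i))) m = mval (\<lambda>i. s0 (prod_encode (p, Suc i))) (single 0 (lookup m 0) + ?m)"
    by (rule arg_cong)
   also have "\<dots> = s0 (prod_encode (p, Suc 0)) ^ lookup m 0 * mval (\<lambda>i. s0 (prod_encode (p, Suc i))) ?m"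
    by (simp only: mval_add mval_single)
   also have "s0 (prod_encode (p, Suc 0)) = 1" by (simp add: s0_def)
   also have "mval (\<lambda>i. s0 (prod_encode (p, Suc i))) ?m = mval (S.rho (g p)) ?m"
    by (rule mval_cong) (auto simp: s0_def in_keys_iff lookup_minus lookup_single)
   finally show ?thesis by simp
  qed
  have hD: "h (fact D / of_nat (mfact m)) = fact D * h (1 / of_nat (mfact m))"
  proof -
   have "h (of_nat (fact D)) = of_nat (fact D)" by (rule hom_of_nat[OF h])
   then have hf: "h (fact D) = fact D" by simp
   have "h (fact D / of_nat (mfact m)) = h (fact D * (1 / of_nat (mfact m)))" by simp
   also have "\<dots> = h (fact D) * h (1 / of_nat (mfact m))" by (rule h.hom_mult)
   finally show ?thesis by (simp only: hf)
  qed
  have "peval h s0 (secant_coeff N n D m)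
   = (\<Sum>p<N. w (g p) / fact D * (fact D * h (1 / of_nat (mfact m)) * mval (S.rho (g p)) ?m))"
   using True by (simp only: peval_secant_coeff[OF h] if_True mv hD) (simp add: s0_def)
  also have "\<dots> = (\<Sum>p<N. h (1 / of_nat (mfact m)) * (w (g p) * mval (S.rho (g p)) ?m))"
   by (intro sum.cong refl) simp
  also have "\<dots> = h (1 / of_nat (mfact m)) * (\<Sum>\<mu>\<in>form_monomials n d. w \<mu> * mval (S.rho \<mu>) ?m)"
   unfolding sum_distrib_left by (rule sum.reindex_bij_betw[OF g])
  also have "(\<Sum>\<mu>\<in>form_monomials n d. w \<mu> * mval (S.rho \<mu>) ?m) = peval (\<lambda>c. c) (\<lambda>i. h (b i)) (S.Theta (single ?m 1))"
   unfolding w_def using S.peval_Theta[OF m'[OF True] \<kappa>] by (simp add: peval_single)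
  also have "S.Theta (single ?m 1) = mapc q (A.Theta (single ?m 1))"
   using Theta_mapc[OF c q m'[OF True], of d] by (simp add: mapc_single)
  also have "peval (\<lambda>c. c) (\<lambda>i. h (b i)) (mapc q (A.Theta (single ?m 1)))
   = q (peval (\<lambda>c. c) (\<lambda>i. fps_const (b i)) (A.Theta (single ?m 1)))"
   unfolding peval_mapc[OF comm_ring_hom_id q] h_def by (subst hom_peval[OF q]) simp_all
  finally show ?thesis using True by (simp only: x_def if_True q.hom_mult h_def[symmetric])
 qed (simp add: peval_secant_coeff[OF h] x_def)
 have x0: "x m $ 0 = lookup H m" for m
 proof (cases "m \<in> form_monomials n D")
  case True
  note e = comm_ring_hom_fps_nth_0[where 'a = 'k]
  let ?m = "m - single 0 (lookup m 0)"
  have "peval (\<lambda>c. c) (\<lambda>i. fps_const (b i)) (A.Theta (single ?m 1)) $ 0 = peval (\<lambda>c. c $ 0) b (A.Theta (single ?m 1))"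
   by (subst hom_peval[OF e]) simp_all
  also have "\<dots> = peval (\<lambda>c. c) b (mapc (\<lambda>c. c $ 0) (A.Theta (single ?m 1)))"
   unfolding peval_mapc[OF comm_ring_hom_id e] ..
  also have "mapc (\<lambda>c. c $ 0) (A.Theta (single ?m 1)) = K.Theta (single ?m 1)"
   using Theta_mapc[OF c e m'[OF True], of d] by (simp add: mapc_single c0)
  finally show ?thesis using True lookup_H[of m] unfolding D_def b_def[abs_def] by (simp add: x_def D_def b_def)
 next
  case False
  then have "m \<notin> keys H" using H_form by (auto simp: forms_def polys_def form_monomials_def D_def)
  with False show ?thesis by (simp add: x_def in_keys_iff)
 qed
 have "H \<in> zariski_closure (forms n D) {G \<in> forms n D. waring_rank n D G \<le> enat N}"
  unfolding zariski_closure_def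
 proof (intro InterI, elim CollectE conjE exE)
  fix Z and \<Psi> :: "(((nat \<Rightarrow>\<^sub>0 nat) \<Rightarrow>\<^sub>0 nat) \<Rightarrow>\<^sub>0 'k) set" assume Z: "{G \<in> forms n D. waring_rank n D G \<le> enat N} \<subseteq> Z" "Z = zero_locus (forms n D) \<Psi>"
  have "peval (\<lambda>c. c) (lookup H) \<phi> = 0" if \<phi>: "\<phi> \<in> \<Psi>" for \<phi>
  proof -
   \<comment> \<open>The equation \<phi> pulled back to the parameters. It vanishes at all
     parameters over K, so it is the zero polynomial and can be evaluated over any
     extension.\<close>
   define \<Phi> where "\<Phi> = peval Const (secant_coeff N n D) \<phi>"
   have P: "peval k s \<Phi> = peval k (\<lambda>m. peval k s (secant_coeff N n D m)) \<phi>" if k: "comm_ring_hom k" for k s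
   proof -
    interpret k: comm_ring_hom k by (rule k)
    show ?thesis unfolding \<Phi>_def by (subst hom_peval[OF comm_ring_hom_peval[OF k]]) simp_all
   qed
   have "\<Phi> = 0"
   proof (rule mpoly_zero_function)
    fix s :: "nat => 'k"
    define G where "G = (\<Sum>p<N. Const (s (prod_encode (p, 0))) * linform n (\<lambda>i. s (prod_encode (p, Suc i))) ^ D)"
    have Gf: "G \<in> forms n D" unfolding G_def
     using power_forms[OF linform_forms, of n _ D] by (intro sum_forms Const_mult_forms) simp
    have "\<exists>c L. (\<forall>i<N. L i \<in> forms n 1) \<and> G = (\<Sum>i<N. Const (c i) * L i ^ D)"
     by (rule exI[of _ "\<lambda>p. s (prod_encode (p, 0))"], rule exI[of _ "\<lambda>p. linform n (\<lambda>i. s (prod_encode (p, Suc i)))"])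
       (simp add: G_def linform_forms)
    then have "waring_rank n D G \<le> enat N" unfolding waring_rank_def by (intro Inf_lower) blast
    then have "G \<in> Z" using Z(1) Gf by blast
    then have "peval (\<lambda>c. c) (lookup G) \<phi> = 0" using \<phi> Z(2) by (simp add: zero_locus_def)
    moreover have "lookup G = (\<lambda>m. peval (\<lambda>c. c) s (secant_coeff N n D m))"
     unfolding G_def by (rule ext) (rule lookup_secant)
    ultimately show "peval (\<lambda>c. c) s \<Phi> = 0" unfolding P[OF comm_ring_hom_id] by simp
   qed
   then have "0 = peval h s0 \<Phi>" by (simp add: peval_def)
   also have "\<dots> = peval h (\<lambda>m. q (x m)) \<phi>" unfolding P[OF h] sx ..
   also have "\<dots> = q (peval fps_const x \<phi>)" unfolding h_def by (subst hom_peval[OF q]) simp_all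
   \<comment> \<open>Injectivity of \<open>q\<close> brings the equation back to K[[t]], where t = 0
     may be set.\<close>
   finally have "peval fps_const x \<phi> = 0" using q_inj by metis
   then have "0 = (peval fps_const x \<phi>) $ 0" by simp
   also have "\<dots> = peval (\<lambda>c. fps_const c $ 0) (\<lambda>m. x m $ 0) \<phi>"
    by (rule hom_peval[OF comm_ring_hom_fps_nth_0]) simp
   also have "\<dots> = peval (\<lambda>c. c) (lookup H) \<phi>" by (simp add: x0)
   finally show ?thesis by simp
  qed
  then show "H \<in> Z" unfolding Z(2) zero_locus_def using H_form by (simp add: D_def)
 qed
 then show ?thesis unfolding border_rank_def D_def by (intro Inf_lower) blast
qed

text \<open>The common end of the four rank computations: the lower bound is always
  \<open>not_dependent\<close>, applied in the middle degree.\<close>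

lemma enat_rankI:
 assumes "R \<le> enat N" "\<And>r. R \<le> enat r ==> dependent_derivs n mid r H" shows "R = enat N"
proof (rule antisym[OF assms(1)])
 obtain r where r: "R = enat r" using assms(1) by (cases R) auto
 show "enat N \<le> R" using assms(2)[of r] not_dependent[of r] r by (cases "r < N") auto
qed

end

theorem theorem1p8:
  fixes F f :: "'k::{alg_closed_field, field_char_0} mpoly" and n e d :: nat
  assumes "F \<in> forms n e"
    and "concise {0..n} F"
    and "f = dehomogenize F"
    and "encompassing {1..n} f"
    and "smoothable (Ap_map {1..n} f) (Ap {1..n} f)"
    and "d \<ge> 1"
  shows "smoothable_rank n (twist (F ^ d)) = enat ((n + d) choose d)
       \<and> border_rank n (d * e) (twist (F ^ d)) = enat ((n + d) choose d)
       \<and> cactus_rank n (twist (F ^ d)) = enat ((n + d) choose d)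
       \<and> border_cactus_rank n (d * e) (twist (F ^ d)) = enat ((n + d) choose d)
       \<and> middle_catalecticant_rank n (d * e) (twist (F ^ d)) = (n + d) choose d
       \<and> smoothable (Ap_map {1..n} (f ^ d)) (Ap {1..n} (f ^ d))
       \<and> apolar n (embedded_ideal n (Ann {1..n} (f ^ d))) (twist (F ^ d))"
proof -
  have "encompassing_poly n f" unfolding assms(3) using assms(1-4) by (intro encompassing_polyI) auto
  then interpret form_power n f F e d
    unfolding form_power_def form_power_axioms_def using assms by blast
  have sm: "smoothable (Ap_map {1..n} (f ^ d)) (Ap {1..n} (f ^ d))" by (rule smoothable_power[OF assms(5)])
  have s: "smoothable_rank n H \<le> enat N" unfolding smoothable_rank_def
    by (rule Inf_lower) (use finite_E smoothable_E[OF sm] apolar_E in blast)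
  have c: "cactus_rank n H \<le> enat N" unfolding cactus_rank_def
    by (rule Inf_lower) (use finite_E apolar_E in blast)
  have "H \<in> zariski_closure (forms n (d * e)) {G \<in> forms n (d * e). cactus_rank n G \<le> enat N}"
    unfolding zariski_closure_def using H_form c by blast
  then have b: "border_cactus_rank n (d * e) H \<le> enat N" unfolding border_cactus_rank_def
    by (intro Inf_lower) blast
  have "smoothable_rank n H = enat N" by (rule enat_rankI[OF s smoothable_rank_dependent])
  moreover have "border_rank n (d * e) H = enat N"
    by (rule enat_rankI[OF border_rank_upper[OF assms(5)] border_rank_dependent])
  moreover have "cactus_rank n H = enat N" by (rule enat_rankI[OF c cactus_rank_dependent])
  moreover have "border_cactus_rank n (d * e) H = enat N" by (rule enat_rankI[OF b border_cactus_rank_dependent])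
  ultimately show ?thesis using middle_catalecticant sm apolar_E unfolding H_def by blast
qed

end
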